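(* Let $g:\Omega\times[0,T]\times\mathbb{R}\times[L^2(\mathbf L;\mathbb R)]^{m-1}\times\mathbb{R}^d\times L^2_\nu(E,\mathcal B(E);\mathbb R)\to\mathbb{R}$ be such that $g(\cdot,\cdot,y,h,z,k)$ is $\mathcal P_{0,T}$-measurable for every fixed $(y,h,z,k)$, and assume: (i) there is a constant $L_g\ge 0$ such that, $P$-a.s., for all $t\in[0,T]$ and all $(y_j,h_j,z_j,k_j)$, $j=1,2$, $$|g(t,y_1,h_1,z_1,k_1)-g(t,y_2,h_2,z_2,k_2)|\le L_g\big(|y_1-y_2|+\|h_1-h_2\|_{[L^2(\mathbf L;\mathbb R)]^{m-1}}+|z_1-z_2|+\|k_1-k_2\|_{L^2_\nu(E,\mathcal B(E);\mathbb R)}\big);$$ (ii) $\mathbb{E}\big[\int_0^T|g(s,0,0,0,0)|^2ds\big]<\infty$. For $j=1,2$ let $\varphi_j$ be a real-valued progressively measurable process with $\mathbb E\int_0^T|\varphi_j(s)|^2ds<\infty$, let $\xi_j\in L^2(\Omega,\mathcal F_T,P;\mathbb R)$, put $g_j(s,y,h,z,k)=g(s,y,h,z,k)+\varphi_j(s)$, and let $(Y^j,H^j,Z^j,K^j)\in\mathcal S^2[0,T]$ be the unique solution of $$dY_s=-g_j(s,Y_s,H_s,Z_s,K_s)ds+Z_sdB_s+\sum_{l=1}^{m-1}H_s(l)d\tilde N_s(l)+\int_EK_s(e)\tilde\mu(ds,de),\ s\in[0,T],\quad Y_T=\xi_j.$$ Then for all $\beta>2L_g+4L_g^2+\frac2\lambda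 L_g^2+1$ there exists a constant $C>0$ such that, $P$-a.s., for $t\in[0,T]$, $$|Y^1_t-Y^2_t|^2+\mathbb E\Big[\int_t^Te^{\beta(s-t)}\Big(|Y^1_s-Y^2_s|^2+\lambda\sum_{l=1}^{m-1}|H^1_s(l)-H^2_s(l)|^2+|Z^1_s-Z^2_s|^2+\int_E|K^1_s(e)-K^2_s(e)|^2\nu(de)\Big)ds\,\Big|\,\mathcal F_t\Big]$$ $$\le C\,\mathbb E\Big[e^{\beta(T-t)}|\xi_1-\xi_2|^2+\int_t^Te^{\beta(s-t)}|\varphi_1(s)-\varphi_2(s)|^2ds\,\Big|\,\mathcal F_t\Big].$$
   Context: Fix $T>0$, integers $m\ge2$ and $d,q\ge1$, $\lambda>0$, $\mathbf L=\{1,\dots,m-1\}$, $E=\mathbb R^q\setminus\{0\}$ with Borel $\sigma$-field $\mathcal B(E)$, and a $\sigma$-finite measure $\nu$ on $E$ with $\int_E(1\wedge|e|^2)\nu(de)<\infty$. $(\Omega,\mathcal F,P)$ is the completed product of canonical spaces carrying three independent objects: a two-sided $d$-dimensional Brownian motion $B$ ($B_0=0$; $(B_s)_{s\ge0}$ and $(B_{-s})_{s\ge0}$ independent Brownian motions), a Poisson random measure $N$ on $\mathbb R\times\mathbf L$ with compensator $\hat N((s,t]\times\{l\})=\lambda(t-s)$, and a Poisson random measure $\mu$ on $\mathbb R\times E$ with compensator $dt\,\nu(de)$. Put $\tilde N_s(l)=N((0,s]\times\{l\})-\lambda s$ and $\tilde\mu(dt,de)=\mu(dt,de)-dt\,\nu(de)$.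 $\mathbb F=(\mathcal F_t)_{t\ge0}$ is the filtration where $\mathcal F_t$ is generated by $B_r$, $r\le t$, and by the restrictions of $N$ and $\mu$ to times in $(-\infty,t]$ (made right-continuous), augmented by the $P$-null sets. $\mathcal P_{t,T}$ is the $\sigma$-field of $\mathbb F$-predictable subsets of $\Omega\times[t,T]$. $[L^2(\mathbf L;\mathbb R)]^{m-1}$ is the set of maps $h:\mathbf L\to\mathbb R$ with norm $(\sum_{l=1}^{m-1}h(l)^2)^{1/2}$; $L^2_\nu(E,\mathcal B(E);\mathbb R)$ is the space of Borel $k:E\to\mathbb R$ with $\|k\|^2=\int_E|k(e)|^2\nu(de)<\infty$. $\mathcal S^2[t,T]$ is the set of $(Y,H,Z,K)$ such that: $Y$ is real-valued, adapted, càdlàg with $\mathbb E[\sup_{s\in[t,T]}|Y_s|^2]<\infty$; $H=(H(1),\dots,H(m-1))$ is predictable with $\mathbb E\int_t^T\sum_{l}H_s(l)^2ds<\infty$; $Z$ is $\mathbb R^d$-valued progressively measurable with $\mathbb E\int_t^T|Z_s|^2ds<\infty$; $K:\Omega\times[t,T]\times E\to\mathbb R$ is $\mathcal P_{t,T}\otimes\mathcal B(E)$-measurable with $\mathbb E\int_t^T\int_E|K_s(e)|^2\nu(de)ds<\infty$. The displayed BSDEs are uniquely solvable in $\mathcal S^2[0,T]$ under the stated assumptions. *)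

theory Defs
  imports "HOL-Probability.Probability"
begin

text \<open>
  Processes are functions \<open>real \<Rightarrow> 'w \<Rightarrow> _\<close> (time first); random measures are maps from the
  sample space into measures.  Expectations of nonnegative quantities that occur in finiteness or
  convergence conditions are \<open>\<integral>\<^sup>+\<close>-integrals, so that no condition can hold merely because a
  Bochner integral of a non-integrable function is 0.
\<close>

definition gen_sets :: "'w measure \<Rightarrow> ('i \<Rightarrow> 'w \<Rightarrow> 'x::topological_space) \<Rightarrow> 'i set \<Rightarrow> 'w set set"
  where "gen_sets M X I =
    sigma_sets (space M) (\<Union>i\<in>I. {X i -` A \<inter> space M |A. A \<in> sets borel})"

definition cadlag_on :: "real \<Rightarrow> real \<Rightarrow> (real \<Rightarrow> real) \<Rightarrow> bool"
  where "cadlag_on a b f \<longleftrightarrow>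
    (\<forall>s\<in>{a..<b}. (f \<longlongrightarrow> f s) (at_right s)) \<and> (\<forall>s\<in>{a<..b}. \<exists>l. (f \<longlongrightarrow> l) (at_left s))"


section \<open>Driving noises\<close>

definition brownian_motion :: "'w measure \<Rightarrow> (real \<Rightarrow> 'w \<Rightarrow> real ^ 'd::finite) \<Rightarrow> bool"
  where "brownian_motion M W \<longleftrightarrow>
    (\<forall>s\<ge>0. W s \<in> borel_measurable M) \<and>
    (\<forall>\<omega>\<in>space M. W 0 \<omega> = 0 \<and> continuous_on {0..} (\<lambda>s. W s \<omega>)) \<and>
    (\<forall>s t. 0 \<le> s \<and> s < t \<longrightarrow> distributed M lborel (\<lambda>\<omega>. W t \<omega> - W s \<omega>)
        (\<lambda>x. ennreal (\<Prod>i\<in>UNIV. normal_density 0 (sqrt (t - s)) (x $ i)))) \<and>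
    (\<forall>n (\<tau>::nat \<Rightarrow> real). 0 \<le> \<tau> 0 \<and> (\<forall>i<n. \<tau> i \<le> \<tau> (Suc i)) \<longrightarrow>
        prob_space.indep_vars M (\<lambda>_. borel) (\<lambda>i \<omega>. W (\<tau> (Suc i)) \<omega> - W (\<tau> i) \<omega>) {..<n})"

definition two_sided_brownian_motion ::
    "'w measure \<Rightarrow> (real \<Rightarrow> 'w \<Rightarrow> real ^ 'd::finite) \<Rightarrow> bool"
  where "two_sided_brownian_motion M B \<longleftrightarrow>
    brownian_motion M B \<and> brownian_motion M (\<lambda>s. B (- s)) \<and>
    prob_space.indep_set M (gen_sets M B {0..}) (gen_sets M (\<lambda>s. B (- s)) {0..})"

definition poisson_random_measure ::
    "'w measure \<Rightarrow> 'x measure \<Rightarrow> ('w \<Rightarrow> 'x measure) \<Rightarrow> bool"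
  where "poisson_random_measure M \<Lambda> R \<longleftrightarrow>
    (\<forall>\<omega>\<in>space M. sets (R \<omega>) = sets \<Lambda> \<and>
        (\<forall>A\<in>sets \<Lambda>. emeasure (R \<omega>) A \<in> insert \<infinity> (range of_nat))) \<and>
    (\<forall>A\<in>sets \<Lambda>. (\<lambda>\<omega>. emeasure (R \<omega>) A) \<in> borel_measurable M) \<and>
    (\<forall>A\<in>sets \<Lambda>. emeasure \<Lambda> A < \<infinity> \<longrightarrow> (\<forall>j::nat.
        measure M {\<omega>\<in>space M. emeasure (R \<omega>) A = of_nat j} =
          measure \<Lambda> A ^ j / fact j * exp (- measure \<Lambda> A))) \<and>
    (\<forall>A\<in>sets \<Lambda>. emeasure \<Lambda> A = \<infinity> \<longrightarrow> (AE \<omega> in M. emeasure (R \<omega>) A = \<infinity>)) \<and>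
    (\<forall>n (A::nat \<Rightarrow> 'x set). (\<forall>i<n. A i \<in> sets \<Lambda>) \<and> disjoint_family_on A {..<n} \<longrightarrow>
        prob_space.indep_vars M (\<lambda>_. borel) (\<lambda>i \<omega>. emeasure (R \<omega>) (A i)) {..<n})"

definition marks :: "nat \<Rightarrow> nat set"
  where "marks m = {1..m - 1}"

definition intensity_N :: "real \<Rightarrow> nat \<Rightarrow> (real \<times> nat) measure"
  where "intensity_N lam m = lborel \<Otimes>\<^sub>M scale_measure (ennreal lam) (count_space (marks m))"

definition intensity_mu :: "'e measure \<Rightarrow> (real \<times> 'e) measure"
  where "intensity_mu \<nu> = lborel \<Otimes>\<^sub>M \<nu>"

locale bsde_setting = prob_space M + complete_measure M
  for M :: "'w measure" +
  fixes B :: "real \<Rightarrow> 'w \<Rightarrow> real ^ 'd::finite"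
    and N :: "'w \<Rightarrow> (real \<times> nat) measure"
    and \<mu> :: "'w \<Rightarrow> (real \<times> (real ^ 'q::finite)) measure"
    and \<nu> :: "(real ^ 'q) measure"
    and lam :: real and m :: nat and T :: real
  assumes T_pos: "0 < T"
    and m_ge_2: "2 \<le> m"
    and lam_pos: "0 < lam"
    and sets_nu: "sets \<nu> = sets (restrict_space borel (- {0}))"
    and nu_sigma_finite: "sigma_finite_measure \<nu>"
    and nu_levy: "(\<integral>\<^sup>+e. ennreal (min 1 ((norm e)\<^sup>2)) \<partial>\<nu>) < \<infinity>"
    and brownian: "two_sided_brownian_motion M B"
    and poisson_N: "poisson_random_measure M (intensity_N lam m) N"
    and poisson_mu: "poisson_random_measure M (intensity_mu \<nu>) \<mu>"
    and noises_independent: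
      "prob_space.indep_sets M
         (\<lambda>j. [gen_sets M B UNIV,
               gen_sets M (\<lambda>A \<omega>. emeasure (N \<omega>) A) (sets (intensity_N lam m)),
               gen_sets M (\<lambda>A \<omega>. emeasure (\<mu> \<omega>) A) (sets (intensity_mu \<nu>))] ! j)
         {..<3::nat}"


section \<open>Filtration and measurability of processes\<close>

definition past_sets :: "'w measure \<Rightarrow> (real \<times> 'x) measure \<Rightarrow> ('w \<Rightarrow> (real \<times> 'x) measure) \<Rightarrow>
    real \<Rightarrow> 'w set set"
  where "past_sets M \<Lambda> R t =
    gen_sets M (\<lambda>A \<omega>. emeasure (R \<omega>) A) {A \<in> sets \<Lambda>. A \<subseteq> {..t} \<times> UNIV}"

definition noise_filtration :: "'w measure \<Rightarrow> (real \<Rightarrow> 'w \<Rightarrow> real ^ 'd::finite) \<Rightarrow>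
    ('w \<Rightarrow> (real \<times> nat) measure) \<Rightarrow> ('w \<Rightarrow> (real \<times> 'e) measure) \<Rightarrow> 'e measure \<Rightarrow>
    real \<Rightarrow> nat \<Rightarrow> real \<Rightarrow> 'w measure"
  where "noise_filtration M B N \<mu> \<nu> lam m t = sigma (space M)
    (gen_sets M B {..t} \<union>
     (\<Inter>s\<in>{t<..}. past_sets M (intensity_N lam m) N s) \<union>
     (\<Inter>s\<in>{t<..}. past_sets M (intensity_mu \<nu>) \<mu> s) \<union>
     null_sets M)"

definition predictable :: "'w measure \<Rightarrow> (real \<Rightarrow> 'w measure) \<Rightarrow> ('w \<times> real) measure"
  where "predictable M F = sigma (space M \<times> {0..})
    ({A \<times> {0} |A. A \<in> sets (F 0)} \<union>
     {A \<times> {s<..r} |A s r. 0 \<le> s \<and> s \<le> r \<and> A \<in> sets (F s)})"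

definition predictable_on ::
    "'w measure \<Rightarrow> (real \<Rightarrow> 'w measure) \<Rightarrow> real \<Rightarrow> real \<Rightarrow> ('w \<times> real) measure"
  where "predictable_on M F t T = restrict_space (predictable M F) (space M \<times> {t..T})"

definition progressive :: "(real \<Rightarrow> 'w measure) \<Rightarrow> real \<Rightarrow> real \<Rightarrow>
    (real \<Rightarrow> 'w \<Rightarrow> 'x::topological_space) \<Rightarrow> bool"
  where "progressive F t T X \<longleftrightarrow> (\<forall>r\<in>{t..T}.
    (\<lambda>(\<omega>, s). X s \<omega>) \<in> borel_measurable (F r \<Otimes>\<^sub>M restrict_space borel {t..r}))"


section \<open>Function spaces\<close>

text \<open>
  A map \<open>h\<close> on the marks is a function on \<open>nat\<close> of which only the values on \<^term>\<open>marks m\<close>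
  enter; its norm is \<^term>\<open>L2_set h (marks m)\<close>.
\<close>

definition L2_fun :: "'e measure \<Rightarrow> ('e \<Rightarrow> real) set"
  where "L2_fun \<nu> = {k \<in> borel_measurable \<nu>. (\<integral>\<^sup>+e. ennreal ((k e)\<^sup>2) \<partial>\<nu>) < \<infinity>}"

definition L2_norm :: "'e measure \<Rightarrow> ('e \<Rightarrow> real) \<Rightarrow> real"
  where "L2_norm \<nu> k = sqrt (\<integral>e. (k e)\<^sup>2 \<partial>\<nu>)"

definition S2 :: "'w measure \<Rightarrow> (real \<Rightarrow> 'w measure) \<Rightarrow> 'e measure \<Rightarrow> nat \<Rightarrow> real \<Rightarrow> real \<Rightarrow>
    ((real \<Rightarrow> 'w \<Rightarrow> real) \<times> (real \<Rightarrow> 'w \<Rightarrow> nat \<Rightarrow> real) \<times>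
     (real \<Rightarrow> 'w \<Rightarrow> (real ^ 'd::finite)) \<times> (real \<Rightarrow> 'w \<Rightarrow> 'e \<Rightarrow> real)) set"
  where "S2 M F \<nu> m t T = {(Y, H, Z, K).
    (\<forall>s\<in>{t..T}. Y s \<in> borel_measurable (F s)) \<and>
    (AE \<omega> in M. cadlag_on t T (\<lambda>s. Y s \<omega>)) \<and>
    (\<integral>\<^sup>+\<omega>. (SUP s\<in>{t..T}. ennreal ((Y s \<omega>)\<^sup>2)) \<partial>M) < \<infinity> \<and>
    (\<forall>l\<in>marks m. (\<lambda>(\<omega>, s). H s \<omega> l) \<in> borel_measurable (predictable_on M F t T)) \<and>
    (\<integral>\<^sup>+\<omega>. (\<integral>\<^sup>+s\<in>{t..T}. ennreal (\<Sum>l\<in>marks m. (H s \<omega> l)\<^sup>2) \<partial>lborel) \<partial>M) < \<infinity> \<and>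
    progressive F t T Z \<and>
    (\<integral>\<^sup>+\<omega>. (\<integral>\<^sup>+s\<in>{t..T}. ennreal ((norm (Z s \<omega>))\<^sup>2) \<partial>lborel) \<partial>M) < \<infinity> \<and>
    (\<lambda>((\<omega>, s), e). K s \<omega> e) \<in> borel_measurable (predictable_on M F t T \<Otimes>\<^sub>M \<nu>) \<and>
    (\<integral>\<^sup>+\<omega>. (\<integral>\<^sup>+s\<in>{t..T}. (\<integral>\<^sup>+e. ennreal ((K s \<omega> e)\<^sup>2) \<partial>\<nu>) \<partial>lborel) \<partial>M) < \<infinity>}"


section \<open>Stochastic integrals\<close>

text \<open>
  Both integrals are the \<open>L\<^sup>2\<close>-extensions, with cadlag paths, of the elementary integrals of
  simple integrands.  An entry \<open>(s, r, \<zeta>)\<close> of a list stands for the integrand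
  \<open>\<zeta> 1\<^bsub>(s,r]\<^esub>\<close>, an entry \<open>(s, r, A, \<zeta>)\<close> for \<open>\<zeta> 1\<^bsub>(s,r]\<times>A\<^esub>\<close>, and the list for
  the sum of its entries.

  The first notion is used for integrators whose predictable quadratic variation is a constant
  multiple of time (components of a Brownian motion, compensated Poisson processes), for which
  \<open>L\<^sup>2(dt \<otimes> P)\<close> is the right space of integrands.
\<close>

definition simple_integrand ::
    "'w measure \<Rightarrow> (real \<Rightarrow> 'w measure) \<Rightarrow> real \<Rightarrow> (real \<times> real \<times> ('w \<Rightarrow> real)) list \<Rightarrow> bool"
  where "simple_integrand M F T c \<longleftrightarrow> (\<forall>(s, r, \<zeta>)\<in>set c.
    0 \<le> s \<and> s \<le> r \<and> r \<le> T \<and> \<zeta> \<in> borel_measurable (F s) \<and> bounded (\<zeta> ` space M))"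

definition simple_value :: "(real \<times> real \<times> ('w \<Rightarrow> real)) list \<Rightarrow> real \<Rightarrow> 'w \<Rightarrow> real"
  where "simple_value c u \<omega> = (\<Sum>(s, r, \<zeta>)\<leftarrow>c. \<zeta> \<omega> * indicator {s<..r} u)"

definition simple_integral ::
    "(real \<Rightarrow> 'w \<Rightarrow> real) \<Rightarrow> (real \<times> real \<times> ('w \<Rightarrow> real)) list \<Rightarrow> real \<Rightarrow> 'w \<Rightarrow> real"
  where "simple_integral X c u \<omega> =
    (\<Sum>(s, r, \<zeta>)\<leftarrow>c. \<zeta> \<omega> * (X (min r u) \<omega> - X (min s u) \<omega>))"

definition stochastic_integral :: "'w measure \<Rightarrow> (real \<Rightarrow> 'w measure) \<Rightarrow> real \<Rightarrow>
    (real \<Rightarrow> 'w \<Rightarrow> real) \<Rightarrow> (real \<Rightarrow> 'w \<Rightarrow> real) \<Rightarrow> (real \<Rightarrow> 'w \<Rightarrow> real) \<Rightarrow> bool"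
  where "stochastic_integral M F T X h J \<longleftrightarrow>
    (\<forall>u\<in>{0..T}. J u \<in> borel_measurable (F u)) \<and>
    (AE \<omega> in M. cadlag_on 0 T (\<lambda>u. J u \<omega>)) \<and>
    (\<exists>c::nat \<Rightarrow> _. (\<forall>n. simple_integrand M F T (c n)) \<and>
      (\<lambda>n. \<integral>\<^sup>+\<omega>. (\<integral>\<^sup>+s\<in>{0..T}. ennreal ((h s \<omega> - simple_value (c n) s \<omega>)\<^sup>2) \<partial>lborel) \<partial>M)
        \<longlonglongrightarrow> 0 \<and>
      (\<forall>u\<in>{0..T}.
        (\<lambda>n. \<integral>\<^sup>+\<omega>. ennreal ((J u \<omega> - simple_integral X (c n) u \<omega>)\<^sup>2) \<partial>M) \<longlonglongrightarrow> 0))"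

definition simple_random_field :: "'w measure \<Rightarrow> (real \<Rightarrow> 'w measure) \<Rightarrow> 'e measure \<Rightarrow> real \<Rightarrow>
    (real \<times> real \<times> 'e set \<times> ('w \<Rightarrow> real)) list \<Rightarrow> bool"
  where "simple_random_field M F \<nu> T c \<longleftrightarrow> (\<forall>(s, r, A, \<zeta>)\<in>set c.
    0 \<le> s \<and> s \<le> r \<and> r \<le> T \<and> A \<in> sets \<nu> \<and> emeasure \<nu> A < \<infinity> \<and>
    \<zeta> \<in> borel_measurable (F s) \<and> bounded (\<zeta> ` space M))"

definition simple_field_value ::
    "(real \<times> real \<times> 'e set \<times> ('w \<Rightarrow> real)) list \<Rightarrow> real \<Rightarrow> 'w \<Rightarrow> 'e \<Rightarrow> real"
  where "simple_field_value c u \<omega> e =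
    (\<Sum>(s, r, A, \<zeta>)\<leftarrow>c. \<zeta> \<omega> * indicator {s<..r} u * indicator A e)"

definition compensated_mu :: "('w \<Rightarrow> (real \<times> 'e) measure) \<Rightarrow> 'e measure \<Rightarrow>
    real \<Rightarrow> real \<Rightarrow> 'e set \<Rightarrow> 'w \<Rightarrow> real"
  where "compensated_mu \<mu> \<nu> s r A \<omega> = measure (\<mu> \<omega>) ({s<..r} \<times> A) - (r - s) * measure \<nu> A"

definition simple_field_integral :: "('w \<Rightarrow> (real \<times> 'e) measure) \<Rightarrow> 'e measure \<Rightarrow>
    (real \<times> real \<times> 'e set \<times> ('w \<Rightarrow> real)) list \<Rightarrow> real \<Rightarrow> 'w \<Rightarrow> real"
  where "simple_field_integral \<mu> \<nu> c u \<omega> =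
    (\<Sum>(s, r, A, \<zeta>)\<leftarrow>c. \<zeta> \<omega> * compensated_mu \<mu> \<nu> (min s u) (min r u) A \<omega>)"

definition compensated_integral :: "'w measure \<Rightarrow> (real \<Rightarrow> 'w measure) \<Rightarrow> 'e measure \<Rightarrow> real \<Rightarrow>
    ('w \<Rightarrow> (real \<times> 'e) measure) \<Rightarrow> (real \<Rightarrow> 'w \<Rightarrow> 'e \<Rightarrow> real) \<Rightarrow> (real \<Rightarrow> 'w \<Rightarrow> real) \<Rightarrow> bool"
  where "compensated_integral M F \<nu> T \<mu> K J \<longleftrightarrow>
    (\<forall>u\<in>{0..T}. J u \<in> borel_measurable (F u)) \<and>
    (AE \<omega> in M. cadlag_on 0 T (\<lambda>u. J u \<omega>)) \<and>
    (\<exists>c::nat \<Rightarrow> _. (\<forall>n. simple_random_field M F \<nu> T (c n)) \<and>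
      (\<lambda>n. \<integral>\<^sup>+\<omega>. (\<integral>\<^sup>+s\<in>{0..T}.
          (\<integral>\<^sup>+e. ennreal ((K s \<omega> e - simple_field_value (c n) s \<omega> e)\<^sup>2) \<partial>\<nu>) \<partial>lborel) \<partial>M)
        \<longlonglongrightarrow> 0 \<and>
      (\<forall>u\<in>{0..T}.
        (\<lambda>n. \<integral>\<^sup>+\<omega>. ennreal ((J u \<omega> - simple_field_integral \<mu> \<nu> (c n) u \<omega>)\<^sup>2) \<partial>M)
          \<longlonglongrightarrow> 0))"


section \<open>Backward stochastic differential equations\<close>

definition compensated_N :: "('w \<Rightarrow> (real \<times> nat) measure) \<Rightarrow> real \<Rightarrow> nat \<Rightarrow> real \<Rightarrow> 'w \<Rightarrow> real"
  where "compensated_N N lam l s \<omega> = measure (N \<omega>) ({0<..s} \<times> {l}) - lam * s"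

text \<open>
  The driver is integrated against the completed Lebesgue measure: \<open>K s \<omega>\<close> may lie outside
  \<^term>\<open>L2_fun \<nu>\<close> for \<open>s\<close> in a null set, where nothing is known about the driver and
  Borel measurability in \<open>s\<close> could fail.
\<close>

definition bsde_solution :: "'w measure \<Rightarrow> (real \<Rightarrow> 'w measure) \<Rightarrow>
    (real \<Rightarrow> 'w \<Rightarrow> real ^ 'd::finite) \<Rightarrow> ('w \<Rightarrow> (real \<times> nat) measure) \<Rightarrow>
    ('w \<Rightarrow> (real \<times> 'e) measure) \<Rightarrow> 'e measure \<Rightarrow> real \<Rightarrow> nat \<Rightarrow> real \<Rightarrow>
    ('w \<Rightarrow> real \<Rightarrow> real \<Rightarrow> (nat \<Rightarrow> real) \<Rightarrow> real ^ 'd \<Rightarrow> ('e \<Rightarrow> real) \<Rightarrow> real) \<Rightarrow>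
    ('w \<Rightarrow> real) \<Rightarrow> (real \<Rightarrow> 'w \<Rightarrow> real) \<Rightarrow> (real \<Rightarrow> 'w \<Rightarrow> nat \<Rightarrow> real) \<Rightarrow>
    (real \<Rightarrow> 'w \<Rightarrow> real ^ 'd) \<Rightarrow> (real \<Rightarrow> 'w \<Rightarrow> 'e \<Rightarrow> real) \<Rightarrow> bool"
  where "bsde_solution M F B N \<mu> \<nu> lam m T f \<xi> Y H Z K \<longleftrightarrow>
    (Y, H, Z, K) \<in> S2 M F \<nu> m 0 T \<and>
    (\<exists>JB JN J\<mu>.
      (\<forall>i. stochastic_integral M F T (\<lambda>s \<omega>. B s \<omega> $ i) (\<lambda>s \<omega>. Z s \<omega> $ i) (JB i)) \<and>
      (\<forall>l\<in>marks m. stochastic_integral M F T (compensated_N N lam l) (\<lambda>s \<omega>. H s \<omega> l) (JN l)) \<and>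
      compensated_integral M F \<nu> T \<mu> K J\<mu> \<and>
      (AE \<omega> in M.
        set_integrable lebesgue {0..T} (\<lambda>s. f \<omega> s (Y s \<omega>) (H s \<omega>) (Z s \<omega>) (K s \<omega>)) \<and>
        (\<forall>t\<in>{0..T}. Y t \<omega> =
           \<xi> \<omega> + (LINT s:{t..T}|lebesgue. f \<omega> s (Y s \<omega>) (H s \<omega>) (Z s \<omega>) (K s \<omega>))
           - (\<Sum>i\<in>UNIV. JB i T \<omega> - JB i t \<omega>)
           - (\<Sum>l\<in>marks m. JN l T \<omega> - JN l t \<omega>)
           - (J\<mu> T \<omega> - J\<mu> t \<omega>))))"

end

theory Submission
  imports Defs
begin

text \<open>Write \<open>Y\<close>, \<open>S\<close> for the differences of the two solutions and of their martingale parts, so that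
  \<open>Y t + (S u - S t)\<close> equals \<open>Y u\<close> plus the integrated drift over \<open>(t, u]\<close>. Multiplying the square of this
  identity by the indicator of \<open>A \<in> F t\<close> and integrating needs no Ito formula: the cross term vanishes and
  the square of \<open>S u - S t\<close> is given by the isometry, while the drift contributes at most \<open>K * (u - t)\<close>
  times the integrated squares, by Cauchy--Schwarz and the Lipschitz condition. On short intervals the
  drift is absorbed on the left, and finitely many short steps lead from \<open>t\<close> to \<open>T\<close>. The weights
  \<open>exp (\<beta> * (s - t))\<close> lie between \<open>1\<close> and \<open>exp (\<beta> * T)\<close> and only enlarge the constant; as \<open>A\<close> is arbitrary,
  the bound holds for conditional expectations.\<close>

section \<open>Independence of generated sigma-algebras\<close>

text \<open>The stochastic integrals enter only as mean-square limits of step integrals, and this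
  decides what has to be known about the noise: the conditional mean and the conditional covariances
  of increments over \<open>(s, r]\<close> given \<open>F s\<close>. These two facts are the
  laborious part. The definitions of the noises give independence for finitely many Brownian
  increments and for finitely many disjoint sets, whereas \<open>F s\<close> contains negative
  times, a right-continuous Poisson past and the null sets; pi-system arguments bridge the gap.
  Brownian coordinates and the compensated counts of \<open>N\<close> and \<open>\<mu>\<close> are
  then indexed by one type and treated as a single family with one bracket, so the isometry and the
  vanishing of all mixed terms come from one computation. The price of avoiding the Ito formula is a
  factor 2 in front of the later value at every step, from squaring a sum of two terms. Over
  \<open>n\<close> steps the loss is geometric, but \<open>n\<close> depends only on
  \<open>T\<close>, the Lipschitz constant and \<open>lam\<close>, so the constant is the same for
  all \<open>t\<close> and all events.\<close>

lemma sigma_algebra_gen_sets: "sigma_algebra (space M) (gen_sets M X I)"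
  unfolding gen_sets_def by (rule sigma_algebra_sigma_sets) auto

lemma sets_sigma_gen_sets [simp]: "sets (sigma (space M) (gen_sets M X I)) = gen_sets M X I"
  using sigma_algebra_gen_sets
  by (metis sigma_algebra.sets_measure_of_eq)

lemma space_sigma_gen_sets [simp]: "space (sigma (space M) (gen_sets M X I)) = space M"
  by (simp add: space_measure_of_conv)

lemma measurable_gen_sets:
  "i \<in> I \<Longrightarrow> X i \<in> borel_measurable (sigma (space M) (gen_sets M X I))"
proof (rule measurableI, simp, unfold sets_sigma_gen_sets space_sigma_gen_sets)
  fix A :: "'c set" assume "i \<in> I" "A \<in> sets borel"
  then show "X i -` A \<inter> space M \<in> gen_sets M X I"
    unfolding gen_sets_def by auto
qed

lemma gen_sets_subset:
  assumes "\<And>j. j \<in> J \<Longrightarrow> Y j \<in> borel_measurable N" "space N = space M"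
  shows "gen_sets M Y J \<subseteq> sets N"
  unfolding gen_sets_def assms(2)[symmetric]
  by (rule sets.sigma_sets_subset) (use measurable_sets[OF assms(1)] in auto)

lemma gen_sets_mono: "J \<subseteq> I \<Longrightarrow> gen_sets M X J \<subseteq> gen_sets M X I"
  unfolding gen_sets_def by (intro sigma_sets_mono') blast

lemma Int_stable_vimages: "Int_stable {X -` A \<inter> S |A. A \<in> sets N}"
proof (clarsimp simp: Int_stable_def)
  fix a b assume "a \<in> sets N" "b \<in> sets N"
  then show "\<exists>A. X -` a \<inter> S \<inter> (X -` b \<inter> S) = X -` A \<inter> S \<and> A \<in> sets N"
    by (intro exI[of _ "a \<inter> b"]) auto
qed

lemma Int_stable_sigma_algebra: "sigma_algebra S A \<Longrightarrow> Int_stable A"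
  unfolding Int_stable_def
  using sigma_algebra.axioms(1)[of S A] unfolding algebra_iff_Int Int_stable_def by blast

context prob_space
begin

lemma indep_set_mono: "indep_set A B \<Longrightarrow> A' \<subseteq> A \<Longrightarrow> B' \<subseteq> B \<Longrightarrow> indep_set A' B'"
  unfolding indep_sets2_eq by blast

lemma indep_set_commute: "indep_set A B \<Longrightarrow> indep_set B A"
  unfolding indep_sets2_eq by (metis Int_commute mult.commute)

text \<open>Preimages of Borel sets under one variable form a pi-system, so independence survives
  grouping the variables into two disjoint blocks and generating a sigma-algebra from each.
  \<open>case_bool\<close> presents the two blocks as a family over \<open>bool\<close>.\<close>

lemma indep_vars_imp_indep_set_gen_sets:
  fixes X :: "'i \<Rightarrow> 'a \<Rightarrow> 'x::topological_space"
  assumes "indep_vars (\<lambda>_. borel) X I" "I1 \<subseteq> I" "I2 \<subseteq> I" "I1 \<inter> I2 = {}"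
  shows "indep_set (gen_sets M X I1) (gen_sets M X I2)"
proof -
  have "indep_sets (\<lambda>j. sigma_sets (space M) (\<Union>i\<in>case_bool I1 I2 j.
      {X i -` A \<inter> space M | A. A \<in> sets borel})) UNIV"
  proof (rule indep_sets_collect_sigma)
    show "indep_sets (\<lambda>i. {X i -` A \<inter> space M |A. A \<in> sets borel}) (\<Union>j\<in>UNIV. case_bool I1 I2 j)"
    proof (rule indep_sets_mono_index)
      show "indep_sets (\<lambda>i. {X i -` A \<inter> space M |A. A \<in> sets borel}) I"
        using assms(1) unfolding indep_vars_def2 by auto
    qed (use assms in \<open>auto split: bool.splits\<close>)
    show "disjoint_family (case_bool I1 I2)"
      using assms(4) by (auto simp: disjoint_family_on_def split: bool.splits)
  qed (rule Int_stable_vimages)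
  moreover have "(\<lambda>j. sigma_sets (space M) (\<Union>i\<in>case_bool I1 I2 j.
      {X i -` A \<inter> space M | A. A \<in> sets borel})) = case_bool (gen_sets M X I1) (gen_sets M X I2)"
    by (auto simp: gen_sets_def fun_eq_iff split: bool.splits)
  ultimately show ?thesis
    unfolding indep_set_def by simp
qed

text \<open>The sigma-algebras of finite subfamilies are directed upwards, so their union is a
  pi-system, and it generates the sigma-algebra of the whole family. This is how statements about
  finitely many increments or sets reach the full past.\<close>

lemma indep_set_gen_sets_finite:
  assumes fin: "\<And>J. finite J \<Longrightarrow> J \<subseteq> I \<Longrightarrow> indep_set (gen_sets M X J) \<B>"
    and "Int_stable \<B>"
  shows "indep_set (gen_sets M X I) (sigma_sets (space M) \<B>)"
proof -
  define \<P> where "\<P> = (\<Union>J\<in>{J. finite J \<and> J \<subseteq> I}. gen_sets M X J)"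
  have "Int_stable \<P>"
    unfolding Int_stable_def
  proof safe
    fix A B assume "A \<in> \<P>" "B \<in> \<P>"
    then obtain J K where *: "finite J" "J \<subseteq> I" "finite K" "K \<subseteq> I"
        "A \<in> gen_sets M X J" "B \<in> gen_sets M X K"
      by (auto simp: \<P>_def)
    then have "A \<in> gen_sets M X (J \<union> K)" "B \<in> gen_sets M X (J \<union> K)"
      using gen_sets_mono[of J "J \<union> K" M X] gen_sets_mono[of K "J \<union> K" M X] by auto
    then have "A \<inter> B \<in> gen_sets M X (J \<union> K)"
      using Int_stable_sigma_algebra[OF sigma_algebra_gen_sets, of M X "J \<union> K"]
      unfolding Int_stable_def by blast
    with * show "A \<inter> B \<in> \<P>"
      by (auto simp: \<P>_def intro!: exI[of _ "J \<union> K"])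
  qed
  moreover have "indep_set \<P> \<B>"
    using fin unfolding indep_sets2_eq \<P>_def by blast
  ultimately have "indep_set (sigma_sets (space M) \<P>) (sigma_sets (space M) \<B>)"
    using assms(2) by (intro indep_set_sigma_sets)
  moreover have "gen_sets M X I \<subseteq> sigma_sets (space M) \<P>"
    unfolding gen_sets_def
  proof (rule sigma_sets_mono, clarify)
    fix i A assume "i \<in> I" "A \<in> sets (borel :: 'c measure)"
    then have "X i -` A \<inter> space M \<in> gen_sets M X {i}"
      by (auto simp: gen_sets_def)
    with \<open>i \<in> I\<close> show "X i -` A \<inter> space M \<in> sigma_sets (space M) \<P>"
      by (intro sigma_sets.Basic) (auto simp: \<P>_def intro!: exI[of _ "{i}"])
  qed
  ultimately show ?thesis
    by (rule indep_set_mono) auto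
qed

text \<open>Set form of a conditional expectation that is constant: with \<open>G\<close> the past
  and \<open>f\<close> a function of the future, it delivers the mean and covariance axioms of the
  noise.\<close>

lemma indep_set_integral:
  fixes f :: "'a \<Rightarrow> real"
  assumes ind: "indep_set (sets G) (sets H)" and sp: "space G = space M" "space H = space M"
    and A: "A \<in> sets G" and f: "f \<in> borel_measurable H" "integrable M f"
  shows "(\<integral>\<omega>. indicator A \<omega> * f \<omega> \<partial>M) = prob A * (\<integral>\<omega>. f \<omega> \<partial>M)"
proof -
  have ev: "sets G \<subseteq> events" "sets H \<subseteq> events"
    using indep_setD_ev1[OF ind] indep_setD_ev2[OF ind] by auto
  have "indep_var borel (indicator A :: 'a \<Rightarrow> real) borel f"
    unfolding indep_var_eq
  proof (intro conjI)
    show "indep_set (sigma_sets (space M) {(indicator A :: 'a \<Rightarrow> real) -` B \<inter> space M |B. B \<in> sets borel})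
       (sigma_sets (space M) {f -` B \<inter> space M |B. B \<in> sets borel})"
    proof (rule indep_set_mono[OF ind])
      have "(indicator A :: 'a \<Rightarrow> real) \<in> borel_measurable G" using A by simp
      from measurable_sets[OF this] sp show "sigma_sets (space M) {(indicator A :: 'a \<Rightarrow> real) -` B \<inter> space M |B. B \<in> sets borel} \<subseteq> sets G"
        unfolding sp(1)[symmetric] by (intro sets.sigma_sets_subset) auto
      show "sigma_sets (space M) {f -` B \<inter> space M |B. B \<in> sets borel} \<subseteq> sets H"
        using measurable_sets[OF f(1)]
        unfolding sp(2)[symmetric] by (intro sets.sigma_sets_subset) auto
    qed
  qed (use A ev f in auto)
  moreover have "integrable M (indicator A :: 'a \<Rightarrow> real)"
    using A ev by (intro integrable_real_indicator) (auto simp: emeasure_eq_measure)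
  ultimately show ?thesis
    using indep_var_lebesgue_integral[of "indicator A" f] f A ev by auto
qed

end

section \<open>Past and future of the noises\<close>

text \<open>A Poisson random measure is only assumed independent over disjoint sets, so an arbitrary
  finite family is first cut into its atoms. An atom collects the points lying in exactly the
  members of a subfamily \<open>K\<close>; the empty subfamily is left out so that all atoms stay
  inside the union of the family.\<close>

lemma disjoint_refinement:
  assumes "finite J" "J \<subseteq> sets N"
  obtains n :: nat and C where "\<And>i. i < n \<Longrightarrow> C i \<in> sets N" "\<And>i. i < n \<Longrightarrow> C i \<subseteq> \<Union>J"
    "disjoint_family_on C {..<n}" "\<And>D. D \<in> J \<Longrightarrow> \<exists>I\<subseteq>{..<n}. D = \<Union>(C ` I)"
proof -
  define S where "S = Pow J - {{}}"
  define At where "At K = \<Inter>K - \<Union>(J - K)" for K :: "'a set set"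
  have "finite S" using assms by (auto simp: S_def)
  then obtain h where h: "bij_betw h {0..<card S} S"
    using ex_bij_betw_nat_finite by blast
  have hS: "h i \<in> S" if "i < card S" for i
    using h that by (auto simp: bij_betw_def)
  \<comment> \<open>The subfamily can be read off from any point of its atom; disjointness and
    covering both follow.\<close>
  have At_iff: "x \<in> At K \<longleftrightarrow> K = {D\<in>J. x \<in> D}" if "K \<in> S" for x K
    using that by (auto simp: S_def At_def)
  show thesis
  proof (rule that[of "card S" "\<lambda>i. At (h i)"])
    fix i assume "i < card S"
    then have i: "h i \<subseteq> J" "h i \<noteq> {}" using hS[of i] by (auto simp: S_def)
    with assms have "finite (h i)" "finite (J - h i)" by (auto intro: finite_subset)
    moreover have "h i \<subseteq> sets N" "J - h i \<subseteq> sets N" using i assms by auto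
    ultimately show "At (h i) \<in> sets N"
      using i sets.finite_INT[of "h i" "\<lambda>x. x" N]
      unfolding At_def by (intro sets.Diff sets.finite_Union) auto
    show "At (h i) \<subseteq> \<Union>J" using i by (auto simp: At_def)
  next
    show "disjoint_family_on (\<lambda>i. At (h i)) {..<card S}"
      unfolding disjoint_family_on_def
    proof (intro ballI impI)
      fix i j assume *: "i \<in> {..<card S}" "j \<in> {..<card S}" "i \<noteq> j"
      then have "h i \<noteq> h j" using h by (auto simp: bij_betw_def inj_on_def)
      then show "At (h i) \<inter> At (h j) = {}"
        using At_iff[OF hS] * by auto
    qed
  next
    fix D assume D: "D \<in> J"
    have "D = \<Union>((\<lambda>i. At (h i)) ` {i. i < card S \<and> D \<in> h i})"
    proof (intro equalityI subsetI)
      fix x assume x: "x \<in> D"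
      define K where "K = {D\<in>J. x \<in> D}"
      have K: "K \<in> S" "D \<in> K" using x D by (auto simp: K_def S_def)
      then obtain i where i: "i < card S" "h i = K"
        using h by (auto simp: bij_betw_def) (metis (no_types, lifting) atLeastLessThan_iff imageE)
      with K have "x \<in> At (h i)" using At_iff[of "h i" x] by (simp add: K_def)
      with i K show "x \<in> \<Union>((\<lambda>i. At (h i)) ` {i. i < card S \<and> D \<in> h i})" by auto
    qed (auto simp: At_def)
    then show "\<exists>I\<subseteq>{..<card S}. D = \<Union>((\<lambda>i. At (h i)) ` I)"
      by (intro exI[of _ "{i. i < card S \<and> D \<in> h i}"]) auto
  qed
qed

section \<open>Past and future of a Poisson random measure and of Brownian motion\<close>

context prob_space
begin

text \<open>The atoms of both families are put into one disjoint list, where the definition gives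
  joint independence. The count of each original set is the sum of the counts of its atoms, hence a
  function of its own block only.\<close>

lemma poisson_indep_set_disjoint_finite:
  assumes prm: "poisson_random_measure M \<Lambda> R"
    and J: "finite J" "J \<subseteq> sets \<Lambda>" and K: "finite K" "K \<subseteq> sets \<Lambda>"
    and disj: "\<Union>J \<inter> \<Union>K = {}"
  shows "indep_set (gen_sets M (\<lambda>A \<omega>. emeasure (R \<omega>) A) J) (gen_sets M (\<lambda>A \<omega>. emeasure (R \<omega>) A) K)"
proof -
  obtain n1 :: nat and C1 where C1: "\<And>i. i < n1 \<Longrightarrow> C1 i \<in> sets \<Lambda>" "\<And>i. i < n1 \<Longrightarrow> C1 i \<subseteq> \<Union>J"
    "disjoint_family_on C1 {..<n1}" "\<And>D. D \<in> J \<Longrightarrow> \<exists>I\<subseteq>{..<n1}. D = \<Union>(C1 ` I)"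
    using disjoint_refinement[OF J] by metis
  obtain n2 :: nat and C2 where C2: "\<And>i. i < n2 \<Longrightarrow> C2 i \<in> sets \<Lambda>" "\<And>i. i < n2 \<Longrightarrow> C2 i \<subseteq> \<Union>K"
    "disjoint_family_on C2 {..<n2}" "\<And>D. D \<in> K \<Longrightarrow> \<exists>I\<subseteq>{..<n2}. D = \<Union>(C2 ` I)"
    using disjoint_refinement[OF K] by metis
  \<comment> \<open>Indices below \<open>n1\<close> carry the atoms of \<open>J\<close>, the next
    \<open>n2\<close> those of \<open>K\<close>; disjointness across the two blocks comes from
    \<open>disj\<close>.\<close>
  define C where "C i = (if i < n1 then C1 i else C2 (i - n1))" for i
  have C_sets: "C i \<in> sets \<Lambda>" if "i < n1 + n2" for i
    using that C1(1) C2(1) by (auto simp: C_def)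
  have C_disj: "disjoint_family_on C {..<n1 + n2}"
    unfolding disjoint_family_on_def
  proof (intro ballI impI)
    fix i j assume ij: "i \<in> {..<n1 + n2}" "j \<in> {..<n1 + n2}" "i \<noteq> j"
    consider "i < n1" "j < n1" | "i < n1" "\<not> j < n1" | "\<not> i < n1" "j < n1" | "\<not> i < n1" "\<not> j < n1"
      by blast
    then show "C i \<inter> C j = {}"
    proof cases
      case 1 then show ?thesis using C1(3) ij by (auto simp: C_def disjoint_family_on_def)
    next
      case 2
      then have "C i \<subseteq> \<Union>J" "C j \<subseteq> \<Union>K" using C1(2)[of i] C2(2)[of "j - n1"] ij by (auto simp: C_def)
      then show ?thesis using disj by blast
    next
      case 3
      then have "C j \<subseteq> \<Union>J" "C i \<subseteq> \<Union>K" using C1(2)[of j] C2(2)[of "i - n1"] ij by (auto simp: C_def)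
      then show ?thesis using disj by blast
    next
      case 4
      then have "i - n1 < n2" "j - n1 < n2" "i - n1 \<noteq> j - n1" using ij by auto
      then show ?thesis using C2(3) 4 by (auto simp: C_def disjoint_family_on_def)
    qed
  qed
  have iv: "indep_vars (\<lambda>_. borel) (\<lambda>i \<omega>. emeasure (R \<omega>) (C i)) {..<n1 + n2}"
    using prm C_sets C_disj unfolding poisson_random_measure_def by blast
  have sets_R: "sets (R \<omega>) = sets \<Lambda>" if "\<omega> \<in> space M" for \<omega>
    using prm that unfolding poisson_random_measure_def by blast
  have sub: "gen_sets M (\<lambda>A \<omega>. emeasure (R \<omega>) A) \<D> \<subseteq> gen_sets M (\<lambda>i \<omega>. emeasure (R \<omega>) (C i)) I"
    if *: "I \<subseteq> {..<n1 + n2}" "\<And>D. D \<in> \<D> \<Longrightarrow> \<exists>I'\<subseteq>I. D = \<Union>(C ` I')" for \<D> I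
  proof -
    let ?G = "sigma (space M) (gen_sets M (\<lambda>i \<omega>. emeasure (R \<omega>) (C i)) I)"
    have "(\<lambda>\<omega>. emeasure (R \<omega>) D) \<in> borel_measurable ?G" if "D \<in> \<D>" for D
    proof -
      obtain I' where I': "I' \<subseteq> I" "D = \<Union>(C ` I')" using *(2)[OF \<open>D \<in> \<D>\<close>] by blast
      have "(\<lambda>\<omega>. \<Sum>i\<in>I'. emeasure (R \<omega>) (C i)) \<in> borel_measurable ?G"
        using I' by (intro borel_measurable_sum measurable_gen_sets) auto
      moreover have "emeasure (R \<omega>) D = (\<Sum>i\<in>I'. emeasure (R \<omega>) (C i))" if "\<omega> \<in> space ?G" for \<omega>
      proof -
        have "finite I'" using I'(1) *(1) by (auto intro: finite_subset)
        moreover have "disjoint_family_on C I'"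
          using C_disj I'(1) *(1) by (auto intro: disjoint_family_on_mono)
        moreover have "C ` I' \<subseteq> sets (R \<omega>)"
          using sets_R that C_sets I'(1) *(1) by auto
        ultimately show ?thesis
          unfolding I'(2) by (intro sum_emeasure[symmetric])
      qed
      ultimately show ?thesis
        using measurable_cong[of ?G "\<lambda>\<omega>. emeasure (R \<omega>) D" "\<lambda>\<omega>. \<Sum>i\<in>I'. emeasure (R \<omega>) (C i)" borel] by blast
    qed
    then show ?thesis
      using gen_sets_subset[of \<D> "\<lambda>A \<omega>. emeasure (R \<omega>) A" ?G M] by simp
  qed
  have "indep_set (gen_sets M (\<lambda>i \<omega>. emeasure (R \<omega>) (C i)) {..<n1})
     (gen_sets M (\<lambda>i \<omega>. emeasure (R \<omega>) (C i)) {n1..<n1+n2})"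
    using iv by (rule indep_vars_imp_indep_set_gen_sets) auto
  then show ?thesis
  proof (rule indep_set_mono)
    show "gen_sets M (\<lambda>A \<omega>. emeasure (R \<omega>) A) J \<subseteq> gen_sets M (\<lambda>i \<omega>. emeasure (R \<omega>) (C i)) {..<n1}"
    proof (rule sub)
      fix D assume "D \<in> J"
      then obtain I where "I \<subseteq> {..<n1}" "D = \<Union>(C1 ` I)" using C1(4) by blast
      moreover from this have "C1 ` I = C ` I" by (force simp: C_def)
      ultimately show "\<exists>I'\<subseteq>{..<n1}. D = \<Union>(C ` I')" by metis
    qed auto
    show "gen_sets M (\<lambda>A \<omega>. emeasure (R \<omega>) A) K \<subseteq> gen_sets M (\<lambda>i \<omega>. emeasure (R \<omega>) (C i)) {n1..<n1+n2}"
    proof (rule sub)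
      fix D assume "D \<in> K"
      then obtain I where I: "I \<subseteq> {..<n2}" "D = \<Union>(C2 ` I)" using C2(4) by blast
      have "C2 ` I = C ` ((+) n1 ` I)" by (force simp: C_def image_image)
      with I show "\<exists>I'\<subseteq>{n1..<n1+n2}. D = \<Union>(C ` I')"
        by (intro exI[of _ "(+) n1 ` I"]) auto
    qed auto
  qed
qed

text \<open>Finiteness is removed from one family at a time; symmetry of independence lets the same
  extension lemma serve both.\<close>

lemma poisson_indep_set_disjoint:
  assumes prm: "poisson_random_measure M \<Lambda> R"
    and J: "J \<subseteq> sets \<Lambda>" and K: "K \<subseteq> sets \<Lambda>"
    and disj: "\<Union>J \<inter> \<Union>K = {}"
  shows "indep_set (gen_sets M (\<lambda>A \<omega>. emeasure (R \<omega>) A) J) (gen_sets M (\<lambda>A \<omega>. emeasure (R \<omega>) A) K)"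
proof -
  let ?X = "\<lambda>A \<omega>. emeasure (R \<omega>) A"
  have Int: "Int_stable (gen_sets M ?X L)" for L
    by (rule Int_stable_sigma_algebra[OF sigma_algebra_gen_sets])
  have ss: "sigma_sets (space M) (gen_sets M ?X L) = gen_sets M ?X L" for L
    using sigma_algebra.sigma_sets_eq[OF sigma_algebra_gen_sets] by metis
  have "indep_set (gen_sets M ?X J) (gen_sets M ?X K')" if K': "finite K'" "K' \<subseteq> K" for K'
  proof -
    have "indep_set (gen_sets M ?X J') (gen_sets M ?X K')" if "finite J'" "J' \<subseteq> J" for J'
    proof (rule poisson_indep_set_disjoint_finite[OF prm])
      show "\<Union>J' \<inter> \<Union>K' = {}" using disj that K' by blast
    qed (use that J K K' in auto)
    then show ?thesis
      using indep_set_gen_sets_finite[of J ?X "gen_sets M ?X K'"] Int unfolding ss by blast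
  qed
  then show ?thesis
    using indep_set_gen_sets_finite[of K ?X "gen_sets M ?X J"] Int
    unfolding ss by (meson indep_set_commute)
qed

text \<open>An event of the right-continuous past at \<open>s\<close> belongs to the past at every
  \<open>u > s\<close>, while a generating event of the future only sees sets beyond one such
  \<open>u\<close>; for this \<open>u\<close> the two live on disjoint time sets. The generating
  events are nested in \<open>u\<close>, hence a pi-system.\<close>

lemma poisson_indep_past_future:
  assumes prm: "poisson_random_measure M \<Lambda> R"
  shows "indep_set (\<Inter>u\<in>{s<..}. past_sets M \<Lambda> R u)
    (sigma_sets (space M) (\<Union>u\<in>{s<..}. gen_sets M (\<lambda>A \<omega>. emeasure (R \<omega>) A)
       {A \<in> sets \<Lambda>. A \<subseteq> {u<..} \<times> UNIV}))"
proof -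
  let ?X = "\<lambda>A \<omega>. emeasure (R \<omega>) A"
  let ?U = "\<lambda>u. gen_sets M ?X {A \<in> sets \<Lambda>. A \<subseteq> {u<..} \<times> UNIV}"
  have ind: "indep_set (past_sets M \<Lambda> R u) (?U u)" for u
  proof -
    have "\<Union>{A \<in> sets \<Lambda>. A \<subseteq> {..u} \<times> UNIV} \<subseteq> {..u} \<times> UNIV"
      "\<Union>{A \<in> sets \<Lambda>. A \<subseteq> {u<..} \<times> UNIV} \<subseteq> {u<..} \<times> UNIV" by blast+
    then have "\<Union>{A \<in> sets \<Lambda>. A \<subseteq> {..u} \<times> UNIV} \<inter> \<Union>{A \<in> sets \<Lambda>. A \<subseteq> {u<..} \<times> UNIV} = {}"
      by fastforce
    then show ?thesis
      unfolding past_sets_def by (intro poisson_indep_set_disjoint[OF prm]) auto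
  qed
  have past: "(\<Inter>u\<in>{s<..}. past_sets M \<Lambda> R u) \<subseteq> past_sets M \<Lambda> R u" if "s < u" for u
    using that by auto
  have "indep_set (\<Inter>u\<in>{s<..}. past_sets M \<Lambda> R u) (\<Union>u\<in>{s<..}. ?U u)"
    unfolding indep_sets2_eq
  proof (intro conjI ballI)
    show "(\<Inter>u\<in>{s<..}. past_sets M \<Lambda> R u) \<subseteq> events"
      using ind[of "s+1"] past[of "s+1"] unfolding indep_sets2_eq by auto
    show "(\<Union>u\<in>{s<..}. ?U u) \<subseteq> events"
      using ind unfolding indep_sets2_eq by blast
    fix a b assume "a \<in> (\<Inter>u\<in>{s<..}. past_sets M \<Lambda> R u)" "b \<in> (\<Union>u\<in>{s<..}. ?U u)"
    then obtain u where "s < u" "b \<in> ?U u" "a \<in> past_sets M \<Lambda> R u" by auto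
    then show "prob (a \<inter> b) = prob a * prob b"
      using ind[of u] unfolding indep_sets2_eq by blast
  qed
  moreover have "Int_stable (\<Inter>u\<in>{s<..}. past_sets M \<Lambda> R u)"
    unfolding Int_stable_def past_sets_def
    using Int_stable_sigma_algebra[OF sigma_algebra_gen_sets, of M ?X] unfolding Int_stable_def by blast
  moreover have "Int_stable (\<Union>u\<in>{s<..}. ?U u)"
    unfolding Int_stable_def
  proof (intro ballI)
    fix a b assume "a \<in> (\<Union>u\<in>{s<..}. ?U u)" "b \<in> (\<Union>u\<in>{s<..}. ?U u)"
    then obtain u v where uv: "s < u" "s < v" "a \<in> ?U u" "b \<in> ?U v" by auto
    \<comment> \<open>Lowering the time bound enlarges the family, so two events of the future share
      the level \<open>min u v\<close>.\<close>
    have "{w<..} \<times> UNIV \<subseteq> {min u v<..} \<times> (UNIV :: 'b set)" if "w \<in> {u, v}" for w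
      using that by auto
    then have "?U u \<subseteq> ?U (min u v)" "?U v \<subseteq> ?U (min u v)"
      by (intro gen_sets_mono; blast)+
    then have "a \<in> ?U (min u v)" "b \<in> ?U (min u v)" using uv by auto
    then have "a \<inter> b \<in> ?U (min u v)"
      using Int_stable_sigma_algebra[OF sigma_algebra_gen_sets, of M ?X] unfolding Int_stable_def by blast
    then show "a \<inter> b \<in> (\<Union>u\<in>{s<..}. ?U u)"
      using uv by (intro UN_I[of "min u v"]) auto
  qed
  ultimately show ?thesis
    using indep_set_sigma_sets by (meson indep_set_mono sigma_sets_superset_generator order_refl)
qed

text \<open>The past runs over all of \<open>{..s}\<close>, negative times included. Over
  \<open>[0, s]\<close> it is reached through finitely many increments at a time. The branch at
  negative times is independent of the whole branch at nonnegative times, which contains the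
  increment as well.\<close>

lemma brownian_indep_increment:
  fixes B :: "real \<Rightarrow> 'a \<Rightarrow> real ^ 'd::finite"
  assumes bm: "two_sided_brownian_motion M B" and s: "0 \<le> s" "s < r"
  shows "indep_set (gen_sets M B {..s}) (gen_sets M (\<lambda>_ \<omega>. B r \<omega> - B s \<omega>) (UNIV :: unit set))"
proof -
  have Int: "Int_stable (gen_sets M X L)" for X :: "'z \<Rightarrow> 'a \<Rightarrow> real ^ 'd" and L
    by (rule Int_stable_sigma_algebra[OF sigma_algebra_gen_sets])
  have ss: "sigma_sets (space M) (gen_sets M X L) = gen_sets M X L" for X :: "'z \<Rightarrow> 'a \<Rightarrow> real ^ 'd" and L
    using sigma_algebra.sigma_sets_eq[OF sigma_algebra_gen_sets] by metis
  let ?Fu = "gen_sets M (\<lambda>_ \<omega>. B r \<omega> - B s \<omega>) (UNIV :: unit set)"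
  have bm1: "brownian_motion M B" and bm2: "indep_set (gen_sets M B {0..}) (gen_sets M (\<lambda>s. B (- s)) {0..})"
    using bm by (auto simp: two_sided_brownian_motion_def)
  have B0: "B 0 \<omega> = 0" if "\<omega> \<in> space M" for \<omega>
    using bm1 that by (auto simp: brownian_motion_def)
  have pos: "indep_set (gen_sets M B {0..s}) ?Fu"
  proof -
    have "indep_set (gen_sets M B J) ?Fu" if J: "finite J" "J \<subseteq> {0..s}" for J
    proof -
      \<comment> \<open>The finite set of times is enlarged by \<open>0\<close> and \<open>s\<close>
        and sorted; past the end of the list, \<open>\<tau>\<close> takes the default value
        \<open>r\<close>. So the increment with index \<open>n - 1\<close> is exactly
        \<open>B r - B s\<close>, and the earlier ones determine \<open>B\<close> at all listed
        times because \<open>B 0 = 0\<close>.\<close>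
      define l where "l = sorted_list_of_set (insert 0 (insert s J))"
      define n where "n = length l"
      define \<tau> where "\<tau> i = (if i < n then l ! i else r)" for i
      have fin: "finite (insert 0 (insert s J))" using J by auto
      have l: "sorted l" "set l = insert 0 (insert s J)" "distinct l"
        unfolding l_def using fin
        by (simp_all del: sorted_list_of_set_insert_remove)
      have l_range: "l ! i \<in> {0..s}" if "i < n" for i
        using nth_mem[of i l] that l(2) J(2) s by (auto simp: n_def)
      have n0: "0 < n" using l(2) by (auto simp: n_def length_greater_0_conv)
      have \<tau>0: "\<tau> 0 = 0"
      proof -
        obtain i where "i < n" "l ! i = 0" using l(2) in_set_conv_nth[of 0 l] by (auto simp: n_def)
        then have "l ! 0 \<le> 0" using sorted_nth_mono[OF l(1), of 0 i] by (auto simp: n_def)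
        then show ?thesis using l_range[of 0] n0 by (auto simp: \<tau>_def)
      qed
      have \<tau>n: "\<tau> (n - 1) = s"
      proof -
        obtain i where "i < n" "l ! i = s" using l(2) in_set_conv_nth[of s l] by (auto simp: n_def)
        then have "s \<le> l ! (n - 1)" using sorted_nth_mono[OF l(1), of i "n - 1"] by (auto simp: n_def)
        then show ?thesis using l_range[of "n - 1"] n0 by (auto simp: \<tau>_def)
      qed
      have mono: "\<forall>i<n. \<tau> i \<le> \<tau> (Suc i)"
      proof (intro allI impI)
        fix i assume "i < n"
        show "\<tau> i \<le> \<tau> (Suc i)"
        proof (cases "Suc i < n")
          case True
          then have "l ! i \<le> l ! Suc i" unfolding n_def by (intro sorted_nth_mono[OF l(1)]) simp_all
          with True \<open>i < n\<close> show ?thesis unfolding \<tau>_def by (simp only: if_True)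
        next
          case False
          from l_range[OF \<open>i < n\<close>] s(2) have "l ! i \<le> r" unfolding atLeastAtMost_iff by (meson order.trans less_imp_le)
          with False \<open>i < n\<close> show ?thesis unfolding \<tau>_def by (simp only: if_True if_False)
        qed
      qed
      let ?D = "\<lambda>i \<omega>. B (\<tau> (Suc i)) \<omega> - B (\<tau> i) \<omega>"
      have "indep_vars (\<lambda>_. borel) ?D {..<n}"
        using bm1[unfolded brownian_motion_def, THEN conjunct2, THEN conjunct2, THEN conjunct2, rule_format, of \<tau> n]
          eq_refl[OF \<tau>0[symmetric]] mono by simp
      then have i1: "indep_set (gen_sets M ?D {..<n-1}) (gen_sets M ?D {n-1})"
        by (rule indep_vars_imp_indep_set_gen_sets) (use n0 in auto)
      have i2: "gen_sets M ?D {n-1} = ?Fu"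
      proof -
        have "Suc (n - 1) = n" using n0 by simp
        then show ?thesis unfolding gen_sets_def \<tau>n using \<tau>n by (simp add: \<tau>_def)
      qed
      have i3: "gen_sets M B J \<subseteq> gen_sets M ?D {..<n-1}"
      proof -
        let ?G = "sigma (space M) (gen_sets M ?D {..<n-1})"
        have tel: "B (\<tau> k) \<omega> = (\<Sum>i<k. ?D i \<omega>)" if "\<omega> \<in> space M" for k \<omega>
          unfolding sum_lessThan_telescope[of "\<lambda>i. B (\<tau> i) \<omega>" k] \<tau>0 B0[OF that] by (rule diff_zero[symmetric])
        have "B j \<in> borel_measurable ?G" if "j \<in> J" for j
        proof -
          have "j \<in> set l" using l(2) that by simp
          then obtain k where k: "k < n" "l ! k = j" unfolding in_set_conv_nth n_def by blast
          then have "j = \<tau> k" by (simp add: \<tau>_def)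
          have "(\<lambda>\<omega>. \<Sum>i<k. ?D i \<omega>) \<in> borel_measurable ?G"
            using k by (intro borel_measurable_sum measurable_gen_sets) auto
          then show ?thesis
            unfolding \<open>j = \<tau> k\<close>
            by (rule measurable_cong[THEN iffD2, rotated]) (rule tel, simp only: space_sigma_gen_sets)
        qed
        then show ?thesis using gen_sets_subset[of J B ?G M] by simp
      qed
      show ?thesis
        using indep_set_mono[OF i1 i3 order_refl] unfolding i2 .
    qed
    then show ?thesis
      using indep_set_gen_sets_finite[of "{0..s}" B ?Fu] Int unfolding ss by blast
  qed
  have Fu_sub: "?Fu \<subseteq> gen_sets M B {0..}"
  proof -
    have "(\<lambda>\<omega>. B r \<omega> - B s \<omega>) \<in> borel_measurable (sigma (space M) (gen_sets M B {0..}))"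
      using s by (intro borel_measurable_diff measurable_gen_sets) auto
    then show ?thesis
      using gen_sets_subset[of UNIV "\<lambda>_ \<omega>. B r \<omega> - B s \<omega>" "sigma (space M) (gen_sets M B {0..})" M] by simp
  qed
  let ?neg = "gen_sets M (\<lambda>s. B (- s)) {0..}"
  \<comment> \<open>Intersections of an event at negative times with one at times in
    \<open>[0, s]\<close>: a pi-system that contains the generators of both, since either factor may
    be the whole space.\<close>
  define \<P> where "\<P> = {a \<inter> b |a b. a \<in> ?neg \<and> b \<in> gen_sets M B {0..s}}"
  have sub0: "gen_sets M B {0..s} \<subseteq> gen_sets M B {0..}" by (intro gen_sets_mono) auto
  have P1: "indep_set \<P> ?Fu"
    unfolding indep_sets2_eq
  proof (intro conjI ballI)
    show "\<P> \<subseteq> events" "?Fu \<subseteq> events"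
      using pos bm2 unfolding \<P>_def indep_sets2_eq by auto
    fix x c assume "x \<in> \<P>" "c \<in> ?Fu"
    then obtain a b where ab: "x = a \<inter> b" "a \<in> ?neg" "b \<in> gen_sets M B {0..s}" by (auto simp: \<P>_def)
    have bc: "b \<inter> c \<in> gen_sets M B {0..}"
      using Int[of B "{0..}"] ab(3) sub0 Fu_sub \<open>c \<in> ?Fu\<close> unfolding Int_stable_def by blast
    \<comment> \<open>The increment is grouped with the nonnegative part first, so that the
      independence of the two branches applies to \<open>b \<inter> c\<close> against
      \<open>a\<close>; it is then used backwards for \<open>b\<close> alone.\<close>
    have "prob (x \<inter> c) = prob ((b \<inter> c) \<inter> a)" by (simp add: ab ac_simps)
    also have "\<dots> = prob (b \<inter> c) * prob a" using indep_setD[OF bm2 bc ab(2)] .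
    also have "prob (b \<inter> c) = prob b * prob c" using indep_setD[OF pos ab(3) \<open>c \<in> ?Fu\<close>] .
    also have "prob b * prob c * prob a = prob (b \<inter> a) * prob c"
      using indep_setD[OF bm2 _ ab(2), of b] ab(3) sub0 by auto
    finally show "prob (x \<inter> c) = prob x * prob c" by (simp add: ab Int_commute)
  qed
  have P2: "Int_stable \<P>"
    unfolding Int_stable_def
  proof (intro ballI)
    fix x y assume "x \<in> \<P>" "y \<in> \<P>"
    then obtain a b a' b' where "x = a \<inter> b" "a \<in> ?neg" "b \<in> gen_sets M B {0..s}"
      "y = a' \<inter> b'" "a' \<in> ?neg" "b' \<in> gen_sets M B {0..s}" by (auto simp: \<P>_def)
    then show "x \<inter> y \<in> \<P>"
      using Int[of B "{0..s}"] Int[of "\<lambda>s. B (- s)" "{0..}"] unfolding \<P>_def Int_stable_def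
      by (intro CollectI exI[of _ "a \<inter> a'"] exI[of _ "b \<inter> b'"]) auto
  qed
  have "indep_set (sigma_sets (space M) \<P>) ?Fu"
    using indep_set_sigma_sets[OF P1 P2 Int] unfolding ss .
  moreover have "gen_sets M B {..s} \<subseteq> sigma_sets (space M) \<P>"
    unfolding gen_sets_def[of M B]
  proof (rule sigma_sets_mono, rule subsetI)
    fix x assume "x \<in> (\<Union>u\<in>{..s}. {B u -` A \<inter> space M |A. A \<in> sets borel})"
    then obtain u A where u: "u \<in> {..s}" and A: "A \<in> sets borel" and x: "x = B u -` A \<inter> space M"
      by blast
    have top: "space M \<in> gen_sets M X L" for X :: "real \<Rightarrow> 'a \<Rightarrow> real ^ 'd" and L
      using sets.top[of "sigma (space M) (gen_sets M X L)"] by simp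
    have "B u -` A \<inter> space M \<in> \<P>"
    proof (cases "0 \<le> u")
      case True
      then have "B u -` A \<inter> space M \<in> gen_sets M B {0..s}" using u A unfolding gen_sets_def
        by (intro sigma_sets.Basic UN_I[of u]) auto
      then show ?thesis unfolding \<P>_def
        using top by (intro CollectI exI[of _ "space M"] exI[of _ "B u -` A \<inter> space M"]) auto
    next
      case False
      then have "B (- (- u)) -` A \<inter> space M \<in> ?neg" using u A unfolding gen_sets_def
        by (intro sigma_sets.Basic UN_I[of "- u"]) auto
      then show ?thesis unfolding \<P>_def
        using top by (intro CollectI exI[of _ "space M"] exI[of _ "B u -` A \<inter> space M"]) auto
    qed
    then show "x \<in> sigma_sets (space M) \<P>" unfolding x by (rule sigma_sets.Basic)
  qed
  ultimately show ?thesis by (rule indep_set_mono) auto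
qed

end

section \<open>Moments of the noises\<close>

text \<open>The product formula for Lebesgue measure runs over \<open>Basis\<close>, the Gaussian
  density over coordinates; the two index sets correspond through \<open>axis i 1\<close>.\<close>

lemma prod_Basis_vec: "(\<Prod>b\<in>Basis. f b) = (\<Prod>i\<in>UNIV. f (axis i 1))" for f :: "real ^ 'd \<Rightarrow> 'z::comm_monoid_mult"
proof -
  have "Basis = (\<lambda>i. axis i (1::real)) ` (UNIV :: 'd set)"
    by (auto simp: Basis_vec_def)
  moreover have "inj (\<lambda>i::'d. axis i (1::real))" by (auto simp: inj_on_def axis_eq_axis)
  ultimately show ?thesis by (subst \<open>Basis = _\<close>, subst prod.reindex) auto
qed

text \<open>Everything rests on the shift \<open>(j + 1) * p (j + 1) = l * p j\<close> of the
  Poisson weights. It reduces the first moment to the total mass, and the second moment to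
  \<open>l\<close> times the sum of the first moment and the mass, that is to
  \<open>l * (l + 1)\<close>.\<close>

lemma sums_poisson_moments:
  fixes l :: real
  shows "(\<lambda>j. l ^ j / fact j * exp (- l)) sums 1"
    and "(\<lambda>j. real j * (l ^ j / fact j * exp (- l))) sums l"
    and "(\<lambda>j. (real j)\<^sup>2 * (l ^ j / fact j * exp (- l))) sums (l\<^sup>2 + l)"
proof -
  let ?p = "\<lambda>j. l ^ j / fact j * exp (- l)"
  have "(\<lambda>j. l ^ j / fact j) sums exp l"
    using exp_converges[of l] by (simp add: field_simps)
  from sums_mult2[OF this, of "exp (- l)"] show p: "?p sums 1"
    by (simp add: exp_minus)
  have "(\<lambda>j. real (Suc j) * ?p (Suc j)) = (\<lambda>j. l * ?p j)"
    by (simp add: fun_eq_iff field_simps del: of_nat_Suc)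
  then have "(\<lambda>j. real (Suc j) * ?p (Suc j)) sums l"
    using sums_mult[OF p, of l] by (simp only: mult_1_right)
  then show q: "(\<lambda>j. real j * ?p j) sums l"
    using sums_Suc[of "\<lambda>j. real j * ?p j" l] by simp
  have "(real (Suc j))\<^sup>2 * ?p (Suc j) = l * (real j * ?p j + ?p j)" for j
  proof -
    have "(real (Suc j))\<^sup>2 * ?p (Suc j) = real (Suc j) * (real (Suc j) * ?p (Suc j))"
      by (simp only: power2_eq_square mult.assoc)
    also have "real (Suc j) * ?p (Suc j) = l * ?p j"
      by (simp add: field_simps del: of_nat_Suc)
    finally show ?thesis by (simp only: of_nat_Suc ring_distribs mult_1_left ac_simps)
  qed
  then have "(\<lambda>j. (real (Suc j))\<^sup>2 * ?p (Suc j)) sums (l\<^sup>2 + l)"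
    using sums_mult[OF sums_add[OF q p], of l] by (simp add: power2_eq_square algebra_simps)
  then show "(\<lambda>j. (real j)\<^sup>2 * ?p j) sums (l\<^sup>2 + l)"
    using sums_Suc[of "\<lambda>j. (real j)\<^sup>2 * ?p j" "l\<^sup>2 + l"] by simp
qed

context prob_space
begin

section \<open>Moments of Poisson counts\<close>

context
  fixes \<Lambda> :: "'x measure" and R :: "'a \<Rightarrow> 'x measure" and D :: "'x set"
  assumes prm: "poisson_random_measure M \<Lambda> R" and D: "D \<in> sets \<Lambda>" "emeasure \<Lambda> D < \<infinity>"
begin

lemma poisson_measurable: "(\<lambda>\<omega>. emeasure (R \<omega>) D) \<in> borel_measurable M"
  and poisson_measurable': "(\<lambda>\<omega>. measure (R \<omega>) D) \<in> borel_measurable M"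
proof -
  show *: "(\<lambda>\<omega>. emeasure (R \<omega>) D) \<in> borel_measurable M"
    using prm D unfolding poisson_random_measure_def by blast
  show "(\<lambda>\<omega>. measure (R \<omega>) D) \<in> borel_measurable M"
    unfolding measure_def using * by measurable
qed

lemma poisson_prob: "prob {\<omega>\<in>space M. emeasure (R \<omega>) D = of_nat j} =
    measure \<Lambda> D ^ j / fact j * exp (- measure \<Lambda> D)"
  using prm D unfolding poisson_random_measure_def by blast

text \<open>The prescribed probabilities of the values 0, 1, 2, ... already sum to 1, which excludes
  the value infinity.\<close>

lemma AE_poisson_nat: "AE \<omega> in M. \<exists>j::nat. emeasure (R \<omega>) D = of_nat j"
proof -
  let ?E = "\<lambda>j::nat. {\<omega>\<in>space M. emeasure (R \<omega>) D = of_nat j}"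
  have E: "?E j \<in> events" for j
    using poisson_measurable by measurable
  have "(\<lambda>j. prob (?E j)) sums prob (\<Union>j. ?E j)"
    using E by (intro finite_measure_UNION) (auto simp: disjoint_family_on_def)
  with sums_poisson_moments(1)[of "measure \<Lambda> D"] have "prob (\<Union>j. ?E j) = 1"
    unfolding poisson_prob by (rule sums_unique2[rotated])
  then have "AE \<omega> in M. \<omega> \<in> (\<Union>j. ?E j)"
    using E by (subst AE_in_set_eq_1) auto
  then show ?thesis by eventually_elim auto
qed

lemma AE_poisson_finite: "AE \<omega> in M. emeasure (R \<omega>) D \<noteq> \<infinity>"
  using AE_poisson_nat by eventually_elim auto

text \<open>The function is expanded over the values of the count, and nonnegativity of
  \<open>f\<close> allows the exchange of series and integral. On the null set where the count is
  infinite, \<open>measure\<close> returns 0, which the integral does not see.\<close>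

lemma poisson_moment:
  assumes "(\<lambda>j. f j * (measure \<Lambda> D ^ j / fact j * exp (- measure \<Lambda> D))) sums m" "\<And>j. 0 \<le> f j"
    and g: "\<And>j. g (real j) = f j" "g \<in> borel_measurable borel"
  shows "has_bochner_integral M (\<lambda>\<omega>. g (measure (R \<omega>) D)) m"
proof -
  let ?E = "\<lambda>j::nat. {\<omega>\<in>space M. emeasure (R \<omega>) D = of_nat j}"
  have E: "?E j \<in> events" for j
    using poisson_measurable by measurable
  let ?p = "\<lambda>j. measure \<Lambda> D ^ j / fact j * exp (- measure \<Lambda> D)"
  have eq: "AE \<omega> in M. ennreal (g (measure (R \<omega>) D)) = (\<Sum>j. ennreal (f j) * indicator (?E j) \<omega>) \<and> 0 \<le> g (measure (R \<omega>) D)"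
    using AE_poisson_nat AE_space
  proof eventually_elim
    case (elim \<omega>)
    then obtain j :: nat where j: "emeasure (R \<omega>) D = of_nat j" by auto
    have "(\<Sum>i. ennreal (f i) * indicator (?E i) \<omega>) = (\<Sum>i\<in>{j}. ennreal (f i) * indicator (?E i) \<omega>)"
      by (rule suminf_finite) (auto simp: j)
    also have "\<dots> = ennreal (f j)" using elim j by simp
    finally show ?case
      using assms(2) by (simp add: measure_def j g)
  qed
  have "(\<integral>\<^sup>+\<omega>. ennreal (g (measure (R \<omega>) D)) \<partial>M) = (\<integral>\<^sup>+\<omega>. (\<Sum>j. ennreal (f j) * indicator (?E j) \<omega>) \<partial>M)"
    using eq by (intro nn_integral_cong_AE) auto
  also have "\<dots> = (\<Sum>j. \<integral>\<^sup>+\<omega>. ennreal (f j) * indicator (?E j) \<omega> \<partial>M)"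
    using E by (intro nn_integral_suminf) auto
  also have "\<dots> = (\<Sum>j. ennreal (f j * ?p j))"
    using E by (intro suminf_cong) (simp add: nn_integral_cmult_indicator emeasure_eq_measure poisson_prob assms(2) flip: ennreal_mult)
  also have "\<dots> = ennreal m"
    using assms(1,2) by (intro suminf_ennreal_eq) auto
  finally have "(\<integral>\<^sup>+\<omega>. ennreal (g (measure (R \<omega>) D)) \<partial>M) = ennreal m" .
  moreover have "0 \<le> m"
    using assms(1,2) by (intro sums_le[OF _ sums_zero assms(1)]) auto
  moreover have "(\<lambda>\<omega>. g (measure (R \<omega>) D)) \<in> borel_measurable M"
    using poisson_measurable' g by measurable
  ultimately show ?thesis
    using eq by (intro has_bochner_integral_nn_integral) auto
qed

lemma poisson_mean: "has_bochner_integral M (\<lambda>\<omega>. measure (R \<omega>) D) (measure \<Lambda> D)"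
  using poisson_moment[OF sums_poisson_moments(2), of "\<lambda>x. x"] by simp

lemma poisson_second_moment:
  "has_bochner_integral M (\<lambda>\<omega>. (measure (R \<omega>) D)\<^sup>2) ((measure \<Lambda> D)\<^sup>2 + measure \<Lambda> D)"
  using poisson_moment[OF sums_poisson_moments(3), of "\<lambda>x. x\<^sup>2"] by simp

lemma poisson_compensated_mean:
  "has_bochner_integral M (\<lambda>\<omega>. measure (R \<omega>) D - measure \<Lambda> D) 0"
  using has_bochner_integral_diff[OF poisson_mean, of "\<lambda>_. measure \<Lambda> D" "measure \<Lambda> D"]
  by (simp add: has_bochner_integral_iff prob_space)

lemma poisson_compensated_variance:
  "has_bochner_integral M (\<lambda>\<omega>. (measure (R \<omega>) D - measure \<Lambda> D)\<^sup>2) (measure \<Lambda> D)"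
proof -
  let ?l = "measure \<Lambda> D"
  have "has_bochner_integral M (\<lambda>\<omega>. (measure (R \<omega>) D)\<^sup>2 - 2 * ?l * measure (R \<omega>) D + ?l\<^sup>2)
     (?l\<^sup>2 + ?l - 2 * ?l * ?l + ?l\<^sup>2)"
    by (intro has_bochner_integral_add has_bochner_integral_diff poisson_second_moment
        has_bochner_integral_mult_right poisson_mean)
       (simp add: has_bochner_integral_iff prob_space)
  then show ?thesis by (simp add: power2_diff algebra_simps power2_eq_square)
qed

end

lemma square_integrable_imp_integrable:
  fixes f :: "'a \<Rightarrow> real"
  assumes "f \<in> borel_measurable M" "integrable M (\<lambda>x. (f x)\<^sup>2)"
  shows "integrable M f"
proof (rule Bochner_Integration.integrable_bound)
  show "integrable M (\<lambda>x. 1 + (f x)\<^sup>2)" using assms by auto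
  have "\<bar>y\<bar> \<le> 1 + y\<^sup>2" for y :: real
    using zero_le_power2[of "\<bar>y\<bar> - 1 / 2"] unfolding power2_diff by (simp add: power2_eq_square)
  then show "AE x in M. norm (f x) \<le> norm (1 + (f x)\<^sup>2)"
    by (intro AE_I2) (smt (verit) real_norm_def zero_le_power2)
qed fact

section \<open>Moments of Gaussian increments\<close>

context
  fixes D :: "'a \<Rightarrow> real ^ 'd::finite" and \<sigma> :: real
  assumes \<sigma>: "0 < \<sigma>"
    and dist: "distributed M lborel D (\<lambda>x. ennreal (\<Prod>i\<in>UNIV. normal_density 0 \<sigma> (x $ i)))"
begin

lemma gaussian_measurable: "D \<in> borel_measurable M"
  using distributed_measurable[OF dist] by simp

text \<open>The square of coordinate \<open>i\<close> is absorbed into the \<open>i\<close>-th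
  factor of the product density, so the integral factorizes into total masses equal to 1 and a
  single one-dimensional variance.\<close>

lemma gaussian_nn_second_moment: "(\<integral>\<^sup>+\<omega>. ennreal ((D \<omega> $ i)\<^sup>2) \<partial>M) = ennreal (\<sigma>\<^sup>2)"
proof -
  let ?n = "normal_density 0 \<sigma>"
  let ?f = "\<lambda>(b :: real ^ 'd) y. ennreal (?n y * (if b = axis i 1 then y\<^sup>2 else 1))"
  have "(\<integral>\<^sup>+\<omega>. ennreal ((D \<omega> $ i)\<^sup>2) \<partial>M) =
    (\<integral>\<^sup>+x. ennreal (\<Prod>i\<in>UNIV. ?n (x $ i)) * ennreal ((x $ i)\<^sup>2) \<partial>lborel)"
    using distributed_nn_integral[OF dist, of "\<lambda>x. ennreal ((x $ i)\<^sup>2)"] by simp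
  also have "\<dots> = (\<integral>\<^sup>+x. (\<Prod>b\<in>Basis. ?f b (x \<bullet> b)) \<partial>lborel)"
  proof (rule nn_integral_cong)
    fix x :: "real ^ 'd"
    have "(\<Prod>b\<in>Basis. ?f b (x \<bullet> b)) = (\<Prod>j\<in>UNIV. ennreal (?n (x $ j) * (if j = i then (x $ j)\<^sup>2 else 1)))"
      unfolding prod_Basis_vec by (intro prod.cong) (auto simp: inner_axis axis_eq_axis)
    also have "\<dots> = ennreal (\<Prod>j\<in>UNIV. ?n (x $ j) * (if j = i then (x $ j)\<^sup>2 else 1))"
      by (intro prod_ennreal) auto
    also have "(\<Prod>j\<in>UNIV. ?n (x $ j) * (if j = i then (x $ j)\<^sup>2 else 1)) = (\<Prod>j\<in>UNIV. ?n (x $ j)) * (x $ i)\<^sup>2"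
      by (simp add: prod.distrib)
    finally show "ennreal (\<Prod>i\<in>UNIV. ?n (x $ i)) * ennreal ((x $ i)\<^sup>2) = (\<Prod>b\<in>Basis. ?f b (x \<bullet> b))"
      by (simp add: ennreal_mult prod_nonneg)
  qed
  also have "\<dots> = (\<Prod>b\<in>Basis. \<integral>\<^sup>+y. ?f b y \<partial>lborel)"
    by (rule nn_integral_lborel_prod) auto
  also have "\<dots> = (\<Prod>b\<in>(Basis :: (real ^ 'd) set). if b = axis i 1 then ennreal (\<sigma>\<^sup>2) else 1)"
  proof (rule prod.cong[OF refl])
    fix b :: "real ^ 'd"
    have "has_bochner_integral lborel (\<lambda>y. ?n y * y\<^sup>2) (\<sigma>\<^sup>2)"
      using normal_moment_even[OF \<sigma>, of 0 1] \<sigma> by (simp add: power2_eq_square field_simps)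
    then have "(\<integral>\<^sup>+y. ennreal (?n y * y\<^sup>2) \<partial>lborel) = ennreal (\<sigma>\<^sup>2)"
      by (subst nn_integral_eq_integral) (auto simp: has_bochner_integral_iff)
    moreover have "(\<integral>\<^sup>+y. ennreal (?n y) \<partial>lborel) = 1"
      using \<sigma> by (subst nn_integral_eq_integral) auto
    ultimately show "(\<integral>\<^sup>+y. ?f b y \<partial>lborel) = (if b = axis i 1 then ennreal (\<sigma>\<^sup>2) else 1)"
      by (cases "b = axis i 1") auto
  qed
  also have "\<dots> = ennreal (\<sigma>\<^sup>2)"
    by (subst prod.delta) (auto simp: Basis_vec_def)
  finally show ?thesis .
qed

lemma gaussian_second_moment: "has_bochner_integral M (\<lambda>\<omega>. (D \<omega> $ i)\<^sup>2) (\<sigma>\<^sup>2)"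
  using measurable_compose[OF gaussian_measurable, of "\<lambda>x. (x $ i)\<^sup>2" borel] gaussian_nn_second_moment
  by (intro has_bochner_integral_nn_integral) auto

text \<open>Reflection in coordinate \<open>i\<close> preserves Lebesgue measure and the product
  density, so the integral equals its own negative. The mean and the off-diagonal covariances are
  both of this kind.\<close>

lemma gaussian_odd_integral:
  fixes h :: "real ^ 'd \<Rightarrow> real"
  assumes [measurable]: "h \<in> borel_measurable borel"
    and odd: "\<And>x. h (\<chi> k. if k = i then - x $ k else x $ k) = - h x"
  shows "(\<integral>\<omega>. h (D \<omega>) \<partial>M) = 0"
proof -
  let ?p = "\<lambda>x::real^'d. \<Prod>i\<in>UNIV. normal_density 0 \<sigma> (x $ i)"
  define c where "c b = (if b = axis i 1 then -1 else 1 :: real)" for b :: "real ^ 'd"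
  let ?\<rho> = "\<lambda>x::real^'d. \<Sum>j\<in>Basis. (c j * (x \<bullet> j)) *\<^sub>R j"
  have \<rho>: "?\<rho> x = (\<chi> k. if k = i then - x $ k else x $ k)" for x
  proof (rule vec_eq_iff[THEN iffD2], rule allI)
    fix k
    have "?\<rho> x $ k = ?\<rho> x \<bullet> axis k 1" by (simp only: inner_axis) simp
    also have "\<dots> = c (axis k 1) * (x \<bullet> axis k 1)"
      by (rule inner_sum_left_Basis) (auto simp: Basis_vec_def)
    finally show "?\<rho> x $ k = (\<chi> k. if k = i then - x $ k else x $ k) $ k"
      by (simp add: c_def axis_eq_axis inner_axis)
  qed
  \<comment> \<open>The reflection is the diagonal map with entries \<open>c j\<close>, each of
    absolute value 1, so the Jacobian factor is 1.\<close>
  have "lborel = density (distr lborel borel (\<lambda>x. 0 + ?\<rho> x)) (\<lambda>_. (\<Prod>j\<in>Basis. \<bar>c j\<bar>))"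
    by (rule lborel_affine_euclidean) (simp add: c_def)
  moreover have "(\<Prod>j\<in>(Basis :: (real^'d) set). \<bar>c j\<bar>) = 1" by (rule prod.neutral) (simp add: c_def)
  ultimately have inv: "lborel = distr lborel borel ?\<rho>" by (simp add: density_1)
  have "(\<integral>\<omega>. h (D \<omega>) \<partial>M) = (\<integral>x. ?p x * h x \<partial>lborel)"
    using distributed_integral[OF dist, of h] by (simp add: prod_nonneg)
  also have "\<dots> = (\<integral>x. ?p x * h x \<partial>distr lborel borel ?\<rho>)"
    using inv by simp
  also have "\<dots> = (\<integral>x. ?p (?\<rho> x) * h (?\<rho> x) \<partial>lborel)"
    by (rule integral_distr) auto
  also have "\<dots> = (\<integral>x. - (?p x * h x) \<partial>lborel)"
  proof (rule Bochner_Integration.integral_cong[OF refl])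
    fix x
    have "?p (?\<rho> x) = ?p x"
      unfolding \<rho> by (intro prod.cong) (auto simp: normal_density_def)
    then show "?p (?\<rho> x) * h (?\<rho> x) = - (?p x * h x)"
      using odd[of x] unfolding \<rho>[symmetric] by simp
  qed
  also have "\<dots> = - (\<integral>\<omega>. h (D \<omega>) \<partial>M)"
    using distributed_integral[OF dist, of h] by (simp add: prod_nonneg)
  finally show ?thesis by simp
qed

lemma gaussian_mean: "(\<integral>\<omega>. D \<omega> $ i \<partial>M) = 0"
  by (rule gaussian_odd_integral[where i=i]) auto

lemma gaussian_covariance: "(\<integral>\<omega>. D \<omega> $ i * D \<omega> $ j \<partial>M) = (if i = j then \<sigma>\<^sup>2 else 0)"
proof (cases "i = j")
  case True
  then show ?thesis
    using gaussian_second_moment[of i] by (simp add: has_bochner_integral_iff power2_eq_square)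
next
  case False
  then have "(\<integral>\<omega>. D \<omega> $ i * D \<omega> $ j \<partial>M) = 0"
    by (intro gaussian_odd_integral[where i=i and h="\<lambda>x. x $ i * x $ j"]) auto
  with False show ?thesis by simp
qed

end

end

section \<open>Convergence in mean square\<close>

lemma integrable_mult_square_integrable:
  fixes f g :: "'a \<Rightarrow> real"
  assumes [measurable]: "f \<in> borel_measurable M" "g \<in> borel_measurable M"
    and "integrable M (\<lambda>x. (f x)\<^sup>2)" "integrable M (\<lambda>x. (g x)\<^sup>2)"
  shows "integrable M (\<lambda>x. f x * g x)"
proof (rule Bochner_Integration.integrable_bound)
  show "integrable M (\<lambda>x. (f x)\<^sup>2 + (g x)\<^sup>2)" using assms by auto
  have "\<bar>a * b\<bar> \<le> \<bar>a\<^sup>2 + b\<^sup>2\<bar>" for a b :: real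
  proof -
    have "0 \<le> \<bar>a\<bar> * \<bar>b\<bar>" by simp
    then have "\<bar>a\<bar> * \<bar>b\<bar> \<le> a\<^sup>2 + b\<^sup>2"
      using sum_squares_bound[of "\<bar>a\<bar>" "\<bar>b\<bar>"] unfolding power2_abs by linarith
    then show ?thesis by (simp add: abs_mult)
  qed
  then show "AE x in M. norm (f x * g x) \<le> norm ((f x)\<^sup>2 + (g x)\<^sup>2)"
    by simp
qed simp

lemma square_integrable_add:
  fixes f g :: "'a \<Rightarrow> real"
  assumes "f \<in> borel_measurable M" "g \<in> borel_measurable M"
    and "integrable M (\<lambda>x. (f x)\<^sup>2)" "integrable M (\<lambda>x. (g x)\<^sup>2)"
  shows "integrable M (\<lambda>x. (f x + g x)\<^sup>2)"
  unfolding power2_sum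
  using assms integrable_mult_square_integrable[OF assms] by (auto simp: mult.assoc)

lemma square_integrable_diff:
  fixes f g :: "'a \<Rightarrow> real"
  assumes "f \<in> borel_measurable M" "g \<in> borel_measurable M"
    and "integrable M (\<lambda>x. (f x)\<^sup>2)" "integrable M (\<lambda>x. (g x)\<^sup>2)"
  shows "integrable M (\<lambda>x. (f x - g x)\<^sup>2)"
  using square_integrable_add[of f M "\<lambda>x. - g x"] assms by simp

lemma integral_mult_Cauchy_Schwarz:
  fixes f g :: "'a \<Rightarrow> real"
  assumes [measurable]: "f \<in> borel_measurable M" "g \<in> borel_measurable M"
    and f: "integrable M (\<lambda>x. (f x)\<^sup>2)" and g: "integrable M (\<lambda>x. (g x)\<^sup>2)"
  shows "\<bar>\<integral>x. f x * g x \<partial>M\<bar> \<le> sqrt (\<integral>x. (f x)\<^sup>2 \<partial>M) * sqrt (\<integral>x. (g x)\<^sup>2 \<partial>M)"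
proof -
  have fg: "integrable M (\<lambda>x. f x * g x)"
    using integrable_mult_square_integrable[OF assms] .
  have "(\<integral>\<^sup>+x. ennreal \<bar>f x\<bar> * ennreal \<bar>g x\<bar> \<partial>M) = ennreal (\<integral>x. \<bar>f x * g x\<bar> \<partial>M)"
    using nn_integral_eq_integral[OF integrable_abs[OF fg]] by (simp add: abs_mult ennreal_mult)
  then have "ennreal ((\<integral>x. \<bar>f x * g x\<bar> \<partial>M)\<^sup>2) = (\<integral>\<^sup>+x. ennreal \<bar>f x\<bar> * ennreal \<bar>g x\<bar> \<partial>M)\<^sup>2"
    by (simp add: ennreal_power)
  also have "\<dots> \<le> (\<integral>\<^sup>+x. ennreal \<bar>f x\<bar> ^ 2 \<partial>M) * (\<integral>\<^sup>+x. ennreal \<bar>g x\<bar> ^ 2 \<partial>M)"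
    by (rule Cauchy_Schwarz_nn_integral) auto
  also have "\<dots> = ennreal ((\<integral>x. (f x)\<^sup>2 \<partial>M) * (\<integral>x. (g x)\<^sup>2 \<partial>M))"
    using f g by (simp add: ennreal_power nn_integral_eq_integral ennreal_mult)
  finally have "(\<integral>x. \<bar>f x * g x\<bar> \<partial>M)\<^sup>2 \<le> (\<integral>x. (f x)\<^sup>2 \<partial>M) * (\<integral>x. (g x)\<^sup>2 \<partial>M)"
    by (subst (asm) ennreal_le_iff) auto
  then have "(\<integral>x. \<bar>f x * g x\<bar> \<partial>M) \<le> sqrt (\<integral>x. (f x)\<^sup>2 \<partial>M) * sqrt (\<integral>x. (g x)\<^sup>2 \<partial>M)"
    unfolding real_sqrt_mult[symmetric] by (rule real_le_rsqrt)
  moreover have "\<bar>\<integral>x. f x * g x \<partial>M\<bar> \<le> (\<integral>x. \<bar>f x * g x\<bar> \<partial>M)"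
    using integral_norm_bound[of M "\<lambda>x. f x * g x"] by simp
  ultimately show ?thesis by linarith
qed

text \<open>Square integrability of the limit and of every member is part of the notion; without it
  the Bochner integral in the last clause could be 0 by default.\<close>

definition L2_tendsto :: "'a measure \<Rightarrow> (nat \<Rightarrow> 'a \<Rightarrow> real) \<Rightarrow> ('a \<Rightarrow> real) \<Rightarrow> bool"
  where "L2_tendsto M fn f \<longleftrightarrow> f \<in> borel_measurable M \<and> integrable M (\<lambda>x. (f x)\<^sup>2) \<and>
    (\<forall>n. fn n \<in> borel_measurable M \<and> integrable M (\<lambda>x. (fn n x)\<^sup>2)) \<and>
    (\<lambda>n. \<integral>x. (f x - fn n x)\<^sup>2 \<partial>M) \<longlonglongrightarrow> 0"

text \<open>Convergence of the nonnegative integrals to 0 makes some difference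
  \<open>f - fn n\<close> square integrable, and adding \<open>fn n\<close> back shows this for
  \<open>f\<close> itself. The conversion to Bochner integrals is then safe.\<close>

lemma L2_tendstoI:
  assumes f: "f \<in> borel_measurable M" and fn: "\<And>n. fn n \<in> borel_measurable M"
    "\<And>n. integrable M (\<lambda>x. (fn n x)\<^sup>2)"
    and lim: "(\<lambda>n. \<integral>\<^sup>+x. ennreal ((f x - fn n x)\<^sup>2) \<partial>M) \<longlonglongrightarrow> 0"
  shows "L2_tendsto M fn f"
proof -
  note [measurable] = f fn(1)
  have "\<forall>\<^sub>F n in sequentially. (\<integral>\<^sup>+x. ennreal ((f x - fn n x)\<^sup>2) \<partial>M) < 1"
    using lim by (rule order_tendstoD) simp
  then obtain n where "(\<integral>\<^sup>+x. ennreal ((f x - fn n x)\<^sup>2) \<partial>M) < 1"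
    by (auto simp: eventually_sequentially)
  then have "integrable M (\<lambda>x. (f x - fn n x)\<^sup>2)"
    by (intro integrableI_nonneg) (auto intro: less_trans)
  then have "integrable M (\<lambda>x. ((f x - fn n x) + fn n x)\<^sup>2)"
    using fn by (intro square_integrable_add) auto
  then have f2: "integrable M (\<lambda>x. (f x)\<^sup>2)" by simp
  then have "integrable M (\<lambda>x. (f x - fn n x)\<^sup>2)" for n
    using fn by (intro square_integrable_diff) auto
  then have "(\<integral>x. (f x - fn n x)\<^sup>2 \<partial>M) = enn2real (\<integral>\<^sup>+x. ennreal ((f x - fn n x)\<^sup>2) \<partial>M)" for n
    by (subst nn_integral_eq_integral) auto
  moreover have "(\<lambda>n. enn2real (\<integral>\<^sup>+x. ennreal ((f x - fn n x)\<^sup>2) \<partial>M)) \<longlonglongrightarrow> enn2real 0"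
    using lim by (intro tendsto_enn2real) auto
  ultimately show ?thesis
    using f2 f fn by (simp add: L2_tendsto_def)
qed

lemma L2_tendsto_mult:
  assumes "L2_tendsto M fn f" and [measurable]: "w \<in> borel_measurable M" and w: "\<And>x. \<bar>w x\<bar> \<le> 1"
  shows "L2_tendsto M (\<lambda>n x. w x * fn n x) (\<lambda>x. w x * f x)"
proof -
  note f = assms(1)[unfolded L2_tendsto_def]
  have [measurable]: "f \<in> borel_measurable M" "\<And>n. fn n \<in> borel_measurable M" using f by auto
  have le: "(w x * y)\<^sup>2 \<le> y\<^sup>2" for x y
    using mult_right_mono[OF power_mono[OF w[of x], of 2], of "y\<^sup>2"] by (simp add: power_mult_distrib)
  have int: "integrable M (\<lambda>x. (w x * h x)\<^sup>2)" if "integrable M (\<lambda>x. (h x)\<^sup>2)" "h \<in> borel_measurable M" for h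
    using that(2) by (intro Bochner_Integration.integrable_bound[OF that(1)] AE_I2) (auto simp: le)
  have d: "integrable M (\<lambda>x. (f x - fn n x)\<^sup>2)" for n
    using f by (intro square_integrable_diff) auto
  have "(\<lambda>n. \<integral>x. (w x * f x - w x * fn n x)\<^sup>2 \<partial>M) \<longlonglongrightarrow> 0"
  proof (rule tendsto_sandwich[OF _ _ tendsto_const])
    show "(\<lambda>n. \<integral>x. (f x - fn n x)\<^sup>2 \<partial>M) \<longlonglongrightarrow> 0" using f by simp
    show "\<forall>\<^sub>F n in sequentially. (\<integral>x. (w x * f x - w x * fn n x)\<^sup>2 \<partial>M) \<le> (\<integral>x. (f x - fn n x)\<^sup>2 \<partial>M)"
      unfolding right_diff_distrib[symmetric]
      using d int[OF d] by (intro always_eventually allI integral_mono) (auto simp: le)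
  qed (auto intro!: always_eventually)
  moreover have "integrable M (\<lambda>x. (w x * f x)\<^sup>2)" "integrable M (\<lambda>x. (w x * fn n x)\<^sup>2)" for n
    by (rule int; use f in simp)+
  ultimately show ?thesis
    unfolding L2_tendsto_def by (intro conjI allI) measurable
qed

text \<open>Continuity of the inner product, through which every isometry and orthogonality relation
  passes from step integrals to their limits.\<close>

lemma L2_tendsto_inner:
  assumes "L2_tendsto M fn f" "L2_tendsto M gn g"
  shows "(\<lambda>n. \<integral>x. fn n x * gn n x \<partial>M) \<longlonglongrightarrow> (\<integral>x. f x * g x \<partial>M)"
proof -
  note f = assms(1)[unfolded L2_tendsto_def] and g = assms(2)[unfolded L2_tendsto_def]
  have [measurable]: "f \<in> borel_measurable M" "\<And>n. fn n \<in> borel_measurable M"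
      "g \<in> borel_measurable M" "\<And>n. gn n \<in> borel_measurable M" using f g by auto
  have df: "integrable M (\<lambda>x. (f x - fn n x)\<^sup>2)" and dg: "integrable M (\<lambda>x. (g x - gn n x)\<^sup>2)" for n
    by (rule square_integrable_diff; use f g in simp)+
  let ?df = "\<lambda>n. \<integral>x. (f x - fn n x)\<^sup>2 \<partial>M" and ?dg = "\<lambda>n. \<integral>x. (g x - gn n x)\<^sup>2 \<partial>M"
  define a where "a = (\<lambda>n. sqrt (?df n))"
  define b where "b = (\<lambda>n. sqrt (?dg n))"
  define A where "A = sqrt (\<integral>x. (f x)\<^sup>2 \<partial>M)"
  define A' where "A' = sqrt (\<integral>x. (g x)\<^sup>2 \<partial>M)"
  have "\<bar>(\<integral>x. fn n x * gn n x \<partial>M) - (\<integral>x. f x * g x \<partial>M)\<bar> \<le>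
      sqrt (?df n) * sqrt (?dg n) + sqrt (\<integral>x. (f x)\<^sup>2 \<partial>M) * sqrt (?dg n) + sqrt (?df n) * sqrt (\<integral>x. (g x)\<^sup>2 \<partial>M)" for n
  proof -
    have int: "integrable M (\<lambda>x. (f x - fn n x) * (g x - gn n x))" "integrable M (\<lambda>x. f x * (g x - gn n x))"
        "integrable M (\<lambda>x. (f x - fn n x) * g x)" "integrable M (\<lambda>x. f x * g x)" "integrable M (\<lambda>x. fn n x * gn n x)"
      by (rule integrable_mult_square_integrable; use f g df[of n] dg[of n] in simp)+
    \<comment> \<open>With errors \<open>f - fn\<close> and \<open>g - gn\<close>, the difference of
      the products is a product of errors minus two terms linear in one error; Cauchy--Schwarz makes
      each of them vanish in the limit.\<close>
    have e0: "(\<lambda>x. fn n x * gn n x) = (\<lambda>x. f x * g x + ((f x - fn n x) * (g x - gn n x) - f x * (g x - gn n x) - (f x - fn n x) * g x))"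
      by (simp add: fun_eq_iff algebra_simps)
    have e1: "(\<integral>x. fn n x * gn n x \<partial>M) = (\<integral>x. f x * g x \<partial>M) +
        (\<integral>x. (f x - fn n x) * (g x - gn n x) - f x * (g x - gn n x) - (f x - fn n x) * g x \<partial>M)"
      unfolding e0 using int(1-4) by (intro Bochner_Integration.integral_add Bochner_Integration.integrable_diff)
    have e2: "(\<integral>x. (f x - fn n x) * (g x - gn n x) - f x * (g x - gn n x) - (f x - fn n x) * g x \<partial>M)
        = (\<integral>x. (f x - fn n x) * (g x - gn n x) - f x * (g x - gn n x) \<partial>M) - (\<integral>x. (f x - fn n x) * g x \<partial>M)"
      using int(1-3) by (intro Bochner_Integration.integral_diff Bochner_Integration.integrable_diff)
    have e3: "(\<integral>x. (f x - fn n x) * (g x - gn n x) - f x * (g x - gn n x) \<partial>M)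
        = (\<integral>x. (f x - fn n x) * (g x - gn n x) \<partial>M) - (\<integral>x. f x * (g x - gn n x) \<partial>M)"
      using int(1-2) by (intro Bochner_Integration.integral_diff)
    have eq: "(\<integral>x. fn n x * gn n x \<partial>M) - (\<integral>x. f x * g x \<partial>M) =
        (\<integral>x. (f x - fn n x) * (g x - gn n x) \<partial>M) - (\<integral>x. f x * (g x - gn n x) \<partial>M)
        - (\<integral>x. (f x - fn n x) * g x \<partial>M)"
      unfolding e1 e2 e3 by (rule add_diff_cancel_left')
    have tri: "\<bar>W\<bar> \<le> x + y + z" if "W = X - Y - Z" "\<bar>X\<bar> \<le> x" "\<bar>Y\<bar> \<le> y" "\<bar>Z\<bar> \<le> z" for W X Y Z x y z :: real
      unfolding that(1)
      by (rule order_trans[OF abs_triangle_ineq4 add_mono[OF order_trans[OF abs_triangle_ineq4 add_mono[OF that(2,3)]] that(4)]])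
    show "\<bar>(\<integral>x. fn n x * gn n x \<partial>M) - (\<integral>x. f x * g x \<partial>M)\<bar> \<le>
      sqrt (?df n) * sqrt (?dg n) + sqrt (\<integral>x. (f x)\<^sup>2 \<partial>M) * sqrt (?dg n) + sqrt (?df n) * sqrt (\<integral>x. (g x)\<^sup>2 \<partial>M)"
      by (rule tri[OF eq]; rule integral_mult_Cauchy_Schwarz;
          (rule df dg f[THEN conjunct2, THEN conjunct1] g[THEN conjunct2, THEN conjunct1] | measurable))
  qed
  then have le: "norm ((\<integral>x. fn n x * gn n x \<partial>M) - (\<integral>x. f x * g x \<partial>M)) \<le>
      a n * b n + A * b n + a n * A'" for n
    unfolding a_def b_def A_def A'_def real_norm_def .
  have ab: "a \<longlonglongrightarrow> 0" "b \<longlonglongrightarrow> 0"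
    using f[THEN conjunct2, THEN conjunct2, THEN conjunct2, THEN tendsto_real_sqrt]
      g[THEN conjunct2, THEN conjunct2, THEN conjunct2, THEN tendsto_real_sqrt]
    unfolding a_def b_def real_sqrt_zero .
  have "(\<lambda>n. a n * b n + A * b n + a n * A') \<longlonglongrightarrow> 0"
    using tendsto_add[OF tendsto_add[OF tendsto_mult[OF ab] tendsto_mult[OF tendsto_const ab(2)]]
        tendsto_mult[OF ab(1) tendsto_const]]
    by (simp only: mult_zero_left mult_zero_right add_0_left)
  then have "(\<lambda>n. (\<integral>x. fn n x * gn n x \<partial>M) - (\<integral>x. f x * g x \<partial>M)) \<longlonglongrightarrow> 0"
    by (rule Lim_null_comparison[rotated, where g="\<lambda>n. a n * b n + A * b n + a n * A'"])
       (intro always_eventually allI le)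
  then show ?thesis by (rule LIM_zero_cancel)
qed

section \<open>Bilinear expansion over sums and lists\<close>

lemma integral_sum2:
  fixes h :: "'i \<Rightarrow> 'j \<Rightarrow> 'a \<Rightarrow> real"
  assumes "\<And>i j. i \<in> I \<Longrightarrow> j \<in> J \<Longrightarrow> integrable M (h i j)"
  shows "(\<integral>x. (\<Sum>i\<in>I. \<Sum>j\<in>J. h i j x) \<partial>M) = (\<Sum>i\<in>I. \<Sum>j\<in>J. \<integral>x. h i j x \<partial>M)"
proof -
  have "(\<integral>x. (\<Sum>i\<in>I. \<Sum>j\<in>J. h i j x) \<partial>M) = (\<Sum>i\<in>I. \<integral>x. (\<Sum>j\<in>J. h i j x) \<partial>M)"
    using assms by (intro Bochner_Integration.integral_sum Bochner_Integration.integrable_sum)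
  also have "\<dots> = (\<Sum>i\<in>I. \<Sum>j\<in>J. \<integral>x. h i j x \<partial>M)"
    using assms by (intro sum.cong refl Bochner_Integration.integral_sum)
  finally show ?thesis .
qed

text \<open>Bilinearity: an identity between inner products on two measure spaces, known for pairs
  of entries, extends to sums over lists. Here \<open>M\<close> will carry the integrals of the
  entries, \<open>N\<close> their integrands, and \<open>\<kappa>\<close> is the rate linking the
  two.\<close>

lemma integral_sum_list_mult:
  fixes f f' :: "'e \<Rightarrow> 'a \<Rightarrow> real" and v v' :: "'e \<Rightarrow> 'b \<Rightarrow> real"
  assumes "\<And>e e'. e \<in> set c \<Longrightarrow> e' \<in> set c' \<Longrightarrow> integrable M (\<lambda>x. f e x * f' e' x)"
    and "\<And>e e'. e \<in> set c \<Longrightarrow> e' \<in> set c' \<Longrightarrow> integrable N (\<lambda>x. v e x * v' e' x)"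
    and "\<And>e e'. e \<in> set c \<Longrightarrow> e' \<in> set c' \<Longrightarrow>
      (\<integral>x. f e x * f' e' x \<partial>M) = \<kappa> * (\<integral>x. v e x * v' e' x \<partial>N)"
  shows "integrable M (\<lambda>x. (\<Sum>e\<leftarrow>c. f e x) * (\<Sum>e\<leftarrow>c'. f' e x))"
    and "integrable N (\<lambda>x. (\<Sum>e\<leftarrow>c. v e x) * (\<Sum>e\<leftarrow>c'. v' e x))"
    and "(\<integral>x. (\<Sum>e\<leftarrow>c. f e x) * (\<Sum>e\<leftarrow>c'. f' e x) \<partial>M) =
      \<kappa> * (\<integral>x. (\<Sum>e\<leftarrow>c. v e x) * (\<Sum>e\<leftarrow>c'. v' e x) \<partial>N)"
proof -
  have prod_eq: "(\<Sum>e\<leftarrow>c. F e) * (\<Sum>e\<leftarrow>c'. G e) =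
      (\<Sum>i = 0..<length c. \<Sum>j = 0..<length c'. F (c ! i) * G (c' ! j))" for F G :: "'e \<Rightarrow> real"
    by (simp add: sum_list_sum_nth sum_product)
  have nth: "c ! i \<in> set c" "c' ! j \<in> set c'" if "i \<in> {0..<length c}" "j \<in> {0..<length c'}" for i j
    using that by auto
  note int = assms(1,2)[OF nth] and eq = assms(3)[OF nth]
  show "integrable M (\<lambda>x. (\<Sum>e\<leftarrow>c. f e x) * (\<Sum>e\<leftarrow>c'. f' e x))"
    and "integrable N (\<lambda>x. (\<Sum>e\<leftarrow>c. v e x) * (\<Sum>e\<leftarrow>c'. v' e x))"
    unfolding prod_eq
    using int by (auto intro!: Bochner_Integration.integrable_sum)
  have "(\<integral>x. (\<Sum>e\<leftarrow>c. f e x) * (\<Sum>e\<leftarrow>c'. f' e x) \<partial>M) =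
      (\<Sum>i = 0..<length c. \<Sum>j = 0..<length c'. \<integral>x. f (c ! i) x * f' (c' ! j) x \<partial>M)"
    unfolding prod_eq by (rule integral_sum2[OF int(1)])
  also have "\<dots> = (\<Sum>i = 0..<length c. \<Sum>j = 0..<length c'. \<kappa> * (\<integral>x. v (c ! i) x * v' (c' ! j) x \<partial>N))"
    using eq by (intro sum.cong) auto
  also have "\<dots> = \<kappa> * (\<integral>x. (\<Sum>e\<leftarrow>c. v e x) * (\<Sum>e\<leftarrow>c'. v' e x) \<partial>N)"
    unfolding prod_eq sum_distrib_left[where r=\<kappa>, symmetric]
    by (rule arg_cong[where f="(*) \<kappa>"], rule integral_sum2[OF int(2), symmetric])
  finally show "(\<integral>x. (\<Sum>e\<leftarrow>c. f e x) * (\<Sum>e\<leftarrow>c'. f' e x) \<partial>M) =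
      \<kappa> * (\<integral>x. (\<Sum>e\<leftarrow>c. v e x) * (\<Sum>e\<leftarrow>c'. v' e x) \<partial>N)" .
qed

lemma integrable_pair_mult:
  fixes f :: "'a \<Rightarrow> real" and g :: "'b \<Rightarrow> real"
  assumes "sigma_finite_measure M" "sigma_finite_measure N"
    and f: "integrable M f" and g: "integrable N g"
  shows "integrable (M \<Otimes>\<^sub>M N) (\<lambda>(x, y). f x * g y)"
    and "(\<integral>(x, y). f x * g y \<partial>(M \<Otimes>\<^sub>M N)) = (\<integral>x. f x \<partial>M) * (\<integral>y. g y \<partial>N)"
proof -
  interpret pair_sigma_finite M N using assms by (simp add: pair_sigma_finite_def)
  have [measurable]: "f \<in> borel_measurable M" "g \<in> borel_measurable N" using f g by auto
  show *: "integrable (M \<Otimes>\<^sub>M N) (\<lambda>(x, y). f x * g y)"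
    by (rule Fubini_integrable) (use f g in \<open>auto simp: abs_mult\<close>)
  show "(\<integral>(x, y). f x * g y \<partial>(M \<Otimes>\<^sub>M N)) = (\<integral>x. f x \<partial>M) * (\<integral>y. g y \<partial>N)"
    using integral_fst'[OF *] by simp
qed

section \<open>Integrals of step processes\<close>

text \<open>The axioms are those properties of increments that step integrals use: conditional mean
  zero and conditional covariance \<open>(r - s) * br a b\<close>, both written against events of
  \<open>F s\<close> so that independence can verify them. The index \<open>a\<close> ranges over
  all noises at once, which makes mixed covariances part of the same axiom.\<close>

locale noise_martingale = prob_space M for M :: "'w measure" +
  fixes F :: "real \<Rightarrow> 'w measure" and X :: "'a \<Rightarrow> real \<Rightarrow> 'w \<Rightarrow> real"
    and S :: "'a set" and br :: "'a \<Rightarrow> 'a \<Rightarrow> real"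
  assumes F_subalgebra: "\<And>t. 0 \<le> t \<Longrightarrow> subalgebra M (F t)"
    and F_mono: "\<And>s t. 0 \<le> s \<Longrightarrow> s \<le> t \<Longrightarrow> sets (F s) \<subseteq> sets (F t)"
    and X_meas: "\<And>a s r. a \<in> S \<Longrightarrow> 0 \<le> s \<Longrightarrow> s \<le> r \<Longrightarrow> (\<lambda>\<omega>. X a r \<omega> - X a s \<omega>) \<in> borel_measurable (F r)"
    and X_square_integrable: "\<And>a s r. a \<in> S \<Longrightarrow> 0 \<le> s \<Longrightarrow> s \<le> r \<Longrightarrow> integrable M (\<lambda>\<omega>. (X a r \<omega> - X a s \<omega>)\<^sup>2)"
    and X_mean: "\<And>a s r A. a \<in> S \<Longrightarrow> 0 \<le> s \<Longrightarrow> s \<le> r \<Longrightarrow> A \<in> sets (F s) \<Longrightarrow>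
      (\<integral>\<omega>. indicator A \<omega> * (X a r \<omega> - X a s \<omega>) \<partial>M) = 0"
    and X_covariance: "\<And>a b s r A. a \<in> S \<Longrightarrow> b \<in> S \<Longrightarrow> 0 \<le> s \<Longrightarrow> s \<le> r \<Longrightarrow> A \<in> sets (F s) \<Longrightarrow>
      (\<integral>\<omega>. indicator A \<omega> * ((X a r \<omega> - X a s \<omega>) * (X b r \<omega> - X b s \<omega>)) \<partial>M) = prob A * ((r - s) * br a b)"
    and br_commute: "\<And>a b. br a b = br b a"
begin

lemma F_space: "0 \<le> t \<Longrightarrow> space (F t) = space M"
  and F_sets: "0 \<le> t \<Longrightarrow> sets (F t) \<subseteq> sets M"
  using F_subalgebra by (auto simp: subalgebra_def)

lemma F_measurable_M: "0 \<le> t \<Longrightarrow> f \<in> borel_measurable (F t) \<Longrightarrow> f \<in> borel_measurable M"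
  using measurable_from_subalg[OF F_subalgebra] .

lemma F_measurable_mono: "0 \<le> s \<Longrightarrow> s \<le> t \<Longrightarrow> f \<in> borel_measurable (F s) \<Longrightarrow> f \<in> borel_measurable (F t)"
  using F_mono[of s t] F_space[of s] F_space[of t] by (auto simp: measurable_def)

lemma X_measurable_M: "a \<in> S \<Longrightarrow> 0 \<le> s \<Longrightarrow> s \<le> r \<Longrightarrow> (\<lambda>\<omega>. X a r \<omega> - X a s \<omega>) \<in> borel_measurable M"
  by (rule F_measurable_M[OF _ X_meas]) auto

lemma sigma_finite_subalgebra_F: "0 \<le> t \<Longrightarrow> sigma_finite_subalgebra M (F t)"
  using F_subalgebra finite_measure_axioms
  by (intro finite_measure_subalgebra_is_sigma_finite)
     (simp add: finite_measure_subalgebra_def finite_measure_subalgebra_axioms_def)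

lemma X_integrable: "a \<in> S \<Longrightarrow> 0 \<le> s \<Longrightarrow> s \<le> r \<Longrightarrow> integrable M (\<lambda>\<omega>. X a r \<omega> - X a s \<omega>)"
  using square_integrable_imp_integrable X_square_integrable X_measurable_M by blast

section \<open>Expectations of products of increments\<close>

lemma X_product_integrable:
  assumes "a \<in> S" "0 \<le> s" "s \<le> r" "b \<in> S" "0 \<le> s'" "s' \<le> r'"
  shows "integrable M (\<lambda>\<omega>. (X a r \<omega> - X a s \<omega>) * (X b r' \<omega> - X b s' \<omega>))"
  using assms by (intro integrable_mult_square_integrable X_measurable_M X_square_integrable)

lemma bounded_mult_integrable:
  fixes f :: "'w \<Rightarrow> real"
  assumes "D \<in> borel_measurable M" "\<And>\<omega>. \<omega> \<in> space M \<Longrightarrow> \<bar>D \<omega>\<bar> \<le> c" "integrable M f"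
  shows "integrable M (\<lambda>\<omega>. D \<omega> * f \<omega>)"
proof (rule Bochner_Integration.integrable_bound)
  show "integrable M (\<lambda>\<omega>. c * f \<omega>)" using assms by simp
  show "(\<lambda>\<omega>. D \<omega> * f \<omega>) \<in> borel_measurable M"
    using assms(1) borel_measurable_integrable[OF assms(3)] by measurable
  show "AE \<omega> in M. norm (D \<omega> * f \<omega>) \<le> norm (c * f \<omega>)"
  proof (rule AE_I2)
    fix \<omega> assume "\<omega> \<in> space M"
    then have "\<bar>D \<omega>\<bar> \<le> \<bar>c\<bar>" using assms(2)[of \<omega>] by auto
    then show "norm (D \<omega> * f \<omega>) \<le> norm (c * f \<omega>)"
      by (simp add: abs_mult mult_right_mono)
  qed
qed

text \<open>\<open>X_mean\<close> says that the conditional expectation of the increment given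
  \<open>F s\<close> vanishes; pulling out the \<open>F s\<close>-measurable factor extends this
  from events to every \<open>D\<close> with integrable product.\<close>

lemma X_orthogonal:
  assumes a: "a \<in> S" "0 \<le> s" "s \<le> r"
    and D: "D \<in> borel_measurable (F s)" "integrable M (\<lambda>\<omega>. D \<omega> * (X a r \<omega> - X a s \<omega>))"
  shows "(\<integral>\<omega>. D \<omega> * (X a r \<omega> - X a s \<omega>) \<partial>M) = 0"
proof -
  interpret sigma_finite_subalgebra M "F s" by (rule sigma_finite_subalgebra_F) fact
  let ?f = "\<lambda>\<omega>. X a r \<omega> - X a s \<omega>"
  have "AE \<omega> in M. real_cond_exp M (F s) ?f \<omega> = 0"
  proof (rule real_cond_exp_charact)
    fix A assume "A \<in> sets (F s)"
    then show "(\<integral>\<omega>\<in>A. ?f \<omega> \<partial>M) = (\<integral>\<omega>\<in>A. 0 \<partial>M)"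
      using X_mean[OF a, of A] by (simp add: set_lebesgue_integral_def)
  qed (use X_integrable[OF a] in auto)
  then have "(\<integral>\<omega>. D \<omega> * real_cond_exp M (F s) ?f \<omega> \<partial>M) = (\<integral>\<omega>. 0 \<partial>M)"
    by (intro integral_cong_AE) (use F_measurable_M[OF a(2) D(1)] in auto)
  then show ?thesis
    using real_cond_exp_intg(2)[OF D(2) D(1) X_measurable_M[OF a]] by simp
qed

lemma X_product_expectation:
  assumes a: "a \<in> S" "b \<in> S" "0 \<le> s" "s \<le> r"
    and D: "D \<in> borel_measurable (F s)" "\<And>\<omega>. \<omega> \<in> space M \<Longrightarrow> \<bar>D \<omega>\<bar> \<le> c"
  shows "(\<integral>\<omega>. D \<omega> * ((X a r \<omega> - X a s \<omega>) * (X b r \<omega> - X b s \<omega>)) \<partial>M) = br a b * (\<integral>\<omega>. D \<omega> \<partial>M) * (r - s)"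
proof -
  interpret sigma_finite_subalgebra M "F s" by (rule sigma_finite_subalgebra_F) fact
  let ?f = "\<lambda>\<omega>. (X a r \<omega> - X a s \<omega>) * (X b r \<omega> - X b s \<omega>)"
  have f: "integrable M ?f" using X_product_integrable a by blast
  have DM: "D \<in> borel_measurable M" using F_measurable_M[OF a(3) D(1)] .
  have "AE \<omega> in M. real_cond_exp M (F s) ?f \<omega> = (r - s) * br a b"
  proof (rule real_cond_exp_charact)
    fix A assume A: "A \<in> sets (F s)"
    then show "(\<integral>\<omega>\<in>A. ?f \<omega> \<partial>M) = (\<integral>\<omega>\<in>A. (r - s) * br a b \<partial>M)"
      using X_covariance[OF a A] F_sets[OF a(3)] sets.Int_space_eq2[of A M]
      by (auto simp: set_lebesgue_integral_def)
  qed (use f in auto)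
  then have "(\<integral>\<omega>. D \<omega> * real_cond_exp M (F s) ?f \<omega> \<partial>M) = (\<integral>\<omega>. D \<omega> * ((r - s) * br a b) \<partial>M)"
    by (intro integral_cong_AE) (use DM in auto)
  then show ?thesis
    using real_cond_exp_intg(2)[OF bounded_mult_integrable[OF DM D(2) f] D(1) borel_measurable_integrable[OF f]]
    by simp
qed

text \<open>Two overlapping intervals are cut so that pairs of pieces are either equal or ordered.
  Equal pieces contribute the covariance, ordered ones nothing, because \<open>D\<close> times the
  earlier increment is known when the later one starts.\<close>

lemma X_product_expectation_intervals_aux:
  assumes a: "a \<in> S" "b \<in> S" and pq: "0 \<le> p" "p \<le> q" "0 \<le> p'" "p' \<le> q'" "p \<le> p'"
    and D: "D \<in> borel_measurable (F p')" "\<And>\<omega>. \<omega> \<in> space M \<Longrightarrow> \<bar>D \<omega>\<bar> \<le> c"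
  shows "(\<integral>\<omega>. D \<omega> * ((X a q \<omega> - X a p \<omega>) * (X b q' \<omega> - X b p' \<omega>)) \<partial>M) =
    br a b * (\<integral>\<omega>. D \<omega> \<partial>M) * max 0 (min q q' - p')"
proof -
  have DM: "D \<in> borel_measurable M" using F_measurable_M[OF pq(3) D(1)] .
  have int: "integrable M (\<lambda>\<omega>. D \<omega> * ((X a' r \<omega> - X a' s \<omega>) * (X b' r' \<omega> - X b' s' \<omega>)))"
    if "a' \<in> S" "b' \<in> S" "0 \<le> s" "s \<le> r" "0 \<le> s'" "s' \<le> r'" for a' b' s r s' r'
    using that by (intro bounded_mult_integrable[OF DM D(2)] X_product_integrable)
  have zero: "(\<integral>\<omega>. D \<omega> * ((X a' r \<omega> - X a' s \<omega>) * (X b' r' \<omega> - X b' s' \<omega>)) \<partial>M) = 0"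
    if *: "a' \<in> S" "b' \<in> S" "0 \<le> s" "s \<le> r" "r \<le> s'" "s' \<le> r'" "p' \<le> s'" for a' b' s r s' r'
  proof -
    have s'r: "0 \<le> r" "0 \<le> s'" using * by auto
    have "(\<lambda>\<omega>. D \<omega> * (X a' r \<omega> - X a' s \<omega>)) \<in> borel_measurable (F s')"
      using F_measurable_mono[OF pq(3) *(7) D(1)] F_measurable_mono[OF s'r(1) *(5) X_meas[OF *(1,3,4)]]
      by measurable
    from X_orthogonal[OF *(2) s'r(2) *(6) this] int[OF *(1,2,3,4) s'r(2) *(6)] show ?thesis
      by (simp add: mult.assoc)
  qed
  show ?thesis
  proof (cases "q \<le> p'")
    case True
    then show ?thesis using zero[OF a pq(1,2) True pq(4)] by simp
  next
    case False
    define m where "m = min q q'"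
    have m: "p' \<le> m" "m \<le> q" "m \<le> q'" "0 \<le> m" using False pq by (auto simp: m_def)
    have m': "q = m \<or> q' = m" by (auto simp: m_def min_def)
    let ?I = "\<lambda>a' s r b' s' r'. \<lambda>\<omega>. D \<omega> * ((X a' r \<omega> - X a' s \<omega>) * (X b' r' \<omega> - X b' s' \<omega>))"
    \<comment> \<open>Since \<open>m\<close> is one of \<open>q\<close> and \<open>q'\<close>, at
      least one of the last two terms is zero, and the product over \<open>(m, q]\<close> and
      \<open>(m, q']\<close> is zero as well.\<close>
    have split: "?I a p q b p' q' \<omega> = ?I a p p' b p' q' \<omega> + ?I a p' m b p' m \<omega> + ?I a p' m b m q' \<omega>
        + ?I b p' m a m q \<omega>" for \<omega>
      using m' by (auto simp: algebra_simps)
    have i: "integrable M (?I a p p' b p' q')" "integrable M (?I a p' m b p' m)"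
        "integrable M (?I a p' m b m q')" "integrable M (?I b p' m a m q)"
      using a pq m by (auto intro!: int)
    have "integral\<^sup>L M (?I a p q b p' q') = integral\<^sup>L M (?I a p p' b p' q') + integral\<^sup>L M (?I a p' m b p' m)
        + integral\<^sup>L M (?I a p' m b m q') + integral\<^sup>L M (?I b p' m a m q)"
      unfolding split using i
      by (simp only: Bochner_Integration.integral_add Bochner_Integration.integrable_add)
    also have "integral\<^sup>L M (?I a p p' b p' q') = 0" using a pq by (intro zero) auto
    also have "integral\<^sup>L M (?I a p' m b m q') = 0" using a pq m by (intro zero) auto
    also have "integral\<^sup>L M (?I b p' m a m q) = 0" using a pq m by (intro zero) auto
    also have "integral\<^sup>L M (?I a p' m b p' m) = br a b * (\<integral>\<omega>. D \<omega> \<partial>M) * (m - p')"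
      by (rule X_product_expectation[OF a pq(3) m(1) D])
    finally show ?thesis using m by (simp add: m_def)
  qed
qed

text \<open>The overlap is expressed as a Lebesgue measure because it must later match the time
  integral of a product of indicators. Symmetry of \<open>br\<close> reduces the order of the left
  endpoints to one case.\<close>

lemma X_product_expectation_intervals:
  assumes a: "a \<in> S" "b \<in> S" and pq: "0 \<le> p" "p \<le> q" "0 \<le> p'" "p' \<le> q'"
    and D: "D \<in> borel_measurable (F (max p p'))" "\<And>\<omega>. \<omega> \<in> space M \<Longrightarrow> \<bar>D \<omega>\<bar> \<le> c"
  shows "(\<integral>\<omega>. D \<omega> * ((X a q \<omega> - X a p \<omega>) * (X b q' \<omega> - X b p' \<omega>)) \<partial>M) =
    br a b * (\<integral>\<omega>. D \<omega> \<partial>M) * measure lborel ({p<..q} \<inter> {p'<..q'})"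
proof -
  have "{p<..q} \<inter> {p'<..q'} = {max p p'<..min q q'}" by auto
  moreover have "measure lborel {x<..y} = max 0 (y - x)" for x y :: real
    by (cases "x \<le> y") simp_all
  ultimately have "measure lborel ({p<..q} \<inter> {p'<..q'}) = max 0 (min q q' - max p p')"
    by simp
  moreover have "(\<integral>\<omega>. D \<omega> * ((X a q \<omega> - X a p \<omega>) * (X b q' \<omega> - X b p' \<omega>)) \<partial>M) =
    br a b * (\<integral>\<omega>. D \<omega> \<partial>M) * max 0 (min q q' - max p p')"
  proof (cases "p \<le> p'")
    case True
    then show ?thesis
      using X_product_expectation_intervals_aux[OF a pq True _ D(2)] D(1) by (simp add: max_absorb2)
  next
    case False
    then show ?thesis
      using X_product_expectation_intervals_aux[OF a(2,1) pq(3,4,1,2) _ _ D(2)] D(1)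
      by (simp add: max_absorb1 br_commute[of b a] min.commute mult.commute[of "X b q' _ - X b p' _"])
  qed
  ultimately show ?thesis by simp
qed

text \<open>The third component names the integrator, so lists for one scalar integrator and lists
  for the random measure are instances of one format.\<close>

definition entry_integral :: "real \<times> real \<times> 'a \<times> ('w \<Rightarrow> real) \<Rightarrow> real \<Rightarrow> 'w \<Rightarrow> real"
  where "entry_integral e u \<omega> = (case e of (s, r, a, \<zeta>) \<Rightarrow> \<zeta> \<omega> * (X a (min r u) \<omega> - X a (min s u) \<omega>))"

definition valid_entry :: "real \<times> real \<times> 'a \<times> ('w \<Rightarrow> real) \<Rightarrow> bool"
  where "valid_entry e \<longleftrightarrow> (case e of (s, r, a, \<zeta>) \<Rightarrow> 0 \<le> s \<and> s \<le> r \<and> a \<in> S \<and>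
    \<zeta> \<in> borel_measurable (F s) \<and> bounded (\<zeta> ` space M))"

lemma valid_entryE:
  assumes "valid_entry (s, r, a, \<zeta>)"
  obtains c where "0 \<le> s" "s \<le> r" "a \<in> S" "\<zeta> \<in> borel_measurable (F s)"
    "\<zeta> \<in> borel_measurable M" "0 \<le> c" "\<And>\<omega>. \<omega> \<in> space M \<Longrightarrow> \<bar>\<zeta> \<omega>\<bar> \<le> c"
proof -
  obtain c where c: "\<forall>x\<in>\<zeta> ` space M. norm x \<le> c"
    using assms unfolding valid_entry_def bounded_iff by auto
  have "\<zeta> \<in> borel_measurable M"
    using assms unfolding valid_entry_def by (auto intro: F_measurable_M[of s])
  with that[of "max 0 c"] show thesis
    using assms c unfolding valid_entry_def by (auto simp: le_max_iff_disj)
qed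

text \<open>Clamping both endpoints of the entry to \<open>[t, u]\<close> turns the increment over
  \<open>(t, u]\<close> into a single increment of \<open>X\<close>, which is trivial if the entry
  lies outside.\<close>

lemma entry_integral_diff:
  assumes "s \<le> r" "t \<le> u"
  shows "entry_integral (s, r, a, \<zeta>) u \<omega> - entry_integral (s, r, a, \<zeta>) t \<omega> =
    \<zeta> \<omega> * (X a (min (max r t) u) \<omega> - X a (min (max s t) u) \<omega>)"
proof -
  consider "r \<le> t" | "s \<le> t" "t \<le> r" "r \<le> u" | "s \<le> t" "u \<le> r" | "t \<le> s" "r \<le> u" | "t \<le> s" "s \<le> u" "u \<le> r" | "u \<le> s"
    using assms by linarith
  then show ?thesis
    by cases (use assms in \<open>simp_all add: entry_integral_def min_absorb1 min_absorb2 max_absorb1 max_absorb2 algebra_simps\<close>)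
qed

text \<open>After clamping, each product is a bounded coefficient times two increments over
  intervals in \<open>[t, u]\<close>, so the covariance formula applies once the coefficient is
  measurable at the later left endpoint.\<close>

lemma
  assumes e: "valid_entry (s, r, a, \<zeta>)" and e': "valid_entry (s', r', b, \<zeta>')"
    and tu: "0 \<le> t" "t \<le> u"
    and w: "w \<in> borel_measurable (F t)" "\<And>\<omega>. \<bar>w \<omega>\<bar> \<le> 1"
  shows entry_product_integrable: "integrable M (\<lambda>\<omega>.
        (w \<omega> * (entry_integral (s, r, a, \<zeta>) u \<omega> - entry_integral (s, r, a, \<zeta>) t \<omega>)) *
        (entry_integral (s', r', b, \<zeta>') u \<omega> - entry_integral (s', r', b, \<zeta>') t \<omega>))"
    and entry_product_expectation: "(\<integral>\<omega>.
        (w \<omega> * (entry_integral (s, r, a, \<zeta>) u \<omega> - entry_integral (s, r, a, \<zeta>) t \<omega>)) *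
        (entry_integral (s', r', b, \<zeta>') u \<omega> - entry_integral (s', r', b, \<zeta>') t \<omega>) \<partial>M) =
      br a b * (\<integral>\<omega>. w \<omega> * \<zeta> \<omega> * \<zeta>' \<omega> \<partial>M) * measure lborel ({s<..r} \<inter> {s'<..r'} \<inter> {t<..u})"
proof -
  obtain c where c: "0 \<le> s" "s \<le> r" "a \<in> S" "\<zeta> \<in> borel_measurable (F s)"
    "\<zeta> \<in> borel_measurable M" "0 \<le> c" "\<And>\<omega>. \<omega> \<in> space M \<Longrightarrow> \<bar>\<zeta> \<omega>\<bar> \<le> c" by (rule valid_entryE[OF e]) (rule that)
  obtain c' where c': "0 \<le> s'" "s' \<le> r'" "b \<in> S" "\<zeta>' \<in> borel_measurable (F s')"
    "\<zeta>' \<in> borel_measurable M" "0 \<le> c'" "\<And>\<omega>. \<omega> \<in> space M \<Longrightarrow> \<bar>\<zeta>' \<omega>\<bar> \<le> c'" by (rule valid_entryE[OF e']) (rule that)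
  define p q p' q' where "p = min (max s t) u" and "q = min (max r t) u"
    and "p' = min (max s' t) u" and "q' = min (max r' t) u"
  define D where "D \<omega> = w \<omega> * \<zeta> \<omega> * \<zeta>' \<omega>" for \<omega>
  have pq: "0 \<le> p" "p \<le> q" "0 \<le> p'" "p' \<le> q'" "t \<le> p" "t \<le> p'"
    using tu c(1,2) c'(1,2) by (auto simp: p_def q_def p'_def q'_def min_def max_def)
  have wM: "w \<in> borel_measurable M" using F_measurable_M[OF tu(1) w(1)] .
  have DM: "D \<in> borel_measurable M" unfolding D_def using wM c(5) c'(5) by measurable
  have Db: "\<bar>D \<omega>\<bar> \<le> c * c'" if "\<omega> \<in> space M" for \<omega>
  proof -
    have "\<bar>w \<omega>\<bar> * \<bar>\<zeta> \<omega>\<bar> \<le> 1 * c" using w(2) c(6,7) that by (intro mult_mono) auto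
    from mult_mono[OF this c'(7)[OF that]]
    have "\<bar>w \<omega>\<bar> * \<bar>\<zeta> \<omega>\<bar> * \<bar>\<zeta>' \<omega>\<bar> \<le> (1 * c) * c'" using c(6) by simp
    then show ?thesis by (simp add: D_def abs_mult)
  qed
  have eq: "(w \<omega> * (entry_integral (s, r, a, \<zeta>) u \<omega> - entry_integral (s, r, a, \<zeta>) t \<omega>)) *
        (entry_integral (s', r', b, \<zeta>') u \<omega> - entry_integral (s', r', b, \<zeta>') t \<omega>) =
      D \<omega> * ((X a q \<omega> - X a p \<omega>) * (X b q' \<omega> - X b p' \<omega>))" for \<omega>
    unfolding entry_integral_diff[OF c(2) tu(2)] entry_integral_diff[OF c'(2) tu(2)]
    by (simp add: D_def p_def q_def p'_def q'_def)
  show "integrable M (\<lambda>\<omega>.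
        (w \<omega> * (entry_integral (s, r, a, \<zeta>) u \<omega> - entry_integral (s, r, a, \<zeta>) t \<omega>)) *
        (entry_integral (s', r', b, \<zeta>') u \<omega> - entry_integral (s', r', b, \<zeta>') t \<omega>))"
    unfolding eq by (rule bounded_mult_integrable[OF DM Db X_product_integrable[OF c(3) pq(1,2) c'(3) pq(3,4)]])
  have "(\<integral>\<omega>. D \<omega> * ((X a q \<omega> - X a p \<omega>) * (X b q' \<omega> - X b p' \<omega>)) \<partial>M) =
      br a b * (\<integral>\<omega>. D \<omega> \<partial>M) * measure lborel ({s<..r} \<inter> {s'<..r'} \<inter> {t<..u})"
  \<comment> \<open>If both entries start by time \<open>u\<close>, each coefficient is known at the
    later clamped left endpoint. An entry starting after \<open>u\<close> may have a coefficient
    that is not yet known there, but its clamped interval is empty.\<close>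
  proof (cases "s \<le> u \<and> s' \<le> u")
    case True
    have sp: "s \<le> max p p'" "s' \<le> max p p'" "t \<le> max p p'"
      using True tu by (auto simp: p_def p'_def)
    have "D \<in> borel_measurable (F (max p p'))"
      unfolding D_def
      using F_measurable_mono[OF tu(1) sp(3) w(1)] F_measurable_mono[OF c(1) sp(1) c(4)]
        F_measurable_mono[OF c'(1) sp(2) c'(4)] by measurable
    moreover have "{s<..r} \<inter> {s'<..r'} \<inter> {t<..u} = {p<..q} \<inter> {p'<..q'}"
      by (auto simp: p_def q_def p'_def q'_def)
    ultimately show ?thesis
      using X_product_expectation_intervals[OF c(3) c'(3) pq(1-4) _ Db] by simp
  next
    case False
    then have "p = q \<or> p' = q'" using c(2) c'(2) tu by (auto simp: p_def q_def p'_def q'_def)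
    moreover have "{s<..r} \<inter> {s'<..r'} \<inter> {t<..u} = {}" using False by auto
    ultimately show ?thesis by auto
  qed
  then show "(\<integral>\<omega>.
        (w \<omega> * (entry_integral (s, r, a, \<zeta>) u \<omega> - entry_integral (s, r, a, \<zeta>) t \<omega>)) *
        (entry_integral (s', r', b, \<zeta>') u \<omega> - entry_integral (s', r', b, \<zeta>') t \<omega>) \<partial>M) =
      br a b * (\<integral>\<omega>. w \<omega> * \<zeta> \<omega> * \<zeta>' \<omega> \<partial>M) * measure lborel ({s<..r} \<inter> {s'<..r'} \<inter> {t<..u})"
    unfolding eq D_def .
qed

definition list_integral :: "(real \<times> real \<times> 'a \<times> ('w \<Rightarrow> real)) list \<Rightarrow> real \<Rightarrow> 'w \<Rightarrow> real"
  where "list_integral c u \<omega> = (\<Sum>e\<leftarrow>c. entry_integral e u \<omega>)"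

lemma list_integral_diff:
  "w * (list_integral c u \<omega> - list_integral c t \<omega>) =
    (\<Sum>e\<leftarrow>c. w * (entry_integral e u \<omega> - entry_integral e t \<omega>))"
  unfolding list_integral_def by (induction c) (simp_all add: algebra_simps)

lemma entry_integral_measurable:
  assumes "valid_entry e" "0 \<le> u"
  shows "entry_integral e u \<in> borel_measurable M"
proof -
  obtain s r a \<zeta> where e: "e = (s, r, a, \<zeta>)" by (cases e)
  show ?thesis
  proof (rule valid_entryE[OF assms(1)[unfolded e]])
    fix c assume *: "0 \<le> s" "s \<le> r" "a \<in> S" "\<zeta> \<in> borel_measurable M"
    then have "(\<lambda>\<omega>. X a (min r u) \<omega> - X a (min s u) \<omega>) \<in> borel_measurable M"
      using assms(2) by (intro X_measurable_M) auto
    with *(4) show ?thesis unfolding e entry_integral_def by simp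
  qed
qed

lemma list_integral_measurable:
  assumes "\<And>e. e \<in> set c \<Longrightarrow> valid_entry e" "0 \<le> u"
  shows "list_integral c u \<in> borel_measurable M"
  unfolding list_integral_def using assms
proof (induction c)
  case (Cons e c)
  then show ?case using entry_integral_measurable[of e u] by simp
qed simp

text \<open>The first component of \<open>\<Theta>\<close> below is the sample space; \<open>val\<close> is the value of an entry
  as an integrand, and \<open>\<kappa>\<close> the constant rate of the quadratic variation.\<close>

lemma list_integral_product:
  fixes val :: "real \<times> real \<times> 'a \<times> ('w \<Rightarrow> real) \<Rightarrow> 'b \<Rightarrow> real"
  assumes c: "\<And>e. e \<in> set c \<Longrightarrow> valid_entry e \<and> P e" and c': "\<And>e. e \<in> set c' \<Longrightarrow> valid_entry e \<and> P' e"
    and tu: "0 \<le> t" "t \<le> u"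
    and w: "w \<in> borel_measurable (F t)" "\<And>\<omega>. \<bar>w \<omega>\<bar> \<le> 1"
    and base: "\<And>s r a \<zeta> s' r' b \<zeta>'. valid_entry (s, r, a, \<zeta>) \<Longrightarrow> P (s, r, a, \<zeta>) \<Longrightarrow>
        valid_entry (s', r', b, \<zeta>') \<Longrightarrow> P' (s', r', b, \<zeta>') \<Longrightarrow>
        integrable \<Theta> (\<lambda>x. W x * val (s, r, a, \<zeta>) x * val (s', r', b, \<zeta>') x) \<and>
        br a b * (\<integral>\<omega>. w \<omega> * \<zeta> \<omega> * \<zeta>' \<omega> \<partial>M) * measure lborel ({s<..r} \<inter> {s'<..r'} \<inter> {t<..u}) =
        \<kappa> * (\<integral>x. W x * val (s, r, a, \<zeta>) x * val (s', r', b, \<zeta>') x \<partial>\<Theta>)"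
  shows "integrable M (\<lambda>\<omega>. (w \<omega> * (list_integral c u \<omega> - list_integral c t \<omega>)) *
        (list_integral c' u \<omega> - list_integral c' t \<omega>))" (is ?i1)
    and "integrable \<Theta> (\<lambda>x. (W x * (\<Sum>e\<leftarrow>c. val e x)) * (\<Sum>e\<leftarrow>c'. val e x))" (is ?i2)
    and "(\<integral>\<omega>. (w \<omega> * (list_integral c u \<omega> - list_integral c t \<omega>)) *
        (list_integral c' u \<omega> - list_integral c' t \<omega>) \<partial>M) =
      \<kappa> * (\<integral>x. (W x * (\<Sum>e\<leftarrow>c. val e x)) * (\<Sum>e\<leftarrow>c'. val e x) \<partial>\<Theta>)" (is ?e)
proof -
  let ?f = "\<lambda>e \<omega>. w \<omega> * (entry_integral e u \<omega> - entry_integral e t \<omega>)"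
  let ?f' = "\<lambda>e \<omega>. entry_integral e u \<omega> - entry_integral e t \<omega>"
  have entry: "integrable M (\<lambda>\<omega>. ?f e \<omega> * ?f' e' \<omega>) \<and> integrable \<Theta> (\<lambda>x. (W x * val e x) * val e' x) \<and>
      (\<integral>\<omega>. ?f e \<omega> * ?f' e' \<omega> \<partial>M) = \<kappa> * (\<integral>x. (W x * val e x) * val e' x \<partial>\<Theta>)"
    if "e \<in> set c" "e' \<in> set c'" for e e'
  proof -
    obtain s r a \<zeta> where e: "e = (s, r, a, \<zeta>)" by (cases e)
    obtain s' r' b \<zeta>' where e': "e' = (s', r', b, \<zeta>')" by (cases e')
    have v: "valid_entry (s, r, a, \<zeta>)" "P (s, r, a, \<zeta>)" "valid_entry (s', r', b, \<zeta>')" "P' (s', r', b, \<zeta>')"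
      using c c' that unfolding e e' by auto
    show ?thesis
      unfolding e e'
      by (intro conjI entry_product_integrable[OF v(1,3) tu w] conjunct1[OF base[OF v]]
          trans[OF entry_product_expectation[OF v(1,3) tu w] conjunct2[OF base[OF v]]])
  qed
  have l: "w \<omega> * (list_integral c u \<omega> - list_integral c t \<omega>) = (\<Sum>e\<leftarrow>c. ?f e \<omega>)"
    "list_integral c' u \<omega> - list_integral c' t \<omega> = (\<Sum>e\<leftarrow>c'. ?f' e \<omega>)" for \<omega>
    using list_integral_diff[of 1 c' u \<omega> t] list_integral_diff[of "w \<omega>" c u \<omega> t] by simp_all
  note E = entry[THEN conjunct1] entry[THEN conjunct2, THEN conjunct1] entry[THEN conjunct2, THEN conjunct2]
  have lW: "W x * (\<Sum>e\<leftarrow>c. val e x) = (\<Sum>e\<leftarrow>c. W x * val e x)" for x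
    by (rule sum_list_const_mult[symmetric])
  show ?i1 unfolding l by (rule integral_sum_list_mult(1)[OF E])
  show ?i2 unfolding lW by (rule integral_sum_list_mult(2)[OF E])
  show ?e unfolding l lW by (rule integral_sum_list_mult(3)[OF E])
qed

text \<open>Entry by entry: \<open>\<zeta> * D\<close> is known at the clamped left endpoint, where
  the increment has conditional mean zero. As \<open>D\<close> is only square integrable,
  integrability comes from the product of \<open>D\<close> with the increment, and then from the
  bound on \<open>\<zeta>\<close>.\<close>

lemma list_integral_orthogonal:
  assumes c: "\<And>e. e \<in> set c \<Longrightarrow> valid_entry e"
    and tu: "0 \<le> t" "t \<le> u"
    and D: "D \<in> borel_measurable (F t)" "integrable M (\<lambda>\<omega>. (D \<omega>)\<^sup>2)"
  shows "integrable M (\<lambda>\<omega>. D \<omega> * (list_integral c u \<omega> - list_integral c t \<omega>)) \<and>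
    (\<integral>\<omega>. D \<omega> * (list_integral c u \<omega> - list_integral c t \<omega>) \<partial>M) = 0"
  using c
proof (induction c)
  case Nil
  then show ?case by (simp add: list_integral_def)
next
  case (Cons e c)
  obtain s r a \<zeta> where e: "e = (s, r, a, \<zeta>)" by (cases e)
  obtain k where c: "0 \<le> s" "s \<le> r" "a \<in> S" "\<zeta> \<in> borel_measurable (F s)"
    "\<zeta> \<in> borel_measurable M" "0 \<le> k" "\<And>\<omega>. \<omega> \<in> space M \<Longrightarrow> \<bar>\<zeta> \<omega>\<bar> \<le> k"
    by (rule valid_entryE[of s r a \<zeta>]) (use Cons.prems[of e] e in simp, rule that)
  define p q where "p = min (max s t) u" and "q = min (max r t) u"
  have pq: "0 \<le> p" "p \<le> q" "t \<le> p" using tu c by (auto simp: p_def q_def)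
  have DM: "D \<in> borel_measurable M" using F_measurable_M[OF tu(1) D(1)] .
  have eq: "D \<omega> * (entry_integral e u \<omega> - entry_integral e t \<omega>) = (\<zeta> \<omega> * D \<omega>) * (X a q \<omega> - X a p \<omega>)" for \<omega>
    unfolding e entry_integral_diff[OF c(2) tu(2)] by (simp add: p_def q_def)
  have "integrable M (\<lambda>\<omega>. D \<omega> * (X a q \<omega> - X a p \<omega>))"
    using c pq by (intro integrable_mult_square_integrable DM D X_measurable_M X_square_integrable)
  from bounded_mult_integrable[OF c(5,7) this]
  have i: "integrable M (\<lambda>\<omega>. (\<zeta> \<omega> * D \<omega>) * (X a q \<omega> - X a p \<omega>))" by (simp add: mult.assoc)
  have z: "(\<integral>\<omega>. (\<zeta> \<omega> * D \<omega>) * (X a q \<omega> - X a p \<omega>) \<partial>M) = 0"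
  proof (cases "s \<le> u")
    case True
    then have "s \<le> p" by (auto simp: p_def)
    then have "(\<lambda>\<omega>. \<zeta> \<omega> * D \<omega>) \<in> borel_measurable (F p)"
      using F_measurable_mono[OF c(1) _ c(4)] F_measurable_mono[OF tu(1) pq(3) D(1)] by simp
    then show ?thesis by (rule X_orthogonal[OF c(3) pq(1,2) _ i])
  next
    case False
    then have "p = q" using c tu by (auto simp: p_def q_def)
    then show ?thesis by simp
  qed
  have "D \<omega> * (list_integral (e # c) u \<omega> - list_integral (e # c) t \<omega>) =
      D \<omega> * (entry_integral e u \<omega> - entry_integral e t \<omega>) + D \<omega> * (list_integral c u \<omega> - list_integral c t \<omega>)" for \<omega>
    by (simp add: list_integral_def algebra_simps)
  then show ?case
    using Cons.IH Cons.prems i z unfolding eq by simp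
qed

end

section \<open>Limits of step integrals\<close>

lemma L2_tendsto_diff:
  assumes "L2_tendsto M fn f" "L2_tendsto M gn g"
  shows "L2_tendsto M (\<lambda>n x. fn n x - gn n x) (\<lambda>x. f x - g x)"
proof -
  note f = assms(1)[unfolded L2_tendsto_def] and g = assms(2)[unfolded L2_tendsto_def]
  have m: "f \<in> borel_measurable M" "fn n \<in> borel_measurable M"
      "g \<in> borel_measurable M" "gn n \<in> borel_measurable M" for n using f g by simp_all
  note [measurable] = m
  have i: "integrable M (\<lambda>x. (f x)\<^sup>2)" "integrable M (\<lambda>x. (fn n x)\<^sup>2)"
      "integrable M (\<lambda>x. (g x)\<^sup>2)" "integrable M (\<lambda>x. (gn n x)\<^sup>2)" for n using f g by simp_all
  have df: "integrable M (\<lambda>x. (f x - fn n x)\<^sup>2)" and dg: "integrable M (\<lambda>x. (g x - gn n x)\<^sup>2)" for n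
    by (intro square_integrable_diff m i)+
  have dd: "integrable M (\<lambda>x. ((f x - fn n x) - (g x - gn n x))\<^sup>2)" for n
    by (intro square_integrable_diff df dg borel_measurable_diff m)
  have le: "(\<integral>x. ((f x - fn n x) - (g x - gn n x))\<^sup>2 \<partial>M) \<le> 2 * (\<integral>x. (f x - fn n x)\<^sup>2 \<partial>M) + 2 * (\<integral>x. (g x - gn n x)\<^sup>2 \<partial>M)" for n
  proof -
    have "(a - b)\<^sup>2 \<le> 2 * a\<^sup>2 + 2 * b\<^sup>2" for a b :: real
      using zero_le_power2[of "a + b"] by (simp add: power2_diff power2_sum)
    then have "(\<integral>x. ((f x - fn n x) - (g x - gn n x))\<^sup>2 \<partial>M) \<le> (\<integral>x. 2 * (f x - fn n x)\<^sup>2 + 2 * (g x - gn n x)\<^sup>2 \<partial>M)"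
      using df dg dd by (intro integral_mono) simp_all
    also have "\<dots> = 2 * (\<integral>x. (f x - fn n x)\<^sup>2 \<partial>M) + 2 * (\<integral>x. (g x - gn n x)\<^sup>2 \<partial>M)"
      using df dg by simp
    finally show ?thesis .
  qed
  have "(\<lambda>n. 2 * (\<integral>x. (f x - fn n x)\<^sup>2 \<partial>M) + 2 * (\<integral>x. (g x - gn n x)\<^sup>2 \<partial>M)) \<longlonglongrightarrow> 2 * 0 + 2 * 0"
    by (intro tendsto_add tendsto_mult tendsto_const) (use f g in simp_all)
  then have "(\<lambda>n. \<integral>x. ((f x - fn n x) - (g x - gn n x))\<^sup>2 \<partial>M) \<longlonglongrightarrow> 0"
    unfolding mult_zero_right add_0_left
    by (rule tendsto_sandwich[OF _ _ tendsto_const, rotated 2]) (simp_all add: le)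
  moreover have "((f x - fn n x) - (g x - gn n x)) = (f x - g x - (fn n x - gn n x))" for n x by simp
  ultimately show ?thesis
    unfolding L2_tendsto_def by (auto intro!: square_integrable_diff m i)
qed

lemma L2_tendsto_const:
  "f \<in> borel_measurable M \<Longrightarrow> integrable M (\<lambda>x. (f x)\<^sup>2) \<Longrightarrow> L2_tendsto M (\<lambda>_. f) f"
  unfolding L2_tendsto_def by simp

lemma sum_list_square_integrable:
  fixes f :: "'e \<Rightarrow> 'a \<Rightarrow> real"
  assumes "\<And>e. e \<in> set c \<Longrightarrow> f e \<in> borel_measurable M \<and> integrable M (\<lambda>x. (f e x)\<^sup>2)"
  shows "(\<lambda>x. \<Sum>e\<leftarrow>c. f e x) \<in> borel_measurable M \<and> integrable M (\<lambda>x. (\<Sum>e\<leftarrow>c. f e x)\<^sup>2)"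
  using assms
proof (induction c)
  case (Cons e c)
  then have fe: "f e \<in> borel_measurable M" "integrable M (\<lambda>x. (f e x)\<^sup>2)" by auto
  with Cons show ?case by (auto intro!: square_integrable_add borel_measurable_add)
qed simp

section \<open>Processes approximated by lists of entries\<close>

context noise_martingale
begin

lemma entry_integral_square_integrable:
  assumes "valid_entry e" "0 \<le> t" "t \<le> u"
  shows "integrable M (\<lambda>\<omega>. (entry_integral e u \<omega> - entry_integral e t \<omega>)\<^sup>2)"
proof -
  obtain s r a \<zeta> where e: "e = (s, r, a, \<zeta>)" by (cases e)
  show ?thesis
    using entry_product_integrable[OF assms(1)[unfolded e] assms(1)[unfolded e] assms(2,3), of "\<lambda>_. 1"]
    unfolding e by (simp add: power2_eq_square)
qed

lemma list_integral_square_integrable: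
  assumes "\<And>e. e \<in> set c \<Longrightarrow> valid_entry e" "0 \<le> t" "t \<le> u"
  shows "integrable M (\<lambda>\<omega>. (list_integral c u \<omega> - list_integral c t \<omega>)\<^sup>2)"
proof -
  have "(\<lambda>x. \<Sum>e\<leftarrow>c. entry_integral e u x - entry_integral e t x) \<in> borel_measurable M \<and>
    integrable M (\<lambda>x. (\<Sum>e\<leftarrow>c. entry_integral e u x - entry_integral e t x)\<^sup>2)"
    using assms by (intro sum_list_square_integrable conjI borel_measurable_diff
        entry_integral_measurable entry_integral_square_integrable) auto
  then show ?thesis
    using list_integral_diff[of 1 c u _ t] by simp
qed

text \<open>Both truncated endpoints are 0 at time 0. So the value at time \<open>v\<close> is an
  increment, and square integrability of increments covers values too.\<close>

lemma list_integral_0: "(\<And>e. e \<in> set c \<Longrightarrow> valid_entry e) \<Longrightarrow> list_integral c 0 \<omega> = 0"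
proof -
  have "entry_integral e 0 \<omega> = 0" if "valid_entry e" for e
    using that by (cases e) (auto simp: entry_integral_def valid_entry_def min_absorb2)
  then show "(\<And>e. e \<in> set c \<Longrightarrow> valid_entry e) \<Longrightarrow> list_integral c 0 \<omega> = 0"
    unfolding list_integral_def by (induction c) simp_all
qed

definition approximates :: "(nat \<Rightarrow> (real \<times> real \<times> 'a \<times> ('w \<Rightarrow> real)) list) \<Rightarrow>
    (real \<Rightarrow> 'w \<Rightarrow> real) \<Rightarrow> real \<Rightarrow> real \<Rightarrow> bool"
  where "approximates c J t u \<longleftrightarrow> (\<forall>n. \<forall>e\<in>set (c n). valid_entry e) \<and>
    L2_tendsto M (\<lambda>n \<omega>. list_integral (c n) u \<omega> - list_integral (c n) t \<omega>) (\<lambda>\<omega>. J u \<omega> - J t \<omega>)"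

lemma approximatesI:
  assumes c: "\<And>n e. e \<in> set (c n) \<Longrightarrow> valid_entry e" and tu: "0 \<le> t" "t \<le> u"
    and J: "J u \<in> borel_measurable M" "J t \<in> borel_measurable M"
    and lim: "(\<lambda>n. \<integral>\<^sup>+\<omega>. ennreal ((J u \<omega> - list_integral (c n) u \<omega>)\<^sup>2) \<partial>M) \<longlonglongrightarrow> 0"
      "(\<lambda>n. \<integral>\<^sup>+\<omega>. ennreal ((J t \<omega> - list_integral (c n) t \<omega>)\<^sup>2) \<partial>M) \<longlonglongrightarrow> 0"
  shows "approximates c J t u"
  unfolding approximates_def
proof (intro conjI allI ballI c)
  have sq: "integrable M (\<lambda>\<omega>. (list_integral (c n) v \<omega>)\<^sup>2)" if "0 \<le> v" for n v
    using list_integral_square_integrable[of "c n" 0 v] c that by (simp add: list_integral_0)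
  show "L2_tendsto M (\<lambda>n \<omega>. list_integral (c n) u \<omega> - list_integral (c n) t \<omega>) (\<lambda>\<omega>. J u \<omega> - J t \<omega>)"
    using tu by (intro L2_tendsto_diff L2_tendstoI list_integral_measurable sq J lim c) auto
qed

text \<open>Appending the entries of a second list with negated coefficients represents a difference
  of integrals, which keeps the difference of two solutions inside the class of approximable
  processes.\<close>

definition neg_entry :: "real \<times> real \<times> 'a \<times> ('w \<Rightarrow> real) \<Rightarrow> real \<times> real \<times> 'a \<times> ('w \<Rightarrow> real)"
  where "neg_entry e = (case e of (s, r, a, \<zeta>) \<Rightarrow> (s, r, a, \<lambda>\<omega>. - \<zeta> \<omega>))"

lemma valid_neg_entry: "valid_entry e \<Longrightarrow> valid_entry (neg_entry e)"
  by (auto simp: valid_entry_def neg_entry_def bounded_iff split: prod.splits)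

lemma list_integral_append_neg:
  "list_integral (c @ map neg_entry c') u \<omega> = list_integral c u \<omega> - list_integral c' u \<omega>"
proof -
  have "(\<Sum>e\<leftarrow>map neg_entry c'. entry_integral e u \<omega>) = - (\<Sum>e\<leftarrow>c'. entry_integral e u \<omega>)"
    by (induction c') (auto simp: entry_integral_def neg_entry_def split: prod.splits)
  then show ?thesis by (simp add: list_integral_def)
qed

lemma approximates_diff:
  assumes "approximates c J t u" "approximates c' J' t u"
  shows "approximates (\<lambda>n. c n @ map neg_entry (c' n)) (\<lambda>v \<omega>. J v \<omega> - J' v \<omega>) t u"
proof -
  have "L2_tendsto M (\<lambda>n \<omega>. (list_integral (c n) u \<omega> - list_integral (c n) t \<omega>) - (list_integral (c' n) u \<omega> - list_integral (c' n) t \<omega>))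
    (\<lambda>\<omega>. (J u \<omega> - J t \<omega>) - (J' u \<omega> - J' t \<omega>))"
    by (rule L2_tendsto_diff) (use assms in \<open>simp_all add: approximates_def\<close>)
  then have "L2_tendsto M (\<lambda>n \<omega>. (list_integral (c n) u \<omega> - list_integral (c' n) u \<omega>) - (list_integral (c n) t \<omega> - list_integral (c' n) t \<omega>))
    (\<lambda>\<omega>. (J u \<omega> - J' u \<omega>) - (J t \<omega> - J' t \<omega>))"
    by (simp add: algebra_simps)
  then show ?thesis
    using assms valid_neg_entry unfolding approximates_def list_integral_append_neg by auto
qed

lemma approximates_square_integrable:
  "approximates c J t u \<Longrightarrow> (\<lambda>\<omega>. J u \<omega> - J t \<omega>) \<in> borel_measurable M \<and> integrable M (\<lambda>\<omega>. (J u \<omega> - J t \<omega>)\<^sup>2)"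
  unfolding approximates_def L2_tendsto_def by blast

lemma approximates_orthogonal:
  assumes a: "approximates c J t u" and tu: "0 \<le> t" "t \<le> u"
    and D: "D \<in> borel_measurable (F t)" "integrable M (\<lambda>\<omega>. (D \<omega>)\<^sup>2)"
  shows "(\<integral>\<omega>. D \<omega> * (J u \<omega> - J t \<omega>) \<partial>M) = 0"
proof (rule LIMSEQ_unique)
  show "(\<lambda>n. \<integral>\<omega>. D \<omega> * (list_integral (c n) u \<omega> - list_integral (c n) t \<omega>) \<partial>M) \<longlonglongrightarrow>
      (\<integral>\<omega>. D \<omega> * (J u \<omega> - J t \<omega>) \<partial>M)"
    using a D F_measurable_M[OF tu(1) D(1)] unfolding approximates_def
    by (intro L2_tendsto_inner L2_tendsto_const) auto
  have "(\<integral>\<omega>. D \<omega> * (list_integral (c n) u \<omega> - list_integral (c n) t \<omega>) \<partial>M) = 0" for n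
    using list_integral_orthogonal[OF _ tu D] a unfolding approximates_def by blast
  then show "(\<lambda>n. \<integral>\<omega>. D \<omega> * (list_integral (c n) u \<omega> - list_integral (c n) t \<omega>) \<partial>M) \<longlonglongrightarrow> 0"
    by simp
qed

text \<open>Both sides of the identity for lists are inner products of mean-square convergent
  sequences, one over \<open>M\<close> and one over the integrand space \<open>\<Theta>\<close>, so
  they converge to the inner products of the limits. Weights bounded by 1 do not disturb the
  convergence.\<close>

lemma approximates_product:
  fixes val :: "real \<times> real \<times> 'a \<times> ('w \<Rightarrow> real) \<Rightarrow> 'b \<Rightarrow> real"
  assumes a: "approximates c J t u" "approximates c' J' t u"
    and tu: "0 \<le> t" "t \<le> u"
    and w: "w \<in> borel_measurable (F t)" "\<And>\<omega>. \<bar>w \<omega>\<bar> \<le> 1"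
    and P: "\<And>n e. e \<in> set (c n) \<Longrightarrow> P e" "\<And>n e. e \<in> set (c' n) \<Longrightarrow> P' e"
    and W: "W \<in> borel_measurable \<Theta>" "\<And>x. \<bar>W x\<bar> \<le> 1"
    and h: "L2_tendsto \<Theta> (\<lambda>n x. \<Sum>e\<leftarrow>c n. val e x) h" "L2_tendsto \<Theta> (\<lambda>n x. \<Sum>e\<leftarrow>c' n. val e x) h'"
    and base: "\<And>s r a \<zeta> s' r' b \<zeta>'. valid_entry (s, r, a, \<zeta>) \<Longrightarrow> P (s, r, a, \<zeta>) \<Longrightarrow>
        valid_entry (s', r', b, \<zeta>') \<Longrightarrow> P' (s', r', b, \<zeta>') \<Longrightarrow>
        integrable \<Theta> (\<lambda>x. W x * val (s, r, a, \<zeta>) x * val (s', r', b, \<zeta>') x) \<and>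
        br a b * (\<integral>\<omega>. w \<omega> * \<zeta> \<omega> * \<zeta>' \<omega> \<partial>M) * measure lborel ({s<..r} \<inter> {s'<..r'} \<inter> {t<..u}) =
        \<kappa> * (\<integral>x. W x * val (s, r, a, \<zeta>) x * val (s', r', b, \<zeta>') x \<partial>\<Theta>)"
  shows "(\<integral>\<omega>. (w \<omega> * (J u \<omega> - J t \<omega>)) * (J' u \<omega> - J' t \<omega>) \<partial>M) = \<kappa> * (\<integral>x. (W x * h x) * h' x \<partial>\<Theta>)"
proof (rule LIMSEQ_unique)
  have wM: "w \<in> borel_measurable M" using F_measurable_M[OF tu(1) w(1)] .
  show "(\<lambda>n. \<integral>\<omega>. (w \<omega> * (list_integral (c n) u \<omega> - list_integral (c n) t \<omega>)) * (list_integral (c' n) u \<omega> - list_integral (c' n) t \<omega>) \<partial>M)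
      \<longlonglongrightarrow> (\<integral>\<omega>. (w \<omega> * (J u \<omega> - J t \<omega>)) * (J' u \<omega> - J' t \<omega>) \<partial>M)"
    using a unfolding approximates_def by (intro L2_tendsto_inner L2_tendsto_mult wM w(2)) simp_all
  have "(\<integral>\<omega>. (w \<omega> * (list_integral (c n) u \<omega> - list_integral (c n) t \<omega>)) * (list_integral (c' n) u \<omega> - list_integral (c' n) t \<omega>) \<partial>M)
      = \<kappa> * (\<integral>x. (W x * (\<Sum>e\<leftarrow>c n. val e x)) * (\<Sum>e\<leftarrow>c' n. val e x) \<partial>\<Theta>)" for n
    by (rule list_integral_product(3)[where P=P and P'=P', OF _ _ tu w base])
       (use a P in \<open>auto simp: approximates_def\<close>)
  then show "(\<lambda>n. \<integral>\<omega>. (w \<omega> * (list_integral (c n) u \<omega> - list_integral (c n) t \<omega>)) * (list_integral (c' n) u \<omega> - list_integral (c' n) t \<omega>) \<partial>M)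
      \<longlonglongrightarrow> \<kappa> * (\<integral>x. (W x * h x) * h' x \<partial>\<Theta>)"
    by (simp only:) (intro tendsto_mult tendsto_const L2_tendsto_inner L2_tendsto_mult W h)
qed

lemma approximates_cross:
  assumes a: "approximates c J t u" "approximates c' J' t u"
    and tu: "0 \<le> t" "t \<le> u"
    and w: "w \<in> borel_measurable (F t)" "\<And>\<omega>. \<bar>w \<omega>\<bar> \<le> 1"
    and P: "\<And>n s r a \<zeta>. (s, r, a, \<zeta>) \<in> set (c n) \<Longrightarrow> a \<in> SA" "\<And>n s r a \<zeta>. (s, r, a, \<zeta>) \<in> set (c' n) \<Longrightarrow> a \<in> SB"
    and br0: "\<And>a b. a \<in> SA \<Longrightarrow> b \<in> SB \<Longrightarrow> br a b = 0"
  shows "(\<integral>\<omega>. (w \<omega> * (J u \<omega> - J t \<omega>)) * (J' u \<omega> - J' t \<omega>) \<partial>M) = 0"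
proof -
  \<comment> \<open>Brackets between the two groups vanish, so the general product lemma is used
    with rate 0 and the zero integrand on both sides.\<close>
  have "(\<integral>\<omega>. (w \<omega> * (J u \<omega> - J t \<omega>)) * (J' u \<omega> - J' t \<omega>) \<partial>M) = 0 * (\<integral>x. ((\<lambda>_. 1) x * (\<lambda>_. 0) x) * (\<lambda>_. 0) x \<partial>M)"
  proof (rule approximates_product[where val="\<lambda>_ _. 0" and P="\<lambda>(s,r,a,\<zeta>). a \<in> SA" and P'="\<lambda>(s,r,a,\<zeta>). a \<in> SB", OF a tu w])
    show "L2_tendsto M (\<lambda>n x. \<Sum>e\<leftarrow>c n. 0) (\<lambda>_. 0)" "L2_tendsto M (\<lambda>n x. \<Sum>e\<leftarrow>c' n. 0) (\<lambda>_. 0)"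
      by (simp_all add: L2_tendsto_def)
  qed (use P br0 in \<open>auto\<close>)
  then show ?thesis by simp
qed

section \<open>Entries as functions of scenario, time and mark\<close>

definition scalar_value :: "real \<times> real \<times> 'a \<times> ('w \<Rightarrow> real) \<Rightarrow> 'w \<times> real \<Rightarrow> real"
  where "scalar_value e x = (case e of (s, r, a, \<zeta>) \<Rightarrow> \<zeta> (fst x) * indicator {s<..r} (snd x))"

definition field_value :: "('a \<Rightarrow> 'e set) \<Rightarrow> real \<times> real \<times> 'a \<times> ('w \<Rightarrow> real) \<Rightarrow> ('w \<times> real) \<times> 'e \<Rightarrow> real"
  where "field_value A e x = (case e of (s, r, a, \<zeta>) \<Rightarrow>
    \<zeta> (fst (fst x)) * indicator {s<..r} (snd (fst x)) * indicator (A a) (snd x))"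

abbreviation (input) time :: "real \<Rightarrow> real measure"
  where "time T \<equiv> restrict_space lborel {0..T}"

lemma finite_measure_time: "finite_measure (time T)"
  by (intro finite_measureI, cases "0 \<le> T") (auto simp: emeasure_restrict_space)

lemma time_indicator:
  assumes "I \<subseteq> {0..T}" "I \<in> sets borel"
  shows "integrable (time T) (indicator I :: real \<Rightarrow> real)"
    "(\<integral>v. indicator I v \<partial>time T) = measure lborel I"
proof -
  interpret L: finite_measure "time T" by (rule finite_measure_time)
  have I: "I \<in> sets (time T)" using assms by (auto simp: sets_restrict_space)
  show "integrable (time T) (indicator I :: real \<Rightarrow> real)"
    using I by (intro integrable_real_indicator) (auto simp: L.emeasure_eq_measure)
  have "I \<inter> space (time T) = I" using assms by (auto simp: space_restrict_space)
  then show "(\<integral>v. indicator I v \<partial>time T) = measure lborel I"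
    using assms(1) by (simp add: measure_restrict_space)
qed

text \<open>The integrand side of the isometry for one pair of entries: the product separates into a
  factor in \<open>\<omega>\<close> and the indicator of the common time interval, which produces
  exactly the overlap length of \<open>entry_product_expectation\<close>.\<close>

lemma
  fixes w :: "'w \<Rightarrow> real" and \<zeta> :: "'w \<Rightarrow> real"
  assumes e: "valid_entry (s, r, a, \<zeta>)" and e': "valid_entry (s', r', b, \<zeta>')"
    and tu: "0 \<le> t" "t \<le> u" "u \<le> T"
    and w: "w \<in> borel_measurable M" "\<And>\<omega>. \<bar>w \<omega>\<bar> \<le> 1"
  shows scalar_value_product_integrable: "integrable (M \<Otimes>\<^sub>M time T) (\<lambda>x. (w (fst x) * indicator {t<..u} (snd x)) *
      scalar_value (s, r, a, \<zeta>) x * scalar_value (s', r', b, \<zeta>') x)"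
    and scalar_value_product_integral: "(\<integral>x. (w (fst x) * indicator {t<..u} (snd x)) *
      scalar_value (s, r, a, \<zeta>) x * scalar_value (s', r', b, \<zeta>') x \<partial>(M \<Otimes>\<^sub>M time T)) =
      (\<integral>\<omega>. w \<omega> * \<zeta> \<omega> * \<zeta>' \<omega> \<partial>M) * measure lborel ({s<..r} \<inter> {s'<..r'} \<inter> {t<..u})"
proof -
  obtain c where c: "0 \<le> s" "s \<le> r" "a \<in> S" "\<zeta> \<in> borel_measurable (F s)"
    "\<zeta> \<in> borel_measurable M" "0 \<le> c" "\<And>\<omega>. \<omega> \<in> space M \<Longrightarrow> \<bar>\<zeta> \<omega>\<bar> \<le> c" by (rule valid_entryE[OF e]) (rule that)
  obtain c' where c': "0 \<le> s'" "s' \<le> r'" "b \<in> S" "\<zeta>' \<in> borel_measurable (F s')"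
    "\<zeta>' \<in> borel_measurable M" "0 \<le> c'" "\<And>\<omega>. \<omega> \<in> space M \<Longrightarrow> \<bar>\<zeta>' \<omega>\<bar> \<le> c'" by (rule valid_entryE[OF e']) (rule that)
  let ?I = "{s<..r} \<inter> {s'<..r'} \<inter> {t<..u}"
  have sub: "?I \<subseteq> {0..T}" using tu by auto
  interpret L: finite_measure "time T" by (rule finite_measure_time)
  have 1: "integrable M (\<lambda>\<omega>. w \<omega> * (\<zeta> \<omega> * (\<zeta>' \<omega> * 1)))"
    using bounded_mult_integrable[OF w(1) w(2) bounded_mult_integrable[OF c(5,7) bounded_mult_integrable[OF c'(5,7), of "\<lambda>_. 1"]]]
    by simp
  have Ib: "?I \<in> sets borel" by auto
  note 2 = time_indicator(1)[OF sub Ib]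
  have eq: "(w (fst x) * indicator {t<..u} (snd x)) *
      scalar_value (s, r, a, \<zeta>) x * scalar_value (s', r', b, \<zeta>') x =
      (case x of (\<omega>, v) \<Rightarrow> (w \<omega> * (\<zeta> \<omega> * (\<zeta>' \<omega> * 1))) * indicator ?I v)" for x
    by (cases x) (auto simp: scalar_value_def indicator_def)
  note p = integrable_pair_mult[OF sigma_finite_measure_axioms L.sigma_finite_measure_axioms 1 2]
  show "integrable (M \<Otimes>\<^sub>M time T) (\<lambda>x. (w (fst x) * indicator {t<..u} (snd x)) *
      scalar_value (s, r, a, \<zeta>) x * scalar_value (s', r', b, \<zeta>') x)"
    unfolding eq by (rule p(1))
  show "(\<integral>x. (w (fst x) * indicator {t<..u} (snd x)) *
      scalar_value (s, r, a, \<zeta>) x * scalar_value (s', r', b, \<zeta>') x \<partial>(M \<Otimes>\<^sub>M time T)) =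
      (\<integral>\<omega>. w \<omega> * \<zeta> \<omega> * \<zeta>' \<omega> \<partial>M) * measure lborel ?I"
    unfolding eq p(2) time_indicator(2)[OF sub Ib] by (simp only: mult_1_right mult.assoc)
qed

text \<open>The mark variable adds one more factor, the indicator of
  \<open>A a \<inter> A b\<close>; its integral is the bracket of two mark sets, so the isometry for
  the random measure has rate 1 on the larger space.\<close>

lemma
  fixes w :: "'w \<Rightarrow> real" and \<zeta> :: "'w \<Rightarrow> real"
  assumes e: "valid_entry (s, r, a, \<zeta>)" and e': "valid_entry (s', r', b, \<zeta>')"
    and tu: "0 \<le> t" "t \<le> u" "u \<le> T"
    and w: "w \<in> borel_measurable M" "\<And>\<omega>. \<bar>w \<omega>\<bar> \<le> 1"
    and \<nu>: "sigma_finite_measure \<nu>" "A a \<in> sets \<nu>" "emeasure \<nu> (A a) < \<infinity>" "A b \<in> sets \<nu>"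
  shows field_value_product_integrable: "integrable ((M \<Otimes>\<^sub>M time T) \<Otimes>\<^sub>M \<nu>) (\<lambda>x. (w (fst (fst x)) * indicator {t<..u} (snd (fst x))) *
      field_value A (s, r, a, \<zeta>) x * field_value A (s', r', b, \<zeta>') x)"
    and field_value_product_integral: "(\<integral>x. (w (fst (fst x)) * indicator {t<..u} (snd (fst x))) *
      field_value A (s, r, a, \<zeta>) x * field_value A (s', r', b, \<zeta>') x \<partial>((M \<Otimes>\<^sub>M time T) \<Otimes>\<^sub>M \<nu>)) =
      measure \<nu> (A a \<inter> A b) * (\<integral>\<omega>. w \<omega> * \<zeta> \<omega> * \<zeta>' \<omega> \<partial>M) * measure lborel ({s<..r} \<inter> {s'<..r'} \<inter> {t<..u})"
proof -
  interpret L: finite_measure "time T" by (rule finite_measure_time)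
  interpret MT: pair_sigma_finite M "time T"
    by (simp add: pair_sigma_finite_def sigma_finite_measure_axioms L.sigma_finite_measure_axioms)
  have eq: "(w (fst (fst x)) * indicator {t<..u} (snd (fst x))) *
      field_value A (s, r, a, \<zeta>) x * field_value A (s', r', b, \<zeta>') x =
      (case x of (y, z) \<Rightarrow> ((w (fst y) * indicator {t<..u} (snd y)) *
      scalar_value (s, r, a, \<zeta>) y * scalar_value (s', r', b, \<zeta>') y) * indicator (A a \<inter> A b) z)" for x
    by (cases x) (simp add: field_value_def scalar_value_def indicator_inter_arith ac_simps)
  have "emeasure \<nu> (A a \<inter> A b) \<le> emeasure \<nu> (A a)" using \<nu> by (intro emeasure_mono) auto
  then have 2: "integrable \<nu> (indicator (A a \<inter> A b) :: _ \<Rightarrow> real)"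
    using \<nu> by (intro integrable_real_indicator) (auto simp: top.not_eq_extremum)
  note p = integrable_pair_mult[OF MT.sigma_finite_measure_axioms \<nu>(1) scalar_value_product_integrable[OF e e' tu w] 2]
  show "integrable ((M \<Otimes>\<^sub>M time T) \<Otimes>\<^sub>M \<nu>) (\<lambda>x. (w (fst (fst x)) * indicator {t<..u} (snd (fst x))) *
      field_value A (s, r, a, \<zeta>) x * field_value A (s', r', b, \<zeta>') x)"
    unfolding eq by (rule p(1))
  show "(\<integral>x. (w (fst (fst x)) * indicator {t<..u} (snd (fst x))) *
      field_value A (s, r, a, \<zeta>) x * field_value A (s', r', b, \<zeta>') x \<partial>((M \<Otimes>\<^sub>M time T) \<Otimes>\<^sub>M \<nu>)) =
      measure \<nu> (A a \<inter> A b) * (\<integral>\<omega>. w \<omega> * \<zeta> \<omega> * \<zeta>' \<omega> \<partial>M) * measure lborel ({s<..r} \<inter> {s'<..r'} \<inter> {t<..u})"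
    unfolding eq p(2) scalar_value_product_integral[OF e e' tu w] using \<nu> by simp
qed

end

section \<open>Covariance of compensated Poisson measures\<close>

context prob_space
begin

lemma indep_set_integral_mult:
  fixes f g :: "'a \<Rightarrow> real"
  assumes ind: "indep_set (sets G) (sets H)" and sp: "space G = space M" "space H = space M"
    and f: "f \<in> borel_measurable G" "integrable M f" and g: "g \<in> borel_measurable H" "integrable M g"
  shows "integrable M (\<lambda>\<omega>. f \<omega> * g \<omega>)" "(\<integral>\<omega>. f \<omega> * g \<omega> \<partial>M) = (\<integral>\<omega>. f \<omega> \<partial>M) * (\<integral>\<omega>. g \<omega> \<partial>M)"
proof -
  have iv: "indep_var borel f borel g"
    unfolding indep_var_eq
  proof (intro conjI)
    show "indep_set (sigma_sets (space M) {f -` B \<inter> space M |B. B \<in> sets borel})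
       (sigma_sets (space M) {g -` B \<inter> space M |B. B \<in> sets borel})"
    proof (rule indep_set_mono[OF ind])
      show "sigma_sets (space M) {f -` B \<inter> space M |B. B \<in> sets borel} \<subseteq> sets G"
        using measurable_sets[OF f(1)] unfolding sp(1)[symmetric] by (intro sets.sigma_sets_subset) auto
      show "sigma_sets (space M) {g -` B \<inter> space M |B. B \<in> sets borel} \<subseteq> sets H"
        using measurable_sets[OF g(1)] unfolding sp(2)[symmetric] by (intro sets.sigma_sets_subset) auto
    qed
  qed (use f g in auto)
  show "integrable M (\<lambda>\<omega>. f \<omega> * g \<omega>)" by (rule indep_var_integrable[OF iv f(2) g(2)])
  show "(\<integral>\<omega>. f \<omega> * g \<omega> \<partial>M) = (\<integral>\<omega>. f \<omega> \<partial>M) * (\<integral>\<omega>. g \<omega> \<partial>M)"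
    by (rule indep_var_lebesgue_integral[OF iv f(2) g(2)])
qed

text \<open>Intersecting events of \<open>\<G>\<close> with null sets or the whole space gives a
  pi-system; its members have the probability of the original event or probability 0, so
  independence from \<open>\<H>\<close> is unaffected.\<close>

lemma indep_set_sigma_Un_null_sets:
  assumes ind: "indep_set \<G> \<H>" and st: "Int_stable \<G>" "Int_stable \<H>" and top: "space M \<in> \<G>"
  shows "indep_set (sigma_sets (space M) (\<G> \<union> null_sets M)) (sigma_sets (space M) \<H>)"
proof -
  define \<P> where "\<P> = {g \<inter> k |g k. g \<in> \<G> \<and> k \<in> insert (space M) (null_sets M)}"
  note ev = indep_setD_ev1[OF ind] indep_setD_ev2[OF ind]
  have gs: "g \<inter> space M = g" if "g \<in> events" for g using that by (rule sets.Int_space_eq2)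
  have "indep_set \<P> \<H>"
    unfolding indep_sets2_eq
  proof (intro conjI ballI ev)
    show "\<P> \<subseteq> events" using ev by (auto simp: \<P>_def)
    fix x b assume "x \<in> \<P>" and b: "b \<in> \<H>"
    then obtain g k where x: "x = g \<inter> k" and g: "g \<in> \<G>" and k: "k = space M \<or> k \<in> null_sets M"
      by (auto simp: \<P>_def)
    have gev: "g \<in> events" "b \<in> events" using g b ev by auto
    from k show "prob (x \<inter> b) = prob x * prob b"
    proof
      assume "k = space M"
      then show ?thesis using indep_setD[OF ind g b] gs[OF gev(1)] by (simp add: x)
    next
      assume k: "k \<in> null_sets M"
      then have "g \<inter> k \<in> null_sets M" "g \<inter> k \<inter> b \<in> null_sets M"
        using gev null_sets_subset[OF k] by (auto intro: null_sets_subset[OF k])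
      then show ?thesis unfolding x by (simp add: measure_eq_0_null_sets)
    qed
  qed
  moreover have "Int_stable \<P>"
    unfolding Int_stable_def
  proof (intro ballI)
    fix x y assume "x \<in> \<P>" "y \<in> \<P>"
    then obtain g k g' k' where *: "x = g \<inter> k" "y = g' \<inter> k'" "g \<in> \<G>" "g' \<in> \<G>"
      "k \<in> insert (space M) (null_sets M)" "k' \<in> insert (space M) (null_sets M)"
      unfolding \<P>_def by blast
    have "g \<inter> g' \<in> \<G>" using st(1) * unfolding Int_stable_def by blast
    moreover have "k \<inter> k' \<in> insert (space M) (null_sets M)"
    proof -
      have "k \<inter> k' \<in> null_sets M" if "k \<in> null_sets M \<or> k' \<in> null_sets M"
        using that *(5,6) by (auto intro: null_sets_subset)
      then show ?thesis using *(5,6) by blast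
    qed
    moreover have "x \<inter> y = (g \<inter> g') \<inter> (k \<inter> k')" using * by blast
    ultimately show "x \<inter> y \<in> \<P>" unfolding \<P>_def by blast
  qed
  ultimately have "indep_set (sigma_sets (space M) \<P>) (sigma_sets (space M) \<H>)"
    using st by (intro indep_set_sigma_sets)
  moreover have "sigma_sets (space M) (\<G> \<union> null_sets M) \<subseteq> sigma_sets (space M) \<P>"
  proof (rule sigma_sets_mono, rule subsetI)
    fix x assume "x \<in> \<G> \<union> null_sets M"
    then have "x \<in> \<P>"
    proof
      assume x: "x \<in> \<G>"
      then have "x \<inter> space M = x" using ev(1) by (intro gs) auto
      then have "x = x \<inter> space M" ..
      with x show ?thesis unfolding \<P>_def by blast
    next
      assume x: "x \<in> null_sets M"
      then have "x = space M \<inter> x" using sets.sets_into_space[OF null_setsD2[OF x]] by blast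
      with x top show ?thesis unfolding \<P>_def by blast
    qed
    then show "x \<in> sigma_sets (space M) \<P>" by (rule sigma_sets.Basic)
  qed
  ultimately show ?thesis by (rule indep_set_mono) simp
qed

text \<open>Intersections with one event from each source form pi-systems for the joint past and the
  joint future. The probability of an intersection of two such rectangles factorizes over the
  sources by \<open>ind\<close>, then within each source by \<open>pfi\<close>, and regrouping the
  factors gives the claim.\<close>

lemma indep_set_combine:
  fixes G :: "'i \<Rightarrow> 'a set set"
  assumes fin: "finite I" "I \<noteq> {}" and ind: "indep_sets G I"
    and G: "\<And>i. i \<in> I \<Longrightarrow> Int_stable (G i)"
    and pf: "\<And>i. i \<in> I \<Longrightarrow> p i \<subseteq> G i" "\<And>i. i \<in> I \<Longrightarrow> f i \<subseteq> G i"
    and st: "\<And>i. i \<in> I \<Longrightarrow> Int_stable (p i)" "\<And>i. i \<in> I \<Longrightarrow> Int_stable (f i)"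
    and top: "\<And>i. i \<in> I \<Longrightarrow> space M \<in> p i" "\<And>i. i \<in> I \<Longrightarrow> space M \<in> f i"
    and pfi: "\<And>i. i \<in> I \<Longrightarrow> indep_set (p i) (f i)"
  shows "indep_set (sigma_sets (space M) (\<Union>i\<in>I. p i)) (sigma_sets (space M) (\<Union>i\<in>I. f i))"
proof -
  define \<P> where "\<P> p = {(\<Inter>i\<in>I. a i) |a. \<forall>i\<in>I. a i \<in> p i}" for p :: "'i \<Rightarrow> 'a set set"
  have ev: "p i \<subseteq> events" "f i \<subseteq> events" if "i \<in> I" for i
    using pfi[OF that] indep_setD_ev1 indep_setD_ev2 by blast+
  have PQ: "indep_set (\<P> p) (\<P> f)"
    unfolding indep_sets2_eq
  proof (intro conjI ballI)
    show "\<P> p \<subseteq> events" "\<P> f \<subseteq> events"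
      using ev fin unfolding \<P>_def by (auto intro!: sets.finite_INT; blast)+
    fix x y assume "x \<in> \<P> p" "y \<in> \<P> f"
    then obtain a b where a: "x = (\<Inter>i\<in>I. a i)" "\<forall>i\<in>I. a i \<in> p i" and b: "y = (\<Inter>i\<in>I. b i)" "\<forall>i\<in>I. b i \<in> f i"
      unfolding \<P>_def by blast
    have "a i \<inter> b i \<in> G i" if "i \<in> I" for i
      using G[OF that] pf[OF that] a b that unfolding Int_stable_def by blast
    then have "prob (\<Inter>i\<in>I. a i \<inter> b i) = (\<Prod>i\<in>I. prob (a i \<inter> b i))"
      using fin by (intro indep_setsD[OF ind]) auto
    also have "\<dots> = (\<Prod>i\<in>I. prob (a i) * prob (b i))"
      using a b by (intro prod.cong refl indep_setD[OF pfi]) auto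
    also have "\<dots> = (\<Prod>i\<in>I. prob (a i)) * (\<Prod>i\<in>I. prob (b i))" by (rule prod.distrib)
    also have "(\<Prod>i\<in>I. prob (a i)) = prob x"
      unfolding a(1) using fin a pf by (intro indep_setsD[OF ind, symmetric]) blast+
    also have "(\<Prod>i\<in>I. prob (b i)) = prob y"
      unfolding b(1) using fin b pf by (intro indep_setsD[OF ind, symmetric]) blast+
    also have "(\<Inter>i\<in>I. a i \<inter> b i) = x \<inter> y" unfolding a b by blast
    finally show "prob (x \<inter> y) = prob x * prob y" .
  qed
  have stP: "Int_stable (\<P> p)" if "\<And>i. i \<in> I \<Longrightarrow> Int_stable (p i)" for p
    unfolding Int_stable_def
  proof (intro ballI)
    fix x y assume "x \<in> \<P> p" "y \<in> \<P> p"
    then obtain a b where a: "x = (\<Inter>i\<in>I. a i)" "\<forall>i\<in>I. a i \<in> p i" and b: "y = (\<Inter>i\<in>I. b i)" "\<forall>i\<in>I. b i \<in> p i"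
      unfolding \<P>_def by blast
    have "\<forall>i\<in>I. a i \<inter> b i \<in> p i" using that a b unfolding Int_stable_def by blast
    moreover have "x \<inter> y = (\<Inter>i\<in>I. a i \<inter> b i)" unfolding a b by blast
    ultimately show "x \<inter> y \<in> \<P> p" unfolding \<P>_def by blast
  qed
  have "indep_set (sigma_sets (space M) (\<P> p)) (sigma_sets (space M) (\<P> f))"
    by (rule indep_set_sigma_sets[OF PQ stP[OF st(1)] stP[OF st(2)]])
  \<comment> \<open>A set of a single source is a rectangle whose other sides are the whole space;
    this is the purpose of \<open>top\<close>.\<close>
  moreover have "sigma_sets (space M) (\<Union>i\<in>I. q i) \<subseteq> sigma_sets (space M) (\<P> q)"
    if q: "\<And>i. i \<in> I \<Longrightarrow> space M \<in> q i" "\<And>i. i \<in> I \<Longrightarrow> q i \<subseteq> events" for q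
  proof (rule sigma_sets_mono, rule subsetI)
    fix x assume "x \<in> (\<Union>i\<in>I. q i)"
    then obtain j where j: "j \<in> I" "x \<in> q j" by blast
    have "(\<Inter>i\<in>I. if i = j then x else space M) = x"
      using j q(2)[OF j(1)] sets.sets_into_space[of x M] by (auto split: if_splits)
    moreover have "\<forall>i\<in>I. (if i = j then x else space M) \<in> q i" using j q(1) by auto
    ultimately have "x \<in> \<P> q"
      unfolding \<P>_def by (intro CollectI exI[of _ "\<lambda>i. if i = j then x else space M"]) auto
    then show "x \<in> sigma_sets (space M) (\<P> q)" by (rule sigma_sets.Basic)
  qed
  ultimately show ?thesis
    using top ev by (meson indep_set_mono)
qed

section \<open>Covariance of compensated counts\<close>

context
  fixes \<Lambda> :: "'x measure" and R :: "'a \<Rightarrow> 'x measure"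
  assumes prm: "poisson_random_measure M \<Lambda> R"
begin

lemma poisson_sets: "\<omega> \<in> space M \<Longrightarrow> sets (R \<omega>) = sets \<Lambda>"
  using prm unfolding poisson_random_measure_def by blast

lemma poisson_gen_measurable:
  "D \<in> \<D> \<Longrightarrow> (\<lambda>\<omega>. measure (R \<omega>) D) \<in> borel_measurable (sigma (space M) (gen_sets M (\<lambda>A \<omega>. emeasure (R \<omega>) A) \<D>))"
  unfolding measure_def using measurable_gen_sets[of D \<D> "\<lambda>A \<omega>. emeasure (R \<omega>) A" M] by measurable

text \<open>\<open>measure\<close> is additive only on sets of finite mass, and the counts are
  finite merely almost surely.\<close>

lemma AE_poisson_compensated_Un:
  assumes D: "D1 \<in> sets \<Lambda>" "emeasure \<Lambda> D1 < \<infinity>" "D2 \<in> sets \<Lambda>" "emeasure \<Lambda> D2 < \<infinity>" "D1 \<inter> D2 = {}"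
  shows "AE \<omega> in M. measure (R \<omega>) (D1 \<union> D2) - measure \<Lambda> (D1 \<union> D2) =
    (measure (R \<omega>) D1 - measure \<Lambda> D1) + (measure (R \<omega>) D2 - measure \<Lambda> D2)"
  using AE_poisson_finite[OF prm D(1,2)] AE_poisson_finite[OF prm D(3,4)] AE_space
proof eventually_elim
  case (elim \<omega>)
  then have "measure (R \<omega>) (D1 \<union> D2) = measure (R \<omega>) D1 + measure (R \<omega>) D2"
    using D poisson_sets[of \<omega>] by (intro measure_Union) auto
  moreover have "measure \<Lambda> (D1 \<union> D2) = measure \<Lambda> D1 + measure \<Lambda> D2"
    using D by (intro measure_Union) auto
  ultimately show ?case by simp
qed

lemma poisson_compensated_disjoint_covariance:
  assumes D: "D1 \<in> sets \<Lambda>" "emeasure \<Lambda> D1 < \<infinity>" "D2 \<in> sets \<Lambda>" "emeasure \<Lambda> D2 < \<infinity>" "D1 \<inter> D2 = {}"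
  shows "(\<integral>\<omega>. (measure (R \<omega>) D1 - measure \<Lambda> D1) * (measure (R \<omega>) D2 - measure \<Lambda> D2) \<partial>M) = 0"
proof -
  let ?G = "\<lambda>D. sigma (space M) (gen_sets M (\<lambda>A \<omega>. emeasure (R \<omega>) A) {D})"
  have "indep_set (sets (?G D1)) (sets (?G D2))"
    using poisson_indep_set_disjoint[OF prm, of "{D1}" "{D2}"] D by simp
  moreover have "(\<lambda>\<omega>. measure (R \<omega>) D - measure \<Lambda> D) \<in> borel_measurable (?G D)" for D
    by (intro borel_measurable_diff poisson_gen_measurable) auto
  ultimately have "(\<integral>\<omega>. (measure (R \<omega>) D1 - measure \<Lambda> D1) * (measure (R \<omega>) D2 - measure \<Lambda> D2) \<partial>M) =
      (\<integral>\<omega>. measure (R \<omega>) D1 - measure \<Lambda> D1 \<partial>M) * (\<integral>\<omega>. measure (R \<omega>) D2 - measure \<Lambda> D2 \<partial>M)"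
    using poisson_compensated_mean[OF prm D(1,2)] poisson_compensated_mean[OF prm D(3,4)]
    by (intro indep_set_integral_mult(2)[of "?G D1" "?G D2"]) (auto simp: has_bochner_integral_iff)
  then show ?thesis
    using poisson_compensated_mean[OF prm D(1,2)] by (simp add: has_bochner_integral_iff)
qed

lemma poisson_compensated_measurable:
  assumes "D \<in> sets \<Lambda>" "emeasure \<Lambda> D < \<infinity>"
  shows "(\<lambda>\<omega>. measure (R \<omega>) D - measure \<Lambda> D) \<in> borel_measurable M"
  using poisson_measurable'[OF prm assms] by simp

lemma poisson_compensated_product_integrable:
  assumes D: "D1 \<in> sets \<Lambda>" "emeasure \<Lambda> D1 < \<infinity>" "D2 \<in> sets \<Lambda>" "emeasure \<Lambda> D2 < \<infinity>"
  shows "integrable M (\<lambda>\<omega>. (measure (R \<omega>) D1 - measure \<Lambda> D1) * (measure (R \<omega>) D2 - measure \<Lambda> D2))"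
  using poisson_compensated_variance[OF prm D(1,2)] poisson_compensated_variance[OF prm D(3,4)]
  by (intro integrable_mult_square_integrable poisson_compensated_measurable D)
     (simp_all add: has_bochner_integral_iff)

text \<open>Splitting \<open>D1\<close> and \<open>D2\<close> along their intersection leaves four
  products over disjoint or identical pieces; independence and centring remove all but the variance
  of the common piece.\<close>

lemma poisson_compensated_covariance:
  assumes D: "D1 \<in> sets \<Lambda>" "emeasure \<Lambda> D1 < \<infinity>" "D2 \<in> sets \<Lambda>" "emeasure \<Lambda> D2 < \<infinity>"
  shows "(\<integral>\<omega>. (measure (R \<omega>) D1 - measure \<Lambda> D1) * (measure (R \<omega>) D2 - measure \<Lambda> D2) \<partial>M) = measure \<Lambda> (D1 \<inter> D2)"
proof -
  let ?c = "\<lambda>D \<omega>. measure (R \<omega>) D - measure \<Lambda> D"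
  let ?A = "D1 - D2" and ?B = "D1 \<inter> D2" and ?C = "D2 - D1"
  have fin: "E \<in> sets \<Lambda> \<and> emeasure \<Lambda> E < \<infinity>" if "E \<in> {?A, ?B, ?C}" for E
  proof -
    have "emeasure \<Lambda> E \<le> emeasure \<Lambda> D1 \<or> emeasure \<Lambda> E \<le> emeasure \<Lambda> D2"
      using that D emeasure_mono[of E D1 \<Lambda>] emeasure_mono[of E D2 \<Lambda>] by blast
    then show ?thesis using that D by (auto intro: le_less_trans)
  qed
  then have A: "?A \<in> sets \<Lambda>" "emeasure \<Lambda> ?A < \<infinity>" and B: "?B \<in> sets \<Lambda>" "emeasure \<Lambda> ?B < \<infinity>"
    and C: "?C \<in> sets \<Lambda>" "emeasure \<Lambda> ?C < \<infinity>" by blast+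
  have un: "?A \<union> ?B = D1" "?C \<union> ?B = D2" by auto
  have dis: "?A \<inter> ?B = {}" "?C \<inter> ?B = {}" by auto
  have "AE \<omega> in M. ?c D1 \<omega> * ?c D2 \<omega> = (?c ?A \<omega> * ?c ?C \<omega> + ?c ?A \<omega> * ?c ?B \<omega>) + (?c ?B \<omega> * ?c ?C \<omega> + ?c ?B \<omega> * ?c ?B \<omega>)"
    using AE_poisson_compensated_Un[OF A B dis(1)] AE_poisson_compensated_Un[OF C B dis(2)]
    unfolding un
  proof eventually_elim
    case (elim \<omega>)
    show ?case unfolding elim by (simp only: ring_distribs)
  qed
  then have "(\<integral>\<omega>. ?c D1 \<omega> * ?c D2 \<omega> \<partial>M) =
      (\<integral>\<omega>. (?c ?A \<omega> * ?c ?C \<omega> + ?c ?A \<omega> * ?c ?B \<omega>) + (?c ?B \<omega> * ?c ?C \<omega> + ?c ?B \<omega> * ?c ?B \<omega>) \<partial>M)"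
    by (intro integral_cong_AE borel_measurable_times borel_measurable_add poisson_compensated_measurable A B C D)
  also have "\<dots> = ((\<integral>\<omega>. ?c ?A \<omega> * ?c ?C \<omega> \<partial>M) + (\<integral>\<omega>. ?c ?A \<omega> * ?c ?B \<omega> \<partial>M)) +
      ((\<integral>\<omega>. ?c ?B \<omega> * ?c ?C \<omega> \<partial>M) + (\<integral>\<omega>. ?c ?B \<omega> * ?c ?B \<omega> \<partial>M))"
  proof -
    note i = poisson_compensated_product_integrable
    show ?thesis
      unfolding Bochner_Integration.integral_add[OF Bochner_Integration.integrable_add[OF i[OF A C] i[OF A B]]
          Bochner_Integration.integrable_add[OF i[OF B C] i[OF B B]]]
        Bochner_Integration.integral_add[OF i[OF A C] i[OF A B]]
        Bochner_Integration.integral_add[OF i[OF B C] i[OF B B]] ..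
  qed
  also have "(\<integral>\<omega>. ?c ?A \<omega> * ?c ?C \<omega> \<partial>M) = 0"
    by (rule poisson_compensated_disjoint_covariance[OF A C]) auto
  also have "(\<integral>\<omega>. ?c ?A \<omega> * ?c ?B \<omega> \<partial>M) = 0"
    by (rule poisson_compensated_disjoint_covariance[OF A B]) auto
  also have "(\<integral>\<omega>. ?c ?B \<omega> * ?c ?C \<omega> \<partial>M) = 0"
    by (rule poisson_compensated_disjoint_covariance[OF B C]) auto
  also have "(\<integral>\<omega>. ?c ?B \<omega> * ?c ?B \<omega> \<partial>M) = measure \<Lambda> ?B"
    using poisson_compensated_variance[OF prm B] by (simp add: has_bochner_integral_iff power2_eq_square)
  finally show ?thesis by simp
qed

end

end

section \<open>The noise filtration\<close>

lemma measurable_sets_mono: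
  "f \<in> borel_measurable N \<Longrightarrow> sets N \<subseteq> sets N' \<Longrightarrow> space N = space N' \<Longrightarrow> f \<in> borel_measurable N'"
  by (auto simp: measurable_def)

section \<open>Slabs: a time interval times a mark set\<close>

context
  fixes \<kappa> :: "'e measure" and A :: "'e set" and s r :: real
  assumes \<kappa>: "sigma_finite_measure \<kappa>" "A \<in> sets \<kappa>" "emeasure \<kappa> A < \<infinity>" and sr: "s \<le> r"
begin

lemma slab_sets: "{s<..r} \<times> A \<in> sets (lborel \<Otimes>\<^sub>M \<kappa>)"
  using \<kappa> by auto

lemma slab_emeasure: "emeasure (lborel \<Otimes>\<^sub>M \<kappa>) ({s<..r} \<times> A) = ennreal ((r - s) * measure \<kappa> A)"
proof -
  have "emeasure (lborel \<Otimes>\<^sub>M \<kappa>) ({s<..r} \<times> A) = emeasure lborel {s<..r} * emeasure \<kappa> A"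
    using \<kappa> by (intro sigma_finite_measure.emeasure_pair_measure_Times) auto
  also have "\<dots> = ennreal (r - s) * ennreal (measure \<kappa> A)"
    using \<kappa> sr by (simp add: emeasure_eq_ennreal_measure)
  finally show ?thesis using sr by (simp add: ennreal_mult)
qed

lemma slab_finite: "emeasure (lborel \<Otimes>\<^sub>M \<kappa>) ({s<..r} \<times> A) < \<infinity>"
  unfolding slab_emeasure by simp

lemma slab_measure: "measure (lborel \<Otimes>\<^sub>M \<kappa>) ({s<..r} \<times> A) = (r - s) * measure \<kappa> A"
  unfolding measure_def[of "lborel \<Otimes>\<^sub>M \<kappa>"] slab_emeasure using sr by (simp add: measure_nonneg)

end

text \<open>Each generator stays beyond some \<open>u > s\<close>, the counterpart of the
  right-continuous past at \<open>s\<close>; slabs starting right after \<open>s\<close> are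
  recovered by a limit.\<close>

definition future_sets :: "'w measure \<Rightarrow> (real \<times> 'x) measure \<Rightarrow> ('w \<Rightarrow> (real \<times> 'x) measure) \<Rightarrow> real \<Rightarrow> 'w set set"
  where "future_sets M \<Lambda> R s = sigma_sets (space M) (\<Union>u\<in>{s<..}. gen_sets M (\<lambda>A \<omega>. emeasure (R \<omega>) A)
       {A \<in> sets \<Lambda>. A \<subseteq> {u<..} \<times> UNIV})"

lemma gen_sets_Pow: "gen_sets M X I \<subseteq> Pow (space M)"
  using sets.space_closed[of "sigma (space M) (gen_sets M X I)"] by simp

lemma sigma_algebra_future_sets: "sigma_algebra (space M) (future_sets M \<Lambda> R s)"
  unfolding future_sets_def using gen_sets_Pow by (intro sigma_algebra_sigma_sets) blast

lemma sets_sigma_future_sets: "sets (sigma (space M) (future_sets M \<Lambda> R s)) = future_sets M \<Lambda> R s"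
  using sigma_algebra_future_sets by (metis sigma_algebra.sets_measure_of_eq)

lemma future_sets_subset: "future_sets M \<Lambda> R s \<subseteq> gen_sets M (\<lambda>A \<omega>. emeasure (R \<omega>) A) (sets \<Lambda>)"
proof -
  have "gen_sets M (\<lambda>A \<omega>. emeasure (R \<omega>) A) {A \<in> sets \<Lambda>. A \<subseteq> {u<..} \<times> UNIV} \<subseteq>
      gen_sets M (\<lambda>A \<omega>. emeasure (R \<omega>) A) (sets \<Lambda>)" for u
    by (rule gen_sets_mono) blast
  then show ?thesis
    unfolding future_sets_def
    by (intro sigma_algebra.sigma_sets_subset[OF sigma_algebra_gen_sets]) blast
qed

context prob_space
begin

context
  fixes \<kappa> :: "'e measure" and R :: "'a \<Rightarrow> (real \<times> 'e) measure"
  assumes prm: "poisson_random_measure M (lborel \<Otimes>\<^sub>M \<kappa>) R" and \<kappa>: "sigma_finite_measure \<kappa>"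
begin

text \<open>The slab is the increasing union of slabs starting at \<open>s + 1 / (n + 1)\<close>,
  each of which lies beyond a time later than \<open>s\<close>; counts are continuous along
  increasing unions.\<close>

lemma slab_future_measurable:
  assumes A: "A \<in> sets \<kappa>"
  shows "(\<lambda>\<omega>. measure (R \<omega>) ({s<..r} \<times> A)) \<in>
    borel_measurable (sigma (space M) (future_sets M (lborel \<Otimes>\<^sub>M \<kappa>) R s))"
proof -
  let ?N = "sigma (space M) (future_sets M (lborel \<Otimes>\<^sub>M \<kappa>) R s)"
  define D where "D n = {s + 1 / real (Suc n)<..r} \<times> A" for n
  have Ds: "D n \<in> sets (lborel \<Otimes>\<^sub>M \<kappa>)" for n using A by (auto simp: D_def)
  have inc: "incseq D"
  proof (rule incseq_SucI)
    fix n
    have "1 / real (Suc (Suc n)) \<le> 1 / real (Suc n)" by (simp add: frac_le)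
    then show "D n \<subseteq> D (Suc n)" unfolding D_def by (intro Sigma_mono) auto
  qed
  have un: "(\<Union>n. D n) = {s<..r} \<times> A"
  proof (intro equalityI subsetI)
    fix x assume "x \<in> (\<Union>n. D n)"
    then obtain n where n: "s + 1 / real (Suc n) < fst x" "fst x \<le> r" "snd x \<in> A" by (auto simp: D_def)
    have "0 < 1 / real (Suc n)" by simp
    with n have "s < fst x" by linarith
    with n show "x \<in> {s<..r} \<times> A" by (auto simp: mem_Times_iff)
  next
    fix x assume x: "x \<in> {s<..r} \<times> A"
    then have "0 < fst x - s" by auto
    then obtain n where "1 / real (Suc n) < fst x - s" by (rule nat_approx_posE)
    with x show "x \<in> (\<Union>n. D n)" by (auto simp: D_def mem_Times_iff intro!: exI[of _ n])
  qed
  have "(\<lambda>\<omega>. emeasure (R \<omega>) (D n)) \<in> borel_measurable ?N" for n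
  proof (rule measurable_sets_mono[OF measurable_gen_sets])
    show "D n \<in> {A \<in> sets (lborel \<Otimes>\<^sub>M \<kappa>). A \<subseteq> {s + 1 / real (Suc n)<..} \<times> UNIV}"
      using Ds by (auto simp: D_def)
    show "sets (sigma (space M) (gen_sets M (\<lambda>A \<omega>. emeasure (R \<omega>) A)
        {A \<in> sets (lborel \<Otimes>\<^sub>M \<kappa>). A \<subseteq> {s + 1 / real (Suc n)<..} \<times> UNIV})) \<subseteq> sets ?N"
      unfolding sets_sigma_future_sets unfolding sets_sigma_gen_sets future_sets_def
      by (intro subsetI sigma_sets.Basic UN_I[of "s + 1 / real (Suc n)"]) simp_all
  qed (simp add: space_measure_of_conv)
  then have "(\<lambda>\<omega>. SUP n. emeasure (R \<omega>) (D n)) \<in> borel_measurable ?N" by measurable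
  moreover have "emeasure (R \<omega>) ({s<..r} \<times> A) = (SUP n. emeasure (R \<omega>) (D n))" if "\<omega> \<in> space ?N" for \<omega>
    using that Ds poisson_sets[OF prm, of \<omega>] inc
    by (subst SUP_emeasure_incseq) (auto simp: un space_measure_of_conv)
  ultimately have "(\<lambda>\<omega>. emeasure (R \<omega>) ({s<..r} \<times> A)) \<in> borel_measurable ?N"
    using measurable_cong[of ?N "\<lambda>\<omega>. emeasure (R \<omega>) ({s<..r} \<times> A)" "\<lambda>\<omega>. SUP n. emeasure (R \<omega>) (D n)" borel] by blast
  then show ?thesis unfolding measure_def by measurable
qed

lemma AE_slab_increment:
  assumes A: "A \<in> sets \<kappa>" "emeasure \<kappa> A < \<infinity>" and sr: "0 \<le> s" "s \<le> r"
  shows "AE \<omega> in M. measure (R \<omega>) ({0<..r} \<times> A) - measure (R \<omega>) ({0<..s} \<times> A) = measure (R \<omega>) ({s<..r} \<times> A)"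
proof -
  have un: "{0<..s} \<times> A \<union> {s<..r} \<times> A = {0<..r} \<times> A" using sr by auto
  have "measure (lborel \<Otimes>\<^sub>M \<kappa>) ({0<..r} \<times> A) = measure (lborel \<Otimes>\<^sub>M \<kappa>) ({0<..s} \<times> A) + measure (lborel \<Otimes>\<^sub>M \<kappa>) ({s<..r} \<times> A)"
    using slab_measure[OF \<kappa> A, of 0 r] slab_measure[OF \<kappa> A, of 0 s] slab_measure[OF \<kappa> A, of s r] sr
    by (simp add: algebra_simps)
  moreover have "AE \<omega> in M. measure (R \<omega>) ({0<..r} \<times> A) - measure (lborel \<Otimes>\<^sub>M \<kappa>) ({0<..r} \<times> A) =
     (measure (R \<omega>) ({0<..s} \<times> A) - measure (lborel \<Otimes>\<^sub>M \<kappa>) ({0<..s} \<times> A)) +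
     (measure (R \<omega>) ({s<..r} \<times> A) - measure (lborel \<Otimes>\<^sub>M \<kappa>) ({s<..r} \<times> A))"
    unfolding un[symmetric]
    using slab_sets[OF \<kappa> A] slab_finite[OF \<kappa> A] sr
    by (intro AE_poisson_compensated_Un[OF prm]) auto
  ultimately show ?thesis by (auto elim: AE_mp)
qed

end

end

text \<open>One index type for all integrators, so a single bracket also covers the covariances
  between different noises.\<close>

datatype ('d, 'e) noise = BM 'd | JN nat | JM "'e set"

section \<open>Joint past and joint future of the three noises\<close>

context bsde_setting
begin

abbreviation (input) filt :: "real \<Rightarrow> 'w measure"
  where "filt \<equiv> noise_filtration M B N \<mu> \<nu> lam m"

abbreviation (input) \<kappa>N :: "nat measure"
  where "\<kappa>N \<equiv> scale_measure (ennreal lam) (count_space (marks m))"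

lemma sigma_finite_\<kappa>N: "sigma_finite_measure \<kappa>N"
proof -
  have "finite (marks m)" by (simp add: marks_def)
  then have "finite_measure \<kappa>N"
    by (intro finite_measureI) (simp add: space_scale_measure ennreal_mult_eq_top_iff)
  then show ?thesis by (simp add: finite_measure_def)
qed

lemma \<kappa>N_singleton: "l \<in> marks m \<Longrightarrow> {l} \<in> sets \<kappa>N \<and> emeasure \<kappa>N {l} < \<infinity> \<and> measure \<kappa>N {l} = lam"
  using lam_pos by (simp add: measure_def emeasure_count_space)

lemma prm_N: "poisson_random_measure M (lborel \<Otimes>\<^sub>M \<kappa>N) N"
  using poisson_N by (simp add: intensity_N_def)

lemma prm_mu: "poisson_random_measure M (lborel \<Otimes>\<^sub>M \<nu>) \<mu>"
  using poisson_mu by (simp add: intensity_mu_def)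

lemma bm: "brownian_motion M B" "brownian_motion M (\<lambda>s. B (- s))"
  using brownian by (auto simp: two_sided_brownian_motion_def)

lemma B_measurable: "B s \<in> borel_measurable M"
proof (cases "0 \<le> s")
  case True
  then show ?thesis using bm(1) by (auto simp: brownian_motion_def)
next
  case False
  then have "B (- (- s)) \<in> borel_measurable M" 
    using bm(2)[unfolded brownian_motion_def, THEN conjunct1, rule_format, of "- s"] by simp
  then show ?thesis by simp
qed

lemma past_sets_subset_events:
  assumes "poisson_random_measure M \<Lambda> R"
  shows "past_sets M \<Lambda> R s \<subseteq> events"
  unfolding past_sets_def using assms unfolding poisson_random_measure_def
  by (intro gen_sets_subset) auto

lemma sets_filt: "sets (filt t) = sigma_sets (space M)
    (gen_sets M B {..t} \<union>
     (\<Inter>s\<in>{t<..}. past_sets M (intensity_N lam m) N s) \<union>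
     (\<Inter>s\<in>{t<..}. past_sets M (intensity_mu \<nu>) \<mu> s) \<union>
     null_sets M)"
  and space_filt: "space (filt t) = space M"
  and filt_generators: "gen_sets M B {..t} \<union>
     (\<Inter>s\<in>{t<..}. past_sets M (intensity_N lam m) N s) \<union>
     (\<Inter>s\<in>{t<..}. past_sets M (intensity_mu \<nu>) \<mu> s) \<union>
     null_sets M \<subseteq> events"
proof -
  have "(\<Inter>s\<in>{t<..}. past_sets M (intensity_N lam m) N s) \<subseteq> past_sets M (intensity_N lam m) N (t + 1)"
    "(\<Inter>s\<in>{t<..}. past_sets M (intensity_mu \<nu>) \<mu> s) \<subseteq> past_sets M (intensity_mu \<nu>) \<mu> (t + 1)" by auto
  then have "(\<Inter>s\<in>{t<..}. past_sets M (intensity_N lam m) N s) \<subseteq> events"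
    "(\<Inter>s\<in>{t<..}. past_sets M (intensity_mu \<nu>) \<mu> s) \<subseteq> events"
    using past_sets_subset_events[OF poisson_N] past_sets_subset_events[OF poisson_mu]
    by (blast intro: order_trans)+
  then show *: "gen_sets M B {..t} \<union>
     (\<Inter>s\<in>{t<..}. past_sets M (intensity_N lam m) N s) \<union>
     (\<Inter>s\<in>{t<..}. past_sets M (intensity_mu \<nu>) \<mu> s) \<union>
     null_sets M \<subseteq> events"
    using gen_sets_subset[of "{..t}" B M M, OF B_measurable refl]
    by (intro Un_least) (simp_all add: null_sets_def)
  show "space (filt t) = space M" by (simp add: noise_filtration_def space_measure_of_conv)
  show "sets (filt t) = sigma_sets (space M)
    (gen_sets M B {..t} \<union>
     (\<Inter>s\<in>{t<..}. past_sets M (intensity_N lam m) N s) \<union>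
     (\<Inter>s\<in>{t<..}. past_sets M (intensity_mu \<nu>) \<mu> s) \<union>
     null_sets M)"
    unfolding noise_filtration_def
    by (intro sets_measure_of order_trans[OF *] sets.space_closed)
qed

lemma filt_events: "sets (filt t) \<subseteq> events"
  unfolding sets_filt by (intro sets.sigma_sets_subset filt_generators)

lemma filt_mono: "s \<le> t \<Longrightarrow> sets (filt s) \<subseteq> sets (filt t)"
  unfolding sets_filt
  by (intro sigma_sets_mono' Un_mono INT_anti_mono gen_sets_mono order_refl) auto

lemma B_filt_measurable: "s \<le> t \<Longrightarrow> B s \<in> borel_measurable (filt t)"
proof (rule measurable_sets_mono[OF measurable_gen_sets[of s "{..t}" B M]])
  show "sets (sigma (space M) (gen_sets M B {..t})) \<subseteq> sets (filt t)"
    unfolding sets_filt sets_sigma_gen_sets by (intro subsetI sigma_sets.Basic) simp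
qed (simp_all add: space_filt)

text \<open>A set up to time \<open>t\<close> is also a set up to every later \<open>u\<close>, so
  its count belongs to all the pasts that are intersected.\<close>

lemma past_measurable:
  assumes D: "D \<in> sets \<Lambda>" "D \<subseteq> {..t} \<times> UNIV" and sub: "(\<Inter>s\<in>{t<..}. past_sets M \<Lambda> R s) \<subseteq> sets (filt t)"
  shows "(\<lambda>\<omega>. measure (R \<omega>) D) \<in> borel_measurable (filt t)"
proof -
  have "(\<lambda>\<omega>. emeasure (R \<omega>) D) \<in> borel_measurable (filt t)"
  proof (rule measurableI)
    fix S :: "ennreal set" assume S: "S \<in> sets borel"
    have "(\<lambda>\<omega>. emeasure (R \<omega>) D) -` S \<inter> space M \<in> past_sets M \<Lambda> R u" if "t < u" for u
    proof -
      have "D \<subseteq> {..u} \<times> UNIV" using D(2) that by fastforce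
      with D(1) S show ?thesis unfolding past_sets_def gen_sets_def
        by (intro sigma_sets.Basic UN_I[of D]) auto
    qed
    with sub show "(\<lambda>\<omega>. emeasure (R \<omega>) D) -` S \<inter> space (filt t) \<in> sets (filt t)"
      unfolding space_filt by auto
  qed simp
  then show ?thesis unfolding measure_def by measurable
qed

lemma N_filt_measurable:
  "l \<in> marks m \<Longrightarrow> r \<le> t \<Longrightarrow> (\<lambda>\<omega>. measure (N \<omega>) ({s<..r} \<times> {l})) \<in> borel_measurable (filt t)"
proof (rule past_measurable)
  show "(\<Inter>s\<in>{t<..}. past_sets M (intensity_N lam m) N s) \<subseteq> sets (filt t)"
    unfolding sets_filt by (intro subsetI sigma_sets.Basic) simp
  show "l \<in> marks m \<Longrightarrow> {s<..r} \<times> {l} \<in> sets (intensity_N lam m)"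
    unfolding intensity_N_def by (intro pair_measureI) auto
qed auto

lemma mu_filt_measurable:
  "A \<in> sets \<nu> \<Longrightarrow> r \<le> t \<Longrightarrow> (\<lambda>\<omega>. measure (\<mu> \<omega>) ({s<..r} \<times> A)) \<in> borel_measurable (filt t)"
proof (rule past_measurable)
  show "(\<Inter>s\<in>{t<..}. past_sets M (intensity_mu \<nu>) \<mu> s) \<subseteq> sets (filt t)"
    unfolding sets_filt by (intro subsetI sigma_sets.Basic) simp
  show "A \<in> sets \<nu> \<Longrightarrow> {s<..r} \<times> A \<in> sets (intensity_mu \<nu>)"
    unfolding intensity_mu_def by (intro pair_measureI) auto
qed auto

text \<open>The order of the list is that of the sources in \<open>noises_independent\<close>. For
  \<open>B\<close> the single increment over \<open>(s, r]\<close> is all that enters the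
  moments.\<close>

definition future :: "real \<Rightarrow> real \<Rightarrow> nat \<Rightarrow> 'w set set"
  where "future s r j = [gen_sets M (\<lambda>_ \<omega>. B r \<omega> - B s \<omega>) (UNIV :: unit set),
    future_sets M (intensity_N lam m) N s, future_sets M (intensity_mu \<nu>) \<mu> s] ! j"

lemma lessThan_3: "{..<3::nat} = {0, 1, 2}" by auto

lemma sigma_algebra_future: "j < 3 \<Longrightarrow> sigma_algebra (space M) (future s r j)"
  by (auto simp: future_def less_Suc_eq numeral_3_eq_3 sigma_algebra_gen_sets sigma_algebra_future_sets)

lemma gen_B_increment: "gen_sets M (\<lambda>_ \<omega>. B r \<omega> - B s \<omega>) (UNIV :: unit set) \<subseteq> gen_sets M B UNIV"
proof -
  have "(\<lambda>\<omega>. B r \<omega> - B s \<omega>) \<in> borel_measurable (sigma (space M) (gen_sets M B UNIV))"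
    by (intro borel_measurable_diff measurable_gen_sets) simp_all
  then show ?thesis
    using gen_sets_subset[of UNIV "\<lambda>_ \<omega>. B r \<omega> - B s \<omega>" "sigma (space M) (gen_sets M B UNIV)" M] by simp
qed

lemma future_subset: "j < 3 \<Longrightarrow> future s r j \<subseteq> [gen_sets M B UNIV,
               gen_sets M (\<lambda>A \<omega>. emeasure (N \<omega>) A) (sets (intensity_N lam m)),
               gen_sets M (\<lambda>A \<omega>. emeasure (\<mu> \<omega>) A) (sets (intensity_mu \<nu>))] ! j"
  using gen_B_increment[of r s] future_sets_subset[of M "intensity_N lam m" N s] future_sets_subset[of M "intensity_mu \<nu>" \<mu> s]
  by (auto simp: future_def less_Suc_eq numeral_3_eq_3)

text \<open>Past and future are independent within each source, and the sources are mutually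
  independent, so \<open>indep_set_combine\<close> joins them; null sets are added afterwards to
  reach the augmented filtration. All conditional moments of the noise given \<open>filt s\<close>
  come from this.\<close>

lemma indep_set_filt_future:
  assumes s: "0 \<le> s" "s < r"
  shows "indep_set (sets (filt s)) (sigma_sets (space M) (\<Union>j\<in>{..<3}. future s r j))"
proof -
  define p where "p j = [gen_sets M B {..s}, \<Inter>u\<in>{s<..}. past_sets M (intensity_N lam m) N u,
    \<Inter>u\<in>{s<..}. past_sets M (intensity_mu \<nu>) \<mu> u] ! j" for j
  let ?G = "\<lambda>j. [gen_sets M B UNIV,
               gen_sets M (\<lambda>A \<omega>. emeasure (N \<omega>) A) (sets (intensity_N lam m)),
               gen_sets M (\<lambda>A \<omega>. emeasure (\<mu> \<omega>) A) (sets (intensity_mu \<nu>))] ! j"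
  have st_gen: "Int_stable (gen_sets M X I)" for X :: "'z \<Rightarrow> 'w \<Rightarrow> 'x::topological_space" and I
    by (rule Int_stable_sigma_algebra[OF sigma_algebra_gen_sets])
  have top_gen: "space M \<in> gen_sets M X I" for X :: "'z \<Rightarrow> 'w \<Rightarrow> 'x::topological_space" and I
    using sets.top[of "sigma (space M) (gen_sets M X I)"] by simp
  have st_past: "Int_stable (\<Inter>u\<in>{s<..}. past_sets M \<Lambda> R u)" for \<Lambda> :: "(real \<times> 'x) measure" and R
    using st_gen unfolding Int_stable_def past_sets_def by blast
  have top_past: "space M \<in> (\<Inter>u\<in>{s<..}. past_sets M \<Lambda> R u)" for \<Lambda> :: "(real \<times> 'x) measure" and R
    using top_gen unfolding past_sets_def by blast
  have past_gen: "(\<Inter>u\<in>{s<..}. past_sets M \<Lambda> R u) \<subseteq> gen_sets M (\<lambda>A \<omega>. emeasure (R \<omega>) A) (sets \<Lambda>)"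
    for \<Lambda> :: "(real \<times> 'x) measure" and R
  proof -
    have "(\<Inter>u\<in>{s<..}. past_sets M \<Lambda> R u) \<subseteq> past_sets M \<Lambda> R (s + 1)" by auto
    also have "\<dots> \<subseteq> gen_sets M (\<lambda>A \<omega>. emeasure (R \<omega>) A) (sets \<Lambda>)"
      unfolding past_sets_def by (rule gen_sets_mono) blast
    finally show ?thesis .
  qed
  have fut: "Int_stable (future s r j)" "space M \<in> future s r j" if "j < 3" for j
    using Int_stable_sigma_algebra[OF sigma_algebra_future[OF that]] algebra.top[OF sigma_algebra.axioms(1)[OF sigma_algebra_future[OF that]]] by blast+
  have j3: "j = 0 \<or> j = 1 \<or> j = 2" if "j < 3" for j :: nat using that by auto
  have 1: "indep_set (sigma_sets (space M) (\<Union>j\<in>{..<3::nat}. p j)) (sigma_sets (space M) (\<Union>j\<in>{..<3}. future s r j))"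
  proof (rule indep_set_combine[OF _ _ noises_independent])
    fix j :: nat assume "j \<in> {..<3}"
    then have j: "j < 3" by simp
    show "Int_stable (?G j)" using j3[OF j] by (elim disjE) (simp_all add: st_gen)
    show "p j \<subseteq> ?G j" using j3[OF j] gen_sets_mono[of "{..s}" UNIV M B]
      unfolding p_def by (elim disjE) (simp_all add: past_gen)
    show "future s r j \<subseteq> ?G j" by (rule future_subset[OF j])
    show "Int_stable (p j)" using j3[OF j] unfolding p_def by (elim disjE) (simp_all add: st_gen st_past)
    show "space M \<in> p j" using j3[OF j] unfolding p_def by (elim disjE) (simp_all only: top_gen top_past nth_Cons_0 nth_Cons_Suc One_nat_def numeral_2_eq_2)
    show "Int_stable (future s r j)" "space M \<in> future s r j" by (rule fut[OF j])+
    show "indep_set (p j) (future s r j)"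
      using j3[OF j] brownian_indep_increment[OF brownian s] poisson_indep_past_future[OF poisson_N, of s]
        poisson_indep_past_future[OF poisson_mu, of s]
      unfolding p_def future_def future_sets_def by (elim disjE) simp_all
  qed (simp_all add: lessThan_3)
  have PowF: "(\<Union>j\<in>{..<3}. future s r j) \<subseteq> Pow (space M)"
    using sigma_algebra_future unfolding sigma_algebra_iff2 by fastforce
  have Powp: "(\<Union>j\<in>{..<3}. p j) \<subseteq> Pow (space M)"
    using sets.space_closed[of M] filt_generators[of s] by (auto simp: lessThan_3 p_def)
  have sa: "sigma_algebra (space M) (sigma_sets (space M) (\<Union>j\<in>{..<3}. p j))"
      "sigma_algebra (space M) (sigma_sets (space M) (\<Union>j\<in>{..<3}. future s r j))"
    by (rule sigma_algebra_sigma_sets, fact Powp, rule sigma_algebra_sigma_sets, fact PowF)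
  have "indep_set (sigma_sets (space M) (sigma_sets (space M) (\<Union>j\<in>{..<3}. p j) \<union> null_sets M))
    (sigma_sets (space M) (sigma_sets (space M) (\<Union>j\<in>{..<3}. future s r j)))"
    using sa by (intro indep_set_sigma_Un_null_sets[OF 1] Int_stable_sigma_algebra[OF sa(1)] Int_stable_sigma_algebra[OF sa(2)] sigma_sets_top)
  then show ?thesis
  proof (rule indep_set_mono)
    show "sets (filt s) \<subseteq> sigma_sets (space M) (sigma_sets (space M) (\<Union>j\<in>{..<3}. p j) \<union> null_sets M)"
      unfolding sets_filt
    proof (rule sigma_sets_mono, rule subsetI)
      fix x assume "x \<in> gen_sets M B {..s} \<union>
        (\<Inter>u\<in>{s<..}. past_sets M (intensity_N lam m) N u) \<union>
        (\<Inter>u\<in>{s<..}. past_sets M (intensity_mu \<nu>) \<mu> u) \<union> null_sets M"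
      then have "x \<in> p 0 \<union> p 1 \<union> p 2 \<union> null_sets M" unfolding p_def by simp
      then have "x \<in> (\<Union>j\<in>{..<3}. p j) \<union> null_sets M" unfolding lessThan_3 by blast
      then show "x \<in> sigma_sets (space M) (sigma_sets (space M) (\<Union>j\<in>{..<3}. p j) \<union> null_sets M)"
        by (intro sigma_sets.Basic) (blast intro: sigma_sets.Basic)
    qed
  qed (blast intro: sigma_sets.Basic)
qed

end

section \<open>Martingale increments of the noises\<close>

lemma (in prob_space) indep_sets_imp_indep_set:
  assumes ind: "indep_sets G I" and jk: "j \<in> I" "k \<in> I" "j \<noteq> k"
  shows "indep_set (G j) (G k)"
proof (rule indep_setI)
  show "G j \<subseteq> events" "G k \<subseteq> events" using ind jk unfolding indep_sets_def by auto
  fix a b assume "a \<in> G j" "b \<in> G k"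
  then have "prob (\<Inter>i\<in>{j, k}. if i = j then a else b) = (\<Prod>i\<in>{j, k}. prob (if i = j then a else b))"
    using jk by (intro indep_setsD[OF ind]) auto
  then show "prob (a \<inter> b) = prob a * prob b" using jk by (simp add: Int_commute)
qed

context bsde_setting
begin

definition noise_process :: "('d, (real ^ 'q)) noise \<Rightarrow> real \<Rightarrow> 'w \<Rightarrow> real"
  where "noise_process a s \<omega> = (case a of BM i \<Rightarrow> B s \<omega> $ i
    | JN l \<Rightarrow> compensated_N N lam l s \<omega> | JM A \<Rightarrow> compensated_mu \<mu> \<nu> 0 s A \<omega>)"

text \<open>Mark sets have finite mass here, which makes their compensated counts square
  integrable.\<close>

definition noise_atoms :: "('d, (real ^ 'q)) noise set"
  where "noise_atoms = range BM \<union> JN ` marks m \<union> JM ` {A \<in> sets \<nu>. emeasure \<nu> A < \<infinity>}"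

text \<open>The time density of the predictable covariation: the identity matrix for Brownian
  coordinates, \<open>lam\<close> on the diagonal for marks, the mass of the intersection for mark
  sets, and 0 across sources.\<close>

definition noise_bracket :: "('d, (real ^ 'q)) noise \<Rightarrow> ('d, (real ^ 'q)) noise \<Rightarrow> real"
  where "noise_bracket a b = (case (a, b) of (BM i, BM j) \<Rightarrow> (if i = j then 1 else 0)
    | (JN l, JN k) \<Rightarrow> (if l = k then lam else 0) | (JM A, JM A') \<Rightarrow> measure \<nu> (A \<inter> A') | _ \<Rightarrow> 0)"

text \<open>Almost surely the increment of \<^term>\<open>noise_process a\<close> over \<open>(s, r]\<close>, but visibly a function
  of the noises after time \<open>s\<close>.\<close>

definition fresh_increment :: "('d, (real ^ 'q)) noise \<Rightarrow> real \<Rightarrow> real \<Rightarrow> 'w \<Rightarrow> real"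
  where "fresh_increment a s r \<omega> = (case a of BM i \<Rightarrow> (B r \<omega> - B s \<omega>) $ i
    | JN l \<Rightarrow> measure (N \<omega>) ({s<..r} \<times> {l}) - measure (lborel \<Otimes>\<^sub>M \<kappa>N) ({s<..r} \<times> {l})
    | JM A \<Rightarrow> measure (\<mu> \<omega>) ({s<..r} \<times> A) - measure (lborel \<Otimes>\<^sub>M \<nu>) ({s<..r} \<times> A))"

text \<open>Position of the source in the list \<open>future\<close>.\<close>

definition noise_kind :: "('d, (real ^ 'q)) noise \<Rightarrow> nat"
  where "noise_kind a = (case a of BM i \<Rightarrow> 0 | JN l \<Rightarrow> 1 | JM A \<Rightarrow> 2)"

lemma noise_kind_less: "noise_kind a < 3"
  by (simp add: noise_kind_def split: noise.split)

lemma noise_atomsE: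
  assumes "a \<in> noise_atoms"
  obtains (BM) i where "a = BM i" | (JN) l where "a = JN l" "l \<in> marks m"
    | (JM) A where "a = JM A" "A \<in> sets \<nu>" "emeasure \<nu> A < \<infinity>"
  using assms unfolding noise_atoms_def by blast

lemma sets_sigma_future: "j < 3 \<Longrightarrow> sets (sigma (space M) (future s r j)) = future s r j"
  using sigma_algebra_future by (metis sigma_algebra.sets_measure_of_eq)

lemma fresh_increment_kind_measurable:
  assumes "a \<in> noise_atoms"
  shows "fresh_increment a s r \<in> borel_measurable (sigma (space M) (future s r (noise_kind a)))"
  using assms
proof (cases rule: noise_atomsE)
  case (BM i)
  have "(\<lambda>\<omega>. B r \<omega> - B s \<omega>) \<in> borel_measurable (sigma (space M) (gen_sets M (\<lambda>_ \<omega>. B r \<omega> - B s \<omega>) (UNIV :: unit set)))"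
    by (rule measurable_gen_sets) simp
  from measurable_compose[OF this, of "\<lambda>x. x $ i" borel] show ?thesis
    unfolding fresh_increment_def noise_kind_def future_def BM by simp
next
  case (JN l)
  then show ?thesis
    using slab_future_measurable[OF prm_N sigma_finite_\<kappa>N, of "{l}" s r] \<kappa>N_singleton[of l]
    unfolding fresh_increment_def noise_kind_def future_def intensity_N_def by simp
next
  case (JM A)
  then show ?thesis
    using slab_future_measurable[OF prm_mu nu_sigma_finite, of A s r]
    unfolding fresh_increment_def noise_kind_def future_def intensity_mu_def by simp
qed

lemma sets_sigma_Union_future:
  "sets (sigma (space M) (\<Union>j\<in>{..<3}. future s r j)) = sigma_sets (space M) (\<Union>j\<in>{..<3}. future s r j)"
  using sigma_algebra_future unfolding sigma_algebra_iff2 by (intro sets_measure_of) fastforce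

lemma fresh_increment_measurable:
  assumes "a \<in> noise_atoms"
  shows "fresh_increment a s r \<in> borel_measurable (sigma (space M) (\<Union>j\<in>{..<3}. future s r j))"
proof (rule measurable_sets_mono[OF fresh_increment_kind_measurable[OF assms]])
  show "sets (sigma (space M) (future s r (noise_kind a))) \<subseteq> sets (sigma (space M) (\<Union>j\<in>{..<3}. future s r j))"
    unfolding sets_sigma_future[OF noise_kind_less] sets_sigma_Union_future
    using noise_kind_less[of a] by (intro subsetI sigma_sets.Basic UN_I[of "noise_kind a"]) auto
qed (simp add: space_measure_of_conv)

context
  fixes s r :: real
  assumes s: "0 \<le> s" "s < r"
begin

lemma bm_increment: "distributed M lborel (\<lambda>\<omega>. B r \<omega> - B s \<omega>)
    (\<lambda>x. ennreal (\<Prod>i\<in>UNIV. normal_density 0 (sqrt (r - s)) (x $ i)))"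
  using bm(1) s unfolding brownian_motion_def by blast

lemma sqrt_pos: "0 < sqrt (r - s)" using s by simp

lemmas slabN = slab_sets[OF sigma_finite_\<kappa>N _ _ less_imp_le[OF s(2)]] slab_finite[OF sigma_finite_\<kappa>N _ _ less_imp_le[OF s(2)]]
lemmas slabM = slab_sets[OF nu_sigma_finite _ _ less_imp_le[OF s(2)]] slab_finite[OF nu_sigma_finite _ _ less_imp_le[OF s(2)]]

text \<open>The strict inequality \<open>s < r\<close> of the context provides a nondegenerate
  Gaussian law for the Brownian increment; the other two cases are the moments of a compensated
  count on a slab.\<close>

lemma fresh_increment_moments:
  assumes "a \<in> noise_atoms"
  shows "fresh_increment a s r \<in> borel_measurable M" "integrable M (\<lambda>\<omega>. (fresh_increment a s r \<omega>)\<^sup>2)"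
    "(\<integral>\<omega>. fresh_increment a s r \<omega> \<partial>M) = 0"
proof -
  have "fresh_increment a s r \<in> borel_measurable M \<and> integrable M (\<lambda>\<omega>. (fresh_increment a s r \<omega>)\<^sup>2) \<and>
    (\<integral>\<omega>. fresh_increment a s r \<omega> \<partial>M) = 0"
    using assms
  proof (cases rule: noise_atomsE)
    case (BM i)
    then show ?thesis
      using gaussian_second_moment[OF sqrt_pos bm_increment, of i] gaussian_mean[OF sqrt_pos bm_increment, of i]
        measurable_compose[OF gaussian_measurable[OF sqrt_pos bm_increment], of "\<lambda>x. x $ i" borel]
      by (simp add: fresh_increment_def[abs_def] has_bochner_integral_iff)
  next
    case (JN l)
    note D = slabN[OF \<kappa>N_singleton[OF JN(2), THEN conjunct1] \<kappa>N_singleton[OF JN(2), THEN conjunct2, THEN conjunct1]]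
    show ?thesis
      using poisson_compensated_mean[OF prm_N D] poisson_compensated_variance[OF prm_N D]
         poisson_compensated_measurable[OF prm_N D]
      unfolding has_bochner_integral_iff by (simp only: JN(1) fresh_increment_def[abs_def] noise.case)
  next
    case (JM A)
    note D = slabM[OF JM(2,3)]
    show ?thesis
      using poisson_compensated_mean[OF prm_mu D] poisson_compensated_variance[OF prm_mu D]
         poisson_compensated_measurable[OF prm_mu D]
      unfolding has_bochner_integral_iff by (simp only: JM(1) fresh_increment_def[abs_def] noise.case)
  qed
  then show "fresh_increment a s r \<in> borel_measurable M" "integrable M (\<lambda>\<omega>. (fresh_increment a s r \<omega>)\<^sup>2)"
    "(\<integral>\<omega>. fresh_increment a s r \<omega> \<partial>M) = 0" by blast+
qed

lemma fresh_increment_integrable: "a \<in> noise_atoms \<Longrightarrow> integrable M (fresh_increment a s r)"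
  using fresh_increment_moments square_integrable_imp_integrable by blast

text \<open>Across sources the covariance factorizes into two means, both zero. Within a source it
  is the Gaussian covariance or the intensity of the intersection of two slabs, which over a common
  interval is its length times the mark mass of the intersection.\<close>

lemma fresh_increment_covariance:
  assumes a: "a \<in> noise_atoms" and b: "b \<in> noise_atoms"
  shows "(\<integral>\<omega>. fresh_increment a s r \<omega> * fresh_increment b s r \<omega> \<partial>M) = (r - s) * noise_bracket a b"
proof (cases "noise_kind a = noise_kind b")
  case False
  have "indep_set (sets (sigma (space M) (future s r (noise_kind a)))) (sets (sigma (space M) (future s r (noise_kind b))))"
    unfolding sets_sigma_future[OF noise_kind_less]
    by (rule indep_set_mono[OF indep_sets_imp_indep_set[OF noises_independent _ _ False]
          future_subset[OF noise_kind_less] future_subset[OF noise_kind_less]])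
       (simp_all add: noise_kind_less)
  then have "(\<integral>\<omega>. fresh_increment a s r \<omega> * fresh_increment b s r \<omega> \<partial>M) = 0"
    using fresh_increment_kind_measurable[OF a] fresh_increment_kind_measurable[OF b]
      fresh_increment_integrable[OF a] fresh_increment_integrable[OF b]
    by (subst indep_set_integral_mult(2)[of "sigma (space M) (future s r (noise_kind a))" "sigma (space M) (future s r (noise_kind b))"])
       (simp_all add: space_measure_of_conv fresh_increment_moments(3)[OF a])
  moreover have "noise_bracket a b = 0"
    using False by (auto simp: noise_kind_def noise_bracket_def split: noise.splits)
  ultimately show ?thesis by simp
next
  case True
  show ?thesis
    using a
  proof (cases rule: noise_atomsE)
    case (BM i)
    with True b obtain j where "b = BM j" by (auto simp: noise_kind_def elim!: noise_atomsE)
    with BM s show ?thesis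
      using gaussian_covariance[OF sqrt_pos bm_increment, of i j]
      by (simp add: fresh_increment_def noise_bracket_def)
  next
    case (JN l)
    with True b obtain k where k: "b = JN k" "k \<in> marks m" by (auto simp: noise_kind_def elim!: noise_atomsE)
    have *: "({s<..r} \<times> {l}) \<inter> ({s<..r} \<times> {k}) = {s<..r} \<times> ({l} \<inter> {k})" by auto
    have mlk: "measure (lborel \<Otimes>\<^sub>M \<kappa>N) ({s<..r} \<times> ({l} \<inter> {k})) = (r - s) * (if l = k then lam else 0)"
      using slab_measure[OF sigma_finite_\<kappa>N _ _ less_imp_le[OF s(2)], of "{l}"] \<kappa>N_singleton[OF JN(2)] by auto
    note D = slabN[OF \<kappa>N_singleton[OF JN(2), THEN conjunct1] \<kappa>N_singleton[OF JN(2), THEN conjunct2, THEN conjunct1]]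
      slabN[OF \<kappa>N_singleton[OF k(2), THEN conjunct1] \<kappa>N_singleton[OF k(2), THEN conjunct2, THEN conjunct1]]
    show ?thesis
      using poisson_compensated_covariance[OF prm_N D] mlk
      unfolding * by (simp only: JN(1) k(1) fresh_increment_def noise_bracket_def noise.case prod.case)
  next
    case (JM A)
    with True b obtain A' where k: "b = JM A'" "A' \<in> sets \<nu>" "emeasure \<nu> A' < \<infinity>"
      by (auto simp: noise_kind_def elim!: noise_atomsE)
    have *: "({s<..r} \<times> A) \<inter> ({s<..r} \<times> A') = {s<..r} \<times> (A \<inter> A')" by auto
    have "emeasure \<nu> (A \<inter> A') \<le> emeasure \<nu> A" using JM by (intro emeasure_mono) auto
    then have "measure (lborel \<Otimes>\<^sub>M \<nu>) ({s<..r} \<times> (A \<inter> A')) = (r - s) * measure \<nu> (A \<inter> A')"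
      using JM k by (intro slab_measure[OF nu_sigma_finite _ _ less_imp_le[OF s(2)]]) auto
    then show ?thesis
      using poisson_compensated_covariance[OF prm_mu slabM[OF JM(2,3)] slabM[OF k(2,3)]]
      unfolding * by (simp only: JM(1) k(1) fresh_increment_def noise_bracket_def noise.case prod.case)
  qed
qed

end

text \<open>The Poisson processes count over \<open>(0, r]\<close> and \<open>(0, s]\<close>;
  subtracting counts is legitimate only where they are finite, hence almost surely.\<close>

lemma AE_noise_increment:
  assumes "a \<in> noise_atoms" and s: "0 \<le> s" "s \<le> r"
  shows "AE \<omega> in M. noise_process a r \<omega> - noise_process a s \<omega> = fresh_increment a s r \<omega>"
  using assms(1)
proof (cases rule: noise_atomsE)
  case (BM i)
  then show ?thesis by (simp add: noise_process_def fresh_increment_def)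
next
  case (JN l)
  show ?thesis
    using AE_slab_increment[OF prm_N sigma_finite_\<kappa>N _ _ s, of "{l}"] slab_measure[OF sigma_finite_\<kappa>N _ _ s(2), of "{l}"]
      \<kappa>N_singleton[OF JN(2)]
    unfolding JN(1) noise_process_def fresh_increment_def compensated_N_def
    by (auto simp: algebra_simps elim!: AE_mp)
next
  case (JM A)
  show ?thesis
    using AE_slab_increment[OF prm_mu nu_sigma_finite JM(2,3) s] slab_measure[OF nu_sigma_finite JM(2,3) s(2)]
    unfolding JM(1) noise_process_def fresh_increment_def compensated_mu_def
    by (auto simp: algebra_simps elim!: AE_mp)
qed

lemma noise_increment_filt_measurable:
  assumes "a \<in> noise_atoms" and s: "0 \<le> s" "s \<le> r"
  shows "(\<lambda>\<omega>. noise_process a r \<omega> - noise_process a s \<omega>) \<in> borel_measurable (filt r)"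
  using assms(1)
proof (cases rule: noise_atomsE)
  case (BM i)
  have "(\<lambda>\<omega>. B u \<omega> $ i) \<in> borel_measurable (filt r)" if "u \<le> r" for u
    using measurable_compose[OF B_filt_measurable[OF that], of "\<lambda>x. x $ i" borel] by simp
  with BM s show ?thesis by (simp add: noise_process_def)
next
  case (JN l)
  with N_filt_measurable[of l r r 0] N_filt_measurable[of l s r 0] s show ?thesis
    by (simp add: noise_process_def compensated_N_def)
next
  case (JM A)
  with mu_filt_measurable[of A r r 0] mu_filt_measurable[of A s r 0] s show ?thesis
    by (simp add: noise_process_def compensated_mu_def)
qed

lemma subalgebra_filt: "subalgebra M (filt t)"
  using filt_events by (simp add: subalgebra_def space_filt)

text \<open>Increments are replaced by \<open>fresh_increment\<close>, a function of the noises
  after \<open>s\<close>, and independence from \<open>filt s\<close> turns integrals over events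
  into probability times moment. The interval with \<open>s = r\<close> is separate because the
  moment formulas assume \<open>s < r\<close>.\<close>

lemma noise_martingale: "noise_martingale M filt noise_process noise_atoms noise_bracket"
proof unfold_locales
  fix s t :: real assume "s \<le> t"
  then show "sets (filt s) \<subseteq> sets (filt t)" by (rule filt_mono)
next
  fix a s and r :: real assume a: "a \<in> noise_atoms" and s: "0 \<le> s" "s \<le> r"
  let ?X = "\<lambda>\<omega>. noise_process a r \<omega> - noise_process a s \<omega>"
  show "?X \<in> borel_measurable (filt r)" by (rule noise_increment_filt_measurable[OF a s])
  then have XM: "?X \<in> borel_measurable M" by (rule measurable_from_subalg[OF subalgebra_filt])
  show "integrable M (\<lambda>\<omega>. (?X \<omega>)\<^sup>2)"
  proof (cases "s = r")
    case False
    with s have "s < r" by simp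
    have "AE \<omega> in M. (fresh_increment a s r \<omega>)\<^sup>2 = (?X \<omega>)\<^sup>2"
      using AE_noise_increment[OF a s] by eventually_elim simp
    then show ?thesis
      using fresh_increment_moments(2)[OF s(1) \<open>s < r\<close> a] XM fresh_increment_moments(1)[OF s(1) \<open>s < r\<close> a]
      by (subst integrable_cong_AE[symmetric]) auto
  qed simp
  fix A assume A: "A \<in> sets (filt s)"
  then have AM: "A \<in> events" using filt_events by blast
  show "(\<integral>\<omega>. indicator A \<omega> * ?X \<omega> \<partial>M) = 0"
  proof (cases "s = r")
    case False
    with s have sr: "s < r" by simp
    have "(\<integral>\<omega>. indicator A \<omega> * ?X \<omega> \<partial>M) = (\<integral>\<omega>. indicator A \<omega> * fresh_increment a s r \<omega> \<partial>M)"
      using AE_noise_increment[OF a s] XM AM fresh_increment_moments(1)[OF s(1) sr a]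
      by (intro integral_cong_AE) auto
    also have "\<dots> = prob A * (\<integral>\<omega>. fresh_increment a s r \<omega> \<partial>M)"
      using fresh_increment_measurable[OF a] fresh_increment_integrable[OF s(1) sr a] indep_set_filt_future[OF s(1) sr] A
      by (intro indep_set_integral[of "filt s" "sigma (space M) (\<Union>j\<in>{..<3}. future s r j)"]) (simp_all add: space_filt space_measure_of_conv sets_sigma_Union_future)
    finally show ?thesis using fresh_increment_moments(3)[OF s(1) sr a] by simp
  qed simp
next
  fix a b and s r :: real and A assume a: "a \<in> noise_atoms" and b: "b \<in> noise_atoms" and s: "0 \<le> s" "s \<le> r"
    and A: "A \<in> sets (filt s)"
  then have AM: "A \<in> events" using filt_events by blast
  let ?X = "\<lambda>a \<omega>. noise_process a r \<omega> - noise_process a s \<omega>"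
  have XM: "?X a \<in> borel_measurable M" "?X b \<in> borel_measurable M"
    using noise_increment_filt_measurable[OF a s] noise_increment_filt_measurable[OF b s]
    by (auto intro: measurable_from_subalg[OF subalgebra_filt])
  show "(\<integral>\<omega>. indicator A \<omega> * (?X a \<omega> * ?X b \<omega>) \<partial>M) = prob A * ((r - s) * noise_bracket a b)"
  proof (cases "s = r")
    case False
    with s have sr: "s < r" by simp
    have fm: "fresh_increment a s r \<in> borel_measurable M" "fresh_increment b s r \<in> borel_measurable M"
      by (rule fresh_increment_moments(1)[OF s(1) sr] a b)+
    have "AE \<omega> in M. indicator A \<omega> * (?X a \<omega> * ?X b \<omega>) = indicator A \<omega> * (fresh_increment a s r \<omega> * fresh_increment b s r \<omega>)"
      using AE_noise_increment[OF a s] AE_noise_increment[OF b s] by eventually_elim simp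
    then have "(\<integral>\<omega>. indicator A \<omega> * (?X a \<omega> * ?X b \<omega>) \<partial>M) = (\<integral>\<omega>. indicator A \<omega> * (fresh_increment a s r \<omega> * fresh_increment b s r \<omega>) \<partial>M)"
      using XM AM fm by (intro integral_cong_AE) auto
    also have "\<dots> = prob A * (\<integral>\<omega>. fresh_increment a s r \<omega> * fresh_increment b s r \<omega> \<partial>M)"
      using fresh_increment_measurable[OF a] fresh_increment_measurable[OF b] indep_set_filt_future[OF s(1) sr] A
        integrable_mult_square_integrable[OF fm fresh_increment_moments(2)[OF s(1) sr a] fresh_increment_moments(2)[OF s(1) sr b]]
      by (intro indep_set_integral[of "filt s" "sigma (space M) (\<Union>j\<in>{..<3}. future s r j)"])
         (simp_all add: space_filt space_measure_of_conv sets_sigma_Union_future)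
    finally show ?thesis using fresh_increment_covariance[OF s(1) sr a b] by simp
  qed simp
next
  show "noise_bracket a b = noise_bracket b a" for a b
    by (auto simp: noise_bracket_def Int_commute split: noise.splits)
qed (rule subalgebra_filt)

end

section \<open>Iterating the inequality over short steps\<close>

text \<open>Here \<open>y t\<close>, \<open>W t u\<close>, \<open>V t u\<close>, \<open>\<Phi> t u\<close> are to be integrals over an event of the squared difference of the
  solutions at \<open>t\<close> and, over \<open>(t, u]\<close>, of that square, of the squares of the integrand differences, and of the
  squared difference of the forcing terms.\<close>

definition backward_inequality :: "real \<Rightarrow> real \<Rightarrow> real \<Rightarrow> (real \<Rightarrow> real) \<Rightarrow> (real \<Rightarrow> real \<Rightarrow> real) \<Rightarrow>
    (real \<Rightarrow> real \<Rightarrow> real) \<Rightarrow> (real \<Rightarrow> real \<Rightarrow> real) \<Rightarrow> bool"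
  where "backward_inequality K t0 T y W V \<Phi> \<longleftrightarrow>
    (\<forall>t u. t0 \<le> t \<longrightarrow> t \<le> u \<longrightarrow> u \<le> T \<longrightarrow>
      y t + V t u \<le> 2 * y u + 2 * (u - t) * K * (W t u + V t u + \<Phi> t u) \<and>
      0 \<le> y t \<and> 0 \<le> W t u \<and> 0 \<le> V t u \<and> 0 \<le> \<Phi> t u \<and>
      (\<forall>Z. (\<forall>s\<in>{t..u}. y s \<le> Z) \<longrightarrow> W t u \<le> (u - t) * Z) \<and>
      (\<forall>s. t \<le> s \<longrightarrow> s \<le> u \<longrightarrow> W t u = W t s + W s u \<and> V t u = V t s + V s u \<and> \<Phi> t u = \<Phi> t s + \<Phi> s u))"

lemma backward_inequalityD:
  assumes b: "backward_inequality K t0 T y W V \<Phi>" and t: "t0 \<le> t" "t \<le> u" "u \<le> T"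
  shows "y t + V t u \<le> 2 * y u + 2 * (u - t) * K * (W t u + V t u + \<Phi> t u)"
    and "0 \<le> y t" "0 \<le> W t u" "0 \<le> V t u" "0 \<le> \<Phi> t u"
    and "(\<And>s. t \<le> s \<Longrightarrow> s \<le> u \<Longrightarrow> y s \<le> Z) \<Longrightarrow> W t u \<le> (u - t) * Z"
    and "t \<le> s \<Longrightarrow> s \<le> u \<Longrightarrow> W t u = W t s + W s u"
    and "t \<le> s \<Longrightarrow> s \<le> u \<Longrightarrow> V t u = V t s + V s u"
    and "t \<le> s \<Longrightarrow> s \<le> u \<Longrightarrow> \<Phi> t u = \<Phi> t s + \<Phi> s u"
  using b[unfolded backward_inequality_def, rule_format, OF t] by (blast, blast, blast, blast, blast, force, blast, blast, blast)

text \<open>With \<open>4 * h * K \<le> 1\<close> the drift coefficient is at most one half, and the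
  \<open>V\<close> term on the right is absorbed. The \<open>W\<close> term is absorbed only after a
  uniform bound on \<open>y\<close> over the interval, which is why the estimate is carried out at
  every \<open>s\<close> of it.\<close>

lemma backward_inequality_short:
  assumes b: "backward_inequality K t0 T y W V \<Phi>" and K: "0 \<le> K"
    and h: "h \<le> 1" "4 * h * K \<le> 1" and t: "t0 \<le> t" "t \<le> u" "u \<le> T" "u - t \<le> h"
  shows "y t + W t u + V t u \<le> 16 * y u + 4 * \<Phi> t u"
proof -
  note B = backward_inequalityD[OF b]
  have pos: "0 \<le> y u" "0 \<le> W t u" "0 \<le> V t u" "0 \<le> \<Phi> t u"
    using B(2)[of u u] B(3-5)[of t u] t by simp_all
  have short: "y s + V s u / 2 \<le> 2 * y u + W t u / 2 + \<Phi> t u / 2" if s: "t \<le> s" "s \<le> u" for s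
  proof -
    have B': "y s + V s u \<le> 2 * y u + 2 * (u - s) * K * (W s u + V s u + \<Phi> s u)"
      "0 \<le> W s u" "0 \<le> V s u" "0 \<le> \<Phi> s u"
      using B(1,3-5)[of s u] s t by simp_all
    have split: "W t u = W t s + W s u" "\<Phi> t u = \<Phi> t s + \<Phi> s u" "0 \<le> W t s" "0 \<le> \<Phi> t s"
      using B(7,9)[of t u s] B(3,5)[of t s] s t by simp_all
    have "2 * (u - s) * K \<le> 2 * h * K" using s t K by (intro mult_right_mono) auto
    also have "\<dots> \<le> 1 / 2" using h by linarith
    finally have "2 * (u - s) * K * (W s u + V s u + \<Phi> s u) \<le> 1 / 2 * (W s u + V s u + \<Phi> s u)"
      using B'(2-4) by (intro mult_right_mono) auto
    from order_trans[OF B'(1) add_left_mono[OF this]]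
    have "y s + V s u \<le> 2 * y u + 1 / 2 * (W s u + V s u + \<Phi> s u)" .
    with split show ?thesis by (simp add: field_simps)
  qed
  define Z where "Z = 2 * y u + W t u / 2 + \<Phi> t u / 2"
  have "y s \<le> Z" if "t \<le> s" "s \<le> u" for s
  proof -
    have "0 \<le> V s u" using that t by (intro B(4)) simp_all
    with short[OF that] show ?thesis unfolding Z_def by linarith
  qed
  then have "W t u \<le> (u - t) * Z" by (rule B(6)[OF t(1-3)])
  also have "\<dots> \<le> 1 * Z" using t h pos by (intro mult_right_mono) (simp_all add: Z_def)
  finally have "W t u \<le> 4 * y u + \<Phi> t u" unfolding Z_def by (simp add: field_simps)
  moreover have "0 \<le> y t" using B(2)[of t u] t by simp
  ultimately show ?thesis using short[OF order_refl t(2)] pos by linarith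
qed

text \<open>Backward induction in steps of length at most \<open>h\<close>. A step costs 16 times
  the later value, and the tail over \<open>(u, T]\<close> is counted once more, hence the base
  17.\<close>

lemma backward_inequality_iterate:
  assumes b: "backward_inequality K t0 T y W V \<Phi>" and K: "0 \<le> K"
    and h: "0 < h" "h \<le> 1" "4 * h * K \<le> 1"
  shows "t0 \<le> t \<Longrightarrow> t \<le> T \<Longrightarrow> T - t \<le> real n * h \<Longrightarrow> y t + W t T + V t T \<le> 17 ^ n * (y T + \<Phi> t T)"
proof (induction n arbitrary: t)
  case 0
  note B = backward_inequalityD[OF b]
  have t: "t = T" "t0 \<le> T" using 0 by simp_all
  have "W T T \<le> (T - T) * y T" by (rule B(6)) (use t in \<open>simp_all add: order_antisym_conv\<close>)
  moreover have "V T T = V T T + V T T" "0 \<le> \<Phi> T T"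
    using B(5,8)[of T T] t by simp_all
  ultimately show ?case unfolding t(1) by simp
next
  case (Suc n)
  note B = backward_inequalityD[OF b]
  define u where "u = min T (t + h)"
  have u: "t \<le> u" "u \<le> T" "u - t \<le> h" using Suc.prems h by (auto simp: u_def)
  have "T - u \<le> real n * h" using Suc.prems h by (cases "T \<le> t + h") (simp_all add: u_def min_def algebra_simps)
  then have IH: "y u + W u T + V u T \<le> 17 ^ n * (y T + \<Phi> u T)" using Suc.IH[of u] u Suc.prems by auto
  have st: "y t + W t u + V t u \<le> 16 * y u + 4 * \<Phi> t u"
    using backward_inequality_short[OF b K h(2,3) Suc.prems(1) u] .
  have add: "W t T = W t u + W u T" "V t T = V t u + V u T" "\<Phi> t T = \<Phi> t u + \<Phi> u T"
    using B(7-9)[of t T u] Suc.prems u by simp_all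
  have pos: "0 \<le> W u T" "0 \<le> V u T" "0 \<le> \<Phi> t u"
    using B(3,4)[of u T] B(5)[of t u] Suc.prems u by simp_all
  define a where "a = 17 ^ n * (y T + \<Phi> u T)"
  define q where "q = 17 ^ n * \<Phi> t u"
  have "1 * \<Phi> t u \<le> q" unfolding q_def using pos by (intro mult_right_mono) auto
  moreover have "17 ^ Suc n * (y T + \<Phi> t T) = 17 * (a + q)"
    unfolding add a_def q_def by (simp add: algebra_simps)
  moreover have "0 \<le> y u" using B(2)[of u u] Suc.prems u by simp
  ultimately show ?case using IH[folded a_def] st add(1,2) pos by simp
qed

text \<open>The step length \<open>1 / (1 + 4 * K)\<close> and the number of steps depend on
  \<open>K\<close> and \<open>T\<close> alone. The bound is stated for all data at once because
  every event and every starting time must share the same \<open>C\<close>.\<close>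

lemma backward_inequality_bound:
  assumes K: "0 \<le> K" and T: "0 < T"
  obtains C :: real where "1 \<le> C"
    "\<And>t0 y W V \<Phi>. backward_inequality K t0 T y W V \<Phi> \<Longrightarrow> 0 \<le> t0 \<Longrightarrow> t0 \<le> T \<Longrightarrow>
      y t0 + W t0 T + V t0 T \<le> C * (y T + \<Phi> t0 T)"
proof -
  define h where "h = 1 / (1 + 4 * K)"
  have h: "0 < h" "h \<le> 1" "4 * h * K \<le> 1" using K by (auto simp: h_def field_simps)
  obtain n :: nat where "T / h < real n" using reals_Archimedean2 by blast
  then have n: "T \<le> real n * h" using h by (simp add: field_simps)
  show thesis
  proof (rule that[of "17 ^ n"])
    fix t0 y W V \<Phi> assume "backward_inequality K t0 T y W V \<Phi>" "0 \<le> t0" "t0 \<le> T"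
    then show "y t0 + W t0 T + V t0 T \<le> 17 ^ n * (y T + \<Phi> t0 T)"
      using n by (intro backward_inequality_iterate[OF _ K h order_refl]) simp_all
  qed simp
qed

text \<open>Tested on the event where the conditional expectation is negative, the hypothesis forces
  the integral of a nonnegative function to vanish, so that event is null.\<close>

lemma (in sigma_finite_subalgebra) real_cond_exp_nonneg_sets:
  assumes D: "integrable M D" and nn: "\<And>A. A \<in> sets F \<Longrightarrow> 0 \<le> (\<integral>x. indicator A x * D x \<partial>M)"
  shows "AE x in M. 0 \<le> real_cond_exp M F D x"
proof -
  let ?E = "real_cond_exp M F D"
  define A where "A = {x\<in>space F. ?E x < 0}"
  have A: "A \<in> sets F" unfolding A_def by measurable
  then have AM: "A \<in> sets M" using subalg by (auto simp: subalgebra_def)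
  have spF: "space F = space M" using subalg by (simp add: subalgebra_def)
  have EM: "integrable M ?E" by (rule real_cond_exp_int(1)[OF D])
  have iA: "integrable M (\<lambda>x. indicator A x * ?E x)"
    using integrable_mult_indicator[OF AM EM] by simp
  have "(\<integral>x. indicator A x * ?E x \<partial>M) = (\<integral>x. indicator A x * D x \<partial>M)"
    using real_cond_exp_intA[OF D A] by (simp add: set_lebesgue_integral_def)
  with nn[OF A] have "(\<integral>x. - (indicator A x * ?E x) \<partial>M) \<le> 0" by simp
  moreover have nonneg: "0 \<le> - (indicator A x * ?E x)" for x
    by (auto simp: A_def indicator_def)
  ultimately have "(\<integral>x. - (indicator A x * ?E x) \<partial>M) = 0"
    by (intro antisym integral_nonneg_AE) auto
  then have "AE x in M. - (indicator A x * ?E x) = 0"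
    using nonneg iA by (subst (asm) integral_nonneg_eq_0_iff_AE) auto
  then show ?thesis
    using AE_space
  proof eventually_elim
    case (elim x)
    show ?case
    proof (rule ccontr)
      assume "\<not> 0 \<le> ?E x"
      with elim spF have "x \<in> A" by (auto simp: A_def)
      with elim \<open>\<not> 0 \<le> ?E x\<close> show False by simp
    qed
  qed
qed

text \<open>Cauchy--Schwarz against the constant 1. The drift is integrable for the completed
  Lebesgue measure and its majorant for the Borel one, so the majorant is moved to the completion;
  domination makes \<open>f\<close> square integrable.\<close>

lemma lebesgue_integral_square_le:
  fixes f b :: "real \<Rightarrow> real"
  assumes tu: "t \<le> u" and f: "set_integrable lebesgue {t<..u} f"
    and b: "set_integrable lborel {t<..u} b" "\<And>s. 0 \<le> b s"
    and le: "AE s in lborel. s \<in> {t<..u} \<longrightarrow> (f s)\<^sup>2 \<le> b s"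
  shows "(LINT s:{t<..u}|lebesgue. f s)\<^sup>2 \<le> (u - t) * (LINT s:{t<..u}|lborel. b s)"
proof -
  let ?I = "indicator {t<..u} :: real \<Rightarrow> real"
  have fi: "integrable lebesgue (\<lambda>s. ?I s * f s)" using f by (simp add: set_integrable_def)
  have bl: "integrable lborel (\<lambda>s. ?I s * b s)" using b by (simp add: set_integrable_def)
  then have bi: "integrable lebesgue (\<lambda>s. ?I s * b s)" "(\<integral>s. ?I s * b s \<partial>lebesgue) = (\<integral>s. ?I s * b s \<partial>lborel)"
    using integrable_completion[of "\<lambda>s. ?I s * b s" lborel] integral_completion[of "\<lambda>s. ?I s * b s" lborel]
    by (auto dest: borel_measurable_integrable)
  have le': "AE s in lebesgue. (?I s * f s)\<^sup>2 \<le> ?I s * b s"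
    using AE_completion[OF le] by eventually_elim (auto simp: indicator_def)
  have f2: "integrable lebesgue (\<lambda>s. (?I s * f s)\<^sup>2)"
  proof (rule Bochner_Integration.integrable_bound[OF bi(1)])
    show "(\<lambda>s. (?I s * f s)\<^sup>2) \<in> borel_measurable lebesgue"
      by (intro borel_measurable_power borel_measurable_integrable[OF fi])
    show "AE s in lebesgue. norm ((?I s * f s)\<^sup>2) \<le> norm (?I s * b s)"
      using le' by eventually_elim auto
  qed
  have I2: "integrable lebesgue (\<lambda>s. (?I s)\<^sup>2)" "(\<integral>s. (?I s)\<^sup>2 \<partial>lebesgue) = u - t"
  proof -
    have "(?I s)\<^sup>2 = ?I s" for s by (simp add: indicator_def)
    then show "integrable lebesgue (\<lambda>s. (?I s)\<^sup>2)" "(\<integral>s. (?I s)\<^sup>2 \<partial>lebesgue) = u - t"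
      using tu by simp_all
  qed
  have "?I s * (?I s * f s) = ?I s * f s" for s by (simp add: indicator_def)
  then have I_idem: "(\<lambda>s. ?I s * (?I s * f s)) = (\<lambda>s. ?I s * f s)" by (rule ext)
  have Im: "?I \<in> borel_measurable lebesgue" by (rule borel_measurable_indicator) simp
  have "\<bar>\<integral>s. ?I s * f s \<partial>lebesgue\<bar> \<le> sqrt (u - t) * sqrt (\<integral>s. (?I s * f s)\<^sup>2 \<partial>lebesgue)"
    using integral_mult_Cauchy_Schwarz[OF Im borel_measurable_integrable[OF fi] I2(1) f2] unfolding I2(2) I_idem .
  then have "\<bar>\<integral>s. ?I s * f s \<partial>lebesgue\<bar>\<^sup>2 \<le> (sqrt (u - t) * sqrt (\<integral>s. (?I s * f s)\<^sup>2 \<partial>lebesgue))\<^sup>2"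
    by (rule power_mono) simp
  also have "\<dots> = (u - t) * (\<integral>s. (?I s * f s)\<^sup>2 \<partial>lebesgue)"
    using tu by (simp add: power_mult_distrib)
  also have "\<dots> \<le> (u - t) * (\<integral>s. ?I s * b s \<partial>lebesgue)"
    using tu le' by (intro mult_left_mono integral_mono_AE f2 bi) auto
  finally show ?thesis
    unfolding set_lebesgue_integral_def real_scaleR_def bi(2)[symmetric] by simp
qed

text \<open>The energy carries the weight \<open>lam\<close> on the square of \<open>b\<close>, so
  recovering that square costs \<open>1 / lam\<close>; this is its origin in the constant. The 5 is
  Cauchy--Schwarz for five summands.\<close>

lemma five_term_square:
  fixes L a b c d e lam :: real
  assumes "0 \<le> L" "0 < lam"
  shows "(L * (a + b + c + d) + e)\<^sup>2 \<le> 5 * (1 + L\<^sup>2 * (1 + 1 / lam)) * (a\<^sup>2 + (lam * b\<^sup>2 + c\<^sup>2 + d\<^sup>2) + e\<^sup>2)"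
proof -
  let ?K = "1 + L\<^sup>2 * (1 + 1 / lam)"
  have sq: "(x1 + x2 + x3 + x4 + x5)\<^sup>2 \<le> 5 * (x1\<^sup>2 + x2\<^sup>2 + x3\<^sup>2 + x4\<^sup>2 + x5\<^sup>2)" for x1 x2 x3 x4 x5 :: real
  proof -
    \<comment> \<open>The squares of all pairwise differences add up to the gap in the
      inequality.\<close>
    have "0 \<le> (x1 - x2)\<^sup>2 + (x1 - x3)\<^sup>2 + (x1 - x4)\<^sup>2 + (x1 - x5)\<^sup>2 + (x2 - x3)\<^sup>2 + (x2 - x4)\<^sup>2 + (x2 - x5)\<^sup>2
        + (x3 - x4)\<^sup>2 + (x3 - x5)\<^sup>2 + (x4 - x5)\<^sup>2"
      by (intro add_nonneg_nonneg zero_le_power2)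
    also have "\<dots> = 5 * (x1\<^sup>2 + x2\<^sup>2 + x3\<^sup>2 + x4\<^sup>2 + x5\<^sup>2) - (x1 + x2 + x3 + x4 + x5)\<^sup>2"
      by (simp add: power2_eq_square algebra_simps)
    finally show ?thesis by simp
  qed
  have K: "L\<^sup>2 \<le> ?K" "1 \<le> ?K" "L\<^sup>2 \<le> ?K * lam"
    using assms by (auto simp: field_simps)
  have "(L * (a + b + c + d) + e)\<^sup>2 = (L * a + L * b + L * c + L * d + e)\<^sup>2" by (simp add: algebra_simps)
  also have "\<dots> \<le> 5 * ((L * a)\<^sup>2 + (L * b)\<^sup>2 + (L * c)\<^sup>2 + (L * d)\<^sup>2 + e\<^sup>2)" by (rule sq)
  also have "\<dots> = 5 * (L\<^sup>2 * a\<^sup>2 + L\<^sup>2 * b\<^sup>2 + L\<^sup>2 * c\<^sup>2 + L\<^sup>2 * d\<^sup>2 + 1 * e\<^sup>2)" by (simp add: power_mult_distrib)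
  also have "\<dots> \<le> 5 * (?K * a\<^sup>2 + ?K * lam * b\<^sup>2 + ?K * c\<^sup>2 + ?K * d\<^sup>2 + ?K * e\<^sup>2)"
    using K by (intro mult_left_mono add_mono mult_right_mono) auto
  also have "\<dots> = 5 * ?K * (a\<^sup>2 + (lam * b\<^sup>2 + c\<^sup>2 + d\<^sup>2) + e\<^sup>2)" by (simp only: ring_distribs ac_simps)
  finally show ?thesis .
qed

section \<open>Integrands as limits of step processes\<close>

sublocale bsde_setting \<subseteq> NM: noise_martingale M "noise_filtration M B N \<mu> \<nu> lam m" noise_process noise_atoms noise_bracket
  by (rule noise_martingale)

section \<open>The product of scenario space and time\<close>

context bsde_setting
begin

abbreviation (input) tm :: "real measure"
  where "tm \<equiv> restrict_space lborel {0..T}"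

abbreviation (input) Q :: "('w \<times> real) measure"
  where "Q \<equiv> M \<Otimes>\<^sub>M restrict_space lborel {0..T}"

lemma sigma_finite_tm: "sigma_finite_measure tm"
  using NM.finite_measure_time[of T] by (simp add: finite_measure_def)

lemma pair_sigma_finite_Q: "pair_sigma_finite M tm"
  using sigma_finite_tm sigma_finite_measure_axioms by (simp add: pair_sigma_finite_def)

lemma sigma_finite_Q: "sigma_finite_measure Q"
proof -
  interpret MT: pair_sigma_finite M tm by (rule pair_sigma_finite_Q)
  show ?thesis by (rule MT.sigma_finite_measure_axioms)
qed

lemma pair_sigma_finite_Q_nu: "pair_sigma_finite Q \<nu>"
  using sigma_finite_Q nu_sigma_finite by (simp add: pair_sigma_finite_def)

lemma space_Q: "space Q = space M \<times> {0..T}"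
  by (simp add: space_pair_measure space_restrict_space)

lemma nn_integral_Q:
  assumes "f \<in> borel_measurable Q"
  shows "(\<integral>\<^sup>+\<omega>. (\<integral>\<^sup>+s\<in>{0..T}. f (\<omega>, s) \<partial>lborel) \<partial>M) = (\<integral>\<^sup>+x. f x \<partial>Q)"
proof -
  have "(\<integral>\<^sup>+\<omega>. (\<integral>\<^sup>+s\<in>{0..T}. f (\<omega>, s) \<partial>lborel) \<partial>M) = (\<integral>\<^sup>+\<omega>. (\<integral>\<^sup>+s. f (\<omega>, s) \<partial>tm) \<partial>M)"
    by (rule nn_integral_cong, rule nn_integral_restrict_space[symmetric], simp)
  also have "\<dots> = (\<integral>\<^sup>+x. f x \<partial>Q)"
    by (rule sigma_finite_measure.nn_integral_fst[OF sigma_finite_tm assms])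
  finally show ?thesis .
qed

text \<open>The generating predictable rectangles are products of an event and a Borel set of times,
  so predictable processes are jointly measurable.\<close>

lemma predictable_on_measurable_Q:
  "(\<lambda>x. x) \<in> measurable Q (predictable_on M filt 0 T)"
proof -
  have sub: "{A \<times> {0 :: real} |A. A \<in> sets (filt 0)} \<union> {A \<times> {s<..r} |A s r. 0 \<le> s \<and> s \<le> r \<and> A \<in> sets (filt s)}
      \<subseteq> Pow (space M \<times> {0..})"
  proof -
    have sub1: "A \<times> I \<subseteq> space M \<times> {0..}" if "A \<in> sets (filt s)" "I \<subseteq> {0..}" for A s and I :: "real set"
      using sets.sets_into_space[OF that(1)] that(2) unfolding space_filt by (rule Sigma_mono)
    have sub2: "{s<..r} \<subseteq> {0..}" if "0 \<le> s" for s r :: real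
      using that by auto
    show ?thesis
    proof (intro Un_least subsetI PowI)
      fix y x assume "y \<in> {A \<times> {0 :: real} |A. A \<in> sets (filt 0)}" "x \<in> y"
      then show "x \<in> space M \<times> {0..}" using sub1[of _ 0 "{0}"] by blast
    next
      fix y x assume "y \<in> {A \<times> {s<..r} |A s r. 0 \<le> s \<and> s \<le> r \<and> A \<in> sets (filt s)}" "x \<in> y"
      then obtain A s r where "y = A \<times> {s<..r}" "0 \<le> s" "A \<in> sets (filt s)" by blast
      with \<open>x \<in> y\<close> show "x \<in> space M \<times> {0..}" using sub1[OF _ sub2] by blast
    qed
  qed
  have "(\<lambda>x. x) \<in> measurable Q (predictable M filt)"
    unfolding predictable_def
  proof (rule measurable_measure_of[OF sub])
    show "(\<lambda>x. x) \<in> space Q \<rightarrow> space M \<times> {0..}" by (auto simp: space_Q)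
    fix y assume y: "y \<in> {A \<times> {0 :: real} |A. A \<in> sets (filt 0)} \<union> {A \<times> {s<..r} |A s r. 0 \<le> s \<and> s \<le> r \<and> A \<in> sets (filt s)}"
    then obtain A I where AI: "y = A \<times> I" "A \<in> events" "I \<in> sets (borel :: real measure)"
    proof -
      from y consider A where "y = A \<times> {0}" "A \<in> sets (filt 0)"
        | A s r where "y = A \<times> {s<..r}" "A \<in> sets (filt s)" by blast
      then show thesis
      proof cases
        case (1 A)
        from 1(2) filt_events[of 0] have "A \<in> events" ..
        then show ?thesis by (rule that[OF 1(1)]) simp
      next
        case (2 A s r)
        from 2(2) filt_events[of s] have "A \<in> events" ..
        then show ?thesis by (rule that[OF 2(1)]) simp
      qed
    qed
    have "(\<lambda>x. x) -` y \<inter> space Q = A \<times> (I \<inter> {0..T})"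
      using sets.sets_into_space[OF AI(2)] unfolding space_Q AI(1) by blast
    also have "\<dots> \<in> sets Q"
    proof (rule pair_measureI[OF AI(2)])
      show "I \<inter> {0..T} \<in> sets tm" using AI(3) by (simp add: sets_restrict_space_iff)
    qed
    finally show "(\<lambda>x. x) -` y \<inter> space Q \<in> sets Q" .
  qed
  then show ?thesis
    unfolding predictable_on_def by (intro measurable_restrict_space2) (simp_all add: space_Q)
qed

lemma predictable_on_measurable:
  fixes h :: "real \<Rightarrow> 'w \<Rightarrow> real"
  assumes "(\<lambda>(\<omega>, s). h s \<omega>) \<in> borel_measurable (predictable_on M filt 0 T)"
  shows "(\<lambda>x. h (snd x) (fst x)) \<in> borel_measurable Q"
  using measurable_compose[OF predictable_on_measurable_Q assms] by (simp add: case_prod_beta)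

text \<open>Progressive measurability at the terminal time, weakened from \<open>filt T\<close> to
  \<open>M\<close>.\<close>

lemma progressive_measurable:
  fixes h :: "real \<Rightarrow> 'w \<Rightarrow> 'x::topological_space"
  assumes "progressive filt 0 T h"
  shows "(\<lambda>x. h (snd x) (fst x)) \<in> borel_measurable Q"
proof -
  have 1: "(\<lambda>(\<omega>, s). h s \<omega>) \<in> borel_measurable (filt T \<Otimes>\<^sub>M restrict_space borel {0..T})"
    using assms T_pos unfolding progressive_def by auto
  have id1: "(\<lambda>\<omega>. \<omega>) \<in> measurable M (filt T)"
    using filt_events[of T] by (auto simp: measurable_def space_filt)
  have "(\<lambda>x. (fst x, snd x)) \<in> measurable Q (filt T \<Otimes>\<^sub>M restrict_space borel {0..T})"
  proof (rule measurable_Pair)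
    show "fst \<in> measurable Q (filt T)" using measurable_compose[OF measurable_fst[of M tm] id1] .
    have "sets (restrict_space borel {0..T}) = sets (restrict_space lborel {0..T :: real})"
      by (simp add: sets_restrict_space)
    then show "snd \<in> measurable Q (restrict_space borel {0..T})"
      using measurable_snd[of M tm] measurable_cong_sets by blast
  qed
  from measurable_compose[OF this 1] show ?thesis by simp
qed

lemma field_measurable:
  fixes K :: "real \<Rightarrow> 'w \<Rightarrow> real ^ 'q \<Rightarrow> real"
  assumes "(\<lambda>((\<omega>, s), e). K s \<omega> e) \<in> borel_measurable (predictable_on M filt 0 T \<Otimes>\<^sub>M \<nu>)"
  shows "(\<lambda>x. K (snd (fst x)) (fst (fst x)) (snd x)) \<in> borel_measurable (Q \<Otimes>\<^sub>M \<nu>)"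
proof -
  have "(\<lambda>x. (fst x, snd x)) \<in> measurable (Q \<Otimes>\<^sub>M \<nu>) (predictable_on M filt 0 T \<Otimes>\<^sub>M \<nu>)"
    using measurable_compose[OF measurable_fst predictable_on_measurable_Q]
    by (intro measurable_Pair) simp_all
  from measurable_compose[OF this assms] show ?thesis by (simp add: case_prod_beta)
qed

section \<open>Stochastic integrals as limits of entry lists\<close>

definition entry_atom :: "real \<times> real \<times> ('d, (real ^ 'q)) noise \<times> ('w \<Rightarrow> real) \<Rightarrow> ('d, (real ^ 'q)) noise"
  where "entry_atom e = fst (snd (snd e))"

text \<open>The empty set is a default for atoms of \<open>B\<close> and \<open>N\<close>.\<close>

definition mark_set :: "('d, (real ^ 'q)) noise \<Rightarrow> (real ^ 'q) set"
  where "mark_set a = (case a of JM A \<Rightarrow> A | _ \<Rightarrow> {})"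

text \<open>What remains of the definition of a stochastic integral once step integrands are written
  as lists of entries with the single atom \<open>a\<close>; one sequence of lists serves all pairs
  of times.\<close>

definition scalar_component :: "('d, (real ^ 'q)) noise \<Rightarrow> (real \<Rightarrow> 'w \<Rightarrow> real) \<Rightarrow> (real \<Rightarrow> 'w \<Rightarrow> real) \<Rightarrow> bool"
  where "scalar_component a h J \<longleftrightarrow> (\<exists>c. (\<forall>n. \<forall>e\<in>set (c n). NM.valid_entry e \<and> entry_atom e = a) \<and>
    (\<forall>t u. 0 \<le> t \<longrightarrow> t \<le> u \<longrightarrow> u \<le> T \<longrightarrow> NM.approximates c J t u) \<and>
    L2_tendsto Q (\<lambda>n x. \<Sum>e\<leftarrow>c n. NM.scalar_value e x) (\<lambda>x. h (snd x) (fst x)))"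

definition field_component :: "(real \<Rightarrow> 'w \<Rightarrow> real ^ 'q \<Rightarrow> real) \<Rightarrow> (real \<Rightarrow> 'w \<Rightarrow> real) \<Rightarrow> bool"
  where "field_component K J \<longleftrightarrow> (\<exists>c. (\<forall>n. \<forall>e\<in>set (c n). NM.valid_entry e \<and> entry_atom e \<in> range JM) \<and>
    (\<forall>t u. 0 \<le> t \<longrightarrow> t \<le> u \<longrightarrow> u \<le> T \<longrightarrow> NM.approximates c J t u) \<and>
    L2_tendsto (Q \<Otimes>\<^sub>M \<nu>) (\<lambda>n x. \<Sum>e\<leftarrow>c n. NM.field_value mark_set e x)
      (\<lambda>x. K (snd (fst x)) (fst (fst x)) (snd x)))"

lemma scalar_value_square_integrable:
  assumes "NM.valid_entry e"
  shows "NM.scalar_value e \<in> borel_measurable Q \<and> integrable Q (\<lambda>x. (NM.scalar_value e x)\<^sup>2)"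
proof -
  obtain s r a \<zeta> where e: "e = (s, r, a, \<zeta>)" by (cases e)
  obtain k where z: "0 \<le> s" "\<zeta> \<in> borel_measurable M"
    by (rule NM.valid_entryE[OF assms[unfolded e]]) (rule that)
  have ind: "indicator {s<..r} \<in> borel_measurable tm"
    by (intro measurable_restrict_space1 borel_measurable_indicator) simp
  have m: "NM.scalar_value e \<in> borel_measurable Q"
    unfolding e NM.scalar_value_def prod.case
    by (intro borel_measurable_times measurable_compose[OF measurable_fst z(2)] measurable_compose[OF measurable_snd ind])
  have "integrable Q (\<lambda>x. (1 * indicator {0<..T} (snd x)) * NM.scalar_value (s, r, a, \<zeta>) x * NM.scalar_value (s, r, a, \<zeta>) x)"
    using T_pos by (intro NM.scalar_value_product_integrable[OF assms[unfolded e] assms[unfolded e], of 0 T T "\<lambda>_. 1"]) auto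
  moreover have "(1 * indicator {0<..T} (snd x)) * NM.scalar_value (s, r, a, \<zeta>) x * NM.scalar_value (s, r, a, \<zeta>) x =
      (NM.scalar_value e x)\<^sup>2" if "x \<in> space Q" for x
    using that z(1) unfolding e NM.scalar_value_def space_Q
    by (auto simp: power2_eq_square indicator_def)
  ultimately have "integrable Q (\<lambda>x. (NM.scalar_value e x)\<^sup>2)"
    by (subst (asm) Bochner_Integration.integrable_cong[OF refl, where g="\<lambda>x. (NM.scalar_value e x)\<^sup>2"]) auto
  with m show ?thesis by blast
qed

lemma atom_mark_set:
  assumes "NM.valid_entry (s, r, a, \<zeta>)" "a \<in> range JM"
  shows "mark_set a \<in> sets \<nu>" "emeasure \<nu> (mark_set a) < \<infinity>"
proof -
  have "a \<in> noise_atoms" using assms(1) by (simp add: NM.valid_entry_def)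
  then show "mark_set a \<in> sets \<nu>" "emeasure \<nu> (mark_set a) < \<infinity>"
    using assms(2) by (cases rule: noise_atomsE; auto simp: mark_set_def)+
qed

lemma field_value_square_integrable:
  assumes "NM.valid_entry e" "entry_atom e \<in> range JM"
  shows "NM.field_value mark_set e \<in> borel_measurable (Q \<Otimes>\<^sub>M \<nu>) \<and> integrable (Q \<Otimes>\<^sub>M \<nu>) (\<lambda>x. (NM.field_value mark_set e x)\<^sup>2)"
proof -
  obtain s r a \<zeta> where e: "e = (s, r, a, \<zeta>)" by (cases e)
  obtain k where z: "0 \<le> s" "\<zeta> \<in> borel_measurable M"
    by (rule NM.valid_entryE[OF assms(1)[unfolded e]]) (rule that)
  have a: "mark_set a \<in> sets \<nu>" "emeasure \<nu> (mark_set a) < \<infinity>"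
    using atom_mark_set[OF assms(1)[unfolded e]] assms(2) by (auto simp: e entry_atom_def)
  have fv: "NM.field_value mark_set e x = NM.scalar_value e (fst x) * indicator (mark_set a) (snd x)" for x
    unfolding e NM.field_value_def NM.scalar_value_def by simp
  have m: "NM.field_value mark_set e \<in> borel_measurable (Q \<Otimes>\<^sub>M \<nu>)"
    unfolding fv[abs_def] using scalar_value_square_integrable[OF assms(1)] a
    by (intro borel_measurable_times measurable_compose[OF measurable_fst] measurable_compose[OF measurable_snd]) auto
  have "integrable (Q \<Otimes>\<^sub>M \<nu>) (\<lambda>x. (1 * indicator {0<..T} (snd (fst x))) * NM.field_value mark_set (s, r, a, \<zeta>) x * NM.field_value mark_set (s, r, a, \<zeta>) x)"
    using T_pos a nu_sigma_finite
    by (intro NM.field_value_product_integrable[OF assms(1)[unfolded e] assms(1)[unfolded e], of 0 T T "\<lambda>_. 1"]) auto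
  moreover have "(1 * indicator {0<..T} (snd (fst x))) * NM.field_value mark_set (s, r, a, \<zeta>) x * NM.field_value mark_set (s, r, a, \<zeta>) x =
      (NM.field_value mark_set e x)\<^sup>2" if "x \<in> space (Q \<Otimes>\<^sub>M \<nu>)" for x
    using that z(1) unfolding e NM.field_value_def space_pair_measure[of Q] space_Q
    by (auto simp: power2_eq_square indicator_def)
  ultimately have "integrable (Q \<Otimes>\<^sub>M \<nu>) (\<lambda>x. (NM.field_value mark_set e x)\<^sup>2)"
    by (subst (asm) Bochner_Integration.integrable_cong[OF refl, where g="\<lambda>x. (NM.field_value mark_set e x)\<^sup>2"]) auto
  with m show ?thesis by blast
qed

text \<open>Attaching the atom \<open>a\<close> to each entry translates step integrands and step
  integrals literally; Tonelli identifies the iterated integral of the error with an integral over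
  \<open>Q\<close>.\<close>

lemma stochastic_integral_component:
  assumes si: "stochastic_integral M filt T (noise_process a) h J" and a: "a \<in> noise_atoms"
    and hm: "(\<lambda>x. h (snd x) (fst x)) \<in> borel_measurable Q"
  shows "scalar_component a h J"
proof -
  from si obtain c where J: "\<And>u. u \<in> {0..T} \<Longrightarrow> J u \<in> borel_measurable (filt u)"
    and c: "\<And>n. simple_integrand M filt T (c n)"
    and c1: "(\<lambda>n. \<integral>\<^sup>+\<omega>. (\<integral>\<^sup>+s\<in>{0..T}. ennreal ((h s \<omega> - simple_value (c n) s \<omega>)\<^sup>2) \<partial>lborel) \<partial>M) \<longlonglongrightarrow> 0"
    and c2: "\<And>u. u \<in> {0..T} \<Longrightarrow>
        (\<lambda>n. \<integral>\<^sup>+\<omega>. ennreal ((J u \<omega> - simple_integral (noise_process a) (c n) u \<omega>)\<^sup>2) \<partial>M) \<longlonglongrightarrow> 0"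
    unfolding stochastic_integral_def by blast
  define d where "d n = map (\<lambda>(s, r, \<zeta>). (s, r, a, \<zeta>)) (c n)" for n
  have valid: "NM.valid_entry e \<and> entry_atom e = a" if "e \<in> set (d n)" for e n
    using c[of n] that a unfolding d_def simple_integrand_def NM.valid_entry_def entry_atom_def by auto
  have val: "(\<Sum>e\<leftarrow>d n. NM.scalar_value e (\<omega>, s)) = simple_value (c n) s \<omega>" for n \<omega> s
    unfolding d_def simple_value_def NM.scalar_value_def by (simp add: o_def split_def)
  have int: "NM.list_integral (d n) u \<omega> = simple_integral (noise_process a) (c n) u \<omega>" for n u \<omega>
    unfolding d_def simple_integral_def NM.list_integral_def NM.entry_integral_def by (simp add: o_def split_def)
  have JM: "J u \<in> borel_measurable M" if "u \<in> {0..T}" for u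
    using NM.F_measurable_M[OF _ J[OF that]] that by simp
  have sq: "(\<lambda>x. \<Sum>e\<leftarrow>d n. NM.scalar_value e x) \<in> borel_measurable Q \<and> integrable Q (\<lambda>x. (\<Sum>e\<leftarrow>d n. NM.scalar_value e x)\<^sup>2)" for n
    by (rule sum_list_square_integrable) (use valid scalar_value_square_integrable in blast)
  have "(\<integral>\<^sup>+\<omega>. (\<integral>\<^sup>+s\<in>{0..T}. ennreal ((h s \<omega> - simple_value (c n) s \<omega>)\<^sup>2) \<partial>lborel) \<partial>M) =
      (\<integral>\<^sup>+x. ennreal ((h (snd x) (fst x) - (\<Sum>e\<leftarrow>d n. NM.scalar_value e x))\<^sup>2) \<partial>Q)" for n
  proof -
    have "(\<lambda>x. ennreal ((h (snd x) (fst x) - (\<Sum>e\<leftarrow>d n. NM.scalar_value e x))\<^sup>2)) \<in> borel_measurable Q"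
      by (intro measurable_compose[OF _ measurable_ennreal] borel_measurable_power borel_measurable_diff hm)
         (use sq in blast)
    from nn_integral_Q[OF this] show ?thesis by (simp add: val)
  qed
  then have L2: "L2_tendsto Q (\<lambda>n x. \<Sum>e\<leftarrow>d n. NM.scalar_value e x) (\<lambda>x. h (snd x) (fst x))"
    using c1 sq by (intro L2_tendstoI hm) simp_all
  have "NM.approximates d J t u" if "0 \<le> t" "t \<le> u" "u \<le> T" for t u
    using that c2[of u] c2[of t] valid by (intro NM.approximatesI JM) (simp_all add: int)
  with valid L2 show ?thesis unfolding scalar_component_def by blast
qed

lemma compensated_integral_component:
  assumes si: "compensated_integral M filt \<nu> T \<mu> K J"
    and Km: "(\<lambda>x. K (snd (fst x)) (fst (fst x)) (snd x)) \<in> borel_measurable (Q \<Otimes>\<^sub>M \<nu>)"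
  shows "field_component K J"
proof -
  from si obtain c where J: "\<And>u. u \<in> {0..T} \<Longrightarrow> J u \<in> borel_measurable (filt u)"
    and c: "\<And>n. simple_random_field M filt \<nu> T (c n)"
    and c1: "(\<lambda>n. \<integral>\<^sup>+\<omega>. (\<integral>\<^sup>+s\<in>{0..T}. (\<integral>\<^sup>+e. ennreal ((K s \<omega> e - simple_field_value (c n) s \<omega> e)\<^sup>2) \<partial>\<nu>) \<partial>lborel) \<partial>M) \<longlonglongrightarrow> 0"
    and c2: "\<And>u. u \<in> {0..T} \<Longrightarrow>
        (\<lambda>n. \<integral>\<^sup>+\<omega>. ennreal ((J u \<omega> - simple_field_integral \<mu> \<nu> (c n) u \<omega>)\<^sup>2) \<partial>M) \<longlonglongrightarrow> 0"
    unfolding compensated_integral_def by blast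
  define d :: "nat \<Rightarrow> (real \<times> real \<times> ('d, (real ^ 'q)) noise \<times> ('w \<Rightarrow> real)) list"
    where "d n = map (\<lambda>(s, r, A, \<zeta>). (s, r, JM A, \<zeta>)) (c n)" for n
  have JM_atom: "JM A \<in> noise_atoms" if "A \<in> sets \<nu>" "emeasure \<nu> A < top" for A
    using that by (simp add: noise_atoms_def)
  have valid: "NM.valid_entry e \<and> entry_atom e \<in> range JM" if "e \<in> set (d n)" for e n
    using c[of n] that unfolding d_def simple_random_field_def NM.valid_entry_def entry_atom_def
    by (auto intro: JM_atom)
  have val: "(\<Sum>e\<leftarrow>d n. NM.field_value mark_set e ((\<omega>, s), x)) = simple_field_value (c n) s \<omega> x" for n \<omega> s x
    unfolding d_def simple_field_value_def NM.field_value_def by (simp add: o_def split_def mark_set_def)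
  \<comment> \<open>A step integral over \<open>\<mu>\<close> counts directly on the truncated slab,
    whereas an entry subtracts two counts from time 0. The two agree almost surely, simultaneously
    for the finitely many entries of a list.\<close>
  have int: "AE \<omega> in M. NM.list_integral (d n) u \<omega> = simple_field_integral \<mu> \<nu> (c n) u \<omega>" if u: "0 \<le> u" for n u
  proof -
    have entry: "AE \<omega> in M. noise_process (JM A) (min r u) \<omega> - noise_process (JM A) (min s u) \<omega> = compensated_mu \<mu> \<nu> (min s u) (min r u) A \<omega>"
      if "(s, r, A, \<zeta>) \<in> set (c n)" for s r A \<zeta>
    proof -
      have *: "0 \<le> s" "s \<le> r" "A \<in> sets \<nu>" "emeasure \<nu> A < \<infinity>"
        using c[of n] that unfolding simple_random_field_def by auto
      then have "JM A \<in> noise_atoms" by (simp add: noise_atoms_def)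
      moreover have "0 \<le> min s u" "min s u \<le> min r u" using * u by auto
      ultimately show ?thesis
        using AE_noise_increment[of "JM A" "min s u" "min r u"] slab_measure[OF nu_sigma_finite *(3,4), of "min s u" "min r u"]
        by (simp add: fresh_increment_def compensated_mu_def)
    qed
    then have "AE \<omega> in M. \<forall>e\<in>set (c n). noise_process (JM (fst (snd (snd e)))) (min (fst (snd e)) u) \<omega> -
        noise_process (JM (fst (snd (snd e)))) (min (fst e) u) \<omega> =
        compensated_mu \<mu> \<nu> (min (fst e) u) (min (fst (snd e)) u) (fst (snd (snd e))) \<omega>"
      by (intro AE_finite_allI) auto
    then show ?thesis
    proof eventually_elim
      case (elim \<omega>)
      then show ?case
        unfolding d_def simple_field_integral_def NM.list_integral_def NM.entry_integral_def
        by (auto simp: o_def split_def intro!: arg_cong[where f=sum_list])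
    qed
  qed
  have JM: "J u \<in> borel_measurable M" if "u \<in> {0..T}" for u
    using NM.F_measurable_M[OF _ J[OF that]] that by simp
  have sq: "(\<lambda>x. \<Sum>e\<leftarrow>d n. NM.field_value mark_set e x) \<in> borel_measurable (Q \<Otimes>\<^sub>M \<nu>) \<and>
      integrable (Q \<Otimes>\<^sub>M \<nu>) (\<lambda>x. (\<Sum>e\<leftarrow>d n. NM.field_value mark_set e x)\<^sup>2)" for n
    by (rule sum_list_square_integrable) (use valid field_value_square_integrable in blast)
  have "(\<integral>\<^sup>+\<omega>. (\<integral>\<^sup>+s\<in>{0..T}. (\<integral>\<^sup>+e. ennreal ((K s \<omega> e - simple_field_value (c n) s \<omega> e)\<^sup>2) \<partial>\<nu>) \<partial>lborel) \<partial>M) =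
      (\<integral>\<^sup>+x. ennreal ((K (snd (fst x)) (fst (fst x)) (snd x) - (\<Sum>e\<leftarrow>d n. NM.field_value mark_set e x))\<^sup>2) \<partial>(Q \<Otimes>\<^sub>M \<nu>))" for n
  proof -
    let ?f = "\<lambda>x. ennreal ((K (snd (fst x)) (fst (fst x)) (snd x) - (\<Sum>e\<leftarrow>d n. NM.field_value mark_set e x))\<^sup>2)"
    have m: "?f \<in> borel_measurable (Q \<Otimes>\<^sub>M \<nu>)" 
      by (intro measurable_compose[OF _ measurable_ennreal] borel_measurable_power borel_measurable_diff Km)
         (use sq in blast)
    have "(\<integral>\<^sup>+x. ?f x \<partial>(Q \<Otimes>\<^sub>M \<nu>)) = (\<integral>\<^sup>+y. (\<integral>\<^sup>+e. ?f (y, e) \<partial>\<nu>) \<partial>Q)"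
      by (rule sigma_finite_measure.nn_integral_fst[OF nu_sigma_finite m, symmetric])
    also have "\<dots> = (\<integral>\<^sup>+\<omega>. (\<integral>\<^sup>+s\<in>{0..T}. (\<integral>\<^sup>+e. ?f ((\<omega>, s), e) \<partial>\<nu>) \<partial>lborel) \<partial>M)"
      by (rule nn_integral_Q[symmetric, OF sigma_finite_measure.borel_measurable_nn_integral_fst[OF nu_sigma_finite m]])
    finally show ?thesis by (simp add: val)
  qed
  then have L2: "L2_tendsto (Q \<Otimes>\<^sub>M \<nu>) (\<lambda>n x. \<Sum>e\<leftarrow>d n. NM.field_value mark_set e x) (\<lambda>x. K (snd (fst x)) (fst (fst x)) (snd x))"
    using c1 sq by (intro L2_tendstoI Km) simp_all
  have lim: "(\<lambda>n. \<integral>\<^sup>+\<omega>. ennreal ((J u \<omega> - NM.list_integral (d n) u \<omega>)\<^sup>2) \<partial>M) \<longlonglongrightarrow> 0" if u: "u \<in> {0..T}" for u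
  proof -
    have "(\<integral>\<^sup>+\<omega>. ennreal ((J u \<omega> - NM.list_integral (d n) u \<omega>)\<^sup>2) \<partial>M) = (\<integral>\<^sup>+\<omega>. ennreal ((J u \<omega> - simple_field_integral \<mu> \<nu> (c n) u \<omega>)\<^sup>2) \<partial>M)" for n
      using int[of u n] u by (intro nn_integral_cong_AE) auto
    then show ?thesis using c2[OF u] by simp
  qed
  have "NM.approximates d J t u" if "0 \<le> t" "t \<le> u" "u \<le> T" for t u
    using that valid by (intro NM.approximatesI JM lim) simp_all
  with valid L2 show ?thesis unfolding field_component_def by blast
qed

end

section \<open>The isometry for the full martingale part\<close>

context bsde_setting
begin

lemma scalar_component_diff:
  assumes "scalar_component a h J" "scalar_component a h' J'"
  shows "scalar_component a (\<lambda>s \<omega>. h s \<omega> - h' s \<omega>) (\<lambda>u \<omega>. J u \<omega> - J' u \<omega>)"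
proof -
  obtain c where c: "\<And>n e. e \<in> set (c n) \<Longrightarrow> NM.valid_entry e \<and> entry_atom e = a"
    "\<And>t u. 0 \<le> t \<Longrightarrow> t \<le> u \<Longrightarrow> u \<le> T \<Longrightarrow> NM.approximates c J t u"
    "L2_tendsto Q (\<lambda>n x. \<Sum>e\<leftarrow>c n. NM.scalar_value e x) (\<lambda>x. h (snd x) (fst x))"
    using assms(1) unfolding scalar_component_def by blast
  obtain c' where c': "\<And>n e. e \<in> set (c' n) \<Longrightarrow> NM.valid_entry e \<and> entry_atom e = a"
    "\<And>t u. 0 \<le> t \<Longrightarrow> t \<le> u \<Longrightarrow> u \<le> T \<Longrightarrow> NM.approximates c' J' t u"
    "L2_tendsto Q (\<lambda>n x. \<Sum>e\<leftarrow>c' n. NM.scalar_value e x) (\<lambda>x. h' (snd x) (fst x))"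
    using assms(2) unfolding scalar_component_def by blast
  define d where "d n = c n @ map NM.neg_entry (c' n)" for n
  have neg: "entry_atom (NM.neg_entry e) = entry_atom e" "NM.scalar_value (NM.neg_entry e) x = - NM.scalar_value e x" for e x
    by (simp_all add: entry_atom_def NM.neg_entry_def NM.scalar_value_def split: prod.splits)
  have valid: "NM.valid_entry e \<and> entry_atom e = a" if "e \<in> set (d n)" for n e
  proof -
    from that consider "e \<in> set (c n)" | e' where "e' \<in> set (c' n)" "e = NM.neg_entry e'"
      unfolding d_def set_append set_map by blast
    then show ?thesis
    proof cases
      case 1
      then show ?thesis by (rule c(1))
    next
      case (2 e')
      then show ?thesis using c'(1)[OF 2(1)] NM.valid_neg_entry[of e'] by (simp only: 2(2) neg(1))
    qed
  qed
  have "(\<Sum>e\<leftarrow>d n. NM.scalar_value e x) = (\<Sum>e\<leftarrow>c n. NM.scalar_value e x) - (\<Sum>e\<leftarrow>c' n. NM.scalar_value e x)" for n x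
    unfolding d_def by (simp add: o_def neg uminus_sum_list_map[unfolded o_def, symmetric])
  then have "L2_tendsto Q (\<lambda>n x. \<Sum>e\<leftarrow>d n. NM.scalar_value e x) (\<lambda>x. h (snd x) (fst x) - h' (snd x) (fst x))"
    using L2_tendsto_diff[OF c(3) c'(3)] by simp
  moreover have "NM.approximates d (\<lambda>u \<omega>. J u \<omega> - J' u \<omega>) t u" if "0 \<le> t" "t \<le> u" "u \<le> T" for t u
    unfolding d_def using NM.approximates_diff[OF c(2)[OF that] c'(2)[OF that]] .
  ultimately show ?thesis
    unfolding scalar_component_def using valid by blast
qed

lemma field_component_diff:
  assumes "field_component K J" "field_component K' J'"
  shows "field_component (\<lambda>s \<omega> e. K s \<omega> e - K' s \<omega> e) (\<lambda>u \<omega>. J u \<omega> - J' u \<omega>)"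
proof -
  obtain c where c: "\<And>n e. e \<in> set (c n) \<Longrightarrow> NM.valid_entry e \<and> entry_atom e \<in> range JM"
    "\<And>t u. 0 \<le> t \<Longrightarrow> t \<le> u \<Longrightarrow> u \<le> T \<Longrightarrow> NM.approximates c J t u"
    "L2_tendsto (Q \<Otimes>\<^sub>M \<nu>) (\<lambda>n x. \<Sum>e\<leftarrow>c n. NM.field_value mark_set e x) (\<lambda>x. K (snd (fst x)) (fst (fst x)) (snd x))"
    using assms(1) unfolding field_component_def by blast
  obtain c' where c': "\<And>n e. e \<in> set (c' n) \<Longrightarrow> NM.valid_entry e \<and> entry_atom e \<in> range JM"
    "\<And>t u. 0 \<le> t \<Longrightarrow> t \<le> u \<Longrightarrow> u \<le> T \<Longrightarrow> NM.approximates c' J' t u"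
    "L2_tendsto (Q \<Otimes>\<^sub>M \<nu>) (\<lambda>n x. \<Sum>e\<leftarrow>c' n. NM.field_value mark_set e x) (\<lambda>x. K' (snd (fst x)) (fst (fst x)) (snd x))"
    using assms(2) unfolding field_component_def by blast
  define d where "d n = c n @ map NM.neg_entry (c' n)" for n
  have neg: "entry_atom (NM.neg_entry e) = entry_atom e"
    "NM.field_value mark_set (NM.neg_entry e) x = - NM.field_value mark_set e x" for e x
    by (simp_all add: entry_atom_def NM.neg_entry_def NM.field_value_def split: prod.splits)
  have valid: "NM.valid_entry e \<and> entry_atom e \<in> range JM" if "e \<in> set (d n)" for n e
  proof -
    from that consider "e \<in> set (c n)" | e' where "e' \<in> set (c' n)" "e = NM.neg_entry e'"
      unfolding d_def set_append set_map by blast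
    then show ?thesis
    proof cases
      case 1
      then show ?thesis by (rule c(1))
    next
      case (2 e')
      then show ?thesis using c'(1)[OF 2(1)] NM.valid_neg_entry[of e'] by (simp only: 2(2) neg(1))
    qed
  qed
  have "(\<Sum>e\<leftarrow>d n. NM.field_value mark_set e x) = (\<Sum>e\<leftarrow>c n. NM.field_value mark_set e x) - (\<Sum>e\<leftarrow>c' n. NM.field_value mark_set e x)" for n x
    unfolding d_def by (simp add: o_def neg uminus_sum_list_map[unfolded o_def, symmetric])
  then have "L2_tendsto (Q \<Otimes>\<^sub>M \<nu>) (\<lambda>n x. \<Sum>e\<leftarrow>d n. NM.field_value mark_set e x)
      (\<lambda>x. K (snd (fst x)) (fst (fst x)) (snd x) - K' (snd (fst x)) (fst (fst x)) (snd x))"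
    using L2_tendsto_diff[OF c(3) c'(3)] by simp
  moreover have "NM.approximates d (\<lambda>u \<omega>. J u \<omega> - J' u \<omega>) t u" if "0 \<le> t" "t \<le> u" "u \<le> T" for t u
    unfolding d_def using NM.approximates_diff[OF c(2)[OF that] c'(2)[OF that]] .
  ultimately show ?thesis
    unfolding field_component_def using valid by blast
qed

section \<open>Isometries with a weight known at the left endpoint\<close>

context
  fixes t u :: real and w :: "'w \<Rightarrow> real"
  assumes tu: "0 \<le> t" "t \<le> u" "u \<le> T"
    and w: "w \<in> borel_measurable (filt t)" "\<And>\<omega>. \<bar>w \<omega>\<bar> \<le> 1"
begin

lemma wM: "w \<in> borel_measurable M"
  using NM.F_measurable_M[OF tu(1) w(1)] .

lemma interval_weight:
  "(\<lambda>x. w (fst x) * indicator {t<..u} (snd x)) \<in> borel_measurable Q"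
  "\<bar>w (fst x) * indicator {t<..u} (snd x)\<bar> \<le> 1"
proof -
  have "indicator {t<..u} \<in> borel_measurable tm"
    by (intro measurable_restrict_space1 borel_measurable_indicator) simp
  then show "(\<lambda>x. w (fst x) * indicator {t<..u} (snd x)) \<in> borel_measurable Q"
    by (intro borel_measurable_times measurable_compose[OF measurable_fst wM] measurable_compose[OF measurable_snd])
  show "\<bar>w (fst x) * indicator {t<..u} (snd x)\<bar> \<le> 1"
    using w(2)[of "fst x"] by (simp add: indicator_def)
qed

text \<open>The weight \<open>w\<close> makes this the isometry conditional on
  \<open>filt t\<close>. All entries carry the same atom, so its bracket is the rate.\<close>

lemma scalar_isometry:
  assumes "scalar_component a h J"
  shows "(\<integral>\<omega>. (w \<omega> * (J u \<omega> - J t \<omega>)) * (J u \<omega> - J t \<omega>) \<partial>M) =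
    noise_bracket a a * (\<integral>x. (w (fst x) * indicator {t<..u} (snd x)) * (h (snd x) (fst x))\<^sup>2 \<partial>Q)"
proof -
  obtain c where c: "\<And>n e. e \<in> set (c n) \<Longrightarrow> NM.valid_entry e \<and> entry_atom e = a"
    "NM.approximates c J t u"
    "L2_tendsto Q (\<lambda>n x. \<Sum>e\<leftarrow>c n. NM.scalar_value e x) (\<lambda>x. h (snd x) (fst x))"
    using assms tu unfolding scalar_component_def by blast
  have "(\<integral>\<omega>. (w \<omega> * (J u \<omega> - J t \<omega>)) * (J u \<omega> - J t \<omega>) \<partial>M) =
    noise_bracket a a * (\<integral>x. (w (fst x) * indicator {t<..u} (snd x) * h (snd x) (fst x)) * h (snd x) (fst x) \<partial>Q)"
  proof (rule NM.approximates_product[OF c(2,2) tu(1,2) w _ _ interval_weight c(3,3)])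
    show "entry_atom e = a" if "e \<in> set (c n)" for n e using c(1)[OF that] ..
    show "entry_atom e = a" if "e \<in> set (c n)" for n e using c(1)[OF that] ..
    fix s r a1 \<zeta> s' r' a2 \<zeta>'
    assume e: "NM.valid_entry (s, r, a1, \<zeta>)" "entry_atom (s, r, a1, \<zeta>) = a"
      "NM.valid_entry (s', r', a2, \<zeta>')" "entry_atom (s', r', a2, \<zeta>') = a"
    then have "a1 = a" "a2 = a" by (simp_all add: entry_atom_def)
    then show "integrable Q (\<lambda>x. w (fst x) * indicator {t<..u} (snd x) * NM.scalar_value (s, r, a1, \<zeta>) x * NM.scalar_value (s', r', a2, \<zeta>') x) \<and>
        noise_bracket a1 a2 * (\<integral>\<omega>. w \<omega> * \<zeta> \<omega> * \<zeta>' \<omega> \<partial>M) * measure lborel ({s<..r} \<inter> {s'<..r'} \<inter> {t<..u}) =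
        noise_bracket a a * (\<integral>x. w (fst x) * indicator {t<..u} (snd x) * NM.scalar_value (s, r, a1, \<zeta>) x * NM.scalar_value (s', r', a2, \<zeta>') x \<partial>Q)"
      using NM.scalar_value_product_integrable[OF e(1,3) tu wM w(2)] NM.scalar_value_product_integral[OF e(1,3) tu wM w(2)]
      by (simp only: mult.assoc simp_thms)
  qed
  then show ?thesis by (simp only: power2_eq_square mult.assoc)
qed

text \<open>Atoms vary within the lists here, so the bracket is not one constant rate; it is
  absorbed into the integral over marks, and Fubini then brings the marks inside.\<close>

lemma field_isometry:
  assumes "field_component K J"
  shows "(\<integral>\<omega>. (w \<omega> * (J u \<omega> - J t \<omega>)) * (J u \<omega> - J t \<omega>) \<partial>M) =
    (\<integral>x. (w (fst x) * indicator {t<..u} (snd x)) * (\<integral>e. (K (snd x) (fst x) e)\<^sup>2 \<partial>\<nu>) \<partial>Q)"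
proof -
  obtain c where c: "\<And>n e. e \<in> set (c n) \<Longrightarrow> NM.valid_entry e \<and> entry_atom e \<in> range JM"
    "NM.approximates c J t u"
    "L2_tendsto (Q \<Otimes>\<^sub>M \<nu>) (\<lambda>n x. \<Sum>e\<leftarrow>c n. NM.field_value mark_set e x) (\<lambda>x. K (snd (fst x)) (fst (fst x)) (snd x))"
    using assms tu unfolding field_component_def by blast
  let ?W = "\<lambda>x. w (fst x) * indicator {t<..u} (snd x)"
  let ?K = "\<lambda>x. K (snd (fst x)) (fst (fst x)) (snd x)"
  have "(\<integral>\<omega>. (w \<omega> * (J u \<omega> - J t \<omega>)) * (J u \<omega> - J t \<omega>) \<partial>M) =
    1 * (\<integral>x. (w (fst (fst x)) * indicator {t<..u} (snd (fst x)) * ?K x) * ?K x \<partial>(Q \<Otimes>\<^sub>M \<nu>))"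
  proof (rule NM.approximates_product[OF c(2,2) tu(1,2) w _ _ measurable_compose[OF measurable_fst interval_weight(1)] interval_weight(2) c(3,3)])
    show "entry_atom e \<in> range JM" if "e \<in> set (c n)" for n e using c(1)[OF that] ..
    show "entry_atom e \<in> range JM" if "e \<in> set (c n)" for n e using c(1)[OF that] ..
    fix s r a1 \<zeta> s' r' a2 \<zeta>'
    assume e: "NM.valid_entry (s, r, a1, \<zeta>)" "entry_atom (s, r, a1, \<zeta>) \<in> range JM"
      "NM.valid_entry (s', r', a2, \<zeta>')" "entry_atom (s', r', a2, \<zeta>') \<in> range JM"
    then have a: "a1 \<in> range JM" "a2 \<in> range JM" by (simp_all add: entry_atom_def)
    then have br: "noise_bracket a1 a2 = measure \<nu> (mark_set a1 \<inter> mark_set a2)"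
      by (auto simp: noise_bracket_def mark_set_def)
    note ms = atom_mark_set[OF e(1) a(1)] atom_mark_set(1)[OF e(3) a(2)]
    show "integrable (Q \<Otimes>\<^sub>M \<nu>) (\<lambda>x. w (fst (fst x)) * indicator {t<..u} (snd (fst x)) * NM.field_value mark_set (s, r, a1, \<zeta>) x * NM.field_value mark_set (s', r', a2, \<zeta>') x) \<and>
        noise_bracket a1 a2 * (\<integral>\<omega>. w \<omega> * \<zeta> \<omega> * \<zeta>' \<omega> \<partial>M) * measure lborel ({s<..r} \<inter> {s'<..r'} \<inter> {t<..u}) =
        1 * (\<integral>x. w (fst (fst x)) * indicator {t<..u} (snd (fst x)) * NM.field_value mark_set (s, r, a1, \<zeta>) x * NM.field_value mark_set (s', r', a2, \<zeta>') x \<partial>(Q \<Otimes>\<^sub>M \<nu>))"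
      using NM.field_value_product_integrable[OF e(1,3) tu wM w(2) nu_sigma_finite, of mark_set, OF ms]
        NM.field_value_product_integral[OF e(1,3) tu wM w(2) nu_sigma_finite, of mark_set, OF ms]
      unfolding br by (simp only: mult_1_left simp_thms)
  qed
  also have "\<dots> = (\<integral>x. ?W (fst x) * (?K x)\<^sup>2 \<partial>(Q \<Otimes>\<^sub>M \<nu>))"
    by (simp only: power2_eq_square mult.assoc mult_1_left)
  also have "\<dots> = (\<integral>y. \<integral>e. ?W y * (K (snd y) (fst y) e)\<^sup>2 \<partial>\<nu> \<partial>Q)"
  proof -
    interpret QN: pair_sigma_finite Q \<nu> by (rule pair_sigma_finite_Q_nu)
    have K: "?K \<in> borel_measurable (Q \<Otimes>\<^sub>M \<nu>)" "integrable (Q \<Otimes>\<^sub>M \<nu>) (\<lambda>x. (?K x)\<^sup>2)"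
      using c(3) unfolding L2_tendsto_def by blast+
    have "integrable (Q \<Otimes>\<^sub>M \<nu>) (\<lambda>x. ?W (fst x) * (?K x)\<^sup>2)"
    proof (rule Bochner_Integration.integrable_bound[OF K(2)])
      show "(\<lambda>x. ?W (fst x) * (?K x)\<^sup>2) \<in> borel_measurable (Q \<Otimes>\<^sub>M \<nu>)"
        by (intro borel_measurable_times borel_measurable_power K measurable_compose[OF measurable_fst interval_weight(1)])
      have "\<bar>?W (fst x)\<bar> * (?K x)\<^sup>2 \<le> 1 * (?K x)\<^sup>2" for x
        by (rule mult_right_mono[OF interval_weight(2)]) simp
      then show "AE x in Q \<Otimes>\<^sub>M \<nu>. norm (?W (fst x) * (?K x)\<^sup>2) \<le> norm ((?K x)\<^sup>2)"
        by (simp add: abs_mult)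
    qed
    from QN.integral_fst'[OF this] show ?thesis by simp
  qed
  finally show ?thesis by simp
qed

text \<open>\<open>JM {}\<close> is a placeholder index for the whole integral against
  \<open>\<mu>\<close>; with it the three parts of the martingale become one finite sum.\<close>

lemma components_sum:
  fixes f :: "('d, (real ^ 'q)) noise \<Rightarrow> real"
  shows "(\<Sum>k\<in>insert (JM {}) (range BM \<union> JN ` marks m). f k) =
    (\<Sum>i\<in>UNIV. f (BM i)) + (\<Sum>l\<in>marks m. f (JN l)) + f (JM {})"
proof -
  have fin: "finite (range (BM :: 'd \<Rightarrow> ('d, (real ^ 'q)) noise))" "finite (JN ` marks m :: ('d, (real ^ 'q)) noise set)"
    by (simp_all add: marks_def)
  have "JM {} \<notin> range BM \<union> JN ` marks m" by auto
  then have "(\<Sum>k\<in>insert (JM {}) (range BM \<union> JN ` marks m). f k) = f (JM {}) + (\<Sum>k\<in>range BM \<union> JN ` marks m. f k)"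
    using fin by (intro sum.insert) auto
  also have "(\<Sum>k\<in>range BM \<union> JN ` marks m. f k) = (\<Sum>k\<in>range BM. f k) + (\<Sum>k\<in>JN ` marks m. f k)"
    using fin by (intro sum.union_disjoint) auto
  also have "(\<Sum>k\<in>range BM. f k) = (\<Sum>i\<in>UNIV. f (BM i))"
    by (subst sum.reindex) (auto simp: inj_on_def)
  also have "(\<Sum>k\<in>JN ` marks m. f k) = (\<Sum>l\<in>marks m. f (JN l))"
    by (subst sum.reindex) (auto simp: inj_on_def)
  finally show ?thesis by simp
qed

text \<open>The square of the sum is expanded over all pairs of components. Off the diagonal the
  brackets of the atoms involved vanish; the diagonal is given by the isometries of the
  components.\<close>

lemma total_isometry:
  fixes Z :: "real \<Rightarrow> 'w \<Rightarrow> real ^ 'd"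
  assumes JB: "\<And>i. scalar_component (BM i) (\<lambda>s \<omega>. Z s \<omega> $ i) (JB i)"
    and JN: "\<And>l. l \<in> marks m \<Longrightarrow> scalar_component (JN l) (\<lambda>s \<omega>. H s \<omega> l) (Jn l)"
    and J\<mu>: "field_component K J\<mu>"
  defines "S \<equiv> \<lambda>\<omega>. (\<Sum>i\<in>UNIV. JB i u \<omega> - JB i t \<omega>) + (\<Sum>l\<in>marks m. Jn l u \<omega> - Jn l t \<omega>) + (J\<mu> u \<omega> - J\<mu> t \<omega>)"
  shows "S \<in> borel_measurable M" "integrable M (\<lambda>\<omega>. (S \<omega>)\<^sup>2)"
    "(\<integral>\<omega>. w \<omega> * (S \<omega>)\<^sup>2 \<partial>M) = (\<Sum>i\<in>UNIV. \<integral>x. (w (fst x) * indicator {t<..u} (snd x)) * (Z (snd x) (fst x) $ i)\<^sup>2 \<partial>Q) +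
      (\<Sum>l\<in>marks m. lam * (\<integral>x. (w (fst x) * indicator {t<..u} (snd x)) * (H (snd x) (fst x) l)\<^sup>2 \<partial>Q)) +
      (\<integral>x. (w (fst x) * indicator {t<..u} (snd x)) * (\<integral>e. (K (snd x) (fst x) e)\<^sup>2 \<partial>\<nu>) \<partial>Q)"
    "\<And>D. D \<in> borel_measurable (filt t) \<Longrightarrow> integrable M (\<lambda>\<omega>. (D \<omega>)\<^sup>2) \<Longrightarrow> (\<integral>\<omega>. D \<omega> * S \<omega> \<partial>M) = 0"
proof -
  define I where "I = insert (JM {}) (range BM \<union> JN ` marks m :: ('d, (real ^ 'q)) noise set)"
  define J where "J k = (case k of BM i \<Rightarrow> JB i | JN l \<Rightarrow> Jn l | JM A \<Rightarrow> J\<mu>)" for k :: "('d, (real ^ 'q)) noise"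
  \<comment> \<open>Atoms that the lists of a component may contain: only its own for
    \<open>BM\<close> and \<open>JN\<close>, any mark set for the \<open>\<mu>\<close> component,
    whatever set its index shows.\<close>
  define At where "At k = (case k of JM A \<Rightarrow> range JM | _ \<Rightarrow> {k})" for k :: "('d, (real ^ 'q)) noise"
  have finI: "finite I" by (simp add: I_def marks_def)
  have "\<exists>c. (\<forall>n. \<forall>e\<in>set (c n). entry_atom e \<in> At k) \<and> NM.approximates c (J k) t u" if "k \<in> I" for k
  proof -
    consider i where "k = BM i" | l where "k = JN l" "l \<in> marks m" | "k = JM {}"
      using \<open>k \<in> I\<close> unfolding I_def by blast
    then show ?thesis
    proof cases
      case (1 i)
      from JB[of i] tu obtain c where "\<forall>n. \<forall>e\<in>set (c n). NM.valid_entry e \<and> entry_atom e = BM i"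
        "NM.approximates c (JB i) t u" unfolding scalar_component_def by blast
      then show ?thesis unfolding 1 J_def At_def noise.case by blast
    next
      case (2 l)
      from JN[OF 2(2)] tu obtain c where "\<forall>n. \<forall>e\<in>set (c n). NM.valid_entry e \<and> entry_atom e = JN l"
        "NM.approximates c (Jn l) t u" unfolding scalar_component_def by blast
      then show ?thesis unfolding 2 J_def At_def noise.case by blast
    next
      case 3
      from J\<mu> tu obtain c where "\<forall>n. \<forall>e\<in>set (c n). NM.valid_entry e \<and> entry_atom e \<in> range JM"
        "NM.approximates c J\<mu> t u" unfolding field_component_def by blast
      then show ?thesis unfolding 3 J_def At_def noise.case by blast
    qed
  qed
  then obtain c where c: "\<And>k n e. k \<in> I \<Longrightarrow> e \<in> set (c k n) \<Longrightarrow> entry_atom e \<in> At k"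
    "\<And>k. k \<in> I \<Longrightarrow> NM.approximates (c k) (J k) t u"
    by metis
  define D where "D k \<omega> = J k u \<omega> - J k t \<omega>" for k \<omega>
  have D: "D k \<in> borel_measurable M" "integrable M (\<lambda>\<omega>. (D k \<omega>)\<^sup>2)" if "k \<in> I" for k
    using NM.approximates_square_integrable[OF c(2)[OF that]] unfolding D_def by blast+
  have S: "S = (\<lambda>\<omega>. \<Sum>k\<in>I. D k \<omega>)"
    unfolding S_def I_def components_sum by (simp add: D_def J_def)
  show SM: "S \<in> borel_measurable M" unfolding S using D by (intro borel_measurable_sum)
  have DD: "integrable M (\<lambda>\<omega>. D k \<omega> * D k' \<omega>)" if "k \<in> I" "k' \<in> I" for k k'
    using that by (intro integrable_mult_square_integrable D)
  have SS: "(S \<omega>)\<^sup>2 = (\<Sum>k\<in>I. \<Sum>k'\<in>I. D k \<omega> * D k' \<omega>)" for \<omega>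
    unfolding S power2_eq_square by (rule sum_product)
  show "integrable M (\<lambda>\<omega>. (S \<omega>)\<^sup>2)"
    unfolding SS using DD by (intro Bochner_Integration.integrable_sum)
  have wDD: "integrable M (\<lambda>\<omega>. (w \<omega> * D k \<omega>) * D k' \<omega>)" if "k \<in> I" "k' \<in> I" for k k'
    using NM.bounded_mult_integrable[OF wM w(2) DD[OF that]] by (simp only: mult.assoc)
  have cross: "(\<integral>\<omega>. (w \<omega> * D k \<omega>) * D k' \<omega> \<partial>M) = 0" if k: "k \<in> I" "k' \<in> I" "k \<noteq> k'" for k k'
    unfolding D_def
  proof (rule NM.approximates_cross[OF c(2)[OF k(1)] c(2)[OF k(2)] tu(1,2) w])
    show "a \<in> At k" if "(s, r, a, \<zeta>) \<in> set (c k n)" for n s r a \<zeta>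
      using c(1)[OF k(1) that] by (simp add: entry_atom_def)
    show "a \<in> At k'" if "(s, r, a, \<zeta>) \<in> set (c k' n)" for n s r a \<zeta>
      using c(1)[OF k(2) that] by (simp add: entry_atom_def)
    show "noise_bracket a b = 0" if "a \<in> At k" "b \<in> At k'" for a b
      using that k by (auto simp: At_def noise_bracket_def I_def split: noise.splits)
  qed
  have "(\<integral>\<omega>. w \<omega> * (S \<omega>)\<^sup>2 \<partial>M) = (\<integral>\<omega>. (\<Sum>k\<in>I. \<Sum>k'\<in>I. (w \<omega> * D k \<omega>) * D k' \<omega>) \<partial>M)"
    unfolding SS by (simp only: sum_distrib_left mult.assoc)
  also have "\<dots> = (\<Sum>k\<in>I. \<Sum>k'\<in>I. \<integral>\<omega>. (w \<omega> * D k \<omega>) * D k' \<omega> \<partial>M)"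
    using wDD by (rule integral_sum2)
  also have "\<dots> = (\<Sum>k\<in>I. \<integral>\<omega>. (w \<omega> * D k \<omega>) * D k \<omega> \<partial>M)"
  proof (rule sum.cong[OF refl])
    fix k assume k: "k \<in> I"
    have "(\<Sum>k'\<in>I. \<integral>\<omega>. (w \<omega> * D k \<omega>) * D k' \<omega> \<partial>M) = (\<Sum>k'\<in>I. if k' = k then \<integral>\<omega>. (w \<omega> * D k \<omega>) * D k \<omega> \<partial>M else 0)"
      using cross[OF k] by (intro sum.cong) auto
    then show "(\<Sum>k'\<in>I. \<integral>\<omega>. (w \<omega> * D k \<omega>) * D k' \<omega> \<partial>M) = (\<integral>\<omega>. (w \<omega> * D k \<omega>) * D k \<omega> \<partial>M)"
      using finI k by simp
  qed
  also have "\<dots> = (\<Sum>i\<in>UNIV. \<integral>x. (w (fst x) * indicator {t<..u} (snd x)) * (Z (snd x) (fst x) $ i)\<^sup>2 \<partial>Q) +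
      (\<Sum>l\<in>marks m. lam * (\<integral>x. (w (fst x) * indicator {t<..u} (snd x)) * (H (snd x) (fst x) l)\<^sup>2 \<partial>Q)) +
      (\<integral>x. (w (fst x) * indicator {t<..u} (snd x)) * (\<integral>e. (K (snd x) (fst x) e)\<^sup>2 \<partial>\<nu>) \<partial>Q)"
    unfolding I_def components_sum
  proof (intro arg_cong2[where f="(+)"] sum.cong refl)
    show "(\<integral>\<omega>. (w \<omega> * D (BM i) \<omega>) * D (BM i) \<omega> \<partial>M) = (\<integral>x. (w (fst x) * indicator {t<..u} (snd x)) * (Z (snd x) (fst x) $ i)\<^sup>2 \<partial>Q)" for i
      using scalar_isometry[OF JB[of i]] by (simp add: D_def J_def noise_bracket_def)
    show "(\<integral>\<omega>. (w \<omega> * D (JN l) \<omega>) * D (JN l) \<omega> \<partial>M) = lam * (\<integral>x. (w (fst x) * indicator {t<..u} (snd x)) * (H (snd x) (fst x) l)\<^sup>2 \<partial>Q)"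
      if "l \<in> marks m" for l
      using scalar_isometry[OF JN[OF that]] by (simp add: D_def J_def noise_bracket_def)
    show "(\<integral>\<omega>. (w \<omega> * D (JM {}) \<omega>) * D (JM {}) \<omega> \<partial>M) = (\<integral>x. (w (fst x) * indicator {t<..u} (snd x)) * (\<integral>e. (K (snd x) (fst x) e)\<^sup>2 \<partial>\<nu>) \<partial>Q)"
      using field_isometry[OF J\<mu>] by (simp add: D_def J_def)
  qed
  finally show "(\<integral>\<omega>. w \<omega> * (S \<omega>)\<^sup>2 \<partial>M) = (\<Sum>i\<in>UNIV. \<integral>x. (w (fst x) * indicator {t<..u} (snd x)) * (Z (snd x) (fst x) $ i)\<^sup>2 \<partial>Q) +
      (\<Sum>l\<in>marks m. lam * (\<integral>x. (w (fst x) * indicator {t<..u} (snd x)) * (H (snd x) (fst x) l)\<^sup>2 \<partial>Q)) +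
      (\<integral>x. (w (fst x) * indicator {t<..u} (snd x)) * (\<integral>e. (K (snd x) (fst x) e)\<^sup>2 \<partial>\<nu>) \<partial>Q)" .
  fix D' :: "'w \<Rightarrow> real" assume D': "D' \<in> borel_measurable (filt t)" "integrable M (\<lambda>\<omega>. (D' \<omega>)\<^sup>2)"
  have D'M: "D' \<in> borel_measurable M" using NM.F_measurable_M[OF tu(1) D'(1)] .
  have "(\<integral>\<omega>. D' \<omega> * S \<omega> \<partial>M) = (\<integral>\<omega>. (\<Sum>k\<in>I. D' \<omega> * D k \<omega>) \<partial>M)"
    unfolding S by (simp only: sum_distrib_left)
  also have "\<dots> = (\<Sum>k\<in>I. \<integral>\<omega>. D' \<omega> * D k \<omega> \<partial>M)"
    by (rule Bochner_Integration.integral_sum, rule integrable_mult_square_integrable[OF D'M D(1) D'(2) D(2)])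
  also have "\<dots> = 0"
    unfolding D_def using NM.approximates_orthogonal[OF c(2) tu(1,2) D'] by (intro sum.neutral) blast
  finally show "(\<integral>\<omega>. D' \<omega> * S \<omega> \<partial>M) = 0" .
qed

end

end

section \<open>Measurability of cadlag solutions\<close>

text \<open>For \<open>k = \<lfloor>(n + 1) * s\<rfloor>\<close> this point lies strictly to the right of \<open>s\<close> (or is \<open>T\<close>), so right-continuous
  paths sampled there converge to their value at \<open>s\<close>.\<close>

definition grid :: "real \<Rightarrow> nat \<Rightarrow> int \<Rightarrow> real"
  where "grid T n k = max 0 (min T ((real_of_int k + 1) / real (Suc n)))"

lemma grid_range: "0 \<le> T \<Longrightarrow> grid T n k \<in> {0..T}"
  by (auto simp: grid_def)

lemma grid_tendsto:
  assumes cad: "cadlag_on 0 T f" and s: "s \<in> {0..T}"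
  shows "(\<lambda>n. f (grid T n \<lfloor>s * real (Suc n)\<rfloor>)) \<longlonglongrightarrow> f s"
proof (cases "s = T")
  case True
  \<comment> \<open>At \<open>s = T\<close> no point to the right is available; clipping makes every
    grid point equal to \<open>T\<close>.\<close>
  have "grid T n \<lfloor>s * real (Suc n)\<rfloor> = T" for n
  proof -
    have "s * real (Suc n) \<le> real_of_int \<lfloor>s * real (Suc n)\<rfloor> + 1" by linarith
    then have "s \<le> (real_of_int \<lfloor>s * real (Suc n)\<rfloor> + 1) / real (Suc n)" by (simp add: pos_le_divide_eq del: of_nat_Suc)
    then show ?thesis using True s unfolding grid_def by (simp add: min_absorb1 max_absorb2)
  qed
  then show ?thesis using True by simp
next
  case False
  then have sT: "0 \<le> s" "s < T" using s by auto
  define g where "g n = (real_of_int \<lfloor>s * real (Suc n)\<rfloor> + 1) / real (Suc n)" for n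
  have lower: "s < g n" for n
  proof -
    have "s * real (Suc n) < real_of_int \<lfloor>s * real (Suc n)\<rfloor> + 1" by linarith
    then show ?thesis unfolding g_def by (simp add: pos_less_divide_eq del: of_nat_Suc)
  qed
  have upper: "g n \<le> s + 1 / real (Suc n)" for n
  proof -
    have "real_of_int \<lfloor>s * real (Suc n)\<rfloor> + 1 \<le> s * real (Suc n) + 1" by linarith
    then have "g n \<le> (s * real (Suc n) + 1) / real (Suc n)" unfolding g_def by (rule divide_right_mono) simp
    then show ?thesis by (simp add: add_divide_distrib del: of_nat_Suc)
  qed
  have grid_eq: "grid T n \<lfloor>s * real (Suc n)\<rfloor> = min T (g n)" for n
    using lower[of n] sT unfolding grid_def g_def[symmetric] by (simp add: max_absorb2)
  have lim0: "(\<lambda>n. 1 / real (Suc n)) \<longlonglongrightarrow> 0" using LIMSEQ_inverse_real_of_nat by (simp add: inverse_eq_divide)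
  have "(\<lambda>n. s + 1 / real (Suc n)) \<longlonglongrightarrow> s" using tendsto_add[OF tendsto_const[of s] lim0] by simp
  then have "(\<lambda>n. grid T n \<lfloor>s * real (Suc n)\<rfloor>) \<longlonglongrightarrow> s"
  proof (rule tendsto_sandwich[OF _ _ tendsto_const, rotated 2])
    show "\<forall>\<^sub>F n in sequentially. s \<le> grid T n \<lfloor>s * real (Suc n)\<rfloor>"
      unfolding grid_eq using lower sT by (intro always_eventually allI) (simp add: less_imp_le)
    show "\<forall>\<^sub>F n in sequentially. grid T n \<lfloor>s * real (Suc n)\<rfloor> \<le> s + 1 / real (Suc n)"
      unfolding grid_eq using upper by (intro always_eventually allI) (simp add: min.coboundedI2)
  qed
  \<comment> \<open>Right-continuity is a limit along \<open>at_right s\<close>, so the points must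
    differ from \<open>s\<close>.\<close>
  moreover have "s < grid T n \<lfloor>s * real (Suc n)\<rfloor>" for n
    unfolding grid_eq using lower sT by simp
  ultimately have "filterlim (\<lambda>n. grid T n \<lfloor>s * real (Suc n)\<rfloor>) (at_right s) sequentially"
    unfolding filterlim_at by (auto intro: always_eventually simp: less_imp_neq[THEN not_sym])
  moreover have "(f \<longlongrightarrow> f s) (at_right s)"
    using cad sT unfolding cadlag_on_def by auto
  ultimately show ?thesis by (rule filterlim_compose[rotated])
qed

text \<open>Completeness turns almost sure equality into measurability; this serves a function that
  is defined directly from the paths of the solutions.\<close>

lemma (in complete_measure) borel_measurable_AE_eq:
  fixes f g :: "'a \<Rightarrow> real"
  assumes f: "f \<in> borel_measurable M" and eq: "AE x in M. f x = g x"
  shows "g \<in> borel_measurable M"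
proof (rule measurableI)
  fix A :: "real set" assume A: "A \<in> sets borel"
  show "g -` A \<inter> space M \<in> sets M"
  proof (rule in_sets_AE)
    show "f -` A \<inter> space M \<in> sets M" by (rule measurable_sets[OF f A])
    show "AE x in M. x \<in> f -` A \<inter> space M \<longleftrightarrow> x \<in> g -` A \<inter> space M"
      using eq by eventually_elim auto
  qed simp
qed simp

context bsde_setting
begin

text \<open>Paths are cadlag only almost surely, so \<open>Y\<close> itself need not be jointly
  measurable. Sampling on grids gives jointly measurable processes, and their limit agrees with
  \<open>Y\<close> at all times for almost every scenario.\<close>

lemma cadlag_measurable_version:
  assumes Y: "\<And>s. s \<in> {0..T} \<Longrightarrow> Y s \<in> borel_measurable M"
    and cad: "AE \<omega> in M. cadlag_on 0 T (\<lambda>s. Y s \<omega>)"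
  obtains Y' where "Y' \<in> borel_measurable Q" "AE \<omega> in M. \<forall>s\<in>{0..T}. Y' (\<omega>, s) = Y s \<omega>"
proof -
  \<comment> \<open>For each \<open>n\<close> the sampling index takes countably many values, which
    reduces joint measurability to that of \<open>Y\<close> at fixed times.\<close>
  define X where "X n x = Y (grid T n \<lfloor>snd x * real (Suc n)\<rfloor>) (fst x)" for n and x :: "'w \<times> real"
  have snd_m: "snd \<in> borel_measurable Q"
    using measurable_compose[OF measurable_snd[of M tm] measurable_restrict_space1[of "\<lambda>x. x" lborel borel "{0..T}"]] by simp
  have "X n \<in> borel_measurable Q" for n
  proof -
    have "(\<lambda>x. \<lfloor>snd x * real (Suc n)\<rfloor>) \<in> measurable Q (count_space UNIV)"
      using snd_m by measurable
    moreover have "(\<lambda>x. Y (grid T n k) (fst x)) \<in> borel_measurable Q" for k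
      using measurable_compose[OF measurable_fst[of M tm] Y[OF grid_range]] T_pos by simp
    ultimately show ?thesis
      unfolding X_def[abs_def]
      using measurable_compose_countable[of "\<lambda>k x. Y (grid T n k) (fst x)" Q borel "\<lambda>x. \<lfloor>snd x * real (Suc n)\<rfloor>"] by simp
  qed
  then have m: "(\<lambda>x. lim (\<lambda>n. X n x)) \<in> borel_measurable Q" by (rule borel_measurable_lim_metric)
  have "AE \<omega> in M. \<forall>s\<in>{0..T}. lim (\<lambda>n. X n (\<omega>, s)) = Y s \<omega>"
    using cad
  proof eventually_elim
    case (elim \<omega>)
    then show ?case
      using grid_tendsto[OF elim] by (auto simp: X_def intro!: limI)
  qed
  with m show thesis by (rule that)
qed

lemma nn_integral_Q_snd:
  "f \<in> borel_measurable Q \<Longrightarrow> (\<integral>\<^sup>+x. f x \<partial>Q) = (\<integral>\<^sup>+s. \<integral>\<^sup>+\<omega>. f (\<omega>, s) \<partial>M \<partial>tm)"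
  using pair_sigma_finite.nn_integral_snd[OF pair_sigma_finite_Q, of f] by simp

text \<open>The supremum over an uncountable set of times is used through monotonicity of the
  nonnegative integral: its expectation bounds the second moment at each time, and a finite time
  interval then gives the bound on \<open>Q\<close>.\<close>

lemma sup_square_integrable:
  assumes Y: "\<And>s. s \<in> {0..T} \<Longrightarrow> Y s \<in> borel_measurable M"
    and Y': "Y' \<in> borel_measurable Q" "AE \<omega> in M. \<forall>s\<in>{0..T}. Y' (\<omega>, s) = Y s \<omega>"
    and sup: "(\<integral>\<^sup>+\<omega>. (SUP s\<in>{0..T}. ennreal ((Y s \<omega>)\<^sup>2)) \<partial>M) < \<infinity>"
  shows "integrable Q (\<lambda>x. (Y' x)\<^sup>2)" "\<And>s. s \<in> {0..T} \<Longrightarrow> integrable M (\<lambda>\<omega>. (Y s \<omega>)\<^sup>2)"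
proof -
  let ?c = "\<integral>\<^sup>+\<omega>. (SUP s\<in>{0..T}. ennreal ((Y s \<omega>)\<^sup>2)) \<partial>M"
  have le: "(\<integral>\<^sup>+\<omega>. ennreal ((Y s \<omega>)\<^sup>2) \<partial>M) \<le> ?c" if "s \<in> {0..T}" for s
    using that by (intro nn_integral_mono SUP_upper)
  show "integrable M (\<lambda>\<omega>. (Y s \<omega>)\<^sup>2)" if "s \<in> {0..T}" for s
    using le_less_trans[OF le[OF that] sup] Y[OF that] by (intro integrableI_nonneg) auto
  have m: "(\<lambda>x. ennreal ((Y' x)\<^sup>2)) \<in> borel_measurable Q" using Y'(1) by simp
  have "(\<integral>\<^sup>+x. ennreal ((Y' x)\<^sup>2) \<partial>Q) = (\<integral>\<^sup>+s. \<integral>\<^sup>+\<omega>. ennreal ((Y' (\<omega>, s))\<^sup>2) \<partial>M \<partial>tm)"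
    by (rule nn_integral_Q_snd[OF m])
  also have "\<dots> \<le> (\<integral>\<^sup>+s. ?c \<partial>tm)"
  proof (rule nn_integral_mono)
    fix s assume "s \<in> space tm"
    then have s: "s \<in> {0..T}" by (simp add: space_restrict_space)
    have "(\<integral>\<^sup>+\<omega>. ennreal ((Y' (\<omega>, s))\<^sup>2) \<partial>M) = (\<integral>\<^sup>+\<omega>. ennreal ((Y s \<omega>)\<^sup>2) \<partial>M)"
      using Y'(2) s by (intro nn_integral_cong_AE) (auto elim!: eventually_mono)
    then show "(\<integral>\<^sup>+\<omega>. ennreal ((Y' (\<omega>, s))\<^sup>2) \<partial>M) \<le> ?c" using le[OF s] by simp
  qed
  also have "\<dots> < \<infinity>"
  proof -
    have "emeasure tm (space tm) < \<infinity>"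
      using finite_measure.finite_emeasure_space[OF NM.finite_measure_time[of T]] by (simp add: top.not_eq_extremum)
    then show ?thesis using sup by (simp add: ennreal_mult_less_top)
  qed
  finally show "integrable Q (\<lambda>x. (Y' x)\<^sup>2)" using Y'(1) by (intro integrableI_nonneg) auto
qed

lemma square_integrable_Q:
  fixes h :: "real \<Rightarrow> 'w \<Rightarrow> real"
  assumes m: "(\<lambda>x. h (snd x) (fst x)) \<in> borel_measurable Q"
    and fin: "(\<integral>\<^sup>+\<omega>. (\<integral>\<^sup>+s\<in>{0..T}. ennreal ((h s \<omega>)\<^sup>2) \<partial>lborel) \<partial>M) < \<infinity>"
  shows "integrable Q (\<lambda>x. (h (snd x) (fst x))\<^sup>2)"
proof (rule integrableI_nonneg)
  have m2: "(\<lambda>x. ennreal ((h (snd x) (fst x))\<^sup>2)) \<in> borel_measurable Q" using m by simp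
  show "(\<lambda>x. (h (snd x) (fst x))\<^sup>2) \<in> borel_measurable Q" using m by simp
  show "(\<integral>\<^sup>+x. ennreal ((h (snd x) (fst x))\<^sup>2) \<partial>Q) < \<infinity>"
    using nn_integral_Q[OF m2] fin by simp
qed simp

lemma AE_time:
  assumes "AE x in Q. P x"
  shows "AE \<omega> in M. AE s in lborel. s \<in> {0..T} \<longrightarrow> P (\<omega>, s)"
  using pair_sigma_finite.AE_pair[OF pair_sigma_finite_Q assms]
  by (simp add: AE_restrict_space_iff)

text \<open>The Lipschitz condition speaks only about \<open>L2_fun\<close>; this lets it be applied
  to \<open>K s \<omega>\<close> at almost all times of almost every path.\<close>

lemma AE_L2_fun:
  fixes K :: "real \<Rightarrow> 'w \<Rightarrow> real ^ 'q \<Rightarrow> real"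
  assumes m: "(\<lambda>x. K (snd (fst x)) (fst (fst x)) (snd x)) \<in> borel_measurable (Q \<Otimes>\<^sub>M \<nu>)"
    and fin: "(\<integral>\<^sup>+\<omega>. (\<integral>\<^sup>+s\<in>{0..T}. (\<integral>\<^sup>+e. ennreal ((K s \<omega> e)\<^sup>2) \<partial>\<nu>) \<partial>lborel) \<partial>M) < \<infinity>"
  shows "AE \<omega> in M. AE s in lborel. s \<in> {0..T} \<longrightarrow> K s \<omega> \<in> L2_fun \<nu>"
proof -
  have m2: "(\<lambda>x. ennreal ((K (snd (fst x)) (fst (fst x)) (snd x))\<^sup>2)) \<in> borel_measurable (Q \<Otimes>\<^sub>M \<nu>)" using m by simp
  have m3: "(\<lambda>y. \<integral>\<^sup>+e. ennreal ((K (snd y) (fst y) e)\<^sup>2) \<partial>\<nu>) \<in> borel_measurable Q"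
    using sigma_finite_measure.borel_measurable_nn_integral_fst[OF nu_sigma_finite m2] by simp
  have "(\<integral>\<^sup>+y. (\<integral>\<^sup>+e. ennreal ((K (snd y) (fst y) e)\<^sup>2) \<partial>\<nu>) \<partial>Q) < \<infinity>"
    using nn_integral_Q[OF m3] fin by simp
  then have "AE y in Q. (\<integral>\<^sup>+e. ennreal ((K (snd y) (fst y) e)\<^sup>2) \<partial>\<nu>) \<noteq> \<infinity>"
    using m3 by (intro nn_integral_PInf_AE) auto
  then have "AE y in Q. K (snd y) (fst y) \<in> L2_fun \<nu>"
    using AE_space
  proof eventually_elim
    case (elim y)
    then show ?case
      using measurable_compose_Pair1[OF elim(2) m] by (simp add: L2_fun_def less_top)
  qed
  from AE_time[OF this] show ?thesis by simp
qed

end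

section \<open>The difference of two solutions\<close>

text \<open>Removing \<open>[u, T]\<close> from \<open>[t, T]\<close> leaves an interval that
  differs from \<open>(t, u]\<close> only at the two points \<open>t\<close> and \<open>u\<close>, a
  null set.\<close>

lemma lebesgue_integral_interval_diff:
  fixes f :: "real \<Rightarrow> real"
  assumes f: "set_integrable lebesgue {0..T} f" and tu: "0 \<le> t" "t \<le> u" "u \<le> T"
  shows "(LINT s:{t..T}|lebesgue. f s) - (LINT s:{u..T}|lebesgue. f s) = (LINT s:{t<..u}|lebesgue. f s)"
proof -
  have i: "integrable lebesgue (\<lambda>s. indicator A s * f s)" if "A \<in> sets lebesgue" "A \<subseteq> {0..T}" for A
    using set_integrable_subset[OF f that] unfolding set_integrable_def real_scaleR_def .
  have ne: "AE s in lebesgue. s \<noteq> t" "AE s in lebesgue. s \<noteq> u"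
    by (rule AE_completion[OF AE_lborel_singleton])+
  have "(\<integral>s. indicator {t..T} s * f s \<partial>lebesgue) - (\<integral>s. indicator {u..T} s * f s \<partial>lebesgue)
      = (\<integral>s. indicator {t..T} s * f s - indicator {u..T} s * f s \<partial>lebesgue)"
    by (rule Bochner_Integration.integral_diff[symmetric]; rule i) (use tu in simp_all)
  also have "\<dots> = (\<integral>s. indicator {t<..u} s * f s \<partial>lebesgue)"
  proof (rule integral_cong_AE)
    show "(\<lambda>s. indicator {t..T} s * f s - indicator {u..T} s * f s) \<in> borel_measurable lebesgue"
      by (rule borel_measurable_diff; rule borel_measurable_integrable[OF i]) (use tu in simp_all)
    show "(\<lambda>s. indicator {t<..u} s * f s) \<in> borel_measurable lebesgue"
      by (rule borel_measurable_integrable[OF i]) (use tu in auto)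
    show "AE s in lebesgue. indicator {t..T} s * f s - indicator {u..T} s * f s = indicator {t<..u} s * f s"
      using ne
    proof eventually_elim
      case (elim s)
      then consider "s < t" | "t < s" "s < u" | "u < s" by linarith
      then show ?case using tu by cases (simp_all add: indicator_def)
    qed
  qed
  finally show ?thesis by (simp add: set_lebesgue_integral_def)
qed

context bsde_setting
begin

text \<open>Half-open intervals make the integrals exactly additive over adjacent intervals, as the
  iteration requires.\<close>

definition weighted_integral :: "('w \<Rightarrow> real) \<Rightarrow> ('w \<times> real \<Rightarrow> real) \<Rightarrow> real \<Rightarrow> real \<Rightarrow> real"
  where "weighted_integral w q t u = (\<integral>x. (w (fst x) * indicator {t<..u} (snd x)) * q x \<partial>Q)"

definition time_integral :: "('w \<times> real \<Rightarrow> real) \<Rightarrow> real \<Rightarrow> real \<Rightarrow> 'w \<Rightarrow> real"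
  where "time_integral q t u \<omega> = (\<integral>s. indicator {t<..u} s * q (\<omega>, s) \<partial>tm)"

context
  fixes w :: "'w \<Rightarrow> real" and q :: "'w \<times> real \<Rightarrow> real"
  assumes w: "w \<in> borel_measurable M" "\<And>\<omega>. \<bar>w \<omega>\<bar> \<le> 1" and q: "integrable Q q"
begin

lemma weight_measurable: "(\<lambda>x. w (fst x) * indicator {t<..u} (snd x)) \<in> borel_measurable Q"
proof -
  have "indicator {t<..u} \<in> borel_measurable tm"
    by (intro measurable_restrict_space1 borel_measurable_indicator) simp
  then show ?thesis
    by (intro borel_measurable_times measurable_compose[OF measurable_fst w(1)] measurable_compose[OF measurable_snd])
qed

lemma weighted_integrable: "integrable Q (\<lambda>x. (w (fst x) * indicator {t<..u} (snd x)) * q x)"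
proof (rule Bochner_Integration.integrable_bound[OF q])
  show "(\<lambda>x. (w (fst x) * indicator {t<..u} (snd x)) * q x) \<in> borel_measurable Q"
    by (intro borel_measurable_times[OF weight_measurable] borel_measurable_integrable[OF q])
  have "\<bar>w (fst x) * indicator {t<..u} (snd x)\<bar> * \<bar>q x\<bar> \<le> 1 * \<bar>q x\<bar>" for x
    using w(2)[of "fst x"] by (intro mult_right_mono) (auto simp: indicator_def)
  then show "AE x in Q. norm ((w (fst x) * indicator {t<..u} (snd x)) * q x) \<le> norm (q x)"
    by (simp add: abs_mult)
qed

lemma weighted_integral_split:
  assumes "t \<le> s" "s \<le> u"
  shows "weighted_integral w q t u = weighted_integral w q t s + weighted_integral w q s u"
proof -
  have "(w (fst x) * indicator {t<..u} (snd x)) * q x = (w (fst x) * indicator {t<..s} (snd x)) * q x +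
      (w (fst x) * indicator {s<..u} (snd x)) * q x" for x
    using assms by (auto simp: indicator_def)
  then show ?thesis
    unfolding weighted_integral_def
    by (simp only: Bochner_Integration.integral_add[OF weighted_integrable weighted_integrable])
qed

lemma time_integral_integrable: "integrable M (time_integral q t u)"
  and weighted_time_integral: "(\<integral>\<omega>. w \<omega> * time_integral q t u \<omega> \<partial>M) = weighted_integral w q t u"
proof -
  interpret QP: pair_sigma_finite M tm by (rule pair_sigma_finite_Q)
  have "integrable Q (\<lambda>x. (1 * indicator {t<..u} (snd x)) * q x)"
  proof (rule Bochner_Integration.integrable_bound[OF q])
    have "indicator {t<..u} \<in> borel_measurable tm"
      by (intro measurable_restrict_space1 borel_measurable_indicator) simp
    then show "(\<lambda>x. (1 * indicator {t<..u} (snd x)) * q x) \<in> borel_measurable Q"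
      by (intro borel_measurable_times borel_measurable_const measurable_compose[OF measurable_snd] borel_measurable_integrable[OF q])
    show "AE x in Q. norm ((1 * indicator {t<..u} (snd x)) * q x) \<le> norm (q x)"
      by (intro AE_I2) (auto simp: indicator_def)
  qed
  from QP.integrable_fst'[OF this] show "integrable M (time_integral q t u)"
    by (simp add: time_integral_def[abs_def])
  have "(\<integral>\<omega>. w \<omega> * time_integral q t u \<omega> \<partial>M) = (\<integral>\<omega>. \<integral>s. (w \<omega> * indicator {t<..u} s) * q (\<omega>, s) \<partial>tm \<partial>M)"
    unfolding time_integral_def by (simp add: mult.assoc)
  then show "(\<integral>\<omega>. w \<omega> * time_integral q t u \<omega> \<partial>M) = weighted_integral w q t u"
    unfolding weighted_integral_def using QP.integral_fst'[OF weighted_integrable] by simp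
qed

lemma weighted_integral_nonneg:
  "(\<And>\<omega>. 0 \<le> w \<omega>) \<Longrightarrow> (\<And>x. 0 \<le> q x) \<Longrightarrow> 0 \<le> weighted_integral w q t u"
  unfolding weighted_integral_def by (intro Bochner_Integration.integral_nonneg) simp

text \<open>Fubini with time as the outer variable; this supplies the clause of
  \<open>backward_inequality\<close> that bounds \<open>W\<close> through a bound on
  \<open>y\<close>.\<close>

lemma weighted_integral_le:
  assumes tu: "0 \<le> t" "t \<le> u" "u \<le> T"
    and Z: "\<And>s. t \<le> s \<Longrightarrow> s \<le> u \<Longrightarrow> (\<integral>\<omega>. w \<omega> * q (\<omega>, s) \<partial>M) \<le> Z"
  shows "weighted_integral w q t u \<le> (u - t) * Z"
proof -
  interpret QP: pair_sigma_finite M tm by (rule pair_sigma_finite_Q)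
  have i: "integrable Q (\<lambda>(\<omega>, s). (w \<omega> * indicator {t<..u} s) * q (\<omega>, s))"
    using weighted_integrable[of t u] by (simp only: split_beta' prod.collapse)
  have sub: "{t<..u} \<subseteq> {0..T}" using tu by auto
  have ti: "integrable tm (indicator {t<..u} :: real \<Rightarrow> real)" "(\<integral>s. indicator {t<..u} s \<partial>tm) = u - t"
    by (rule NM.time_indicator(1)[OF sub], simp) (rule trans[OF NM.time_indicator(2)[OF sub]], use tu in simp_all)
  have "weighted_integral w q t u = (\<integral>s. (\<integral>\<omega>. (w \<omega> * indicator {t<..u} s) * q (\<omega>, s) \<partial>M) \<partial>tm)"
    unfolding weighted_integral_def using QP.integral_snd[OF i] by (simp only: split_beta' prod.collapse)
  also have "\<dots> \<le> (\<integral>s. indicator {t<..u} s * Z \<partial>tm)"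
  proof (rule integral_mono[OF QP.integrable_snd[OF i]])
    show "integrable tm (\<lambda>s. indicator {t<..u} s * Z)" using ti(1) by simp
    show "(\<integral>\<omega>. (w \<omega> * indicator {t<..u} s) * q (\<omega>, s) \<partial>M) \<le> indicator {t<..u} s * Z" for s
      using Z[of s] by (cases "s \<in> {t<..u}") auto
  qed
  also have "\<dots> = (u - t) * Z" unfolding integral_mult_left_zero ti(2) ..
  finally show ?thesis .
qed

end

lemma AE_time_integrable:
  fixes q :: "'w \<times> real \<Rightarrow> real"
  assumes "integrable Q q"
  shows "AE \<omega> in M. integrable tm (\<lambda>s. q (\<omega>, s))"
  using pair_sigma_finite.AE_integrable_fst'[OF pair_sigma_finite_Q assms] .

lemma tm_integral_lborel:
  fixes f :: "real \<Rightarrow> real"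
  assumes "0 \<le> t" "u \<le> T"
  shows "(\<integral>s. indicator {t<..u} s * f s \<partial>tm) = (LINT s:{t<..u}|lborel. f s)"
    and "integrable tm f \<Longrightarrow> set_integrable lborel {t<..u} f"
proof -
  have ind: "indicator {0..T} s *\<^sub>R (indicator {t<..u} s * f s) = indicator {t<..u} s *\<^sub>R f s" for s
    using assms by (auto simp: indicator_def)
  show "(\<integral>s. indicator {t<..u} s * f s \<partial>tm) = (LINT s:{t<..u}|lborel. f s)"
    unfolding set_lebesgue_integral_def by (subst integral_restrict_space) (simp_all only: ind, simp)
  assume "integrable tm f"
  then have "set_integrable lborel {0..T} f"
    unfolding set_integrable_def by (subst (asm) integrable_restrict_space) simp_all
  then show "set_integrable lborel {t<..u} f"
    by (rule set_integrable_subset) (use assms in auto)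
qed

end

section \<open>Two solutions with a common driver\<close>

locale bsde_pair = bsde_setting M B N \<mu> \<nu> lam m T
  for M :: "'w measure" and B :: "real \<Rightarrow> 'w \<Rightarrow> real ^ 'd::finite"
    and N :: "'w \<Rightarrow> (real \<times> nat) measure"
    and \<mu> :: "'w \<Rightarrow> (real \<times> (real ^ 'q::finite)) measure"
    and \<nu> :: "(real ^ 'q) measure"
    and lam :: real and m :: nat and T :: real +
  fixes L :: real
    and g :: "'w \<Rightarrow> real \<Rightarrow> real \<Rightarrow> (nat \<Rightarrow> real) \<Rightarrow> real ^ 'd \<Rightarrow> (real ^ 'q \<Rightarrow> real) \<Rightarrow> real"
    and \<phi>1 \<phi>2 Y1 Y2 :: "real \<Rightarrow> 'w \<Rightarrow> real" and \<xi>1 \<xi>2 :: "'w \<Rightarrow> real"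
    and H1 H2 :: "real \<Rightarrow> 'w \<Rightarrow> nat \<Rightarrow> real"
    and Z1 Z2 :: "real \<Rightarrow> 'w \<Rightarrow> real ^ 'd"
    and K1 K2 :: "real \<Rightarrow> 'w \<Rightarrow> real ^ 'q \<Rightarrow> real"
  assumes L_nonneg: "0 \<le> L"
    and lipschitz: "AE \<omega> in M. \<forall>t\<in>{0..T}. \<forall>y1 y2 h1 h2 z1 z2. \<forall>k1\<in>L2_fun \<nu>. \<forall>k2\<in>L2_fun \<nu>.
      \<bar>g \<omega> t y1 h1 z1 k1 - g \<omega> t y2 h2 z2 k2\<bar> \<le>
        L * (\<bar>y1 - y2\<bar> + L2_set (\<lambda>l. h1 l - h2 l) (marks m) + norm (z1 - z2)
              + L2_norm \<nu> (\<lambda>e. k1 e - k2 e))"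
    and \<phi>_prog: "progressive (noise_filtration M B N \<mu> \<nu> lam m) 0 T \<phi>1"
      "progressive (noise_filtration M B N \<mu> \<nu> lam m) 0 T \<phi>2"
    and \<phi>_L2: "(\<integral>\<^sup>+\<omega>. (\<integral>\<^sup>+s\<in>{0..T}. ennreal ((\<phi>1 s \<omega>)\<^sup>2) \<partial>lborel) \<partial>M) < \<infinity>"
      "(\<integral>\<^sup>+\<omega>. (\<integral>\<^sup>+s\<in>{0..T}. ennreal ((\<phi>2 s \<omega>)\<^sup>2) \<partial>lborel) \<partial>M) < \<infinity>"
    and sol: "bsde_solution M (noise_filtration M B N \<mu> \<nu> lam m) B N \<mu> \<nu> lam m T
        (\<lambda>\<omega> s y h z k. g \<omega> s y h z k + \<phi>1 s \<omega>) \<xi>1 Y1 H1 Z1 K1"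
      "bsde_solution M (noise_filtration M B N \<mu> \<nu> lam m) B N \<mu> \<nu> lam m T
        (\<lambda>\<omega> s y h z k. g \<omega> s y h z k + \<phi>2 s \<omega>) \<xi>2 Y2 H2 Z2 K2"
begin

text \<open>Passes from the definition of a solution to the form used below: joint measurability on
  \<open>Q\<close>, membership in \<open>L2_fun\<close>, and integrals as limits of entry
  lists.\<close>

lemma solution_facts:
  assumes "bsde_solution M filt B N \<mu> \<nu> lam m T f \<xi> Y H Z K"
  shows "\<And>s. s \<in> {0..T} \<Longrightarrow> Y s \<in> borel_measurable (filt s)"
    and "AE \<omega> in M. cadlag_on 0 T (\<lambda>s. Y s \<omega>)"
    and "(\<integral>\<^sup>+\<omega>. (SUP s\<in>{0..T}. ennreal ((Y s \<omega>)\<^sup>2)) \<partial>M) < \<infinity>"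
    and "\<And>l. l \<in> marks m \<Longrightarrow> (\<lambda>x. H (snd x) (fst x) l) \<in> borel_measurable Q"
    and "(\<lambda>x. Z (snd x) (fst x)) \<in> borel_measurable Q"
    and "(\<lambda>x. K (snd (fst x)) (fst (fst x)) (snd x)) \<in> borel_measurable (Q \<Otimes>\<^sub>M \<nu>)"
    and "AE \<omega> in M. AE s in lborel. s \<in> {0..T} \<longrightarrow> K s \<omega> \<in> L2_fun \<nu>"
    and "\<exists>JB Jn J\<mu>. (\<forall>i. scalar_component (BM i) (\<lambda>s \<omega>. Z s \<omega> $ i) (JB i)) \<and>
      (\<forall>l\<in>marks m. scalar_component (JN l) (\<lambda>s \<omega>. H s \<omega> l) (Jn l)) \<and> field_component K J\<mu> \<and>
      (AE \<omega> in M. set_integrable lebesgue {0..T} (\<lambda>s. f \<omega> s (Y s \<omega>) (H s \<omega>) (Z s \<omega>) (K s \<omega>)) \<and>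
        (\<forall>t\<in>{0..T}. Y t \<omega> =
           \<xi> \<omega> + (LINT s:{t..T}|lebesgue. f \<omega> s (Y s \<omega>) (H s \<omega>) (Z s \<omega>) (K s \<omega>))
           - (\<Sum>i\<in>UNIV. JB i T \<omega> - JB i t \<omega>)
           - (\<Sum>l\<in>marks m. Jn l T \<omega> - Jn l t \<omega>)
           - (J\<mu> T \<omega> - J\<mu> t \<omega>)))"
proof -
  have S2: "(Y, H, Z, K) \<in> S2 M filt \<nu> m 0 T" using assms unfolding bsde_solution_def by blast
  note S = S2[unfolded S2_def mem_Collect_eq prod.case]
  show "\<And>s. s \<in> {0..T} \<Longrightarrow> Y s \<in> borel_measurable (filt s)" using S by blast
  show "AE \<omega> in M. cadlag_on 0 T (\<lambda>s. Y s \<omega>)" using S by blast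
  show "(\<integral>\<^sup>+\<omega>. (SUP s\<in>{0..T}. ennreal ((Y s \<omega>)\<^sup>2)) \<partial>M) < \<infinity>" using S by blast
  show Hm: "(\<lambda>x. H (snd x) (fst x) l) \<in> borel_measurable Q" if "l \<in> marks m" for l
    by (rule predictable_on_measurable) (use S that in blast)
  show Zm: "(\<lambda>x. Z (snd x) (fst x)) \<in> borel_measurable Q"
    by (rule progressive_measurable) (use S in blast)
  show Km: "(\<lambda>x. K (snd (fst x)) (fst (fst x)) (snd x)) \<in> borel_measurable (Q \<Otimes>\<^sub>M \<nu>)"
    by (rule field_measurable) (use S in blast)
  show "AE \<omega> in M. AE s in lborel. s \<in> {0..T} \<longrightarrow> K s \<omega> \<in> L2_fun \<nu>"
    by (rule AE_L2_fun[OF Km]) (use S in blast)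
  obtain JB Jn J\<mu> where
    JB: "\<And>i. stochastic_integral M filt T (\<lambda>s \<omega>. B s \<omega> $ i) (\<lambda>s \<omega>. Z s \<omega> $ i) (JB i)"
    and Jn: "\<And>l. l \<in> marks m \<Longrightarrow> stochastic_integral M filt T (compensated_N N lam l) (\<lambda>s \<omega>. H s \<omega> l) (Jn l)"
    and J\<mu>: "compensated_integral M filt \<nu> T \<mu> K J\<mu>"
    and eq: "AE \<omega> in M. set_integrable lebesgue {0..T} (\<lambda>s. f \<omega> s (Y s \<omega>) (H s \<omega>) (Z s \<omega>) (K s \<omega>)) \<and>
        (\<forall>t\<in>{0..T}. Y t \<omega> =
           \<xi> \<omega> + (LINT s:{t..T}|lebesgue. f \<omega> s (Y s \<omega>) (H s \<omega>) (Z s \<omega>) (K s \<omega>))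
           - (\<Sum>i\<in>UNIV. JB i T \<omega> - JB i t \<omega>)
           - (\<Sum>l\<in>marks m. Jn l T \<omega> - Jn l t \<omega>)
           - (J\<mu> T \<omega> - J\<mu> t \<omega>))"
    using assms unfolding bsde_solution_def by blast
  have np: "noise_process (BM i) = (\<lambda>s \<omega>. B s \<omega> $ i)" "noise_process (JN l) = compensated_N N lam l" for i l
    by (simp_all add: fun_eq_iff noise_process_def)
  have "scalar_component (BM i) (\<lambda>s \<omega>. Z s \<omega> $ i) (JB i)" for i
  proof (rule stochastic_integral_component)
    show "stochastic_integral M filt T (noise_process (BM i)) (\<lambda>s \<omega>. Z s \<omega> $ i) (JB i)"
      unfolding np by (rule JB)
    show "BM i \<in> noise_atoms" by (simp add: noise_atoms_def)
    show "(\<lambda>x. Z (snd x) (fst x) $ i) \<in> borel_measurable Q"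
      using measurable_compose[OF Zm, of "\<lambda>z. z $ i" borel] by simp
  qed
  moreover have "scalar_component (JN l) (\<lambda>s \<omega>. H s \<omega> l) (Jn l)" if "l \<in> marks m" for l
  proof (rule stochastic_integral_component)
    show "stochastic_integral M filt T (noise_process (JN l)) (\<lambda>s \<omega>. H s \<omega> l) (Jn l)"
      unfolding np by (rule Jn[OF that])
    show "JN l \<in> noise_atoms" using that by (simp add: noise_atoms_def)
  qed (rule Hm[OF that])
  moreover have "field_component K J\<mu>" by (rule compensated_integral_component[OF J\<mu> Km])
  ultimately show "\<exists>JB Jn J\<mu>. (\<forall>i. scalar_component (BM i) (\<lambda>s \<omega>. Z s \<omega> $ i) (JB i)) \<and>
      (\<forall>l\<in>marks m. scalar_component (JN l) (\<lambda>s \<omega>. H s \<omega> l) (Jn l)) \<and> field_component K J\<mu> \<and>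
      (AE \<omega> in M. set_integrable lebesgue {0..T} (\<lambda>s. f \<omega> s (Y s \<omega>) (H s \<omega>) (Z s \<omega>) (K s \<omega>)) \<and>
        (\<forall>t\<in>{0..T}. Y t \<omega> =
           \<xi> \<omega> + (LINT s:{t..T}|lebesgue. f \<omega> s (Y s \<omega>) (H s \<omega>) (Z s \<omega>) (K s \<omega>))
           - (\<Sum>i\<in>UNIV. JB i T \<omega> - JB i t \<omega>)
           - (\<Sum>l\<in>marks m. Jn l T \<omega> - Jn l t \<omega>)
           - (J\<mu> T \<omega> - J\<mu> t \<omega>)))"
    using eq by blast
qed

text \<open>The weight \<open>lam\<close> is the bracket of a compensated count, so the integral of
  this function is the second moment of the difference of the martingale parts.\<close>

definition integrand_square :: "'w \<times> real \<Rightarrow> real"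
  where "integrand_square x = lam * (\<Sum>l\<in>marks m. (H1 (snd x) (fst x) l - H2 (snd x) (fst x) l)\<^sup>2)
    + (norm (Z1 (snd x) (fst x) - Z2 (snd x) (fst x)))\<^sup>2
    + (\<integral>e. (K1 (snd x) (fst x) e - K2 (snd x) (fst x) e)\<^sup>2 \<partial>\<nu>)"

definition forcing_square :: "'w \<times> real \<Rightarrow> real"
  where "forcing_square x = (\<phi>1 (snd x) (fst x) - \<phi>2 (snd x) (fst x))\<^sup>2"

definition drift :: "'w \<Rightarrow> real \<Rightarrow> real"
  where "drift \<omega> s = (g \<omega> s (Y1 s \<omega>) (H1 s \<omega>) (Z1 s \<omega>) (K1 s \<omega>) + \<phi>1 s \<omega>) -
    (g \<omega> s (Y2 s \<omega>) (H2 s \<omega>) (Z2 s \<omega>) (K2 s \<omega>) + \<phi>2 s \<omega>)"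

lemma integrand_square_nonneg: "0 \<le> integrand_square x"
  unfolding integrand_square_def using lam_pos
  by (intro add_nonneg_nonneg mult_nonneg_nonneg sum_nonneg zero_le_power2 Bochner_Integration.integral_nonneg) auto

lemma forcing_square_nonneg: "0 \<le> forcing_square x"
  by (simp add: forcing_square_def)

lemma forcing_square_integrable: "integrable Q forcing_square"
proof -
  have m: "(\<lambda>x. \<phi>1 (snd x) (fst x)) \<in> borel_measurable Q" "(\<lambda>x. \<phi>2 (snd x) (fst x)) \<in> borel_measurable Q"
    by (rule progressive_measurable, rule \<phi>_prog)+
  show ?thesis
    unfolding forcing_square_def[abs_def]
    by (intro square_integrable_diff m square_integrable_Q[OF m(1) \<phi>_L2(1)] square_integrable_Q[OF m(2) \<phi>_L2(2)])
qed

text \<open>Collects what the estimate uses of the difference of the martingale parts;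
  \<open>S t u\<close> is its increment over \<open>(t, u]\<close>. The weight \<open>w\<close>
  gives the isometry conditional on \<open>filt t\<close>, and orthogonality to square-integrable
  \<open>D\<close> removes the cross term.\<close>

lemma martingale_part:
  obtains S where
    "\<And>t u. 0 \<le> t \<Longrightarrow> t \<le> u \<Longrightarrow> u \<le> T \<Longrightarrow> S t u \<in> borel_measurable M"
    "\<And>t u. 0 \<le> t \<Longrightarrow> t \<le> u \<Longrightarrow> u \<le> T \<Longrightarrow> integrable M (\<lambda>\<omega>. (S t u \<omega>)\<^sup>2)"
    "\<And>t u w. 0 \<le> t \<Longrightarrow> t \<le> u \<Longrightarrow> u \<le> T \<Longrightarrow> w \<in> borel_measurable (filt t) \<Longrightarrow> (\<And>\<omega>. \<bar>w \<omega>\<bar> \<le> 1) \<Longrightarrow>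
      (\<integral>\<omega>. w \<omega> * (S t u \<omega>)\<^sup>2 \<partial>M) = weighted_integral w integrand_square t u"
    "\<And>t u D. 0 \<le> t \<Longrightarrow> t \<le> u \<Longrightarrow> u \<le> T \<Longrightarrow> D \<in> borel_measurable (filt t) \<Longrightarrow> integrable M (\<lambda>\<omega>. (D \<omega>)\<^sup>2) \<Longrightarrow>
      (\<integral>\<omega>. D \<omega> * S t u \<omega> \<partial>M) = 0"
    "\<And>t u. 0 \<le> t \<Longrightarrow> t \<le> u \<Longrightarrow> u \<le> T \<Longrightarrow> AE \<omega> in M. set_integrable lebesgue {0..T} (drift \<omega>) \<and>
      (Y1 t \<omega> - Y2 t \<omega>) + S t u \<omega> = (Y1 u \<omega> - Y2 u \<omega>) + (LINT s:{t<..u}|lebesgue. drift \<omega> s)"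
    "AE \<omega> in M. Y1 T \<omega> - Y2 T \<omega> = \<xi>1 \<omega> - \<xi>2 \<omega>"
    "integrable Q integrand_square"
proof -
  note f1 = solution_facts[OF sol(1)] and f2 = solution_facts[OF sol(2)]
  let ?g1 = "\<lambda>\<omega> s. g \<omega> s (Y1 s \<omega>) (H1 s \<omega>) (Z1 s \<omega>) (K1 s \<omega>) + \<phi>1 s \<omega>"
  let ?g2 = "\<lambda>\<omega> s. g \<omega> s (Y2 s \<omega>) (H2 s \<omega>) (Z2 s \<omega>) (K2 s \<omega>) + \<phi>2 s \<omega>"
  obtain JB1 Jn1 J\<mu>1 where J1: "\<And>i. scalar_component (BM i) (\<lambda>s \<omega>. Z1 s \<omega> $ i) (JB1 i)"
    "\<And>l. l \<in> marks m \<Longrightarrow> scalar_component (JN l) (\<lambda>s \<omega>. H1 s \<omega> l) (Jn1 l)" "field_component K1 J\<mu>1"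
    and e1: "AE \<omega> in M. set_integrable lebesgue {0..T} (?g1 \<omega>) \<and>
        (\<forall>t\<in>{0..T}. Y1 t \<omega> = \<xi>1 \<omega> + (LINT s:{t..T}|lebesgue. ?g1 \<omega> s)
           - (\<Sum>i\<in>UNIV. JB1 i T \<omega> - JB1 i t \<omega>) - (\<Sum>l\<in>marks m. Jn1 l T \<omega> - Jn1 l t \<omega>) - (J\<mu>1 T \<omega> - J\<mu>1 t \<omega>))"
    using f1(8) by blast
  obtain JB2 Jn2 J\<mu>2 where J2: "\<And>i. scalar_component (BM i) (\<lambda>s \<omega>. Z2 s \<omega> $ i) (JB2 i)"
    "\<And>l. l \<in> marks m \<Longrightarrow> scalar_component (JN l) (\<lambda>s \<omega>. H2 s \<omega> l) (Jn2 l)" "field_component K2 J\<mu>2"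
    and e2: "AE \<omega> in M. set_integrable lebesgue {0..T} (?g2 \<omega>) \<and>
        (\<forall>t\<in>{0..T}. Y2 t \<omega> = \<xi>2 \<omega> + (LINT s:{t..T}|lebesgue. ?g2 \<omega> s)
           - (\<Sum>i\<in>UNIV. JB2 i T \<omega> - JB2 i t \<omega>) - (\<Sum>l\<in>marks m. Jn2 l T \<omega> - Jn2 l t \<omega>) - (J\<mu>2 T \<omega> - J\<mu>2 t \<omega>))"
    using f2(8) by blast
  define JB where "JB i u \<omega> = JB1 i u \<omega> - JB2 i u \<omega>" for i u \<omega>
  define Jn where "Jn l u \<omega> = Jn1 l u \<omega> - Jn2 l u \<omega>" for l u \<omega>
  define J\<mu> where "J\<mu> u \<omega> = J\<mu>1 u \<omega> - J\<mu>2 u \<omega>" for u \<omega>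
  have cB: "scalar_component (BM i) (\<lambda>s \<omega>. (Z1 s \<omega> - Z2 s \<omega>) $ i) (JB i)" for i
    using scalar_component_diff[OF J1(1)[of i] J2(1)[of i]] unfolding JB_def[abs_def] by simp
  have cN: "scalar_component (JN l) (\<lambda>s \<omega>. (\<lambda>l. H1 s \<omega> l - H2 s \<omega> l) l) (Jn l)" if "l \<in> marks m" for l
    using scalar_component_diff[OF J1(2)[OF that] J2(2)[OF that]] unfolding Jn_def[abs_def] by simp
  have cM: "field_component (\<lambda>s \<omega> e. K1 s \<omega> e - K2 s \<omega> e) J\<mu>"
    using field_component_diff[OF J1(3) J2(3)] unfolding J\<mu>_def[abs_def] .
  define S where "S t u \<omega> = (\<Sum>i\<in>UNIV. JB i u \<omega> - JB i t \<omega>) + (\<Sum>l\<in>marks m. Jn l u \<omega> - Jn l t \<omega>) + (J\<mu> u \<omega> - J\<mu> t \<omega>)" for t u \<omega>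
  have S_eq: "S t u = (\<lambda>\<omega>. (\<Sum>i\<in>UNIV. JB i u \<omega> - JB i t \<omega>) + (\<Sum>l\<in>marks m. Jn l u \<omega> - Jn l t \<omega>) + (J\<mu> u \<omega> - J\<mu> t \<omega>))" for t u
    by (rule ext) (rule S_def)
  have iZ: "integrable Q (\<lambda>x. ((Z1 (snd x) (fst x) - Z2 (snd x) (fst x)) $ i)\<^sup>2)" for i
    using cB[of i] unfolding scalar_component_def L2_tendsto_def by blast
  have iH: "integrable Q (\<lambda>x. (H1 (snd x) (fst x) l - H2 (snd x) (fst x) l)\<^sup>2)" if "l \<in> marks m" for l
    using cN[OF that] unfolding scalar_component_def L2_tendsto_def by blast
  have iK: "integrable Q (\<lambda>x. \<integral>e. (K1 (snd x) (fst x) e - K2 (snd x) (fst x) e)\<^sup>2 \<partial>\<nu>)"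
  proof -
    have "integrable (Q \<Otimes>\<^sub>M \<nu>) (\<lambda>x. (K1 (snd (fst x)) (fst (fst x)) (snd x) - K2 (snd (fst x)) (fst (fst x)) (snd x))\<^sup>2)"
      using cM unfolding field_component_def L2_tendsto_def by blast
    from pair_sigma_finite.integrable_fst'[OF pair_sigma_finite_Q_nu this] show ?thesis by simp
  qed
  \<comment> \<open>The isometry is available coordinate by coordinate, so the Euclidean norm of the
    Brownian integrand is expanded.\<close>
  have normZ: "(norm (z :: real ^ 'd))\<^sup>2 = (\<Sum>i\<in>UNIV. (z $ i)\<^sup>2)" for z
    by (simp add: norm_vec_def L2_set_def sum_nonneg)
  have VV_eq: "integrand_square x = lam * (\<Sum>l\<in>marks m. (H1 (snd x) (fst x) l - H2 (snd x) (fst x) l)\<^sup>2)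
    + (\<Sum>i\<in>UNIV. ((Z1 (snd x) (fst x) - Z2 (snd x) (fst x)) $ i)\<^sup>2)
    + (\<integral>e. (K1 (snd x) (fst x) e - K2 (snd x) (fst x) e)\<^sup>2 \<partial>\<nu>)" for x
    unfolding integrand_square_def normZ ..
  have iV: "integrable Q integrand_square"
    unfolding VV_eq[abs_def] using iZ iH iK
    by (intro Bochner_Integration.integrable_add integrable_mult_right Bochner_Integration.integrable_sum)
  have iso: "(\<integral>\<omega>. w \<omega> * (S t u \<omega>)\<^sup>2 \<partial>M) = weighted_integral w integrand_square t u"
    if tu: "0 \<le> t" "t \<le> u" "u \<le> T" and w: "w \<in> borel_measurable (filt t)" "\<And>\<omega>. \<bar>w \<omega>\<bar> \<le> 1" for t u w
  proof -
    let ?W = "\<lambda>x. w (fst x) * indicator {t<..u} (snd x)"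
    note wi = weighted_integrable[OF wM[OF tu w] w(2)]
    have "weighted_integral w integrand_square t u = (\<integral>x. (\<Sum>i\<in>UNIV. ?W x * ((Z1 (snd x) (fst x) - Z2 (snd x) (fst x)) $ i)\<^sup>2) +
        (\<Sum>l\<in>marks m. lam * (?W x * (H1 (snd x) (fst x) l - H2 (snd x) (fst x) l)\<^sup>2)) +
        ?W x * (\<integral>e. (K1 (snd x) (fst x) e - K2 (snd x) (fst x) e)\<^sup>2 \<partial>\<nu>) \<partial>Q)"
      unfolding weighted_integral_def VV_eq sum_distrib_left[symmetric]
      by (intro Bochner_Integration.integral_cong refl) (simp only: ring_distribs ac_simps)
    also have "\<dots> = (\<Sum>i\<in>UNIV. \<integral>x. ?W x * ((Z1 (snd x) (fst x) - Z2 (snd x) (fst x)) $ i)\<^sup>2 \<partial>Q) +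
      (\<Sum>l\<in>marks m. \<integral>x. lam * (?W x * (H1 (snd x) (fst x) l - H2 (snd x) (fst x) l)\<^sup>2) \<partial>Q) +
      (\<integral>x. ?W x * (\<integral>e. (K1 (snd x) (fst x) e - K2 (snd x) (fst x) e)\<^sup>2 \<partial>\<nu>) \<partial>Q)"
    proof -
      have a: "integrable Q (\<lambda>x. ?W x * ((Z1 (snd x) (fst x) - Z2 (snd x) (fst x)) $ i)\<^sup>2)" for i
        by (rule wi[OF iZ])
      have b: "integrable Q (\<lambda>x. lam * (?W x * (H1 (snd x) (fst x) l - H2 (snd x) (fst x) l)\<^sup>2))" if "l \<in> marks m" for l
        by (rule integrable_mult_right, rule wi[OF iH[OF that]])
      have c: "integrable Q (\<lambda>x. ?W x * (\<integral>e. (K1 (snd x) (fst x) e - K2 (snd x) (fst x) e)\<^sup>2 \<partial>\<nu>))"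
        by (rule wi[OF iK])
      have as: "integrable Q (\<lambda>x. \<Sum>i\<in>UNIV. ?W x * ((Z1 (snd x) (fst x) - Z2 (snd x) (fst x)) $ i)\<^sup>2)"
        by (rule Bochner_Integration.integrable_sum[OF a])
      have bs: "integrable Q (\<lambda>x. \<Sum>l\<in>marks m. lam * (?W x * (H1 (snd x) (fst x) l - H2 (snd x) (fst x) l)\<^sup>2))"
        by (rule Bochner_Integration.integrable_sum[OF b])
      have sa: "(\<integral>x. (\<Sum>i\<in>UNIV. ?W x * ((Z1 (snd x) (fst x) - Z2 (snd x) (fst x)) $ i)\<^sup>2) \<partial>Q) =
          (\<Sum>i\<in>UNIV. \<integral>x. ?W x * ((Z1 (snd x) (fst x) - Z2 (snd x) (fst x)) $ i)\<^sup>2 \<partial>Q)"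
        by (rule Bochner_Integration.integral_sum[OF a])
      have sb: "(\<integral>x. (\<Sum>l\<in>marks m. lam * (?W x * (H1 (snd x) (fst x) l - H2 (snd x) (fst x) l)\<^sup>2)) \<partial>Q) =
          (\<Sum>l\<in>marks m. \<integral>x. lam * (?W x * (H1 (snd x) (fst x) l - H2 (snd x) (fst x) l)\<^sup>2) \<partial>Q)"
        by (rule Bochner_Integration.integral_sum[OF b])
      show ?thesis
        unfolding Bochner_Integration.integral_add[OF Bochner_Integration.integrable_add[OF as bs] c]
          Bochner_Integration.integral_add[OF as bs] sa sb ..
    qed
    also have "(\<Sum>l\<in>marks m. \<integral>x. lam * (?W x * (H1 (snd x) (fst x) l - H2 (snd x) (fst x) l)\<^sup>2) \<partial>Q) =
        (\<Sum>l\<in>marks m. lam * (\<integral>x. ?W x * (H1 (snd x) (fst x) l - H2 (snd x) (fst x) l)\<^sup>2 \<partial>Q))"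
      by simp
    finally show ?thesis
      using total_isometry(3)[OF tu w, of "\<lambda>s \<omega>. Z1 s \<omega> - Z2 s \<omega>" JB "\<lambda>s \<omega> l. H1 s \<omega> l - H2 s \<omega> l" Jn
          "\<lambda>s \<omega> e. K1 s \<omega> e - K2 s \<omega> e" J\<mu>, OF cB cN cM]
      unfolding S_eq by simp
  qed
  \<comment> \<open>The facts that involve no weight are read off from the isometry lemma with the
    constant weight 1.\<close>
  have w1: "(\<lambda>_. 1 :: real) \<in> borel_measurable (filt t)" "\<bar>1 :: real\<bar> \<le> 1" for t by simp_all
  show thesis
  proof (rule that[of S])
    fix t u assume tu: "0 \<le> t" "t \<le> u" "u \<le> T"
    show "S t u \<in> borel_measurable M" unfolding S_eq by (rule total_isometry(1)[OF tu w1 cB cN cM])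
    show "integrable M (\<lambda>\<omega>. (S t u \<omega>)\<^sup>2)" unfolding S_eq by (rule total_isometry(2)[OF tu w1 cB cN cM])
    show "(\<integral>\<omega>. D \<omega> * S t u \<omega> \<partial>M) = 0" if "D \<in> borel_measurable (filt t)" "integrable M (\<lambda>\<omega>. (D \<omega>)\<^sup>2)" for D
      unfolding S_eq by (rule total_isometry(4)[OF tu w1 cB cN cM that])
    show "AE \<omega> in M. set_integrable lebesgue {0..T} (drift \<omega>) \<and>
      (Y1 t \<omega> - Y2 t \<omega>) + S t u \<omega> = (Y1 u \<omega> - Y2 u \<omega>) + (LINT s:{t<..u}|lebesgue. drift \<omega> s)"
      using e1 e2
    proof eventually_elim
      case (elim \<omega>)
      have i: "set_integrable lebesgue {0..T} (?g1 \<omega>)" "set_integrable lebesgue {0..T} (?g2 \<omega>)" using elim by blast+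
      have d: "drift \<omega> = (\<lambda>s. ?g1 \<omega> s - ?g2 \<omega> s)" by (simp add: fun_eq_iff drift_def)
      have "set_integrable lebesgue {0..T} (drift \<omega>)"
        unfolding d by (rule set_integral_diff(1)[OF i])
      have tuT: "{t<..u} \<subseteq> {0..T}" using tu by auto
      have i': "set_integrable lebesgue {t<..u} (?g1 \<omega>)" "set_integrable lebesgue {t<..u} (?g2 \<omega>)"
        by (rule set_integrable_subset[OF _ _ tuT]; (rule i | simp))+
      have dint: "(LINT s:{t<..u}|lebesgue. drift \<omega> s) = (LINT s:{t<..u}|lebesgue. ?g1 \<omega> s) - (LINT s:{t<..u}|lebesgue. ?g2 \<omega> s)"
        unfolding d by (rule set_integral_diff(2)[OF i'])
      \<comment> \<open>Subtracting the equations at \<open>t\<close> and \<open>u\<close> cancels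
        the terminal value and all integrals over \<open>(u, T]\<close>, which leaves the identity
        over \<open>(t, u]\<close>.\<close>
      note l1 = lebesgue_integral_interval_diff[OF i(1) tu] and l2 = lebesgue_integral_interval_diff[OF i(2) tu]
      have "t \<in> {0..T}" "u \<in> {0..T}" using tu by auto
      then have y: "Y1 t \<omega> = \<xi>1 \<omega> + (LINT s:{t..T}|lebesgue. ?g1 \<omega> s)
           - (\<Sum>i\<in>UNIV. JB1 i T \<omega> - JB1 i t \<omega>) - (\<Sum>l\<in>marks m. Jn1 l T \<omega> - Jn1 l t \<omega>) - (J\<mu>1 T \<omega> - J\<mu>1 t \<omega>)"
         "Y1 u \<omega> = \<xi>1 \<omega> + (LINT s:{u..T}|lebesgue. ?g1 \<omega> s)
           - (\<Sum>i\<in>UNIV. JB1 i T \<omega> - JB1 i u \<omega>) - (\<Sum>l\<in>marks m. Jn1 l T \<omega> - Jn1 l u \<omega>) - (J\<mu>1 T \<omega> - J\<mu>1 u \<omega>)"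
         "Y2 t \<omega> = \<xi>2 \<omega> + (LINT s:{t..T}|lebesgue. ?g2 \<omega> s)
           - (\<Sum>i\<in>UNIV. JB2 i T \<omega> - JB2 i t \<omega>) - (\<Sum>l\<in>marks m. Jn2 l T \<omega> - Jn2 l t \<omega>) - (J\<mu>2 T \<omega> - J\<mu>2 t \<omega>)"
         "Y2 u \<omega> = \<xi>2 \<omega> + (LINT s:{u..T}|lebesgue. ?g2 \<omega> s)
           - (\<Sum>i\<in>UNIV. JB2 i T \<omega> - JB2 i u \<omega>) - (\<Sum>l\<in>marks m. Jn2 l T \<omega> - Jn2 l u \<omega>) - (J\<mu>2 T \<omega> - J\<mu>2 u \<omega>)"
        using elim by blast+
      have "(Y1 t \<omega> - Y2 t \<omega>) + S t u \<omega> = (Y1 u \<omega> - Y2 u \<omega>) + (LINT s:{t<..u}|lebesgue. drift \<omega> s)"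
        unfolding y dint l1[symmetric] l2[symmetric] S_def JB_def Jn_def J\<mu>_def sum_subtractf by simp
      then show ?case using \<open>set_integrable lebesgue {0..T} (drift \<omega>)\<close> by blast
    qed
  next
    show "AE \<omega> in M. Y1 T \<omega> - Y2 T \<omega> = \<xi>1 \<omega> - \<xi>2 \<omega>"
      using e1 e2
    proof eventually_elim
      case (elim \<omega>)
      have z: "(LINT s:{T..T}|lebesgue. f s) = 0" for f :: "real \<Rightarrow> real"
      proof -
        have "AE s in lebesgue. s \<noteq> T" by (rule AE_completion[OF AE_lborel_singleton])
        then have "AE s in lebesgue. indicator {T..T} s *\<^sub>R f s = 0" by eventually_elim auto
        then show ?thesis unfolding set_lebesgue_integral_def by (rule integral_eq_zero_AE)
      qed
      have "T \<in> {0..T}" using T_pos by auto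
      with elim have "Y1 T \<omega> = \<xi>1 \<omega> + (LINT s:{T..T}|lebesgue. ?g1 \<omega> s)
           - (\<Sum>i\<in>UNIV. JB1 i T \<omega> - JB1 i T \<omega>) - (\<Sum>l\<in>marks m. Jn1 l T \<omega> - Jn1 l T \<omega>) - (J\<mu>1 T \<omega> - J\<mu>1 T \<omega>)"
        "Y2 T \<omega> = \<xi>2 \<omega> + (LINT s:{T..T}|lebesgue. ?g2 \<omega> s)
           - (\<Sum>i\<in>UNIV. JB2 i T \<omega> - JB2 i T \<omega>) - (\<Sum>l\<in>marks m. Jn2 l T \<omega> - Jn2 l T \<omega>) - (J\<mu>2 T \<omega> - J\<mu>2 T \<omega>)"
        by blast+
      then show ?case unfolding z by simp
    qed
  qed (fact iso, fact iV)
qed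

end

section \<open>Drift estimate and backward inequality\<close>

context bsde_pair
begin

abbreviation (input) drift_bound :: real
  where "drift_bound \<equiv> 5 * (1 + L\<^sup>2 * (1 + 1 / lam))"

text \<open>The Lipschitz bound on the driver plus the difference of the forcing terms, squared by
  \<open>five_term_square\<close>; the five squares reassemble into the energy.\<close>

lemma drift_square_le:
  assumes lip: "\<forall>t\<in>{0..T}. \<forall>y1 y2 h1 h2 z1 z2. \<forall>k1\<in>L2_fun \<nu>. \<forall>k2\<in>L2_fun \<nu>.
      \<bar>g \<omega> t y1 h1 z1 k1 - g \<omega> t y2 h2 z2 k2\<bar> \<le>
        L * (\<bar>y1 - y2\<bar> + L2_set (\<lambda>l. h1 l - h2 l) (marks m) + norm (z1 - z2)
              + L2_norm \<nu> (\<lambda>e. k1 e - k2 e))"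
    and s: "s \<in> {0..T}" and k: "K1 s \<omega> \<in> L2_fun \<nu>" "K2 s \<omega> \<in> L2_fun \<nu>"
  shows "(drift \<omega> s)\<^sup>2 \<le> drift_bound * ((Y1 s \<omega> - Y2 s \<omega>)\<^sup>2 + integrand_square (\<omega>, s) + forcing_square (\<omega>, s))"
proof -
  let ?a = "\<bar>Y1 s \<omega> - Y2 s \<omega>\<bar>" and ?b = "L2_set (\<lambda>l. H1 s \<omega> l - H2 s \<omega> l) (marks m)"
    and ?c = "norm (Z1 s \<omega> - Z2 s \<omega>)" and ?d = "L2_norm \<nu> (\<lambda>e. K1 s \<omega> e - K2 s \<omega> e)"
    and ?e = "\<bar>\<phi>1 s \<omega> - \<phi>2 s \<omega>\<bar>"
  have "\<bar>g \<omega> s (Y1 s \<omega>) (H1 s \<omega>) (Z1 s \<omega>) (K1 s \<omega>) - g \<omega> s (Y2 s \<omega>) (H2 s \<omega>) (Z2 s \<omega>) (K2 s \<omega>)\<bar>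
      \<le> L * (?a + ?b + ?c + ?d)"
    using lip s k by blast
  then have "\<bar>drift \<omega> s\<bar> \<le> L * (?a + ?b + ?c + ?d) + ?e"
    unfolding drift_def by (rule order_trans[OF abs_diff_triangle_ineq add_right_mono])
  then have "\<bar>drift \<omega> s\<bar>\<^sup>2 \<le> (L * (?a + ?b + ?c + ?d) + ?e)\<^sup>2" by (rule power_mono) simp
  also have "\<dots> \<le> drift_bound * (?a\<^sup>2 + (lam * ?b\<^sup>2 + ?c\<^sup>2 + ?d\<^sup>2) + ?e\<^sup>2)"
    by (rule five_term_square[OF L_nonneg lam_pos])
  also have "?b\<^sup>2 = (\<Sum>l\<in>marks m. (H1 s \<omega> l - H2 s \<omega> l)\<^sup>2)"
    by (simp add: L2_set_def sum_nonneg)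
  also have "?d\<^sup>2 = (\<integral>e. (K1 s \<omega> e - K2 s \<omega> e)\<^sup>2 \<partial>\<nu>)"
    by (simp add: L2_norm_def)
  finally show ?thesis by (simp only: power2_abs integrand_square_def forcing_square_def fst_conv snd_conv)
qed

context
  fixes Y' :: "'w \<times> real \<Rightarrow> real"
  assumes Y': "Y' \<in> borel_measurable Q" "AE \<omega> in M. \<forall>s\<in>{0..T}. Y' (\<omega>, s) = Y1 s \<omega> - Y2 s \<omega>"
    and Y'2: "integrable Q (\<lambda>x. (Y' x)\<^sup>2)"
begin

text \<open>Majorant of the squared drift, built from the measurable version \<open>Y'\<close> so
  that Fubini applies on \<open>Q\<close>.\<close>

definition rate :: "'w \<times> real \<Rightarrow> real"
  where "rate x = drift_bound * ((Y' x)\<^sup>2 + integrand_square x + forcing_square x)"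

lemma rate_nonneg: "0 \<le> rate x"
  unfolding rate_def using integrand_square_nonneg[of x] forcing_square_nonneg[of x] lam_pos by simp

text \<open>Pathwise Cauchy--Schwarz in time. Exceptional sets occur on two levels: scenarios where
  the Lipschitz condition or the agreement of \<open>Y'\<close> with the solutions fails, and, in
  the remaining scenarios, times at which a mark integrand leaves \<open>L2_fun\<close>.\<close>

lemma drift_integral_square_le:
  assumes integrand_square: "integrable Q integrand_square" and tu: "0 \<le> t" "t \<le> u" "u \<le> T"
  shows "AE \<omega> in M. set_integrable lebesgue {0..T} (drift \<omega>) \<longrightarrow>
    (LINT s:{t<..u}|lebesgue. drift \<omega> s)\<^sup>2 \<le> (u - t) * time_integral rate t u \<omega>"
proof -
  have "integrable Q rate"
    unfolding rate_def[abs_def] using Y'2 integrand_square forcing_square_integrable by simp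
  from AE_time_integrable[OF this] lipschitz solution_facts(7)[OF sol(1)] solution_facts(7)[OF sol(2)] Y'(2)
  show ?thesis
  proof eventually_elim
    case (elim \<omega>)
    note lip = elim(2) and Y'_eq = elim(5)
    show ?case
    proof
      assume d: "set_integrable lebesgue {0..T} (drift \<omega>)"
      have tuT: "{t<..u} \<subseteq> {0..T}" using tu by auto
      have "(LINT s:{t<..u}|lebesgue. drift \<omega> s)\<^sup>2 \<le> (u - t) * (LINT s:{t<..u}|lborel. rate (\<omega>, s))"
      proof (rule lebesgue_integral_square_le[OF tu(2)])
        show "set_integrable lebesgue {t<..u} (drift \<omega>)"
          by (rule set_integrable_subset[OF d _ tuT]) simp
        show "set_integrable lborel {t<..u} (\<lambda>s. rate (\<omega>, s))"
          by (rule tm_integral_lborel(2)[OF tu(1,3) elim(1)])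
        show "AE s in lborel. s \<in> {t<..u} \<longrightarrow> (drift \<omega> s)\<^sup>2 \<le> rate (\<omega>, s)"
          using elim(3,4)
        proof eventually_elim
          case (elim s)
          note K = elim
          show ?case
          proof
            assume "s \<in> {t<..u}"
            then have s: "s \<in> {0..T}" using tuT by blast
            have "Y' (\<omega>, s) = Y1 s \<omega> - Y2 s \<omega>" using Y'_eq s by blast
            then show "(drift \<omega> s)\<^sup>2 \<le> rate (\<omega>, s)"
              unfolding rate_def
              using drift_square_le[OF lip s] K s by (simp only: mp)
          qed
        qed
      qed (rule rate_nonneg)
      then show "(LINT s:{t<..u}|lebesgue. drift \<omega> s)\<^sup>2 \<le> (u - t) * time_integral rate t u \<omega>"
        unfolding time_integral_def tm_integral_lborel(1)[OF tu(1,3)] .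
    qed
  qed
qed

text \<open>An event of \<open>filt t0\<close> is known at every later \<open>t\<close>, so one and
  the same event serves all intervals of the iteration; this is why the starting time is a parameter
  of \<open>backward_inequality\<close>.\<close>

lemma backward_inequality_pair:
  assumes sq: "\<And>s. s \<in> {0..T} \<Longrightarrow> integrable M (\<lambda>\<omega>. (Y1 s \<omega> - Y2 s \<omega>)\<^sup>2)"
    and t0: "0 \<le> t0" "t0 \<le> T" and A: "A \<in> sets (filt t0)"
  shows "backward_inequality drift_bound t0 T (\<lambda>s. \<integral>\<omega>. indicator A \<omega> * (Y1 s \<omega> - Y2 s \<omega>)\<^sup>2 \<partial>M)
    (weighted_integral (indicator A) (\<lambda>x. (Y' x)\<^sup>2)) (weighted_integral (indicator A) integrand_square)
    (weighted_integral (indicator A) forcing_square)"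
proof (rule martingale_part)
  let ?w = "indicator A :: 'w \<Rightarrow> real" and ?Y = "\<lambda>s \<omega>. Y1 s \<omega> - Y2 s \<omega>"
  fix S assume S:
    "\<And>t u. 0 \<le> t \<Longrightarrow> t \<le> u \<Longrightarrow> u \<le> T \<Longrightarrow> S t u \<in> borel_measurable M"
    "\<And>t u. 0 \<le> t \<Longrightarrow> t \<le> u \<Longrightarrow> u \<le> T \<Longrightarrow> integrable M (\<lambda>\<omega>. (S t u \<omega>)\<^sup>2)"
    "\<And>t u w. 0 \<le> t \<Longrightarrow> t \<le> u \<Longrightarrow> u \<le> T \<Longrightarrow> w \<in> borel_measurable (filt t) \<Longrightarrow> (\<And>\<omega>. \<bar>w \<omega>\<bar> \<le> 1) \<Longrightarrow>
      (\<integral>\<omega>. w \<omega> * (S t u \<omega>)\<^sup>2 \<partial>M) = weighted_integral w integrand_square t u"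
    "\<And>t u D. 0 \<le> t \<Longrightarrow> t \<le> u \<Longrightarrow> u \<le> T \<Longrightarrow> D \<in> borel_measurable (filt t) \<Longrightarrow> integrable M (\<lambda>\<omega>. (D \<omega>)\<^sup>2) \<Longrightarrow>
      (\<integral>\<omega>. D \<omega> * S t u \<omega> \<partial>M) = 0"
    "\<And>t u. 0 \<le> t \<Longrightarrow> t \<le> u \<Longrightarrow> u \<le> T \<Longrightarrow> AE \<omega> in M. set_integrable lebesgue {0..T} (drift \<omega>) \<and>
      (Y1 t \<omega> - Y2 t \<omega>) + S t u \<omega> = (Y1 u \<omega> - Y2 u \<omega>) + (LINT s:{t<..u}|lebesgue. drift \<omega> s)"
    "AE \<omega> in M. Y1 T \<omega> - Y2 T \<omega> = \<xi>1 \<omega> - \<xi>2 \<omega>"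
    and integrand_square: "integrable Q integrand_square"
  have AM: "A \<in> events" using A filt_events by blast
  have wM: "?w \<in> borel_measurable M" using AM by simp
  have w1: "\<bar>?w \<omega>\<bar> \<le> 1" for \<omega> by (simp add: indicator_def)
  have w0: "0 \<le> ?w \<omega>" for \<omega> by simp
  have YF: "?Y s \<in> borel_measurable (filt s)" if "s \<in> {0..T}" for s
    using solution_facts(1)[OF sol(1) that] solution_facts(1)[OF sol(2) that] by simp
  have YM: "?Y s \<in> borel_measurable M" if "s \<in> {0..T}" for s
    using measurable_from_subalg[OF subalgebra_filt YF[OF that]] .
  have rate: "integrable Q rate"
    unfolding rate_def[abs_def] using Y'2 integrand_square forcing_square_integrable by simp
  have wi: "integrable M (\<lambda>\<omega>. ?w \<omega> * f \<omega>)" if "integrable M f" for f :: "'w \<Rightarrow> real"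
    using integrable_mult_indicator[OF AM that] by simp
  have ineq: "(\<integral>\<omega>. ?w \<omega> * (?Y t \<omega>)\<^sup>2 \<partial>M) + weighted_integral ?w integrand_square t u \<le>
      2 * (\<integral>\<omega>. ?w \<omega> * (?Y u \<omega>)\<^sup>2 \<partial>M) + 2 * (u - t) * drift_bound * (weighted_integral ?w (\<lambda>x. (Y' x)\<^sup>2) t u +
        weighted_integral ?w integrand_square t u + weighted_integral ?w forcing_square t u)"
    if t: "t0 \<le> t" "t \<le> u" "u \<le> T" for t u
  proof -
    have tu: "0 \<le> t" "t \<le> u" "u \<le> T" using t t0 by auto
    have ts: "t \<in> {0..T}" "u \<in> {0..T}" using tu by auto
    have wF: "?w \<in> borel_measurable (filt t)" using A filt_mono[OF t(1)] by auto
    let ?R = "\<lambda>\<omega>. ?w \<omega> * (2 * (?Y u \<omega>)\<^sup>2 + 2 * (u - t) * time_integral rate t u \<omega>)"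
    have i1: "integrable M (\<lambda>\<omega>. ?w \<omega> * (?Y t \<omega>)\<^sup>2)" by (rule wi[OF sq[OF ts(1)]])
    have i2: "integrable M (\<lambda>\<omega>. ?w \<omega> * (?Y t \<omega> * S t u \<omega>))"
      by (rule wi) (rule integrable_mult_square_integrable[OF YM[OF ts(1)] S(1)[OF tu] sq[OF ts(1)] S(2)[OF tu]])
    have i3: "integrable M (\<lambda>\<omega>. ?w \<omega> * (S t u \<omega>)\<^sup>2)" by (rule wi[OF S(2)[OF tu]])
    have R1: "integrable M (\<lambda>\<omega>. ?w \<omega> * (?Y u \<omega>)\<^sup>2)" by (rule wi[OF sq[OF ts(2)]])
    have R2: "integrable M (\<lambda>\<omega>. ?w \<omega> * time_integral rate t u \<omega>)"
      by (rule wi[OF time_integral_integrable[OF wM w1 rate]])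
    have ti: "(\<integral>\<omega>. ?w \<omega> * time_integral rate t u \<omega> \<partial>M) = weighted_integral ?w rate t u"
      by (rule weighted_time_integral[OF wM w1 rate])
    \<comment> \<open>\<open>?w\<close> times \<open>?Y t\<close> is square integrable and known at
      time \<open>t\<close>, hence orthogonal to the later martingale increment.\<close>
    have cross: "(\<integral>\<omega>. ?w \<omega> * (?Y t \<omega> * S t u \<omega>) \<partial>M) = 0"
    proof -
      have "(\<integral>\<omega>. (?w \<omega> * ?Y t \<omega>) * S t u \<omega> \<partial>M) = 0"
      proof (rule S(4)[OF tu])
        show "(\<lambda>\<omega>. ?w \<omega> * ?Y t \<omega>) \<in> borel_measurable (filt t)"
          by (rule borel_measurable_times[OF wF YF[OF ts(1)]])
        have "(?w \<omega> * ?Y t \<omega>)\<^sup>2 = ?w \<omega> * (?Y t \<omega>)\<^sup>2" for \<omega> by (simp add: indicator_def)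
        then show "integrable M (\<lambda>\<omega>. (?w \<omega> * ?Y t \<omega>)\<^sup>2)" using i1 by simp
      qed
      then show ?thesis by (simp only: mult.assoc)
    qed
    have "(\<integral>\<omega>. ?w \<omega> * (?Y t \<omega>)\<^sup>2 \<partial>M) + weighted_integral ?w integrand_square t u =
        (\<integral>\<omega>. ?w \<omega> * (?Y t \<omega>)\<^sup>2 \<partial>M) + 2 * (\<integral>\<omega>. ?w \<omega> * (?Y t \<omega> * S t u \<omega>) \<partial>M) + (\<integral>\<omega>. ?w \<omega> * (S t u \<omega>)\<^sup>2 \<partial>M)"
      unfolding cross S(3)[OF tu wF w1] by simp
    also have "\<dots> = (\<integral>\<omega>. ?w \<omega> * (?Y t \<omega>)\<^sup>2 + 2 * (?w \<omega> * (?Y t \<omega> * S t u \<omega>)) + ?w \<omega> * (S t u \<omega>)\<^sup>2 \<partial>M)"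
      using i1 i2 i3 by simp
    also have "\<dots> \<le> (\<integral>\<omega>. 2 * (?w \<omega> * (?Y u \<omega>)\<^sup>2) + (2 * (u - t)) * (?w \<omega> * time_integral rate t u \<omega>) \<partial>M)"
    proof (rule integral_mono_AE)
      show "AE \<omega> in M. ?w \<omega> * (?Y t \<omega>)\<^sup>2 + 2 * (?w \<omega> * (?Y t \<omega> * S t u \<omega>)) + ?w \<omega> * (S t u \<omega>)\<^sup>2 \<le>
          2 * (?w \<omega> * (?Y u \<omega>)\<^sup>2) + (2 * (u - t)) * (?w \<omega> * time_integral rate t u \<omega>)"
        using S(5)[OF tu] drift_integral_square_le[OF integrand_square tu]
      proof eventually_elim
        case (elim \<omega>)
        define G where "G = (LINT s:{t<..u}|lebesgue. drift \<omega> s)"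
        have e: "?Y t \<omega> + S t u \<omega> = ?Y u \<omega> + G" and G: "G\<^sup>2 \<le> (u - t) * time_integral rate t u \<omega>"
          using elim unfolding G_def by blast+
        have "(?Y t \<omega>)\<^sup>2 + 2 * (?Y t \<omega> * S t u \<omega>) + (S t u \<omega>)\<^sup>2 = (?Y t \<omega> + S t u \<omega>)\<^sup>2"
          unfolding power2_sum by (simp only: mult.assoc ac_simps)
        \<comment> \<open>The square of a sum is at most twice the sum of the squares: this is the
          factor 2 in \<open>backward_inequality\<close>.\<close>
        also have "\<dots> \<le> 2 * (?Y u \<omega>)\<^sup>2 + 2 * G\<^sup>2"
          unfolding e using zero_le_power2[of "?Y u \<omega> - G"] by (simp only: power2_sum power2_diff) simp
        also have "\<dots> \<le> 2 * (?Y u \<omega>)\<^sup>2 + 2 * ((u - t) * time_integral rate t u \<omega>)"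
          using G by simp
        finally have *: "(?Y t \<omega>)\<^sup>2 + 2 * (?Y t \<omega> * S t u \<omega>) + (S t u \<omega>)\<^sup>2 \<le>
            2 * (?Y u \<omega>)\<^sup>2 + 2 * ((u - t) * time_integral rate t u \<omega>)" .
        show ?case
          using mult_left_mono[OF * w0[of \<omega>]] by (simp only: ring_distribs ac_simps)
      qed
    qed (use i1 i2 i3 R1 R2 in simp_all)
    also have "\<dots> = 2 * (\<integral>\<omega>. ?w \<omega> * (?Y u \<omega>)\<^sup>2 \<partial>M) + 2 * (u - t) * weighted_integral ?w rate t u"
      using R1 R2 ti by simp
    also have "weighted_integral ?w rate t u = drift_bound * (weighted_integral ?w (\<lambda>x. (Y' x)\<^sup>2) t u +
        weighted_integral ?w integrand_square t u + weighted_integral ?w forcing_square t u)"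
    proof -
      let ?W = "\<lambda>x. ?w (fst x) * indicator {t<..u} (snd x) :: real"
      note a = weighted_integrable[OF wM w1 Y'2, of t u] and b = weighted_integrable[OF wM w1 integrand_square, of t u]
        and c = weighted_integrable[OF wM w1 forcing_square_integrable, of t u]
      have "weighted_integral ?w rate t u = (\<integral>x. drift_bound * ((?W x * (Y' x)\<^sup>2 + ?W x * integrand_square x) + ?W x * forcing_square x) \<partial>Q)"
        unfolding weighted_integral_def rate_def by (simp only: ring_distribs ac_simps)
      also have "\<dots> = drift_bound * (((\<integral>x. ?W x * (Y' x)\<^sup>2 \<partial>Q) + (\<integral>x. ?W x * integrand_square x \<partial>Q)) + (\<integral>x. ?W x * forcing_square x \<partial>Q))"
        unfolding integral_mult_right_zero
          Bochner_Integration.integral_add[OF Bochner_Integration.integrable_add[OF a b] c]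
          Bochner_Integration.integral_add[OF a b] ..
      finally show ?thesis unfolding weighted_integral_def .
    qed
    finally show ?thesis by (simp only: mult.assoc)
  qed
  have "weighted_integral ?w (\<lambda>x. (Y' x)\<^sup>2) t u \<le> (u - t) * Z"
    if t: "t0 \<le> t" "t \<le> u" "u \<le> T" and Z: "\<forall>s\<in>{t..u}. (\<integral>\<omega>. ?w \<omega> * (?Y s \<omega>)\<^sup>2 \<partial>M) \<le> Z" for t u Z
  proof (rule weighted_integral_le[OF wM w1 Y'2])
    show "0 \<le> t" "t \<le> u" "u \<le> T" using t t0 by auto
    fix s assume s: "t \<le> s" "s \<le> u"
    then have s': "s \<in> {0..T}" "s \<in> {t..u}" using t t0 by auto
    \<comment> \<open>The version \<open>Y'\<close> agrees with the solutions at all times off one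
      null set, so at each fixed \<open>s\<close> the integrals coincide.\<close>
    have "AE \<omega> in M. ?w \<omega> * (?Y s \<omega>)\<^sup>2 = ?w \<omega> * (Y' (\<omega>, s))\<^sup>2"
      using Y'(2) by eventually_elim (use s' in auto)
    moreover have "(\<lambda>\<omega>. Y' (\<omega>, s)) \<in> borel_measurable M"
    proof -
      have "s \<in> space tm" using s'(1) by (simp add: space_restrict_space)
      from measurable_compose[OF measurable_Pair2'[OF this, of M] Y'(1)] show ?thesis .
    qed
    ultimately have "(\<integral>\<omega>. ?w \<omega> * (Y' (\<omega>, s))\<^sup>2 \<partial>M) = (\<integral>\<omega>. ?w \<omega> * (?Y s \<omega>)\<^sup>2 \<partial>M)"
      using YM[OF s'(1)] wM by (intro integral_cong_AE borel_measurable_times borel_measurable_power) auto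
    then show "(\<integral>\<omega>. ?w \<omega> * (Y' (\<omega>, s))\<^sup>2 \<partial>M) \<le> Z" using Z s'(2) by simp
  qed
  moreover have "0 \<le> (\<integral>\<omega>. ?w \<omega> * (?Y t \<omega>)\<^sup>2 \<partial>M)" for t
    by (rule Bochner_Integration.integral_nonneg) simp
  moreover note ineq weighted_integral_nonneg[OF wM w1 Y'2 w0 zero_le_power2]
    weighted_integral_nonneg[OF wM w1 integrand_square w0 integrand_square_nonneg] weighted_integral_nonneg[OF wM w1 forcing_square_integrable w0 forcing_square_nonneg]
    weighted_integral_split[OF wM w1 Y'2] weighted_integral_split[OF wM w1 integrand_square] weighted_integral_split[OF wM w1 forcing_square_integrable]
  ultimately show ?thesis
    unfolding backward_inequality_def by (intro allI impI conjI) presburger+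
qed

end

end

section \<open>From integrals over events to conditional expectations\<close>

context bsde_setting
begin

lemma integral_Q_fst:
  fixes F :: "'w \<times> real \<Rightarrow> real"
  assumes F: "integrable Q F" and A: "A \<in> events"
  shows "integrable M (\<lambda>\<omega>. \<integral>s. F (\<omega>, s) \<partial>tm)"
    and "integrable Q (\<lambda>x. indicator A (fst x) * F x)"
    and "(\<integral>\<omega>. indicator A \<omega> * (\<integral>s. F (\<omega>, s) \<partial>tm) \<partial>M) = (\<integral>x. indicator A (fst x) * F x \<partial>Q)"
proof -
  interpret QP: pair_sigma_finite M tm by (rule pair_sigma_finite_Q)
  show "integrable M (\<lambda>\<omega>. \<integral>s. F (\<omega>, s) \<partial>tm)" by (rule QP.integrable_fst'[OF F])
  show i: "integrable Q (\<lambda>x. indicator A (fst x) * F x)"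
  proof (rule Bochner_Integration.integrable_bound[OF F])
    show "(\<lambda>x. indicator A (fst x) * F x) \<in> borel_measurable Q"
      using A by (intro borel_measurable_times borel_measurable_integrable[OF F]
          measurable_compose[OF measurable_fst borel_measurable_indicator])
    show "AE x in Q. norm (indicator A (fst x) * F x) \<le> norm (F x)"
      by (intro AE_I2) (simp add: indicator_def)
  qed
  show "(\<integral>\<omega>. indicator A \<omega> * (\<integral>s. F (\<omega>, s) \<partial>tm) \<partial>M) = (\<integral>x. indicator A (fst x) * F x \<partial>Q)"
    using QP.integral_fst'[OF i] by simp
qed

text \<open>The claim integrates over closed intervals \<open>[t, T]\<close>, the estimates over
  \<open>(t, T]\<close>; the instant \<open>t\<close> is negligible in \<open>Q\<close>.\<close>

lemma AE_Q_snd_neq: "AE x in Q. snd x \<noteq> t"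
proof -
  have "AE \<omega> in M. AE s in tm. s \<noteq> t"
  proof (rule AE_I2)
    show "AE s in tm. s \<noteq> t"
      using AE_lborel_singleton[of t] by (auto simp: AE_restrict_space_iff elim: eventually_mono)
  qed
  moreover have "{x \<in> space Q. snd x \<noteq> t} \<in> sets Q"
  proof -
    have "{x \<in> space Q. snd x \<noteq> t} = space M \<times> ({0..T} - {t})" by (auto simp: space_Q)
    also have "\<dots> \<in> sets Q" by (intro pair_measureI) (simp_all add: sets_restrict_space_iff)
    finally show ?thesis .
  qed
  ultimately show ?thesis
    using pair_sigma_finite.AE_pair_measure[OF pair_sigma_finite_Q, of "\<lambda>x. snd x \<noteq> t"] by simp
qed

lemma tm_integral_closed:
  fixes f :: "real \<Rightarrow> real"
  assumes "0 \<le> t"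
  shows "(LINT s:{t..T}|lborel. f s) = (\<integral>s. indicator {t..T} s * f s \<partial>tm)"
proof -
  have ind: "indicator {0..T} s *\<^sub>R (indicator {t..T} s * f s) = indicator {t..T} s *\<^sub>R f s" for s
    using assms by (simp add: indicator_def)
  show ?thesis
    unfolding set_lebesgue_integral_def by (subst integral_restrict_space) (simp_all only: ind, simp)
qed

section \<open>Exponential weights\<close>

lemma exp_weighted_integrable:
  assumes q: "integrable Q q" and \<beta>: "0 < \<beta>" and t: "0 \<le> t"
  shows "integrable Q (\<lambda>x. indicator {t..T} (snd x) * (exp (\<beta> * (snd x - t)) * q x))"
    and "integrable Q (\<lambda>x. indicator {t..T} (snd x) * q x)"
proof -
  have ind: "(\<lambda>x. indicator {t..T} (snd x) :: real) \<in> borel_measurable Q"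
  proof -
    have "indicator {t..T} \<in> borel_measurable tm"
      by (intro measurable_restrict_space1 borel_measurable_indicator) simp
    from measurable_compose[OF measurable_snd this] show ?thesis .
  qed
  have ex: "(\<lambda>x. exp (\<beta> * (snd x - t))) \<in> borel_measurable Q"
  proof -
    have "(\<lambda>s. exp (\<beta> * (s - t))) \<in> borel_measurable tm"
      by (intro measurable_restrict_space1) simp
    from measurable_compose[OF measurable_snd this] show ?thesis .
  qed
  show "integrable Q (\<lambda>x. indicator {t..T} (snd x) * q x)"
  proof (rule Bochner_Integration.integrable_bound[OF q])
    show "(\<lambda>x. indicator {t..T} (snd x) * q x) \<in> borel_measurable Q"
      by (rule borel_measurable_times[OF ind borel_measurable_integrable[OF q]])
    show "AE x in Q. norm (indicator {t..T} (snd x) * q x) \<le> norm (q x)"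
      by (intro AE_I2) (simp add: indicator_def)
  qed
  show "integrable Q (\<lambda>x. indicator {t..T} (snd x) * (exp (\<beta> * (snd x - t)) * q x))"
  proof (rule Bochner_Integration.integrable_bound)
    show "integrable Q (\<lambda>x. exp (\<beta> * T) * q x)" using q by simp
    show "(\<lambda>x. indicator {t..T} (snd x) * (exp (\<beta> * (snd x - t)) * q x)) \<in> borel_measurable Q"
      by (intro borel_measurable_times ind ex borel_measurable_integrable[OF q])
    show "AE x in Q. norm (indicator {t..T} (snd x) * (exp (\<beta> * (snd x - t)) * q x)) \<le> norm (exp (\<beta> * T) * q x)"
    proof (rule AE_I2)
      fix x assume "x \<in> space Q"
      then have "\<beta> * (snd x - t) \<le> \<beta> * T" using \<beta> t by (intro mult_left_mono) (auto simp: space_Q)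
      then have "exp (\<beta> * (snd x - t)) * \<bar>q x\<bar> \<le> exp (\<beta> * T) * \<bar>q x\<bar>" by (intro mult_right_mono) simp_all
      then show "norm (indicator {t..T} (snd x) * (exp (\<beta> * (snd x - t)) * q x)) \<le> norm (exp (\<beta> * T) * q x)"
        by (simp add: indicator_def abs_mult)
    qed
  qed
qed

text \<open>The upper bound serves the left side of the claim, where the weights have to be removed,
  and the lower bound serves the forcing, where they have to be introduced.\<close>

lemma exp_weighted_integral_bounds:
  assumes q: "integrable Q q" "\<And>x. 0 \<le> q x" and \<beta>: "0 < \<beta>" and t: "0 \<le> t" and A: "A \<in> events"
  defines "J \<equiv> \<integral>x. indicator A (fst x) * (indicator {t..T} (snd x) * (exp (\<beta> * (snd x - t)) * q x)) \<partial>Q"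
  shows "J \<le> exp (\<beta> * T) * weighted_integral (indicator A) q t T" "weighted_integral (indicator A) q t T \<le> J"
proof -
  note i1 = integral_Q_fst(2)[OF exp_weighted_integrable(1)[OF q(1) \<beta> t] A]
  note i2 = integral_Q_fst(2)[OF exp_weighted_integrable(2)[OF q(1) \<beta> t] A]
  have w: "(indicator A :: 'w \<Rightarrow> real) \<in> borel_measurable M" "\<And>\<omega>. \<bar>indicator A \<omega> :: real\<bar> \<le> 1"
    using A by (simp_all add: indicator_def)
  have eq: "weighted_integral (indicator A) q t T = (\<integral>x. indicator A (fst x) * (indicator {t..T} (snd x) * q x) \<partial>Q)"
    unfolding weighted_integral_def
  proof (rule integral_cong_AE)
    show "AE x in Q. indicator A (fst x) * indicator {t<..T} (snd x) * q x = indicator A (fst x) * (indicator {t..T} (snd x) * q x)"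
      using AE_Q_snd_neq[of t]
    proof eventually_elim
      case (elim x)
      then have "indicator {t<..T} (snd x) = (indicator {t..T} (snd x) :: real)"
        by (simp add: indicator_def less_le)
      then show ?case by simp
    qed
  qed (rule borel_measurable_integrable[OF weighted_integrable[OF w q(1)]], rule borel_measurable_integrable[OF i2])
  have "J \<le> (\<integral>x. exp (\<beta> * T) * (indicator A (fst x) * (indicator {t..T} (snd x) * q x)) \<partial>Q)"
    unfolding J_def
  proof (rule integral_mono[OF i1])
    show "integrable Q (\<lambda>x. exp (\<beta> * T) * (indicator A (fst x) * (indicator {t..T} (snd x) * q x)))" using i2 by simp
    fix x assume "x \<in> space Q"
    then have "\<beta> * (snd x - t) \<le> \<beta> * T" using \<beta> t by (intro mult_left_mono) (auto simp: space_Q)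
    then have "exp (\<beta> * (snd x - t)) * q x \<le> exp (\<beta> * T) * q x" using q(2) by (intro mult_right_mono) simp_all
    then show "indicator A (fst x) * (indicator {t..T} (snd x) * (exp (\<beta> * (snd x - t)) * q x)) \<le>
        exp (\<beta> * T) * (indicator A (fst x) * (indicator {t..T} (snd x) * q x))"
      by (simp add: indicator_def)
  qed
  then show "J \<le> exp (\<beta> * T) * weighted_integral (indicator A) q t T" unfolding eq by simp
  show "weighted_integral (indicator A) q t T \<le> J"
    unfolding eq J_def
  proof (rule integral_mono[OF i2 i1])
    fix x :: "'w \<times> real"
    show "indicator A (fst x) * (indicator {t..T} (snd x) * q x) \<le>
        indicator A (fst x) * (indicator {t..T} (snd x) * (exp (\<beta> * (snd x - t)) * q x))"
    proof (cases "t \<le> snd x")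
      case True
      then have "1 * q x \<le> exp (\<beta> * (snd x - t)) * q x"
        using \<beta> q(2) by (intro mult_right_mono) simp_all
      then show ?thesis by (simp add: indicator_def)
    qed simp
  qed
qed

end

context bsde_pair
begin

lemma difference_estimate:
  assumes \<xi>m: "\<xi>1 \<in> borel_measurable M" "\<xi>2 \<in> borel_measurable M"
    and \<xi>: "integrable M (\<lambda>\<omega>. (\<xi>1 \<omega>)\<^sup>2)" "integrable M (\<lambda>\<omega>. (\<xi>2 \<omega>)\<^sup>2)" and \<beta>: "0 < \<beta>"
  shows "\<exists>C>0. \<forall>t\<in>{0..T}. AE \<omega> in M.
    \<bar>Y1 t \<omega> - Y2 t \<omega>\<bar>\<^sup>2
    + real_cond_exp M (filt t) (\<lambda>\<omega>. LINT s:{t..T}|lborel. exp (\<beta> * (s - t)) *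
        (\<bar>Y1 s \<omega> - Y2 s \<omega>\<bar>\<^sup>2
         + lam * (\<Sum>l\<in>marks m. \<bar>H1 s \<omega> l - H2 s \<omega> l\<bar>\<^sup>2)
         + (norm (Z1 s \<omega> - Z2 s \<omega>))\<^sup>2
         + (\<integral>e. \<bar>K1 s \<omega> e - K2 s \<omega> e\<bar>\<^sup>2 \<partial>\<nu>))) \<omega>
    \<le> C * real_cond_exp M (filt t) (\<lambda>\<omega>. exp (\<beta> * (T - t)) * \<bar>\<xi>1 \<omega> - \<xi>2 \<omega>\<bar>\<^sup>2
        + (LINT s:{t..T}|lborel. exp (\<beta> * (s - t)) * \<bar>\<phi>1 s \<omega> - \<phi>2 s \<omega>\<bar>\<^sup>2)) \<omega>"
proof -
  note f1 = solution_facts[OF sol(1)] and f2 = solution_facts[OF sol(2)]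
  have YF: "(\<lambda>\<omega>. Y1 s \<omega> - Y2 s \<omega>) \<in> borel_measurable (filt s)" if "s \<in> {0..T}" for s
    using f1(1)[OF that] f2(1)[OF that] by simp
  have YM: "Y1 s \<in> borel_measurable M" "Y2 s \<in> borel_measurable M" if "s \<in> {0..T}" for s
    using measurable_from_subalg[OF subalgebra_filt f1(1)[OF that]]
      measurable_from_subalg[OF subalgebra_filt f2(1)[OF that]] by blast+
  obtain Y1' where Y1': "Y1' \<in> borel_measurable Q" "AE \<omega> in M. \<forall>s\<in>{0..T}. Y1' (\<omega>, s) = Y1 s \<omega>"
    by (rule cadlag_measurable_version[OF YM(1) f1(2)])
  obtain Y2' where Y2': "Y2' \<in> borel_measurable Q" "AE \<omega> in M. \<forall>s\<in>{0..T}. Y2' (\<omega>, s) = Y2 s \<omega>"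
    by (rule cadlag_measurable_version[OF YM(2) f2(2)])
  note sq1 = sup_square_integrable[OF YM(1) Y1' f1(3)] and sq2 = sup_square_integrable[OF YM(2) Y2' f2(3)]
  define Y' where "Y' x = Y1' x - Y2' x" for x
  have Y': "Y' \<in> borel_measurable Q" "integrable Q (\<lambda>x. (Y' x)\<^sup>2)"
    unfolding Y'_def[abs_def]
    by (intro borel_measurable_diff Y1'(1) Y2'(1), intro square_integrable_diff Y1'(1) Y2'(1) sq1(1) sq2(1))
  have Y'_eq: "AE \<omega> in M. \<forall>s\<in>{0..T}. Y' (\<omega>, s) = Y1 s \<omega> - Y2 s \<omega>"
    using Y1'(2) Y2'(2) by eventually_elim (simp add: Y'_def)
  have sq: "integrable M (\<lambda>\<omega>. (Y1 s \<omega> - Y2 s \<omega>)\<^sup>2)" if "s \<in> {0..T}" for s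
    by (rule square_integrable_diff[OF YM[OF that]]) (rule sq1(2) sq2(2); use that in simp)+
  have \<xi>d: "integrable M (\<lambda>\<omega>. (\<xi>1 \<omega> - \<xi>2 \<omega>)\<^sup>2)" by (rule square_integrable_diff[OF \<xi>m \<xi>])
  have "0 \<le> drift_bound" using lam_pos by simp
  then obtain C where C: "1 \<le> C"
    and Cb: "\<And>t0 y W V \<Phi>. backward_inequality drift_bound t0 T y W V \<Phi> \<Longrightarrow> 0 \<le> t0 \<Longrightarrow> t0 \<le> T \<Longrightarrow>
      y t0 + W t0 T + V t0 T \<le> C * (y T + \<Phi> t0 T)"
    using backward_inequality_bound[OF _ T_pos] by blast
  \<comment> \<open>The \<open>obtains\<close> statement acts as an elimination rule here and in the
    next line; only clauses that do not mention \<open>S\<close> are extracted.\<close>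
  have integrand_square: "integrable Q integrand_square" by (rule martingale_part)
  have YT: "AE \<omega> in M. Y1 T \<omega> - Y2 T \<omega> = \<xi>1 \<omega> - \<xi>2 \<omega>" by (rule martingale_part)
  have set_estimate: "(\<integral>\<omega>. indicator A \<omega> * (Y1 t \<omega> - Y2 t \<omega>)\<^sup>2 \<partial>M) + weighted_integral (indicator A) (\<lambda>x. (Y' x)\<^sup>2) t T
      + weighted_integral (indicator A) integrand_square t T
      \<le> C * ((\<integral>\<omega>. indicator A \<omega> * (\<xi>1 \<omega> - \<xi>2 \<omega>)\<^sup>2 \<partial>M) + weighted_integral (indicator A) forcing_square t T)"
    if t: "t \<in> {0..T}" and A: "A \<in> sets (filt t)" for t A
  proof -
    have AM: "A \<in> events" using A filt_events by blast
    have T: "T \<in> {0..T}" using T_pos by simp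
    have "(\<integral>\<omega>. indicator A \<omega> * (Y1 T \<omega> - Y2 T \<omega>)\<^sup>2 \<partial>M) = (\<integral>\<omega>. indicator A \<omega> * (\<xi>1 \<omega> - \<xi>2 \<omega>)\<^sup>2 \<partial>M)"
    proof (rule integral_cong_AE)
      show "AE \<omega> in M. indicator A \<omega> * (Y1 T \<omega> - Y2 T \<omega>)\<^sup>2 = indicator A \<omega> * (\<xi>1 \<omega> - \<xi>2 \<omega>)\<^sup>2"
        using YT by eventually_elim simp
    qed (use AM YM[OF T] \<xi>m in simp_all)
    then show ?thesis
      using Cb[OF backward_inequality_pair[OF Y'(1) Y'_eq Y'(2) sq _ _ A]] t by simp
  qed
  \<comment> \<open>\<open>C\<close> comes from the iteration, the exponential from removing the
    weights on the left side.\<close>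
  let ?C = "C * exp (\<beta> * T)"
  show ?thesis
  proof (intro exI[of _ ?C] conjI ballI)
    show "0 < ?C" using C by simp
    fix t assume t: "t \<in> {0..T}"
    then have t0: "0 \<le> t" "t \<le> T" by auto
    interpret sigma_finite_subalgebra M "filt t" by (rule NM.sigma_finite_subalgebra_F[OF t0(1)])
    let ?q = "\<lambda>x. (Y' x)\<^sup>2 + integrand_square x"
    let ?F = "\<lambda>x. indicator {t..T} (snd x) * (exp (\<beta> * (snd x - t)) * ?q x)"
    let ?G = "\<lambda>x. indicator {t..T} (snd x) * (exp (\<beta> * (snd x - t)) * forcing_square x)"
    let ?lhs = "\<lambda>\<omega>. LINT s:{t..T}|lborel. exp (\<beta> * (s - t)) *
        (\<bar>Y1 s \<omega> - Y2 s \<omega>\<bar>\<^sup>2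
         + lam * (\<Sum>l\<in>marks m. \<bar>H1 s \<omega> l - H2 s \<omega> l\<bar>\<^sup>2)
         + (norm (Z1 s \<omega> - Z2 s \<omega>))\<^sup>2
         + (\<integral>e. \<bar>K1 s \<omega> e - K2 s \<omega> e\<bar>\<^sup>2 \<partial>\<nu>))"
    let ?rhs = "\<lambda>\<omega>. exp (\<beta> * (T - t)) * \<bar>\<xi>1 \<omega> - \<xi>2 \<omega>\<bar>\<^sup>2
        + (LINT s:{t..T}|lborel. exp (\<beta> * (s - t)) * \<bar>\<phi>1 s \<omega> - \<phi>2 s \<omega>\<bar>\<^sup>2)"
    let ?y = "\<lambda>\<omega>. \<bar>Y1 t \<omega> - Y2 t \<omega>\<bar>\<^sup>2"
    \<comment> \<open>\<open>f\<close> and \<open>r\<close> present the two sides through functions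
      integrable on \<open>Q\<close>, so Fubini gives their integrability. \<open>f\<close> agrees
      almost surely with the integral in the claim, which is thereby measurable, \<open>M\<close>
      being complete.\<close>
    define f where "f \<omega> = (\<integral>s. ?F (\<omega>, s) \<partial>tm)" for \<omega>
    define r where "r \<omega> = exp (\<beta> * (T - t)) * (\<xi>1 \<omega> - \<xi>2 \<omega>)\<^sup>2 + (\<integral>s. ?G (\<omega>, s) \<partial>tm)" for \<omega>
    have q: "integrable Q ?q" "\<And>x. 0 \<le> ?q x" using Y'(2) integrand_square integrand_square_nonneg by simp_all
    have F: "integrable Q ?F" by (rule exp_weighted_integrable(1)[OF q(1) \<beta> t0(1)])
    have G: "integrable Q ?G" by (rule exp_weighted_integrable(1)[OF forcing_square_integrable \<beta> t0(1)])
    have fi: "integrable M f" unfolding f_def by (rule integral_Q_fst(1)[OF F sets.top])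
    have Gi: "integrable M (\<lambda>\<omega>. \<integral>s. ?G (\<omega>, s) \<partial>tm)" by (rule integral_Q_fst(1)[OF G sets.top])
    have ri: "integrable M r" unfolding r_def[abs_def] using \<xi>d Gi by simp
    have yi: "integrable M ?y" using sq[OF t] by simp
    have rhs: "?rhs = r"
      unfolding r_def[abs_def] tm_integral_closed[OF t0(1)] by (simp only: power2_abs forcing_square_def fst_conv snd_conv)
    have lhs: "AE \<omega> in M. f \<omega> = ?lhs \<omega>"
      using Y'_eq
    proof eventually_elim
      case (elim \<omega>)
      show ?case
        unfolding f_def tm_integral_closed[OF t0(1)]
      proof (rule Bochner_Integration.integral_cong[OF refl])
        fix s assume "s \<in> space tm"
        then have "s \<in> {0..T}" by (simp add: space_restrict_space)
        then have "Y' (\<omega>, s) = Y1 s \<omega> - Y2 s \<omega>" using elim by blast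
        then show "?F (\<omega>, s) = indicator {t..T} s * (exp (\<beta> * (s - t)) *
          (\<bar>Y1 s \<omega> - Y2 s \<omega>\<bar>\<^sup>2 + lam * (\<Sum>l\<in>marks m. \<bar>H1 s \<omega> l - H2 s \<omega> l\<bar>\<^sup>2)
           + (norm (Z1 s \<omega> - Z2 s \<omega>))\<^sup>2 + (\<integral>e. \<bar>K1 s \<omega> e - K2 s \<omega> e\<bar>\<^sup>2 \<partial>\<nu>)))"
          by (simp only: power2_abs integrand_square_def fst_conv snd_conv add.assoc)
      qed
    qed
    have lhsM: "?lhs \<in> borel_measurable M"
      by (rule borel_measurable_AE_eq[OF borel_measurable_integrable[OF fi] lhs])
    \<comment> \<open>The claim amounts to nonnegativity of the conditional expectation of
      \<open>D\<close>, which is tested on events of \<open>filt t\<close>.\<close>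
    define D where "D \<omega> = ?C * r \<omega> - (?y \<omega> + f \<omega>)" for \<omega>
    have Di: "integrable M D" unfolding D_def[abs_def] using ri yi fi by simp
    have "AE \<omega> in M. 0 \<le> real_cond_exp M (filt t) D \<omega>"
    proof (rule real_cond_exp_nonneg_sets[OF Di])
      fix A assume A: "A \<in> sets (filt t)"
      then have AM: "A \<in> events" using filt_events by blast
      have wi: "integrable M (\<lambda>\<omega>. indicator A \<omega> * h \<omega>)" if "integrable M h" for h :: "'w \<Rightarrow> real"
        using integrable_mult_indicator[OF AM that] by simp
      have Af: "(\<integral>\<omega>. indicator A \<omega> * f \<omega> \<partial>M) \<le> exp (\<beta> * T) * weighted_integral (indicator A) ?q t T"
        unfolding f_def integral_Q_fst(3)[OF F AM]
        by (rule exp_weighted_integral_bounds(1)[OF q \<beta> t0(1) AM])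
      have wq: "weighted_integral (indicator A) ?q t T = weighted_integral (indicator A) (\<lambda>x. (Y' x)\<^sup>2) t T + weighted_integral (indicator A) integrand_square t T"
      proof -
        have w: "(indicator A :: 'w \<Rightarrow> real) \<in> borel_measurable M" "\<And>\<omega>. \<bar>indicator A \<omega> :: real\<bar> \<le> 1"
          using AM by (simp_all add: indicator_def)
        show ?thesis
          unfolding weighted_integral_def distrib_left
          by (rule Bochner_Integration.integral_add[OF weighted_integrable[OF w Y'(2)] weighted_integrable[OF w integrand_square]])
      qed
      have AG: "weighted_integral (indicator A) forcing_square t T \<le> (\<integral>\<omega>. indicator A \<omega> * (\<integral>s. ?G (\<omega>, s) \<partial>tm) \<partial>M)"
        unfolding integral_Q_fst(3)[OF G AM]
        by (rule exp_weighted_integral_bounds(2)[OF forcing_square_integrable forcing_square_nonneg \<beta> t0(1) AM])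
      have x0: "0 \<le> (\<integral>\<omega>. indicator A \<omega> * (\<xi>1 \<omega> - \<xi>2 \<omega>)\<^sup>2 \<partial>M)"
        by (rule Bochner_Integration.integral_nonneg) simp
      have y0: "0 \<le> (\<integral>\<omega>. indicator A \<omega> * (Y1 t \<omega> - Y2 t \<omega>)\<^sup>2 \<partial>M)"
        by (rule Bochner_Integration.integral_nonneg) simp
      have Ar: "(\<integral>\<omega>. indicator A \<omega> * (\<xi>1 \<omega> - \<xi>2 \<omega>)\<^sup>2 \<partial>M) + weighted_integral (indicator A) forcing_square t T \<le> (\<integral>\<omega>. indicator A \<omega> * r \<omega> \<partial>M)"
      proof -
        have "(\<integral>\<omega>. indicator A \<omega> * r \<omega> \<partial>M) = (\<integral>\<omega>. exp (\<beta> * (T - t)) * (indicator A \<omega> * (\<xi>1 \<omega> - \<xi>2 \<omega>)\<^sup>2) + indicator A \<omega> * (\<integral>s. ?G (\<omega>, s) \<partial>tm) \<partial>M)"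
          unfolding r_def by (intro Bochner_Integration.integral_cong refl) (simp only: distrib_left mult.left_commute)
        also have "\<dots> = exp (\<beta> * (T - t)) * (\<integral>\<omega>. indicator A \<omega> * (\<xi>1 \<omega> - \<xi>2 \<omega>)\<^sup>2 \<partial>M) + (\<integral>\<omega>. indicator A \<omega> * (\<integral>s. ?G (\<omega>, s) \<partial>tm) \<partial>M)"
          using wi[OF \<xi>d] wi[OF Gi]
          by (subst Bochner_Integration.integral_add) (simp_all only: integrable_mult_right integral_mult_right_zero)
        finally have e: "(\<integral>\<omega>. indicator A \<omega> * r \<omega> \<partial>M) = exp (\<beta> * (T - t)) * (\<integral>\<omega>. indicator A \<omega> * (\<xi>1 \<omega> - \<xi>2 \<omega>)\<^sup>2 \<partial>M) + (\<integral>\<omega>. indicator A \<omega> * (\<integral>s. ?G (\<omega>, s) \<partial>tm) \<partial>M)" .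
        have "1 * (\<integral>\<omega>. indicator A \<omega> * (\<xi>1 \<omega> - \<xi>2 \<omega>)\<^sup>2 \<partial>M) \<le> exp (\<beta> * (T - t)) * (\<integral>\<omega>. indicator A \<omega> * (\<xi>1 \<omega> - \<xi>2 \<omega>)\<^sup>2 \<partial>M)"
          using x0 \<beta> t0 by (intro mult_right_mono) simp_all
        with AG show ?thesis unfolding e by simp
      qed
      let ?Ey = "\<integral>\<omega>. indicator A \<omega> * (Y1 t \<omega> - Y2 t \<omega>)\<^sup>2 \<partial>M"
      have e1: "1 \<le> exp (\<beta> * T)" using \<beta> T_pos by simp
      \<comment> \<open>The value term has no weight, but it is enlarged by
        \<open>exp (\<beta> * T)\<close> as well so that this factor can be taken out.\<close>
      have "?Ey + (\<integral>\<omega>. indicator A \<omega> * f \<omega> \<partial>M) \<le> exp (\<beta> * T) * ?Ey + exp (\<beta> * T) * weighted_integral (indicator A) ?q t T"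
        using Af mult_right_mono[OF e1 y0] by simp
      also have "\<dots> = exp (\<beta> * T) * (?Ey + weighted_integral (indicator A) (\<lambda>x. (Y' x)\<^sup>2) t T + weighted_integral (indicator A) integrand_square t T)"
        unfolding wq by (simp only: distrib_left add.assoc)
      also have "\<dots> \<le> exp (\<beta> * T) * (C * ((\<integral>\<omega>. indicator A \<omega> * (\<xi>1 \<omega> - \<xi>2 \<omega>)\<^sup>2 \<partial>M) + weighted_integral (indicator A) forcing_square t T))"
        by (rule mult_left_mono[OF set_estimate[OF t A]]) simp
      also have "\<dots> \<le> exp (\<beta> * T) * (C * (\<integral>\<omega>. indicator A \<omega> * r \<omega> \<partial>M))"
        using C by (intro mult_left_mono Ar) simp_all
      finally have le: "?Ey + (\<integral>\<omega>. indicator A \<omega> * f \<omega> \<partial>M) \<le> ?C * (\<integral>\<omega>. indicator A \<omega> * r \<omega> \<partial>M)"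
        by (simp only: ac_simps)
      have "(\<integral>\<omega>. indicator A \<omega> * D \<omega> \<partial>M) = (\<integral>\<omega>. ?C * (indicator A \<omega> * r \<omega>) - (indicator A \<omega> * (Y1 t \<omega> - Y2 t \<omega>)\<^sup>2 + indicator A \<omega> * f \<omega>) \<partial>M)"
        unfolding D_def by (intro Bochner_Integration.integral_cong refl) (simp add: algebra_simps)
      also have "\<dots> = ?C * (\<integral>\<omega>. indicator A \<omega> * r \<omega> \<partial>M) - (?Ey + (\<integral>\<omega>. indicator A \<omega> * f \<omega> \<partial>M))"
      proof -
        note a = integrable_mult_right[OF wi[OF ri], of ?C] and b = wi[OF sq[OF t]] and c = wi[OF fi]
        show ?thesis
          unfolding Bochner_Integration.integral_diff[OF a Bochner_Integration.integrable_add[OF b c]]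
            Bochner_Integration.integral_add[OF b c] integral_mult_right_zero ..
      qed
      finally show "0 \<le> (\<integral>\<omega>. indicator A \<omega> * D \<omega> \<partial>M)" using le by simp
    qed
    moreover have "AE \<omega> in M. real_cond_exp M (filt t) D \<omega> =
        real_cond_exp M (filt t) (\<lambda>\<omega>. ?C * r \<omega>) \<omega> - real_cond_exp M (filt t) (\<lambda>\<omega>. ?y \<omega> + f \<omega>) \<omega>"
      unfolding D_def[abs_def]
      by (rule real_cond_exp_diff[OF integrable_mult_right[OF ri] Bochner_Integration.integrable_add[OF yi fi]])
    moreover have "AE \<omega> in M. real_cond_exp M (filt t) (\<lambda>\<omega>. ?C * r \<omega>) \<omega> = ?C * real_cond_exp M (filt t) r \<omega>"
      by (rule real_cond_exp_cmult[OF ri])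
    moreover have "AE \<omega> in M. real_cond_exp M (filt t) (\<lambda>\<omega>. ?y \<omega> + f \<omega>) \<omega> = real_cond_exp M (filt t) ?y \<omega> + real_cond_exp M (filt t) f \<omega>"
      by (rule real_cond_exp_add[OF yi fi])
    \<comment> \<open>The solutions are adapted, so the squared difference at time \<open>t\<close>
      passes through the conditional expectation unchanged.\<close>
    moreover have "AE \<omega> in M. real_cond_exp M (filt t) ?y \<omega> = ?y \<omega>"
      by (rule real_cond_exp_F_meas[OF yi]) (use YF[OF t] in simp)
    moreover have "AE \<omega> in M. real_cond_exp M (filt t) f \<omega> = real_cond_exp M (filt t) ?lhs \<omega>"
      by (rule real_cond_exp_cong[OF lhs borel_measurable_integrable[OF fi] lhsM])
    ultimately show "AE \<omega> in M. ?y \<omega> + real_cond_exp M (filt t) ?lhs \<omega> \<le> ?C * real_cond_exp M (filt t) ?rhs \<omega>"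
      unfolding rhs by eventually_elim linarith
  qed
qed

end

theorem lemma2p2:
  fixes M :: "'w measure"
    and B :: "real \<Rightarrow> 'w \<Rightarrow> real ^ 'd::finite"
    and N :: "'w \<Rightarrow> (real \<times> nat) measure"
    and \<mu> :: "'w \<Rightarrow> (real \<times> (real ^ 'q::finite)) measure"
    and \<nu> :: "(real ^ 'q) measure"
    and lam T L\<^sub>g \<beta> :: real and m :: nat
    and F :: "real \<Rightarrow> 'w measure"
    and g :: "'w \<Rightarrow> real \<Rightarrow> real \<Rightarrow> (nat \<Rightarrow> real) \<Rightarrow> real ^ 'd \<Rightarrow> (real ^ 'q \<Rightarrow> real) \<Rightarrow> real"
    and \<phi>1 \<phi>2 Y1 Y2 :: "real \<Rightarrow> 'w \<Rightarrow> real" and \<xi>1 \<xi>2 :: "'w \<Rightarrow> real"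
    and H1 H2 :: "real \<Rightarrow> 'w \<Rightarrow> nat \<Rightarrow> real"
    and Z1 Z2 :: "real \<Rightarrow> 'w \<Rightarrow> real ^ 'd"
    and K1 K2 :: "real \<Rightarrow> 'w \<Rightarrow> real ^ 'q \<Rightarrow> real"
  defines "F \<equiv> noise_filtration M B N \<mu> \<nu> lam m"
  assumes setting: "bsde_setting M B N \<mu> \<nu> lam m T"
    and g_predictable: "\<And>y h z k. k \<in> L2_fun \<nu> \<Longrightarrow>
      (\<lambda>(\<omega>, s). g \<omega> s y h z k) \<in> borel_measurable (predictable_on M F 0 T)"
    and L\<^sub>g_nonneg: "0 \<le> L\<^sub>g"
    and g_lipschitz: "AE \<omega> in M. \<forall>t\<in>{0..T}. \<forall>y1 y2 h1 h2 z1 z2. \<forall>k1\<in>L2_fun \<nu>. \<forall>k2\<in>L2_fun \<nu>.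
      \<bar>g \<omega> t y1 h1 z1 k1 - g \<omega> t y2 h2 z2 k2\<bar> \<le>
        L\<^sub>g * (\<bar>y1 - y2\<bar> + L2_set (\<lambda>l. h1 l - h2 l) (marks m) + norm (z1 - z2)
              + L2_norm \<nu> (\<lambda>e. k1 e - k2 e))"
    and g_zero: "(\<integral>\<^sup>+\<omega>. (\<integral>\<^sup>+s\<in>{0..T}.
      ennreal ((g \<omega> s 0 (\<lambda>_. 0) 0 (\<lambda>_. 0))\<^sup>2) \<partial>lborel) \<partial>M) < \<infinity>"
    and \<phi>1_prog: "progressive F 0 T \<phi>1" and \<phi>2_prog: "progressive F 0 T \<phi>2"
    and \<phi>1_L2: "(\<integral>\<^sup>+\<omega>. (\<integral>\<^sup>+s\<in>{0..T}. ennreal ((\<phi>1 s \<omega>)\<^sup>2) \<partial>lborel) \<partial>M) < \<infinity>"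
    and \<phi>2_L2: "(\<integral>\<^sup>+\<omega>. (\<integral>\<^sup>+s\<in>{0..T}. ennreal ((\<phi>2 s \<omega>)\<^sup>2) \<partial>lborel) \<partial>M) < \<infinity>"
    and \<xi>1_meas: "\<xi>1 \<in> borel_measurable (F T)" and \<xi>2_meas: "\<xi>2 \<in> borel_measurable (F T)"
    and \<xi>1_L2: "integrable M (\<lambda>\<omega>. (\<xi>1 \<omega>)\<^sup>2)" and \<xi>2_L2: "integrable M (\<lambda>\<omega>. (\<xi>2 \<omega>)\<^sup>2)"
    and sol1: "bsde_solution M F B N \<mu> \<nu> lam m T
      (\<lambda>\<omega> s y h z k. g \<omega> s y h z k + \<phi>1 s \<omega>) \<xi>1 Y1 H1 Z1 K1"
    and sol2: "bsde_solution M F B N \<mu> \<nu> lam m T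
      (\<lambda>\<omega> s y h z k. g \<omega> s y h z k + \<phi>2 s \<omega>) \<xi>2 Y2 H2 Z2 K2"
    and \<beta>_large: "\<beta> > 2 * L\<^sub>g + 4 * L\<^sub>g\<^sup>2 + 2 / lam * L\<^sub>g\<^sup>2 + 1"
  shows "\<exists>C>0. \<forall>t\<in>{0..T}. AE \<omega> in M.
    \<bar>Y1 t \<omega> - Y2 t \<omega>\<bar>\<^sup>2
    + real_cond_exp M (F t) (\<lambda>\<omega>. LINT s:{t..T}|lborel. exp (\<beta> * (s - t)) *
        (\<bar>Y1 s \<omega> - Y2 s \<omega>\<bar>\<^sup>2
         + lam * (\<Sum>l\<in>marks m. \<bar>H1 s \<omega> l - H2 s \<omega> l\<bar>\<^sup>2)
         + (norm (Z1 s \<omega> - Z2 s \<omega>))\<^sup>2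
         + (\<integral>e. \<bar>K1 s \<omega> e - K2 s \<omega> e\<bar>\<^sup>2 \<partial>\<nu>))) \<omega>
    \<le> C * real_cond_exp M (F t) (\<lambda>\<omega>. exp (\<beta> * (T - t)) * \<bar>\<xi>1 \<omega> - \<xi>2 \<omega>\<bar>\<^sup>2
        + (LINT s:{t..T}|lborel. exp (\<beta> * (s - t)) * \<bar>\<phi>1 s \<omega> - \<phi>2 s \<omega>\<bar>\<^sup>2)) \<omega>"
proof -
  interpret pair: bsde_pair M B N \<mu> \<nu> lam m T L\<^sub>g g \<phi>1 \<phi>2 Y1 Y2 \<xi>1 \<xi>2 H1 H2 Z1 Z2 K1 K2
    by (intro bsde_pair.intro setting bsde_pair_axioms.intro L\<^sub>g_nonneg g_lipschitz \<phi>1_L2 \<phi>2_L2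
        \<phi>1_prog[unfolded F_def] \<phi>2_prog[unfolded F_def] sol1[unfolded F_def] sol2[unfolded F_def])
  \<comment> \<open>The threshold is at least 1, so \<open>\<beta>\<close> is positive, as the
    comparison of the exponential weights with 1 requires.\<close>
  have "0 \<le> 2 * L\<^sub>g + 4 * L\<^sub>g\<^sup>2 + 2 / lam * L\<^sub>g\<^sup>2"
    using L\<^sub>g_nonneg pair.lam_pos by simp
  then have "0 < \<beta>" using \<beta>_large by linarith
  from pair.difference_estimate[OF measurable_from_subalg[OF pair.subalgebra_filt \<xi>1_meas[unfolded F_def]]
      measurable_from_subalg[OF pair.subalgebra_filt \<xi>2_meas[unfolded F_def]] \<xi>1_L2 \<xi>2_L2 \<open>0 < \<beta>\<close>]
  show ?thesis unfolding F_def .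
qed

end
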